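(* Let $W\subset U(V)$ be a finite complex reflection group such that $W$ has a Coxeter-like presentation and such that the topological Hecke algebra $H_u(W)$ can be generated by $|W|$ elements as an $R$-module. Let $F\subset K$ be the character field of $Q\otimes_R H_u(W)$. Then there is a positive integer $N$ such that the field $\mathbb C\cdot F$ is contained in a field obtained from $\mathbb C\cdot Q$ by adjoining radicals of the form $(u_{C,j})^{1/N}$ ($C\in\mathcal C$, $0\le j\le e_C-1$). In particular, $\mathbb C\cdot F$ is an abelian extension of $\mathbb C\cdot Q$.
   Context: $V$ is an $n$-dimensional complex Hilbert space; a finite complex reflection group is a finite subgroup $W\subset U(V)$ generated by complex reflections (elements whose fixed space is a hyperplane). $\mathcal A$ is the set of reflection hyperplanes, $\mathcal C$ the set of $W$-orbits in $\mathcal A$. For $H\in C\in\mathcal C$ the pointwise stabilizer $W_H$ is cyclic of order $e_H=e_C$, with generator $s_H$ satisfying $\det_V(s_H)=\zeta_H:=e^{2\pi\sqrt{-1}/e_H}$. Quantities indexed by $C$ are also indexed by $H\in C$. $V^{\mathrm{reg}}=V\setminus\bigcup_{H\in\mathcal A} H$, $X^{\mathrm{reg}}=W\backslash V^{\mathrm{reg}}$; $v_0\in V^{\mathrm{reg}}$ is a base point with image $x_0$. The braid group is $B=\pi_1(X^{\mathrm{reg}},x_0)$. For $H\in\mathcal A$, $l_H\in B$ is the class of a path in $V^{\mathrm{reg}}$ from $v_0$ to $s_Hv_0$ of the standard form: go from $v_0$ along a path $\gamma$ to a point close to a generic point of $H$, turn around $H$ in the positive direction by the angle $2\pi/e_H$,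 return along $s_H(\gamma^{-1})$. (All choices for fixed $H$ are conjugate in $B$.) With the product in $B$ given by concatenation (left factor first), the map sending a loop to the $w\in W$ such that its lift starting at $v_0$ ends at $wv_0$ is a surjective homomorphism $B\to W$ with $l_H\mapsto s_H$. A Coxeter-like presentation of $W$ is a presentation by a minimal set of generators $\mathcal S\subset W$ such that: (1) $\mathcal S$ consists of reflections (of the form $s_H$), and all relations are generated by homogeneous braid relations (equalities of two positive words of equal length in the generators) and order relations $s^d=e$ ($s\in\mathcal S$); (2) for a suitable choice of the $l_H$ with $s_H\in\mathcal S$, these $l_H$ together with just the homogeneous relations of (1) form a presentation of $B$. $R=\mathbb Z[u_{C,j}^{\pm1}:C\in\mathcal C,\,0\le j\le e_C-1]$ with $u_{C,j}$ indeterminates, and $Q=\mathrm{Frac}(R)$. The topological Hecke algebra is $H_u(W)=R[B]/J$, where $J$ is the two-sided ideal generated by the elements $\prod_{j=0}^{e_H-1}(l_H-u_{H,j})$, $H\in\mathcal A$. $S$ is the ring of entire functions in the complex variables $k=(k_{C,j})_{C\in\mathcal C,\,0\le j\le e_C-1}$ and $K=\mathrm{Frac}(S)$. $R$ is embedded in $S$ (hence $Q$ in $K$) by $u_{C,j}=\zeta_C^{\,j}\exp(-2\pi\sqrt{-1}\,k_{C,j})$, where $\zeta_C=e^{2\pi\sqrt{-1}/e_C}$. Under the hypotheses of the theorem it is known that $K\otimes_RH_u(W)\simeq K[W]$ as $K$-algebras. The character field $F$ is the subfield of $K$ generated over $Q$ by the values of the irreducible characters of $K\otimes_RH_u(W)$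 on $Q\otimes_RH_u(W)$. $\mathbb C\cdot F$ and $\mathbb C\cdot Q$ denote composites inside $K$ (with $\mathbb C\subset S$ the constants). *)

theory Defs
  imports "HOL-Analysis.Analysis" "HOL-Library.Poly_Mapping" "HOL-Algebra.Algebra"
begin

section \<open>Algebraic constructions\<close>

subsection \<open>Associative algebras\<close>

text \<open>The record type \<open>('r, 'a) module\<close> (ring operations together with a scalar multiplication)
  also serves for associative algebras that need not be commutative.\<close>

definition monoid_elem :: "('r, 'p) ring_scheme \<Rightarrow> 'g \<Rightarrow> 'r \<Rightarrow> 'g \<Rightarrow> 'r" where
  "monoid_elem R g r = (\<lambda>x. if x = g then r else \<zero>\<^bsub>R\<^esub>)"

definition monoid_algebra ::
  "('r, 'p) ring_scheme \<Rightarrow> ('g, 'q) monoid_scheme \<Rightarrow> ('r, 'g \<Rightarrow> 'r) module" where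
  "monoid_algebra R G =
     \<lparr>carrier = {f. (\<forall>x. f x \<in> carrier R) \<and> finite {x. f x \<noteq> \<zero>\<^bsub>R\<^esub>} \<and> {x. f x \<noteq> \<zero>\<^bsub>R\<^esub>} \<subseteq> carrier G},
      mult = (\<lambda>f g x. \<Oplus>\<^bsub>R\<^esub>p \<in> {(y, z). f y \<noteq> \<zero>\<^bsub>R\<^esub> \<and> g z \<noteq> \<zero>\<^bsub>R\<^esub> \<and> y \<otimes>\<^bsub>G\<^esub> z = x}.
                         f (fst p) \<otimes>\<^bsub>R\<^esub> g (snd p)),
      one = monoid_elem R \<one>\<^bsub>G\<^esub> \<one>\<^bsub>R\<^esub>,
      ring.zero = (\<lambda>x. \<zero>\<^bsub>R\<^esub>),
      add = (\<lambda>f g x. f x \<oplus>\<^bsub>R\<^esub> g x),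
      module.smult = (\<lambda>r f x. r \<otimes>\<^bsub>R\<^esub> f x)\<rparr>"

definition quot_algebra :: "('r, 'a, 'm) module_scheme \<Rightarrow> 'a set \<Rightarrow> ('r, 'a set) module" where
  "quot_algebra A I =
     \<lparr>carrier = carrier (A Quot I), mult = mult (A Quot I), one = one (A Quot I),
      ring.zero = ring.zero (A Quot I), add = add (A Quot I),
      module.smult = (\<lambda>r Y. \<Union>x\<in>Y. I +>\<^bsub>A\<^esub> (r \<odot>\<^bsub>A\<^esub> x))\<rparr>"

text \<open>The tensor product \<open>K \<otimes>\<^sub>R A\<close> along \<open>\<theta> : R \<rightarrow> K\<close> by generators and relations: the
  generators \<open>x \<otimes> a\<close> span the monoid algebra over \<open>K\<close> of the multiplicative monoid of \<open>A\<close>, and the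
  \<open>K\<close>-span of the bilinearity relations is already stable under multiplication.\<close>

definition tensor_relations ::
  "('r, 'p) ring_scheme \<Rightarrow> ('k, 'q) ring_scheme \<Rightarrow> ('r \<Rightarrow> 'k) \<Rightarrow> ('r, 'a, 'm) module_scheme
     \<Rightarrow> ('a \<Rightarrow> 'k) set" where
  "tensor_relations R K \<theta> A =
     (let M = monoid_algebra K A in
      {monoid_elem K (a \<oplus>\<^bsub>A\<^esub> b) \<one>\<^bsub>K\<^esub> \<ominus>\<^bsub>M\<^esub> (monoid_elem K a \<one>\<^bsub>K\<^esub> \<oplus>\<^bsub>M\<^esub> monoid_elem K b \<one>\<^bsub>K\<^esub>) | a b.
         a \<in> carrier A \<and> b \<in> carrier A} \<union>
      {monoid_elem K (r \<odot>\<^bsub>A\<^esub> a) \<one>\<^bsub>K\<^esub> \<ominus>\<^bsub>M\<^esub> monoid_elem K a (\<theta> r) | r a.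
         r \<in> carrier R \<and> a \<in> carrier A})"

definition tensor_ideal ::
  "('r, 'p) ring_scheme \<Rightarrow> ('k, 'q) ring_scheme \<Rightarrow> ('r \<Rightarrow> 'k) \<Rightarrow> ('r, 'a, 'm) module_scheme
     \<Rightarrow> ('a \<Rightarrow> 'k) set" where
  "tensor_ideal R K \<theta> A = genideal (monoid_algebra K A) (tensor_relations R K \<theta> A)"

definition scalar_extension ::
  "('r, 'p) ring_scheme \<Rightarrow> ('k, 'q) ring_scheme \<Rightarrow> ('r \<Rightarrow> 'k) \<Rightarrow> ('r, 'a, 'm) module_scheme
     \<Rightarrow> ('k, ('a \<Rightarrow> 'k) set) module" where
  "scalar_extension R K \<theta> A = quot_algebra (monoid_algebra K A) (tensor_ideal R K \<theta> A)"

definition pure_tensor ::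
  "('r, 'p) ring_scheme \<Rightarrow> ('k, 'q) ring_scheme \<Rightarrow> ('r \<Rightarrow> 'k) \<Rightarrow> ('r, 'a, 'm) module_scheme
     \<Rightarrow> 'k \<Rightarrow> 'a \<Rightarrow> ('a \<Rightarrow> 'k) set" where
  "pure_tensor R K \<theta> A x a = tensor_ideal R K \<theta> A +>\<^bsub>monoid_algebra K A\<^esub> monoid_elem K a x"

definition module_generated_by ::
  "('r, 'p) ring_scheme \<Rightarrow> ('r, 'a, 'm) module_scheme \<Rightarrow> nat \<Rightarrow> bool" where
  "module_generated_by R M m \<longleftrightarrow>
     (\<exists>b \<in> {..<m} \<rightarrow> carrier M. \<forall>x \<in> carrier M. \<exists>c \<in> {..<m} \<rightarrow> carrier R.
        x = (\<Oplus>\<^bsub>M\<^esub>i\<in>{..<m}. c i \<odot>\<^bsub>M\<^esub> b i))"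


subsection \<open>Field of fractions\<close>

definition fraction :: "('a, 'm) ring_scheme \<Rightarrow> 'a \<Rightarrow> 'a \<Rightarrow> ('a \<times> 'a) set" where
  "fraction D a b =
     {(c, d). c \<in> carrier D \<and> d \<in> carrier D - {\<zero>\<^bsub>D\<^esub>} \<and> a \<otimes>\<^bsub>D\<^esub> d = c \<otimes>\<^bsub>D\<^esub> b}"

definition Frac :: "('a, 'm) ring_scheme \<Rightarrow> ('a \<times> 'a) set ring" where
  "Frac D =
     \<lparr>carrier = {fraction D a b | a b. a \<in> carrier D \<and> b \<in> carrier D - {\<zero>\<^bsub>D\<^esub>}},
      mult = (\<lambda>Y Z. \<Union>(a, b)\<in>Y. \<Union>(c, d)\<in>Z. fraction D (a \<otimes>\<^bsub>D\<^esub> c) (b \<otimes>\<^bsub>D\<^esub> d)),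
      one = fraction D \<one>\<^bsub>D\<^esub> \<one>\<^bsub>D\<^esub>,
      ring.zero = fraction D \<zero>\<^bsub>D\<^esub> \<one>\<^bsub>D\<^esub>,
      add = (\<lambda>Y Z. \<Union>(a, b)\<in>Y. \<Union>(c, d)\<in>Z.
               fraction D ((a \<otimes>\<^bsub>D\<^esub> d) \<oplus>\<^bsub>D\<^esub> (c \<otimes>\<^bsub>D\<^esub> b)) (b \<otimes>\<^bsub>D\<^esub> d))\<rparr>"

definition to_Frac :: "('a, 'm) ring_scheme \<Rightarrow> 'a \<Rightarrow> ('a \<times> 'a) set" where
  "to_Frac D a = fraction D a \<one>\<^bsub>D\<^esub>"


subsection \<open>Irreducible characters of an algebra over a field\<close>

definition mat_algebra :: "('k, 'm) ring_scheme \<Rightarrow> nat \<Rightarrow> ('k, nat \<times> nat \<Rightarrow> 'k) module" where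
  "mat_algebra K d =
     \<lparr>carrier = ({..<d} \<times> {..<d}) \<rightarrow>\<^sub>E carrier K,
      mult = (\<lambda>M N. \<lambda>(i, j) \<in> {..<d} \<times> {..<d}. \<Oplus>\<^bsub>K\<^esub>m\<in>{..<d}. M (i, m) \<otimes>\<^bsub>K\<^esub> N (m, j)),
      one = (\<lambda>(i, j) \<in> {..<d} \<times> {..<d}. if i = j then \<one>\<^bsub>K\<^esub> else \<zero>\<^bsub>K\<^esub>),
      ring.zero = (\<lambda>p \<in> {..<d} \<times> {..<d}. \<zero>\<^bsub>K\<^esub>),
      add = (\<lambda>M N. \<lambda>p \<in> {..<d} \<times> {..<d}. M p \<oplus>\<^bsub>K\<^esub> N p),
      module.smult = (\<lambda>c M. \<lambda>p \<in> {..<d} \<times> {..<d}. c \<otimes>\<^bsub>K\<^esub> M p)\<rparr>"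

definition mat_trace :: "('k, 'm) ring_scheme \<Rightarrow> nat \<Rightarrow> (nat \<times> nat \<Rightarrow> 'k) \<Rightarrow> 'k" where
  "mat_trace K d M = (\<Oplus>\<^bsub>K\<^esub>i\<in>{..<d}. M (i, i))"

definition mat_act ::
  "('k, 'm) ring_scheme \<Rightarrow> nat \<Rightarrow> (nat \<times> nat \<Rightarrow> 'k) \<Rightarrow> (nat \<Rightarrow> 'k) \<Rightarrow> nat \<Rightarrow> 'k" where
  "mat_act K d M v = (\<lambda>i\<in>{..<d}. \<Oplus>\<^bsub>K\<^esub>j\<in>{..<d}. M (i, j) \<otimes>\<^bsub>K\<^esub> v j)"

definition coord_subspace :: "('k, 'm) ring_scheme \<Rightarrow> nat \<Rightarrow> (nat \<Rightarrow> 'k) set \<Rightarrow> bool" where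
  "coord_subspace K d U \<longleftrightarrow>
     U \<subseteq> {..<d} \<rightarrow>\<^sub>E carrier K \<and> (\<lambda>i\<in>{..<d}. \<zero>\<^bsub>K\<^esub>) \<in> U \<and>
     (\<forall>u\<in>U. \<forall>v\<in>U. (\<lambda>i\<in>{..<d}. u i \<oplus>\<^bsub>K\<^esub> v i) \<in> U) \<and>
     (\<forall>c\<in>carrier K. \<forall>u\<in>U. (\<lambda>i\<in>{..<d}. c \<otimes>\<^bsub>K\<^esub> u i) \<in> U)"

definition matrix_rep ::
  "('k, 'm) ring_scheme \<Rightarrow> ('k, 'a, 'n) module_scheme \<Rightarrow> nat \<Rightarrow> ('a \<Rightarrow> nat \<times> nat \<Rightarrow> 'k) \<Rightarrow> bool" where
  "matrix_rep K A d \<rho> \<longleftrightarrow>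
     \<rho> \<in> ring_hom A (mat_algebra K d) \<and>
     (\<forall>c\<in>carrier K. \<forall>a\<in>carrier A. \<rho> (c \<odot>\<^bsub>A\<^esub> a) = c \<odot>\<^bsub>mat_algebra K d\<^esub> \<rho> a)"

definition irreducible_matrix_rep ::
  "('k, 'm) ring_scheme \<Rightarrow> ('k, 'a, 'n) module_scheme \<Rightarrow> nat \<Rightarrow> ('a \<Rightarrow> nat \<times> nat \<Rightarrow> 'k) \<Rightarrow> bool" where
  "irreducible_matrix_rep K A d \<rho> \<longleftrightarrow>
     matrix_rep K A d \<rho> \<and> 0 < d \<and>
     (\<forall>U. coord_subspace K d U \<and> (\<forall>a\<in>carrier A. \<forall>u\<in>U. mat_act K d (\<rho> a) u \<in> U) \<longrightarrow>
        U = {\<lambda>i\<in>{..<d}. \<zero>\<^bsub>K\<^esub>} \<or> U = ({..<d} \<rightarrow>\<^sub>E carrier K))"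

definition irreducible_characters ::
  "('k, 'm) ring_scheme \<Rightarrow> ('k, 'a, 'n) module_scheme \<Rightarrow> ('a \<Rightarrow> 'k) set" where
  "irreducible_characters K A =
     {ch. \<exists>d \<rho>. irreducible_matrix_rep K A d \<rho> \<and> ch = (\<lambda>a. mat_trace K d (\<rho> a))}"


subsection \<open>Abelian extensions\<close>

definition field_automorphisms :: "('k, 'm) ring_scheme \<Rightarrow> 'k set \<Rightarrow> 'k set \<Rightarrow> ('k \<Rightarrow> 'k) set" where
  "field_automorphisms K E L =
     {\<sigma> \<in> ring_iso (K\<lparr>carrier := L\<rparr>) (K\<lparr>carrier := L\<rparr>). \<forall>x\<in>E. \<sigma> x = x}"

text \<open>\<open>E \<subseteq> L\<close> are subfields of the field \<open>K\<close>.\<close>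

definition abelian_extension :: "('k, 'm) ring_scheme \<Rightarrow> 'k set \<Rightarrow> 'k set \<Rightarrow> bool" where
  "abelian_extension K E L \<longleftrightarrow>
     subfield E K \<and> subfield L K \<and> E \<subseteq> L \<and>
     (\<forall>x\<in>L. (ring.algebraic K over E) x) \<and>
     {x\<in>L. \<forall>\<sigma>\<in>field_automorphisms K E L. \<sigma> x = x} = E \<and>
     (\<forall>\<sigma>\<in>field_automorphisms K E L. \<forall>\<tau>\<in>field_automorphisms K E L. \<forall>x\<in>L. \<sigma> (\<tau> x) = \<tau> (\<sigma> x))"


subsection \<open>Group presentations\<close>

text \<open>Words in generators and their formal inverses are lists over \<open>'x \<times> bool\<close>, where \<open>False\<close> marks
  an inverse. A relation is a pair of positive words; an order relation \<open>x\<^sup>d = 1\<close> has an empty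
  right-hand side.\<close>

definition positive_word :: "'x list \<Rightarrow> ('x \<times> bool) list" where
  "positive_word p = map (\<lambda>x. (x, True)) p"

inductive presentation_eq ::
  "'x set \<Rightarrow> ('x list \<times> 'x list) set \<Rightarrow> ('x \<times> bool) list \<Rightarrow> ('x \<times> bool) list \<Rightarrow> bool"
  for Y rels where
    refl: "presentation_eq Y rels u u"
  | sym: "presentation_eq Y rels u v \<Longrightarrow> presentation_eq Y rels v u"
  | trans: "presentation_eq Y rels u v \<Longrightarrow> presentation_eq Y rels v w \<Longrightarrow> presentation_eq Y rels u w"
  | cancel: "x \<in> Y \<Longrightarrow> presentation_eq Y rels (u @ [(x, b), (x, \<not> b)] @ v) (u @ v)"
  | relation: "(p, q) \<in> rels \<Longrightarrow>
      presentation_eq Y rels (u @ positive_word p @ v) (u @ positive_word q @ v)"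

definition eval_word :: "('g, 'm) monoid_scheme \<Rightarrow> ('x \<Rightarrow> 'g) \<Rightarrow> ('x \<times> bool) list \<Rightarrow> 'g" where
  "eval_word G g w =
     foldr (\<lambda>(x, b) y. (if b then g x else inv\<^bsub>G\<^esub> (g x)) \<otimes>\<^bsub>G\<^esub> y) w \<one>\<^bsub>G\<^esub>"

definition group_presentation ::
  "('g, 'm) monoid_scheme \<Rightarrow> 'x set \<Rightarrow> ('x \<Rightarrow> 'g) \<Rightarrow> ('x list \<times> 'x list) set \<Rightarrow> bool" where
  "group_presentation G Y g rels \<longleftrightarrow>
     g \<in> Y \<rightarrow> carrier G \<and> rels \<subseteq> lists Y \<times> lists Y \<and>
     generate G (g ` Y) = carrier G \<and>
     (\<forall>u \<in> lists (Y \<times> UNIV). \<forall>v \<in> lists (Y \<times> UNIV).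
        eval_word G g u = eval_word G g v \<longleftrightarrow> presentation_eq Y rels u v)"


section \<open>Fundamental group of an abstract topological space\<close>

definition quotient_topology :: "'a topology \<Rightarrow> ('a \<Rightarrow> 'b) \<Rightarrow> 'b topology" where
  "quotient_topology Y f =
     topology (\<lambda>U. U \<subseteq> f ` topspace Y \<and> openin Y {x \<in> topspace Y. f x \<in> U})"

definition loop_in :: "'a topology \<Rightarrow> 'a \<Rightarrow> (real \<Rightarrow> 'a) \<Rightarrow> bool" where
  "loop_in Y x p \<longleftrightarrow> pathin Y p \<and> p 0 = x \<and> p 1 = x"

definition loop_class :: "'a topology \<Rightarrow> 'a \<Rightarrow> (real \<Rightarrow> 'a) \<Rightarrow> (real \<Rightarrow> 'a) set" where
  "loop_class Y x p =
     {q. homotopic_with (\<lambda>r. r 0 = x \<and> r 1 = x) (top_of_set {0..1}) Y p q}"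

text \<open>The library's \<open>joinpaths\<close> requires the points to form a topological type class.\<close>

definition concat_path :: "(real \<Rightarrow> 'a) \<Rightarrow> (real \<Rightarrow> 'a) \<Rightarrow> real \<Rightarrow> 'a" where
  "concat_path p q = (\<lambda>t. if t \<le> 1/2 then p (2 * t) else q (2 * t - 1))"

definition fundamental_group :: "'a topology \<Rightarrow> 'a \<Rightarrow> (real \<Rightarrow> 'a) set monoid" where
  "fundamental_group Y x =
     \<lparr>carrier = {loop_class Y x p | p. loop_in Y x p},
      mult = (\<lambda>a b. \<Union>p\<in>a. \<Union>q\<in>b. loop_class Y x (concat_path p q)),
      one = loop_class Y x (\<lambda>t. x)\<rparr>"


section \<open>Complex reflection groups\<close>

text \<open>The Hilbert space \<open>V\<close> is \<open>complex ^ 'n\<close> with its standard Hermitian form.\<close>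

definition hermitian :: "complex ^ 'n \<Rightarrow> complex ^ 'n \<Rightarrow> complex" where
  "hermitian x y = (\<Sum>i\<in>UNIV. x $ i * cnj (y $ i))"

definition unitary_group :: "(complex ^ 'n ^ 'n) monoid" where
  "unitary_group =
     \<lparr>carrier = {A. \<forall>x y. hermitian (A *v x) (A *v y) = hermitian x y},
      mult = (**), one = mat 1\<rparr>"

definition fixed_space :: "complex ^ 'n ^ 'n \<Rightarrow> (complex ^ 'n) set" where
  "fixed_space g = {v. g *v v = v}"

definition is_reflection :: "complex ^ 'n ^ 'n \<Rightarrow> bool" where
  "is_reflection g \<longleftrightarrow> vec.dim (fixed_space g) + 1 = CARD('n)"

definition finite_reflection_group :: "(complex ^ 'n ^ 'n) set \<Rightarrow> bool" where
  "finite_reflection_group W \<longleftrightarrow>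
     finite W \<and> subgroup W unitary_group \<and> generate unitary_group {g \<in> W. is_reflection g} = W"

definition hyperplanes :: "(complex ^ 'n ^ 'n) set \<Rightarrow> (complex ^ 'n) set set" where
  "hyperplanes W = fixed_space ` {g \<in> W. is_reflection g}"

definition hyperplane_orbit ::
  "(complex ^ 'n ^ 'n) set \<Rightarrow> (complex ^ 'n) set \<Rightarrow> (complex ^ 'n) set set" where
  "hyperplane_orbit W H = {(*v) w ` H | w. w \<in> W}"

definition hyperplane_orbits :: "(complex ^ 'n ^ 'n) set \<Rightarrow> (complex ^ 'n) set set set" where
  "hyperplane_orbits W = hyperplane_orbit W ` hyperplanes W"

definition pointwise_stabilizer ::
  "(complex ^ 'n ^ 'n) set \<Rightarrow> (complex ^ 'n) set \<Rightarrow> (complex ^ 'n ^ 'n) set" where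
  "pointwise_stabilizer W H = {w \<in> W. \<forall>v\<in>H. w *v v = v}"

definition stab_order :: "(complex ^ 'n ^ 'n) set \<Rightarrow> (complex ^ 'n) set \<Rightarrow> nat" where
  "stab_order W H = card (pointwise_stabilizer W H)"

definition orbit_order :: "(complex ^ 'n ^ 'n) set \<Rightarrow> (complex ^ 'n) set set \<Rightarrow> nat" where
  "orbit_order W C = (THE e. \<forall>H\<in>C. stab_order W H = e)"

text \<open>Since \<open>det\<close> is injective on the pointwise stabilizer of a hyperplane, the condition on the
  determinant singles out one element, and that element is a generator.\<close>

definition dist_reflection :: "(complex ^ 'n ^ 'n) set \<Rightarrow> (complex ^ 'n) set \<Rightarrow> complex ^ 'n ^ 'n" where
  "dist_reflection W H =
     (THE s. s \<in> pointwise_stabilizer W H \<and> det s = exp (2 * pi * \<i> / of_nat (stab_order W H)))"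


subsection \<open>Braid group\<close>

definition V_reg :: "(complex ^ 'n ^ 'n) set \<Rightarrow> (complex ^ 'n) set" where
  "V_reg W = UNIV - \<Union>(hyperplanes W)"

definition vector_orbit :: "(complex ^ 'n ^ 'n) set \<Rightarrow> complex ^ 'n \<Rightarrow> (complex ^ 'n) set" where
  "vector_orbit W v = {w *v v | w. w \<in> W}"

definition X_reg :: "(complex ^ 'n ^ 'n) set \<Rightarrow> (complex ^ 'n) set topology" where
  "X_reg W = quotient_topology (top_of_set (V_reg W)) (vector_orbit W)"

type_synonym 'n braid = "(real \<Rightarrow> (complex ^ 'n) set) set"

definition braid_group :: "(complex ^ 'n ^ 'n) set \<Rightarrow> complex ^ 'n \<Rightarrow> 'n braid monoid" where
  "braid_group W v0 = fundamental_group (X_reg W) (vector_orbit W v0)"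

text \<open>The path \<open>\<gamma>\<close> ends at a point \<open>a + b\<close> (\<open>a \<in> H\<close>, \<open>b\<close> orthogonal to \<open>H\<close>) of a ball around
  \<open>x \<in> H\<close> that meets no other reflection hyperplane; the rotation by \<open>2\<pi>/e\<^sub>H\<close> in the direction
  orthogonal to \<open>H\<close> stays in that ball and ends at \<open>s\<^sub>H (a + b)\<close>.\<close>

definition reflection_paths ::
  "(complex ^ 'n ^ 'n) set \<Rightarrow> complex ^ 'n \<Rightarrow> (complex ^ 'n) set \<Rightarrow> (real \<Rightarrow> complex ^ 'n) set" where
  "reflection_paths W v0 H =
     {\<gamma> +++ ((\<lambda>t. a + exp (2 * pi * \<i> * of_real t / of_nat (stab_order W H)) *s b)
             +++ ((*v) (dist_reflection W H) \<circ> reversepath \<gamma>)) | \<gamma> a b.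
        path \<gamma> \<and> path_image \<gamma> \<subseteq> V_reg W \<and> pathstart \<gamma> = v0 \<and> pathfinish \<gamma> = a + b \<and>
        a \<in> H \<and> (\<forall>y\<in>H. hermitian y b = 0) \<and>
        (\<exists>x\<in>H. \<exists>r>0. (\<forall>H'\<in>hyperplanes W. H' \<noteq> H \<longrightarrow> ball x r \<inter> H' = {}) \<and> a + b \<in> ball x r)}"

definition braid_reflections ::
  "(complex ^ 'n ^ 'n) set \<Rightarrow> complex ^ 'n \<Rightarrow> (complex ^ 'n) set \<Rightarrow> 'n braid set" where
  "braid_reflections W v0 H =
     (\<lambda>p. loop_class (X_reg W) (vector_orbit W v0) (vector_orbit W \<circ> p)) ` reflection_paths W v0 H"

text \<open>The generating set \<open>S\<close> consists of the reflections \<open>s\<^sub>H\<close> for \<open>H \<in> T\<close>; since \<open>s\<^sub>H\<close> determines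
  \<open>H\<close>, words in the generators are written as words in \<open>T\<close>.\<close>

definition coxeter_like_presentation :: "(complex ^ 'n ^ 'n) set \<Rightarrow> complex ^ 'n \<Rightarrow> bool" where
  "coxeter_like_presentation W v0 \<longleftrightarrow>
     (\<exists>T \<subseteq> hyperplanes W. \<exists>braid_rels order_rels.
        (\<forall>S' \<subset> dist_reflection W ` T. generate unitary_group S' \<noteq> W) \<and>
        (\<forall>(p, q) \<in> braid_rels. length p = length q) \<and>
        order_rels \<subseteq> {(replicate d H, []) | d H. H \<in> T} \<and>
        group_presentation (unitary_group\<lparr>carrier := W\<rparr>) T (dist_reflection W)
          (braid_rels \<union> order_rels) \<and>
        (\<exists>l. (\<forall>H\<in>T. l H \<in> braid_reflections W v0 H) \<and>
             group_presentation (braid_group W v0) T l braid_rels))"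


section \<open>Coefficient rings and fields\<close>

type_synonym 'n param = "(complex ^ 'n) set set \<times> nat"

type_synonym 'i laurent = "('i \<Rightarrow>\<^sub>0 int) \<Rightarrow>\<^sub>0 int"

type_synonym 'i fun_quot = "((('i \<Rightarrow> complex) \<Rightarrow> complex) \<times> (('i \<Rightarrow> complex) \<Rightarrow> complex)) set"

definition param_index :: "(complex ^ 'n ^ 'n) set \<Rightarrow> 'n param set" where
  "param_index W = {(C, j). C \<in> hyperplane_orbits W \<and> j < orbit_order W C}"

definition laurent_ring :: "'i set \<Rightarrow> 'i laurent ring" where
  "laurent_ring I =
     \<lparr>carrier = {p. \<forall>m \<in> Poly_Mapping.keys p. Poly_Mapping.keys m \<subseteq> I}, mult = (*), one = 1, ring.zero = 0, add = (+)\<rparr>"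

definition laurent_var :: "'i \<Rightarrow> 'i laurent" where
  "laurent_var i = Poly_Mapping.single (Poly_Mapping.single i 1) 1"

definition laurent_eval :: "('i \<Rightarrow> complex) \<Rightarrow> 'i laurent \<Rightarrow> complex" where
  "laurent_eval u p =
     (\<Sum>m\<in>Poly_Mapping.keys p. of_int (Poly_Mapping.lookup p m) * (\<Prod>i\<in>Poly_Mapping.keys m. u i powi Poly_Mapping.lookup m i))"

text \<open>Functions of the variables \<open>k i\<close> (\<open>i \<in> I\<close>, \<open>I\<close> finite) are functions on \<open>'i \<Rightarrow> complex\<close>
  independent of the coordinates outside \<open>I\<close>; entire means complex differentiable at every point
  (as a function of several variables).\<close>

definition entire_on_coords :: "'i set \<Rightarrow> (('i \<Rightarrow> complex) \<Rightarrow> complex) \<Rightarrow> bool" where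
  "entire_on_coords I f \<longleftrightarrow>
     (\<forall>k k'. (\<forall>i\<in>I. k i = k' i) \<longrightarrow> f k = f k') \<and>
     (\<forall>k. \<exists>c. \<forall>\<epsilon>>0. \<exists>\<delta>>0. \<forall>h. (\<forall>i\<in>I. cmod (h i) < \<delta>) \<longrightarrow>
        cmod (f (\<lambda>i. k i + h i) - f k - (\<Sum>i\<in>I. c i * h i)) \<le> \<epsilon> * (\<Sum>i\<in>I. cmod (h i)))"

definition entire_ring :: "'i set \<Rightarrow> (('i \<Rightarrow> complex) \<Rightarrow> complex) ring" where
  "entire_ring I =
     \<lparr>carrier = {f. entire_on_coords I f}, mult = (\<lambda>f g k. f k * g k), one = (\<lambda>k. 1),
      ring.zero = (\<lambda>k. 0), add = (\<lambda>f g k. f k + g k)\<rparr>"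

definition ring_R :: "(complex ^ 'n ^ 'n) set \<Rightarrow> 'n param laurent ring" where
  "ring_R W = laurent_ring (param_index W)"

definition ring_S :: "(complex ^ 'n ^ 'n) set \<Rightarrow> (('n param \<Rightarrow> complex) \<Rightarrow> complex) ring" where
  "ring_S W = entire_ring (param_index W)"

definition field_K :: "(complex ^ 'n ^ 'n) set \<Rightarrow> 'n param fun_quot ring" where
  "field_K W = Frac (ring_S W)"

definition u_value :: "(complex ^ 'n ^ 'n) set \<Rightarrow> ('n param \<Rightarrow> complex) \<Rightarrow> 'n param \<Rightarrow> complex" where
  "u_value W k = (\<lambda>(C, j). exp (2 * pi * \<i> / of_nat (orbit_order W C)) ^ j
                             * exp (- 2 * pi * \<i> * k (C, j)))"

definition R_to_K :: "(complex ^ 'n ^ 'n) set \<Rightarrow> 'n param laurent \<Rightarrow> 'n param fun_quot" where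
  "R_to_K W p = to_Frac (ring_S W) (\<lambda>k. laurent_eval (u_value W k) p)"

definition field_Q :: "(complex ^ 'n ^ 'n) set \<Rightarrow> 'n param fun_quot set" where
  "field_Q W = {R_to_K W a \<otimes>\<^bsub>field_K W\<^esub> inv\<^bsub>field_K W\<^esub> (R_to_K W b) | a b.
                  a \<in> carrier (ring_R W) \<and> b \<in> carrier (ring_R W) - {\<zero>\<^bsub>ring_R W\<^esub>}}"

definition constants :: "(complex ^ 'n ^ 'n) set \<Rightarrow> 'n param fun_quot set" where
  "constants W = range (\<lambda>c. to_Frac (ring_S W) (\<lambda>k. c))"

definition complex_composite ::
  "(complex ^ 'n ^ 'n) set \<Rightarrow> 'n param fun_quot set \<Rightarrow> 'n param fun_quot set" where
  "complex_composite W L = generate_field (field_K W) (constants W \<union> L)"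


section \<open>Topological Hecke algebra and character field\<close>

text \<open>The map \<open>l\<close> is a choice of \<open>l\<^sub>H\<close> for every reflection hyperplane \<open>H\<close>.\<close>

definition hecke_element ::
  "(complex ^ 'n ^ 'n) set \<Rightarrow> complex ^ 'n \<Rightarrow> ((complex ^ 'n) set \<Rightarrow> 'n braid)
     \<Rightarrow> (complex ^ 'n) set \<Rightarrow> 'n braid \<Rightarrow> 'n param laurent" where
  "hecke_element W v0 l H =
     (let A = monoid_algebra (ring_R W) (braid_group W v0) in
      foldr (\<lambda>j y. (monoid_elem (ring_R W) (l H) \<one>\<^bsub>ring_R W\<^esub> \<ominus>\<^bsub>A\<^esub>
                     monoid_elem (ring_R W) \<one>\<^bsub>braid_group W v0\<^esub> (laurent_var (hyperplane_orbit W H, j)))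
                   \<otimes>\<^bsub>A\<^esub> y)
        [0..<stab_order W H] \<one>\<^bsub>A\<^esub>)"

definition hecke_algebra ::
  "(complex ^ 'n ^ 'n) set \<Rightarrow> complex ^ 'n \<Rightarrow> ((complex ^ 'n) set \<Rightarrow> 'n braid)
     \<Rightarrow> ('n param laurent, ('n braid \<Rightarrow> 'n param laurent) set) module" where
  "hecke_algebra W v0 l =
     (let A = monoid_algebra (ring_R W) (braid_group W v0) in
      quot_algebra A (genideal A (hecke_element W v0 l ` hyperplanes W)))"

definition K_hecke_algebra ::
  "(complex ^ 'n ^ 'n) set \<Rightarrow> complex ^ 'n \<Rightarrow> ((complex ^ 'n) set \<Rightarrow> 'n braid)
     \<Rightarrow> ('n param fun_quot,
         (('n braid \<Rightarrow> 'n param laurent) set \<Rightarrow> 'n param fun_quot) set) module" where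
  "K_hecke_algebra W v0 l =
     scalar_extension (ring_R W) (field_K W) (R_to_K W) (hecke_algebra W v0 l)"

text \<open>The image of \<open>Q \<otimes>\<^sub>R H\<^sub>u(W)\<close> in \<open>K \<otimes>\<^sub>R H\<^sub>u(W)\<close>: all sums of pure tensors \<open>q \<otimes> h\<close> with \<open>q \<in> Q\<close>.\<close>

definition Q_hecke_algebra ::
  "(complex ^ 'n ^ 'n) set \<Rightarrow> complex ^ 'n \<Rightarrow> ((complex ^ 'n) set \<Rightarrow> 'n braid)
     \<Rightarrow> (('n braid \<Rightarrow> 'n param laurent) set \<Rightarrow> 'n param fun_quot) set set" where
  "Q_hecke_algebra W v0 l =
     generate (add_monoid (K_hecke_algebra W v0 l))
       {pure_tensor (ring_R W) (field_K W) (R_to_K W) (hecke_algebra W v0 l) q h | q h.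
          q \<in> field_Q W \<and> h \<in> carrier (hecke_algebra W v0 l)}"

definition character_field ::
  "(complex ^ 'n ^ 'n) set \<Rightarrow> complex ^ 'n \<Rightarrow> ((complex ^ 'n) set \<Rightarrow> 'n braid)
     \<Rightarrow> 'n param fun_quot set" where
  "character_field W v0 l =
     generate_field (field_K W)
       (field_Q W \<union> {ch x | ch x. ch \<in> irreducible_characters (field_K W) (K_hecke_algebra W v0 l) \<and>
                               x \<in> Q_hecke_algebra W v0 l})"

end

theory Submission
  imports Defs "HOL-Complex_Analysis.Complex_Analysis" "HOL-Library.Landau_Symbols" "Jordan_Normal_Form.Schur_Decomposition"
begin

text \<open>Let \<open>H\<close> be the Hecke algebra, generated over \<open>R\<close> by \<open>n\<close> elements, and let \<open>h \<in> H\<close>. In an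
  irreducible matrix representation of \<open>K \<otimes> H\<close> the eigenvalues of \<open>h\<close> at a generic parameter \<open>k\<close>
  are eigenvalues of an \<open>n \<times> n\<close> matrix of Laurent polynomials in the \<open>exp (-2\<pi>i k\<^sub>i)\<close>. Hence the
  trace of \<open>h\<close> is an entire function, of at most exponential growth, which takes only boundedly
  many values on each orbit of integer translations of \<open>k\<close>; such a function is a polynomial in the
  \<open>exp (\<plusminus>2\<pi>i k\<^sub>i / N)\<close> for a suitable \<open>N\<close>, that is, in radicals of the \<open>u\<^sub>i\<close>. Twisting a
  representation by an integer translation gives another one, so the character field is stable under
  these translations. They act on the field generated by the radicals with the monomials as
  simultaneous eigenvectors, so every element of the composite with the constants is a sum of
  eigenvectors lying in this composite; automorphisms multiply each of these by a root of unity, and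
  therefore commute.\<close>

section \<open>Entire functions of several variables\<close>

text \<open>Traces are a priori fractions of entire functions of several variables, and such a
  fraction has no value where its denominator vanishes. Statements about \<open>f / g\<close> are
  therefore cross-multiplied, and denominators are cancelled because entire functions have no zero
  divisors, by the identity theorem on complex lines. The same fact exchanges quantifiers: if at
  every point some member of a finite family vanishes, one member vanishes identically. It yields
  one period for all \<open>k\<close>, and it shows that roots of unity in \<open>K\<close> are
  constants. The constant is \<open>N = fact (n ^ n)\<close>. In an irreducible representation the
  first columns of the images of the \<open>n\<close> generators span the whole space, so its
  dimension \<open>d\<close> is at most \<open>n\<close>. A trace is a sum of \<open>d\<close>
  numbers out of at most \<open>n\<close> eigenvalues, the same ones after every unit shift of a
  coordinate. Among \<open>n ^ d + 1\<close> consecutive shifts two therefore give the same list of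
  eigenvalues, whence a period of at most \<open>n ^ n\<close>, a divisor of
  \<open>N\<close>.\<close>

definition coord_norm :: "'i set \<Rightarrow> ('i \<Rightarrow> complex) \<Rightarrow> real" where
  "coord_norm I h = (\<Sum>i\<in>I. cmod (h i))"

text \<open>Increments tend to 0 in the coordinates of \<open>I\<close> and are free elsewhere, as
  in the epsilon-delta clause of \<open>entire_on_coords\<close>; with this filter the clause
  becomes a little-o statement.\<close>

definition small_filter :: "'i set \<Rightarrow> ('i \<Rightarrow> complex) filter" where
  "small_filter I = filtercomap (coord_norm I) (nhds 0)"

lemma coord_norm_nonneg [simp]: "0 \<le> coord_norm I h"
  by (simp add: coord_norm_def sum_nonneg)

lemma cmod_le_coord_norm: "finite I \<Longrightarrow> i \<in> I \<Longrightarrow> cmod (h i) \<le> coord_norm I h"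
  unfolding coord_norm_def by (rule member_le_sum) auto

lemma eventually_small_filter:
  assumes "finite I"
  shows "eventually P (small_filter I) \<longleftrightarrow> (\<exists>\<delta>>0. \<forall>h. (\<forall>i\<in>I. cmod (h i) < \<delta>) \<longrightarrow> P h)"
proof
  assume "eventually P (small_filter I)"
  then obtain Q where Q: "eventually Q (nhds (0::real))" "\<And>h. Q (coord_norm I h) \<Longrightarrow> P h"
    unfolding small_filter_def eventually_filtercomap by blast
  then obtain d where d: "d > 0" "\<And>x. \<bar>x\<bar> < d \<Longrightarrow> Q x"
    unfolding eventually_nhds_metric by (auto simp: dist_real_def)
  show "\<exists>\<delta>>0. \<forall>h. (\<forall>i\<in>I. cmod (h i) < \<delta>) \<longrightarrow> P h"
  proof (intro exI conjI allI impI)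
    \<comment> \<open>Up to \<open>card I\<close> summands below this bound add up to less than
      \<open>d\<close>; the added 1 also covers empty \<open>I\<close>.\<close>
    show "d / (real (card I) + 1) > 0" using d by simp
    fix h assume h: "\<forall>i\<in>I. cmod (h i) < d / (real (card I) + 1)"
    have "coord_norm I h \<le> (\<Sum>i\<in>I. d / (real (card I) + 1))"
      unfolding coord_norm_def by (rule sum_mono) (use h in \<open>auto intro: less_imp_le\<close>)
    also have "\<dots> < d" using d by (simp add: field_simps)
    finally show "P h" using d(2) Q(2) by simp
  qed
next
  assume "\<exists>\<delta>>0. \<forall>h. (\<forall>i\<in>I. cmod (h i) < \<delta>) \<longrightarrow> P h"
  then obtain d where d: "d > 0" "\<And>h. (\<forall>i\<in>I. cmod (h i) < d) \<Longrightarrow> P h" by blast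
  have "eventually (\<lambda>x. x < d) (nhds (0::real))"
    using d(1) eventually_nhds_in_open[of "{..<d}" 0] by simp
  moreover have "P h" if "coord_norm I h < d" for h
    using that d(2) cmod_le_coord_norm[OF assms, of _ h] by (meson le_less_trans)
  ultimately show "eventually P (small_filter I)"
    unfolding small_filter_def eventually_filtercomap by blast
qed

definition has_gradient ::
  "'i set \<Rightarrow> (('i \<Rightarrow> complex) \<Rightarrow> complex) \<Rightarrow> ('i \<Rightarrow> complex) \<Rightarrow> ('i \<Rightarrow> complex) \<Rightarrow> bool" where
  "has_gradient I f k c \<longleftrightarrow>
     (\<lambda>h. f (\<lambda>i. k i + h i) - f k - (\<Sum>i\<in>I. c i * h i)) \<in> o[small_filter I](coord_norm I)"

lemma entire_on_coords_alt:
  assumes "finite I"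
  shows "entire_on_coords I f \<longleftrightarrow>
     (\<forall>k k'. (\<forall>i\<in>I. k i = k' i) \<longrightarrow> f k = f k') \<and> (\<forall>k. \<exists>c. has_gradient I f k c)"
  unfolding entire_on_coords_def has_gradient_def smallo_def
  by (auto simp: eventually_small_filter[OF assms] coord_norm_def[symmetric])

lemma tendsto_coord_norm: "(coord_norm I \<longlongrightarrow> 0) (small_filter I)"
  unfolding small_filter_def by (rule filterlim_filtercomap)

lemma coord_norm_square_smallo:
  "(\<lambda>h. complex_of_real (coord_norm I h) * complex_of_real (coord_norm I h))
     \<in> o[small_filter I](\<lambda>h. complex_of_real (coord_norm I h))"
proof -
  have "((\<lambda>h. complex_of_real (coord_norm I h)) \<longlongrightarrow> 0) (small_filter I)"
    using tendsto_of_real[OF tendsto_coord_norm] by fastforce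
  then have "(\<lambda>h. complex_of_real (coord_norm I h)) \<in> o[small_filter I](\<lambda>_. 1)"
    by (intro smalloI_tendsto) auto
  from landau_o.small.mult_right[OF this, of "\<lambda>h. complex_of_real (coord_norm I h)"]
  show ?thesis by simp
qed

lemma linear_bigo:
  assumes "finite I"
  shows "(\<lambda>h. \<Sum>i\<in>I. c i * h i) \<in> O[small_filter I](coord_norm I)"
proof (rule bigoI[where c = "coord_norm I c"], rule always_eventually, rule allI)
  fix h
  have "cmod (\<Sum>i\<in>I. c i * h i) \<le> (\<Sum>i\<in>I. cmod (c i) * cmod (h i))"
    by (rule order_trans[OF norm_sum]) (simp add: norm_mult)
  also have "\<dots> \<le> (\<Sum>i\<in>I. coord_norm I c * cmod (h i))"
    by (intro sum_mono mult_right_mono cmod_le_coord_norm assms) auto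
  finally show "norm (\<Sum>i\<in>I. c i * h i) \<le> coord_norm I c * norm (complex_of_real (coord_norm I h))"
    by (simp add: sum_distrib_left[symmetric] coord_norm_def[symmetric])
qed

lemma has_gradient_add:
  assumes "has_gradient I f k c" "has_gradient I g k c'"
  shows "has_gradient I (\<lambda>k. f k + g k) k (\<lambda>i. c i + c' i)"
  using sum_in_smallo(1)[OF assms[unfolded has_gradient_def]]
  unfolding has_gradient_def by (simp add: algebra_simps sum.distrib)

text \<open>Write \<open>f\<close> and \<open>g\<close> as value plus linear part plus remainder.
  The product of the two increments is of the order of the squared norm, hence negligible, and what
  is left is linear up to a remainder.\<close>

lemma has_gradient_mult:
  assumes fin: "finite I" and f: "has_gradient I f k c" and g: "has_gradient I g k c'"
  shows "has_gradient I (\<lambda>k. f k * g k) k (\<lambda>i. f k * c' i + g k * c i)"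
proof -
  let ?F = "small_filter I" and ?s = "\<lambda>h. complex_of_real (coord_norm I h)"
  define A B where "A = (\<lambda>h. \<Sum>i\<in>I. c i * h i)" and "B = (\<lambda>h. \<Sum>i\<in>I. c' i * h i)"
  define p q where "p = (\<lambda>h. f (\<lambda>i. k i + h i) - f k - A h)"
    and "q = (\<lambda>h. g (\<lambda>i. k i + h i) - g k - B h)"
  have p: "p \<in> o[?F](?s)" and q: "q \<in> o[?F](?s)"
    using f g by (simp_all add: has_gradient_def p_def q_def A_def B_def)
  have "(\<lambda>h. A h + p h) \<in> O[?F](?s)" "(\<lambda>h. B h + q h) \<in> O[?F](?s)"
    unfolding A_def B_def
    by (intro sum_in_bigo linear_bigo fin landau_o.small_imp_big p q)+
  then have "(\<lambda>h. (A h + p h) * (B h + q h)) \<in> O[?F](\<lambda>h. ?s h * ?s h)"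
    by (rule landau_o.big.mult)
  then have "(\<lambda>h. (A h + p h) * (B h + q h)) \<in> o[?F](?s)"
    by (rule landau_o.big_small_trans[OF _ coord_norm_square_smallo])
  moreover have "(\<lambda>h. f k * q h) \<in> o[?F](?s)" "(\<lambda>h. g k * p h) \<in> o[?F](?s)"
    using p q by (cases "f k = 0"; cases "g k = 0"; simp)+
  ultimately have *: "(\<lambda>h. (A h + p h) * (B h + q h) + (f k * q h + g k * p h)) \<in> o[?F](?s)"
    by (intro sum_in_smallo)
  have "(\<Sum>i\<in>I. (f k * c' i + g k * c i) * h i) = f k * B h + g k * A h" for h
    by (simp add: A_def B_def sum_distrib_left sum.distrib algebra_simps)
  then have "(\<lambda>h. f (\<lambda>i. k i + h i) * g (\<lambda>i. k i + h i) - f k * g k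
        - (\<Sum>i\<in>I. (f k * c' i + g k * c i) * h i))
      = (\<lambda>h. (A h + p h) * (B h + q h) + (f k * q h + g k * p h))"
    by (simp add: p_def q_def algebra_simps)
  with * show ?thesis unfolding has_gradient_def by simp
qed

lemma has_gradient_exp:
  assumes fin: "finite I" and i: "i \<in> I"
  shows "has_gradient I (\<lambda>k. exp (a * k i)) k (\<lambda>j. if j = i then a * exp (a * k i) else 0)"
  unfolding has_gradient_def smallo_def
proof (simp, intro allI impI)
  fix e :: real assume e: "e > 0"
  have "((\<lambda>z. exp (a * z)) has_field_derivative a * exp (a * k i)) (at (k i))"
    by (auto intro!: derivative_eq_intros)
  then have "((\<lambda>z. exp (a * z)) has_derivative (*) (a * exp (a * k i))) (at (k i))"
    by (simp add: has_field_derivative_def)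
  then obtain d where d: "d > 0"
    "\<And>y. norm (y - k i) < d \<Longrightarrow>
      norm (exp (a * y) - exp (a * k i) - (a * exp (a * k i)) * (y - k i)) \<le> e * norm (y - k i)"
    using e unfolding has_derivative_within_alt by blast
  show "\<forall>\<^sub>F h in small_filter I.
      cmod (exp (a * (k i + h i)) - exp (a * k i)
        - (\<Sum>j\<in>I. (if j = i then a * exp (a * k i) else 0) * h j)) \<le> e * coord_norm I h"
    unfolding eventually_small_filter[OF fin]
  proof (intro exI[of _ d] conjI d(1) allI impI)
    fix h assume h: "\<forall>j\<in>I. cmod (h j) < d"
    have "(\<Sum>j\<in>I. (if j = i then a * exp (a * k i) else 0) * h j) = a * exp (a * k i) * h i"
      using fin i by (subst sum.cong[OF HOL.refl, of _ _ "\<lambda>j. if j = i then a * exp (a * k i) * h i else 0"])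
        auto
    moreover have "e * cmod (h i) \<le> e * coord_norm I h"
      using e cmod_le_coord_norm[OF fin i] by simp
    ultimately show "cmod (exp (a * (k i + h i)) - exp (a * k i)
        - (\<Sum>j\<in>I. (if j = i then a * exp (a * k i) else 0) * h j)) \<le> e * coord_norm I h"
      using d(2)[of "k i + h i"] h i by force
  qed
qed

section \<open>Closure properties of entire functions\<close>

lemma entire_onI:
  assumes "finite I" "\<And>k k'. (\<And>i. i \<in> I \<Longrightarrow> k i = k' i) \<Longrightarrow> f k = f k'" "\<And>k. has_gradient I f k (c k)"
  shows "entire_on_coords I f"
  unfolding entire_on_coords_alt[OF assms(1)] using assms(2,3) by metis

lemma entire_gradient:
  assumes "finite I" "entire_on_coords I f"
  obtains c where "\<And>k. has_gradient I f k (c k)"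
  using assms(2) unfolding entire_on_coords_alt[OF assms(1)] by metis

lemma entire_cong_coords:
  "entire_on_coords I f \<Longrightarrow> (\<And>i. i \<in> I \<Longrightarrow> k i = k' i) \<Longrightarrow> f k = f k'"
  unfolding entire_on_coords_def by blast

lemma entire_const: "entire_on_coords I (\<lambda>k. a)"
proof -
  have "0 \<le> e * (\<Sum>i\<in>I. cmod (h i))" if "e > 0" for e h
    using that by (simp add: sum_nonneg)
  then show ?thesis
    unfolding entire_on_coords_def
    by (intro conjI allI impI exI[of _ "\<lambda>_. 0"] exI[of _ "1::real"]) auto
qed

lemma entire_add:
  assumes fin: "finite I" and f: "entire_on_coords I f" and g: "entire_on_coords I g"
  shows "entire_on_coords I (\<lambda>k. f k + g k)"
proof -
  obtain c where c: "\<And>k. has_gradient I f k (c k)" using entire_gradient[OF fin f] by blast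
  obtain d where d: "\<And>k. has_gradient I g k (d k)" using entire_gradient[OF fin g] by blast
  show ?thesis
  proof (rule entire_onI[OF fin])
    show "f k + g k = f k' + g k'" if "\<And>i. i \<in> I \<Longrightarrow> k i = k' i" for k k'
      using entire_cong_coords[OF f that] entire_cong_coords[OF g that] by simp
    show "has_gradient I (\<lambda>k. f k + g k) k (\<lambda>i. c k i + d k i)" for k
      by (rule has_gradient_add[OF c d])
  qed
qed

lemma entire_mult:
  assumes fin: "finite I" and f: "entire_on_coords I f" and g: "entire_on_coords I g"
  shows "entire_on_coords I (\<lambda>k. f k * g k)"
proof -
  obtain c where c: "\<And>k. has_gradient I f k (c k)" using entire_gradient[OF fin f] by blast
  obtain d where d: "\<And>k. has_gradient I g k (d k)" using entire_gradient[OF fin g] by blast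
  show ?thesis
  proof (rule entire_onI[OF fin])
    show "f k * g k = f k' * g k'" if "\<And>i. i \<in> I \<Longrightarrow> k i = k' i" for k k'
      using entire_cong_coords[OF f that] entire_cong_coords[OF g that] by simp
    show "has_gradient I (\<lambda>k. f k * g k) k (\<lambda>i. f k * d k i + g k * c k i)" for k
      by (rule has_gradient_mult[OF fin c d])
  qed
qed

lemma entire_minus: "finite I \<Longrightarrow> entire_on_coords I f \<Longrightarrow> entire_on_coords I (\<lambda>k. - f k)"
  using entire_mult[OF _ entire_const[of I "- 1"], of f] by simp

lemma entire_diff:
  "finite I \<Longrightarrow> entire_on_coords I f \<Longrightarrow> entire_on_coords I g \<Longrightarrow> entire_on_coords I (\<lambda>k. f k - g k)"
  using entire_add[of I f "\<lambda>k. - g k"] entire_minus[of I g] by simp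

lemma entire_exp: "finite I \<Longrightarrow> i \<in> I \<Longrightarrow> entire_on_coords I (\<lambda>k. exp (a * k i))"
  by (rule entire_onI[OF _ _ has_gradient_exp]) auto

lemma entire_sum:
  assumes "finite I" "\<And>x. x \<in> A \<Longrightarrow> entire_on_coords I (f x)"
  shows "entire_on_coords I (\<lambda>k. \<Sum>x\<in>A. f x k)"
  using assms by (induction A rule: infinite_finite_induct) (auto intro: entire_const entire_add)

lemma entire_prod:
  assumes "finite I" "\<And>x. x \<in> A \<Longrightarrow> entire_on_coords I (f x)"
  shows "entire_on_coords I (\<lambda>k. \<Prod>x\<in>A. f x k)"
  using assms by (induction A rule: infinite_finite_induct) (auto intro: entire_const entire_mult)

text \<open>Only the gradient has to change: it is extended by 0 to the new coordinates.\<close>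

lemma entire_mono:
  assumes J: "finite J" "I \<subseteq> J" and f: "entire_on_coords I f"
  shows "entire_on_coords J f"
  unfolding entire_on_coords_def
proof (intro conjI allI impI)
  show "f k = f k'" if "\<forall>i\<in>J. k i = k' i" for k k'
    using that J(2) f by (intro entire_cong_coords[OF f]) auto
  fix k
  obtain c where c: "\<And>e. e > 0 \<Longrightarrow> \<exists>\<delta>>0. \<forall>h. (\<forall>i\<in>I. cmod (h i) < \<delta>) \<longrightarrow>
        cmod (f (\<lambda>i. k i + h i) - f k - (\<Sum>i\<in>I. c i * h i)) \<le> e * (\<Sum>i\<in>I. cmod (h i))"
    using f unfolding entire_on_coords_def by metis
  have *: "(\<Sum>i\<in>J. (if i \<in> I then c i else 0) * h i) = (\<Sum>i\<in>I. c i * h i)" for h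
    using J by (intro sum.mono_neutral_cong_right) auto
  show "\<exists>c. \<forall>\<epsilon>>0. \<exists>\<delta>>0. \<forall>h. (\<forall>i\<in>J. cmod (h i) < \<delta>) \<longrightarrow>
        cmod (f (\<lambda>i. k i + h i) - f k - (\<Sum>i\<in>J. c i * h i)) \<le> \<epsilon> * (\<Sum>i\<in>J. cmod (h i))"
  proof (intro exI[of _ "\<lambda>i. if i \<in> I then c i else 0"] allI impI)
    fix e :: real assume e: "e > 0"
    from c[OF e] obtain d where d: "d > 0" "\<And>h. (\<forall>i\<in>I. cmod (h i) < d) \<Longrightarrow>
        cmod (f (\<lambda>i. k i + h i) - f k - (\<Sum>i\<in>I. c i * h i)) \<le> e * (\<Sum>i\<in>I. cmod (h i))" by blast
    have "e * (\<Sum>i\<in>I. cmod (h i)) \<le> e * (\<Sum>i\<in>J. cmod (h i))" for h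
      using e J by (intro mult_left_mono sum_mono2) auto
    then show "\<exists>\<delta>>0. \<forall>h. (\<forall>i\<in>J. cmod (h i) < \<delta>) \<longrightarrow>
        cmod (f (\<lambda>i. k i + h i) - f k - (\<Sum>i\<in>J. (if i \<in> I then c i else 0) * h i))
          \<le> e * (\<Sum>i\<in>J. cmod (h i))"
      unfolding * using d J(2) by (intro exI[of _ d]) (meson order_trans subsetD)
  qed
qed

text \<open>Increments are taken with a 0 in position \<open>i\<close>, so that the gradient of
  \<open>f\<close> serves for the slice as well.\<close>

lemma entire_slice:
  assumes J: "finite J" "i \<notin> J" and f: "entire_on_coords (insert i J) f"
  shows "entire_on_coords J (\<lambda>k. f (k(i := t)))"
  unfolding entire_on_coords_def
proof (intro conjI allI impI)
  show "f (k(i := t)) = f (k'(i := t))" if "\<forall>i\<in>J. k i = k' i" for k k'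
    using that by (intro entire_cong_coords[OF f]) auto
  fix k
  obtain c where c: "\<And>e. e > 0 \<Longrightarrow> \<exists>\<delta>>0. \<forall>h. (\<forall>j\<in>insert i J. cmod (h j) < \<delta>) \<longrightarrow>
        cmod (f (\<lambda>j. (k(i := t)) j + h j) - f (k(i := t)) - (\<Sum>j\<in>insert i J. c j * h j))
          \<le> e * (\<Sum>j\<in>insert i J. cmod (h j))"
    using f unfolding entire_on_coords_def by metis
  show "\<exists>c. \<forall>\<epsilon>>0. \<exists>\<delta>>0. \<forall>h. (\<forall>j\<in>J. cmod (h j) < \<delta>) \<longrightarrow>
        cmod (f ((\<lambda>j. k j + h j)(i := t)) - f (k(i := t)) - (\<Sum>j\<in>J. c j * h j))
          \<le> \<epsilon> * (\<Sum>j\<in>J. cmod (h j))"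
  proof (intro exI[of _ c] allI impI)
    fix e :: real assume e: "e > 0"
    from c[OF e] obtain d where d: "d > 0" "\<And>h. (\<forall>j\<in>insert i J. cmod (h j) < d) \<Longrightarrow>
        cmod (f (\<lambda>j. (k(i := t)) j + h j) - f (k(i := t)) - (\<Sum>j\<in>insert i J. c j * h j))
          \<le> e * (\<Sum>j\<in>insert i J. cmod (h j))" by blast
    have "cmod (f ((\<lambda>j. k j + h j)(i := t)) - f (k(i := t)) - (\<Sum>j\<in>J. c j * h j))
          \<le> e * (\<Sum>j\<in>J. cmod (h j))" if h: "\<forall>j\<in>J. cmod (h j) < d" for h
    proof -
      have eq: "(\<lambda>j. (k(i := t)) j + (h(i := 0)) j) = (\<lambda>j. k j + h j)(i := t)" by auto
      have s: "(\<Sum>j\<in>insert i J. c j * (h(i := 0)) j) = (\<Sum>j\<in>J. c j * h j)"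
        "(\<Sum>j\<in>insert i J. cmod ((h(i := 0)) j)) = (\<Sum>j\<in>J. cmod (h j))"
        using J by (auto intro!: sum.cong)
      have "\<forall>j\<in>insert i J. cmod ((h(i := 0)) j) < d"
        using h d(1) by auto
      from d(2)[OF this] show ?thesis unfolding eq s .
    qed
    then show "\<exists>\<delta>>0. \<forall>h. (\<forall>j\<in>J. cmod (h j) < \<delta>) \<longrightarrow>
        cmod (f ((\<lambda>j. k j + h j)(i := t)) - f (k(i := t)) - (\<Sum>j\<in>J. c j * h j))
          \<le> e * (\<Sum>j\<in>J. cmod (h j))"
      using d(1) by blast
  qed
qed

lemma entire_translate:
  assumes f: "entire_on_coords I f"
  shows "entire_on_coords I (\<lambda>k. f (\<lambda>i. k i + w i))"
  unfolding entire_on_coords_def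
proof (intro conjI allI impI)
  show "f (\<lambda>i. k i + w i) = f (\<lambda>i. k' i + w i)" if "\<forall>i\<in>I. k i = k' i" for k k'
    using that by (intro entire_cong_coords[OF f]) auto
  fix k
  have *: "(\<lambda>i. k i + h i + w i) = (\<lambda>i. (k i + w i) + h i)" for h by (simp add: algebra_simps)
  show "\<exists>c. \<forall>\<epsilon>>0. \<exists>\<delta>>0. \<forall>h. (\<forall>i\<in>I. cmod (h i) < \<delta>) \<longrightarrow>
        cmod (f (\<lambda>i. k i + h i + w i) - f (\<lambda>i. k i + w i) - (\<Sum>i\<in>I. c i * h i))
          \<le> \<epsilon> * (\<Sum>i\<in>I. cmod (h i))"
    using f unfolding * entire_on_coords_def by (elim conjE allE[of _ "\<lambda>i. k i + w i"])
qed

section \<open>Restriction to complex lines and the identity theorem\<close>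

lemma entire_line_holomorphic:
  assumes fin: "finite I" and f: "entire_on_coords I f"
  shows "(\<lambda>t. f (\<lambda>i. k i + t * w i)) holomorphic_on A"
proof -
  have "\<exists>D. ((\<lambda>t. f (\<lambda>i. k i + t * w i)) has_field_derivative D) (at t)" for t
  proof -
    let ?k = "\<lambda>i. k i + t * w i"
    from f obtain c where "\<forall>e>0. \<exists>\<delta>>0. \<forall>h. (\<forall>i\<in>I. cmod (h i) < \<delta>) \<longrightarrow>
        cmod (f (\<lambda>i. ?k i + h i) - f ?k - (\<Sum>i\<in>I. c i * h i)) \<le> e * (\<Sum>i\<in>I. cmod (h i))"
      unfolding entire_on_coords_def by (elim conjE allE[of _ ?k] exE)
    then have c: "\<exists>\<delta>>0. \<forall>h. (\<forall>i\<in>I. cmod (h i) < \<delta>) \<longrightarrow>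
        cmod (f (\<lambda>i. ?k i + h i) - f ?k - (\<Sum>i\<in>I. c i * h i)) \<le> e * (\<Sum>i\<in>I. cmod (h i))"
      if "e > 0" for e using that by simp
    \<comment> \<open>Bounds every \<open>cmod (w i)\<close>; the added 1 keeps \<open>s\<close>,
      and with it \<open>d / s\<close> and \<open>e / s\<close>, positive.\<close>
    define s where "s = (\<Sum>i\<in>I. cmod (w i)) + 1"
    have s: "s > 0" "\<And>i. i \<in> I \<Longrightarrow> cmod (w i) \<le> s"
      using cmod_le_coord_norm[OF fin, of _ w]
      by (force simp: s_def sum_nonneg add_nonneg_pos coord_norm_def)+
    have "((\<lambda>t. f (\<lambda>i. k i + t * w i)) has_derivative (*) (\<Sum>i\<in>I. c i * w i)) (at t)"
      unfolding has_derivative_within_alt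
    proof (intro conjI bounded_linear_mult_right allI impI)
      fix e :: real assume e: "e > 0"
      then have "e / s > 0" using s by simp
      from c[OF this] obtain d where d: "d > 0" "\<And>h. (\<forall>i\<in>I. cmod (h i) < d) \<Longrightarrow>
        cmod (f (\<lambda>i. ?k i + h i) - f ?k - (\<Sum>i\<in>I. c i * h i)) \<le> e / s * (\<Sum>i\<in>I. cmod (h i))"
        by blast
      have "norm (f (\<lambda>i. k i + y * w i) - f ?k - (\<Sum>i\<in>I. c i * w i) * (y - t)) \<le> e * norm (y - t)"
        if y: "norm (y - t) < d / s" for y
      proof -
        have eq: "(\<lambda>i. ?k i + (y - t) * w i) = (\<lambda>i. k i + y * w i)"
          by (simp add: algebra_simps)
        have "cmod ((y - t) * w i) < d" if "i \<in> I" for i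
        proof -
          have "cmod ((y - t) * w i) \<le> cmod (y - t) * s"
            using s(2)[OF that] by (simp add: norm_mult mult_left_mono)
          also have "\<dots> < d" using y s(1) by (simp add: field_simps)
          finally show ?thesis .
        qed
        then have "norm (f (\<lambda>i. k i + y * w i) - f ?k - (\<Sum>i\<in>I. c i * ((y - t) * w i)))
            \<le> e / s * (\<Sum>i\<in>I. cmod ((y - t) * w i))"
          using d(2)[of "\<lambda>i. (y - t) * w i"] unfolding eq by blast
        also have "(\<Sum>i\<in>I. cmod ((y - t) * w i)) = cmod (y - t) * (s - 1)"
          by (simp add: norm_mult s_def sum_distrib_left)
        also have "e / s * (cmod (y - t) * (s - 1)) \<le> e / s * (cmod (y - t) * s)"
          using e s by (intro mult_left_mono) auto
        also have "\<dots> = e * norm (y - t)" using s by simp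
        finally show ?thesis
          by (simp add: sum_distrib_left mult.left_commute mult.commute[of _ "y - t"])
      qed
      then show "\<exists>d>0. \<forall>y\<in>UNIV. norm (y - t) < d \<longrightarrow>
         norm (f (\<lambda>i. k i + y * w i) - f ?k - (\<Sum>i\<in>I. c i * w i) * (y - t)) \<le> e * norm (y - t)"
        using d(1) s(1) by (intro exI[of _ "d / s"]) auto
    qed
    then show ?thesis by (auto simp: has_field_derivative_def)
  qed
  then show ?thesis
    by (meson field_differentiable_at_within field_differentiable_def holomorphic_onI)
qed

lemma entire_coord_holomorphic:
  assumes "finite I" "entire_on_coords I f"
  shows "(\<lambda>t. f (k(i := t))) holomorphic_on A"
proof -
  have "(\<lambda>j. (k(i := 0)) j + t * (if j = i then 1 else 0)) = k(i := t)" for t by auto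
  then show ?thesis
    using entire_line_holomorphic[OF assms, of "k(i := 0)" "\<lambda>j. if j = i then 1 else 0" A] by simp
qed

text \<open>\<open>g\<close> vanishes on the non-empty open set where \<open>f\<close> does not,
  hence everywhere by the identity theorem.\<close>

lemma holomorphic_UNIV_mult_eq_0:
  assumes "f holomorphic_on UNIV" "g holomorphic_on UNIV" "\<And>z::complex. f z * g z = 0" "f a \<noteq> 0"
  shows "g z = 0"
proof (rule ccontr)
  assume z: "g z \<noteq> 0"
  have "continuous_on UNIV f" by (rule holomorphic_on_imp_continuous_on[OF assms(1)])
  then have "open {z. f z \<noteq> 0}"
    using open_Collect_neq[of f "\<lambda>_. 0"] by (simp add: continuous_on_const)
  moreover have "g z = 0" if "z \<in> {z. f z \<noteq> 0}" for z using assms(3)[of z] that by simp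
  moreover have "{z. f z \<noteq> 0} \<noteq> {}" using assms(4) by blast
  ultimately have "g z = 0"
    using analytic_continuation_open[of "{z. f z \<noteq> 0}" UNIV g "\<lambda>_. 0" z] assms(2)
    by (metis UNIV_I connected_UNIV holomorphic_on_const open_UNIV subset_UNIV)
  with z show False by simp
qed

text \<open>The complex line joining \<open>a\<close> to \<open>k\<close> reduces this to one
  variable. It serves as the cancellation law throughout: an equation is proved after multiplication
  by a non-zero entire function, where denominators cause no trouble, and the factor is then
  removed.\<close>

lemma entire_mult_eq_0:
  assumes fin: "finite I" and f: "entire_on_coords I f" and g: "entire_on_coords I g"
    and fg: "\<And>k. f k * g k = 0" and nz: "f a \<noteq> 0"
  shows "g k = 0"
proof -
  let ?l = "\<lambda>t i. a i + t * (k i - a i)"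
  have "g (?l 1) = 0"
    by (rule holomorphic_UNIV_mult_eq_0[of "\<lambda>t. f (?l t)" "\<lambda>t. g (?l t)" 0])
      (use fg nz in \<open>auto intro: entire_line_holomorphic[OF fin f] entire_line_holomorphic[OF fin g]\<close>)
  then show ?thesis by simp
qed

text \<open>Used in contrapositive form: if at every point some factor vanishes, then one factor
  vanishes identically. A choice from a finite set that depends on the point thereby becomes a
  uniform one.\<close>

lemma entire_prod_nonzero:
  assumes "finite I" "finite A" "\<And>x. x \<in> A \<Longrightarrow> entire_on_coords I (f x)" "\<And>x. x \<in> A \<Longrightarrow> \<exists>k. f x k \<noteq> 0"
  shows "\<exists>k. (\<Prod>x\<in>A. f x k) \<noteq> 0"
  using assms(2-)
proof (induction A rule: finite_induct)
  case (insert x A)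
  then obtain a where a: "(\<Prod>x\<in>A. f x a) \<noteq> 0" by auto
  obtain b where b: "f x b \<noteq> 0" using insert.prems by auto
  show ?case
  proof (rule ccontr)
    assume "\<nexists>k. (\<Prod>x\<in>insert x A. f x k) \<noteq> 0"
    then have "(\<Prod>x\<in>A. f x k) * f x k = 0" for k using insert.hyps by (auto simp: mult.commute)
    moreover have "entire_on_coords I (\<lambda>k. \<Prod>x\<in>A. f x k)"
      using insert.prems by (intro entire_prod assms(1)) auto
    ultimately have "f x b = 0"
      using entire_mult_eq_0[of I "\<lambda>k. \<Prod>x\<in>A. f x k" "f x" a b] assms(1) a insert.prems by blast
    with b show False by simp
  qed
qed auto

section \<open>Periodic functions of exponential growth\<close>

text \<open>The quotient is meromorphic, and the continuous bound excludes poles, so every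
  singularity is removable.\<close>

lemma entire_quotient:
  fixes f g :: "complex \<Rightarrow> complex" and b :: "complex \<Rightarrow> real"
  assumes f: "f holomorphic_on UNIV" and g: "g holomorphic_on UNIV" and ga: "g a \<noteq> 0"
    and b: "continuous_on UNIV b" "\<And>z. b z \<ge> 0" and fg: "\<And>z. cmod (f z) \<le> cmod (g z) * b z"
  obtains F where "F holomorphic_on UNIV" "\<And>z. f z = g z * F z" "\<And>z. cmod (F z) \<le> b z"
proof -
  define q where "q = (\<lambda>z. f z / g z)"
  have q_le: "cmod (q z) \<le> b z" for z
    using fg[of z] b(2)[of z] by (cases "g z = 0") (auto simp: q_def norm_divide field_simps)
  have mero: "q meromorphic_on UNIV"
    unfolding q_def by (intro meromorphic_intros analytic_on_imp_meromorphic_on)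
      (use f g in \<open>auto simp: analytic_on_open\<close>)
  have iso: "isolated_singularity_at q z" for z
    using mero by (meson UNIV_I meromorphic_on_isolated_singularity meromorphic_on_subset subset_UNIV)
  have bt: "(b \<longlongrightarrow> b z) (at z)" for z
    using b(1) by (simp add: continuous_on_def)
  have "remove_sings q analytic_on {z}" for z
  proof -
    have "not_essential q z"
      using mero by (meson UNIV_I meromorphic_on_not_essential meromorphic_on_subset subset_UNIV)
    moreover have "\<not> is_pole q z"
    proof
      assume "is_pole q z"
      then have "filterlim (\<lambda>w. norm (q w)) at_top (at z)"
        unfolding is_pole_def by (rule filterlim_at_infinity_imp_norm_at_top)
      then have "eventually (\<lambda>w. norm (q w) > b z + 1) (at z)"
        by (simp add: filterlim_at_top_dense)
      moreover have "eventually (\<lambda>w. b w < b z + 1) (at z)"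
        by (rule order_tendstoD(2)[OF bt]) simp
      ultimately have "eventually (\<lambda>w. False) (at z)"
      proof eventually_elim
        case (elim w)
        then show False using q_le[of w] by linarith
      qed
      then show False by simp
    qed
    ultimately obtain c where "q \<midarrow>z\<rightarrow> c" unfolding not_essential_def by blast
    then show ?thesis by (rule remove_sings_analytic_at[OF iso])
  qed
  then have F: "remove_sings q holomorphic_on UNIV"
    by (meson UNIV_I analytic_on_analytic_at analytic_imp_holomorphic)
  \<comment> \<open>The additional factor \<open>g z\<close> makes the equation trivial at the zeros
    of \<open>g\<close>; it is cancelled next.\<close>
  have "g z * (f z - g z * remove_sings q z) = 0" for z
  proof (cases "g z = 0")
    case False
    then have "q analytic_on {z}"
      unfolding q_def using f g
      by (intro analytic_on_divide) (auto simp: holomorphic_on_imp_analytic_at)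
    then show ?thesis using False by (simp add: q_def)
  qed simp
  then have fq: "f z - g z * remove_sings q z = 0" for z
    by (intro holomorphic_UNIV_mult_eq_0[OF g _ _ ga, where g = "\<lambda>z. f z - g z * remove_sings q z"]
        holomorphic_intros f g F)
  moreover have "f z = g z * remove_sings q z" for z using fq[of z] by simp
  moreover have "cmod (remove_sings q z) \<le> b z" for z
  proof (rule tendsto_le[OF _ bt])
    show "((\<lambda>w. cmod (remove_sings q w)) \<longlongrightarrow> cmod (remove_sings q z)) (at z)"
      using holomorphic_on_imp_continuous_on[OF F]
      by (intro tendsto_norm) (simp add: continuous_on_def)
    show "\<forall>\<^sub>F w in at z. cmod (remove_sings q w) \<le> b w"
      using eventually_remove_sings_eq_at[OF iso] by eventually_elim (simp add: q_le)
  qed simp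
  ultimately show thesis using that[OF F] by simp
qed

lemma periodic_int:
  fixes F :: "complex \<Rightarrow> 'a" and p :: complex
  assumes "\<And>t. F (t + p) = F t"
  shows "F (t + of_int m * p) = F t"
proof (induction m rule: int_induct[where k = 0])
  case (step1 i)
  then show ?case using assms[of "t + of_int i * p"] by (simp add: algebra_simps)
next
  case (step2 i)
  then show ?case using assms[of "t + of_int (i - 1) * p"] by (simp add: algebra_simps)
qed simp

text \<open>In the variable \<open>w = exp (2 pi i t / N)\<close>, growth in \<open>|Im t|\<close>
  becomes growth in \<open>|ln (cmod w)|\<close>. Multiplication by \<open>w ^ M\<close> leaves a
  bounded function near 0 and growth of order \<open>2 * M\<close> at infinity.\<close>

lemma exp_abs_ln_le:
  assumes "r > 0"
  shows "r ^ M * exp (real M * \<bar>ln r\<bar>) \<le> max 1 (r ^ (2 * M))"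
proof (cases "r \<ge> 1")
  case True
  then have "exp (real M * \<bar>ln r\<bar>) = r ^ M"
    using assms by (simp add: exp_of_nat_mult)
  then show ?thesis by (simp add: power_add[symmetric] mult_2)
next
  case False
  then have "exp (real M * \<bar>ln r\<bar>) = exp (- (real M * ln r))"
    using assms by (simp add: abs_if)
  also have "\<dots> = inverse (r ^ M)"
    using assms by (simp only: exp_minus exp_of_nat_mult exp_ln)
  finally have "exp (real M * \<bar>ln r\<bar>) = inverse (r ^ M)" .
  then show ?thesis using assms by simp
qed

text \<open>By periodicity \<open>F\<close> descends to a function of
  \<open>w = exp (2 pi i t / N)\<close> on the punctured plane. After multiplication by
  \<open>w ^ M\<close> the singularity at 0 is removable and the growth is that of a polynomial of
  degree \<open>2 * M\<close>, so Liouville's theorem applies.\<close>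

lemma periodic_growth_imp_trig_polynomial:
  fixes F :: "complex \<Rightarrow> complex" and N M :: nat
  assumes F: "F holomorphic_on UNIV" and N: "N > 0"
    and per: "\<And>t. F (t + of_nat N) = F t"
    and bound: "\<And>t. cmod (F t) \<le> A * exp (2 * pi * real M / real N * \<bar>Im t\<bar>)"
  obtains c where "\<And>t. F t = (\<Sum>m\<le>2 * M. c m * exp (2 * pi * \<i> * of_int (int m - int M) * t / of_nat N))"
proof -
  define P where "P = 2 * pi * \<i> / of_nat N"
  have P: "P \<noteq> 0" using N by (simp add: P_def)
  define H where "H = (\<lambda>w. F (Ln w / P))"
  \<comment> \<open>\<open>F\<close> depends on its argument only through the exponential, so the
    branch of the logarithm chosen in \<open>H\<close> is immaterial.\<close>
  have FE: "F s = F t" if "exp (P * s) = exp (P * t)" for s t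
  proof -
    from that obtain n where "P * s = P * t + of_real (real_of_int (2 * n) * pi) * \<i>"
      unfolding exp_eq by blast
    then have "P * s = P * (t + of_int n * of_nat N)"
      using N by (simp add: P_def field_simps)
    then have "s = t + of_int n * of_nat N" using P by simp
    then show ?thesis using periodic_int[of F "of_nat N", OF per] by simp
  qed
  have HF: "H (exp (P * t)) = F t" for t
    unfolding H_def by (rule FE) (use P in simp)
  have H: "H field_differentiable at w0" if w0: "w0 \<noteq> 0" for w0
  proof -
    \<comment> \<open>The branch of the logarithm centred at \<open>w0\<close> is holomorphic near
      \<open>w0\<close> even if \<open>w0\<close> lies on the cut of \<open>Ln\<close>; by
      \<open>FE\<close> it defines the same function.\<close>
    define K where "K = (\<lambda>w. F ((Ln (w / w0) + Ln w0) / P))"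
    have "K field_differentiable at w0"
    proof -
      have "(\<lambda>w. (Ln (w / w0) + Ln w0) / P) field_differentiable at w0"
        using w0 P by (intro field_differentiable_divide field_differentiable_add
            field_differentiable_const field_differentiable_compose[of "\<lambda>w. w / w0" _ Ln, unfolded o_def]
            field_differentiable_at_Ln field_differentiable_ident) simp_all
      moreover have "F field_differentiable at ((Ln (w0 / w0) + Ln w0) / P)"
        using F by (simp add: holomorphic_on_def field_differentiable_at_within)
      ultimately show ?thesis
        unfolding K_def using field_differentiable_compose[of "\<lambda>w. (Ln (w / w0) + Ln w0) / P" w0 F]
        by (simp add: o_def)
    qed
    moreover have "K w = H w" if "cmod (w - w0) < cmod w0" for w
    proof -
      have "w \<noteq> 0" using that by auto
      then show ?thesis
        unfolding K_def H_def by (intro FE) (use P w0 in \<open>simp add: exp_add\<close>)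
    qed
    ultimately show ?thesis
      using w0 by (intro field_differentiable_transform_within[of "cmod w0" w0 UNIV K H])
        (auto simp: dist_norm)
  qed
  define G where "G = (\<lambda>w. w ^ M * H w)"
  have "cmod (F 0) \<le> A" using bound[of 0] by simp
  then have A: "A \<ge> 0" using norm_ge_zero[of "F 0"] by linarith
  have G_le: "cmod (G w) \<le> A * max 1 (cmod w ^ (2 * M))" if w: "w \<noteq> 0" for w
  proof -
    have "Im (Ln w / P) = - real N / (2 * pi) * ln (cmod w)"
      using N w by (simp add: P_def Im_divide power2_eq_square)
    then have "2 * pi * real M / real N * \<bar>Im (Ln w / P)\<bar> = real M * \<bar>ln (cmod w)\<bar>"
      using N by (simp add: abs_mult)
    then have "cmod (H w) \<le> A * exp (real M * \<bar>ln (cmod w)\<bar>)"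
      using bound[of "Ln w / P"] by (simp add: H_def)
    then have "cmod (G w) \<le> cmod w ^ M * (A * exp (real M * \<bar>ln (cmod w)\<bar>))"
      by (simp add: G_def norm_mult norm_power mult_left_mono)
    also have "\<dots> \<le> A * max 1 (cmod w ^ (2 * M))"
      using mult_left_mono[OF exp_abs_ln_le[of "cmod w" M] A] w by (simp add: mult_ac)
    finally show ?thesis .
  qed
  have "G holomorphic_on UNIV - {0}"
    unfolding G_def holomorphic_on_def
    by (intro ballI field_differentiable_mult field_differentiable_power field_differentiable_ident
        field_differentiable_at_within[OF H]) simp
  moreover have "\<forall>\<^sub>F w in at 0. cmod (G w) \<le> A"
  proof -
    have "\<forall>\<^sub>F w in at (0::complex). w \<in> ball 0 1 - {0}"
      by (intro eventually_at_in_open) auto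
    then show ?thesis
    proof eventually_elim
      case (elim w)
      then have "cmod w ^ (2 * M) \<le> 1" by (intro power_le_one) auto
      then have "max 1 (cmod w ^ (2 * M)) = 1" by simp
      then show ?case using G_le[of w] elim by simp
    qed
  qed
  ultimately have "\<exists>G'. G' holomorphic_on UNIV \<and> (\<forall>w\<in>UNIV - {0}. G' w = G w)"
    by (subst holomorphic_on_extend_bounded) auto
  then obtain G' where G': "G' holomorphic_on UNIV" "\<And>w. w \<noteq> 0 \<Longrightarrow> G' w = G w"
    by blast
  have "cmod (G' w) \<le> A * cmod w ^ (2 * M)" if "1 \<le> cmod w" for w
  proof -
    have "w \<noteq> 0" using that by auto
    moreover have "max 1 (cmod w ^ (2 * M)) = cmod w ^ (2 * M)"
      using that by (intro max_absorb2 one_le_power)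
    ultimately show ?thesis using G_le[of w] G'(2)[of w] by simp
  qed
  then have c: "G' w = (\<Sum>m\<le>2 * M. (deriv ^^ m) G' 0 / fact m * w ^ m)" for w
    by (rule Liouville_polynomial[OF G'(1)])
  define c where "c = (\<lambda>m. (deriv ^^ m) G' 0 / fact m)"
  have "F t = (\<Sum>m\<le>2 * M. c m * exp (2 * pi * \<i> * of_int (int m - int M) * t / of_nat N))" for t
  proof -
    let ?w = "exp (P * t)"
    have "exp (2 * pi * \<i> * of_int (int m - int M) * t / of_nat N) = ?w ^ m / ?w ^ M" for m
    proof -
      have "2 * pi * \<i> * of_int (int m - int M) * t / of_nat N = of_nat m * (P * t) - of_nat M * (P * t)"
        using N by (simp add: P_def divide_simps) (simp add: algebra_simps)
      then show ?thesis by (simp only: exp_diff exp_of_nat_mult)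
    qed
    moreover have "F t = G' ?w / ?w ^ M"
      using G'(2)[of ?w] by (simp add: G_def HF)
    ultimately show ?thesis by (simp add: c c_def sum_divide_distrib)
  qed
  then show thesis by (rule that)
qed

section \<open>Roots of unity and discrete Fourier inversion\<close>

lemma exp_2pi_int_eq_1_iff:
  assumes "L > 0"
  shows "exp (2 * pi * \<i> * of_int d / of_nat L) = 1 \<longleftrightarrow> int L dvd d"
proof
  assume "exp (2 * pi * \<i> * of_int d / of_nat L) = 1"
  then obtain n :: int where "2 * pi * real_of_int d / real L = of_int (2 * n) * pi"
    unfolding exp_eq_1 by auto
  then have "real_of_int d = of_int (n * int L)" using assms by (simp add: field_simps)
  then show "int L dvd d" by (simp only: of_int_eq_iff dvd_triv_right)
next
  assume "int L dvd d"
  then obtain n where "d = int L * n" by blast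
  then have "2 * pi * \<i> * of_int d / of_nat L = 2 * of_int n * pi * \<i>"
    using assms by simp
  then show "exp (2 * pi * \<i> * of_int d / of_nat L) = 1"
    using exp_eq_1[of "2 * of_int n * pi * \<i>"] by auto
qed

lemma sum_roots_of_unity:
  assumes L: "L > 0"
  shows "(\<Sum>j<L. exp (2 * pi * \<i> * of_int d * of_nat j / of_nat L))
    = (if int L dvd d then of_nat L else 0)"
proof -
  define z where "z = exp (2 * pi * \<i> * of_int d / of_nat L)"
  have "exp (2 * pi * \<i> * of_int d * of_nat j / of_nat L) = z ^ j" for j
    unfolding z_def exp_of_nat_mult[symmetric] by (simp add: mult_ac)
  then have eq: "(\<Sum>j<L. exp (2 * pi * \<i> * of_int d * of_nat j / of_nat L)) = (\<Sum>j<L. z ^ j)"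
    by simp
  have "z ^ L = exp (2 * of_int d * pi * \<i>)"
    unfolding z_def exp_of_nat_mult[symmetric] using L by (simp add: mult_ac)
  also have "\<dots> = 1" unfolding exp_eq_1 by auto
  finally have "z ^ L = 1" .
  moreover have "z = 1 \<longleftrightarrow> int L dvd d" unfolding z_def by (rule exp_2pi_int_eq_1_iff[OF L])
  ultimately show ?thesis unfolding eq by (auto simp: geometric_sum)
qed

text \<open>The characters of period \<open>N\<close>. For \<open>m = - 1\<close> and
  \<open>t = k i\<close> this is, up to a constant, an \<open>N\<close>-th root of the parameter
  \<open>u_i\<close>.\<close>

definition harmonic :: "nat \<Rightarrow> int \<Rightarrow> complex \<Rightarrow> complex" where
  "harmonic N m t = exp (2 * pi * \<i> * of_int m * t / of_nat N)"

lemma harmonic_nonzero [simp]: "harmonic N m t \<noteq> 0"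
  by (simp add: harmonic_def)

lemma harmonic_divide: "harmonic N m t / harmonic N m' t = harmonic N (m - m') t"
  unfolding harmonic_def exp_diff[symmetric]
  by (rule arg_cong[of _ _ exp]) (simp add: algebra_simps diff_divide_distrib)

text \<open>Discrete Fourier inversion at \<open>2 * M + 1\<close> equidistant nodes of one period,
  as many as there are frequencies. The offset \<open>s\<close> is left free so that the nodes can
  avoid the zeros of a denominator.\<close>

lemma trig_polynomial_coefficient:
  fixes c :: "nat \<Rightarrow> complex"
  assumes N: "N > 0" and m: "m \<le> 2 * M"
  defines "L \<equiv> 2 * M + 1"
  shows "(\<Sum>j<L. (\<Sum>n\<le>2 * M. c n * harmonic N (int n - int M) (s + of_nat N * of_nat j / of_nat L))
          / harmonic N (int m - int M) (s + of_nat N * of_nat j / of_nat L)) = of_nat L * c m"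
proof -
  have L: "L > 0" by (simp add: L_def)
  let ?t = "\<lambda>j. s + of_nat N * of_nat j / of_nat L :: complex"
  have split: "harmonic N d (?t j) = harmonic N d s * exp (2 * pi * \<i> * of_int d * of_nat j / of_nat L)"
    for d j
    unfolding harmonic_def exp_add[symmetric]
    by (rule arg_cong[of _ _ exp]) (use N L in \<open>simp add: field_simps\<close>)
  have orth: "(\<Sum>j<L. harmonic N (int n - int m) (?t j)) = (if n = m then of_nat L else 0)"
    if "n \<le> 2 * M" for n
  proof -
    \<comment> \<open>Two frequencies differ by at most \<open>2 * M\<close>, which is less than
      \<open>L\<close>.\<close>
    have "int L dvd int n - int m \<longleftrightarrow> n = m"
      using that m dvd_imp_le_int[of "int n - int m" "int L"]
      by (cases "n = m") (auto simp: L_def abs_if split: if_splits)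
    then show ?thesis
      unfolding split sum_distrib_left[symmetric] sum_roots_of_unity[OF L] by (simp add: harmonic_def)
  qed
  have "(\<Sum>j<L. (\<Sum>n\<le>2 * M. c n * harmonic N (int n - int M) (?t j)) / harmonic N (int m - int M) (?t j))
      = (\<Sum>j<L. \<Sum>n\<le>2 * M. c n * harmonic N (int n - int m) (?t j))"
    by (simp add: sum_divide_distrib times_divide_eq_right[symmetric] harmonic_divide
        del: times_divide_eq_right)
  also have "\<dots> = (\<Sum>n\<le>2 * M. c n * (\<Sum>j<L. harmonic N (int n - int m) (?t j)))"
    by (subst sum.swap) (simp add: sum_distrib_left)
  also have "\<dots> = (\<Sum>n\<le>2 * M. if n = m then of_nat L * c m else 0)"
    by (intro sum.cong) (auto simp: orth)
  also have "\<dots> = of_nat L * c m" using m by simp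
  finally show ?thesis .
qed

text \<open>The period of \<open>f / g\<close> is cross-multiplied because \<open>g\<close> may have
  zeros. Once \<open>f = g * F\<close>, cancelling first \<open>g t\<close> and then
  \<open>g (t + N)\<close> makes \<open>F\<close> itself periodic.\<close>

lemma quotient_trig_polynomial:
  fixes f g :: "complex \<Rightarrow> complex" and N M :: nat
  assumes f: "f holomorphic_on UNIV" and g: "g holomorphic_on UNIV" and ga: "g a \<noteq> 0"
    and N: "N > 0" and per: "\<And>t. f t * g (t + of_nat N) = f (t + of_nat N) * g t"
    and bound: "\<And>t. cmod (f t) \<le> cmod (g t) * (A * exp (2 * pi * real M / real N * \<bar>Im t\<bar>))"
  obtains c where "\<And>t. f t = g t * (\<Sum>m\<le>2 * M. c m * harmonic N (int m - int M) t)"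
proof -
  have "0 \<le> cmod (g a) * (A * exp (2 * pi * real M / real N * \<bar>Im a\<bar>))"
    using bound[of a] norm_ge_zero[of "f a"] by linarith
  then have A: "A \<ge> 0" using ga by (simp add: zero_le_mult_iff)
  obtain F where F: "F holomorphic_on UNIV" "\<And>z. f z = g z * F z"
    "\<And>z. cmod (F z) \<le> A * exp (2 * pi * real M / real N * \<bar>Im z\<bar>)"
    by (rule entire_quotient[OF f g ga _ _ bound])
      (use A N in \<open>auto intro!: continuous_intros mult_nonneg_nonneg\<close>)
  have sh: "(\<lambda>t. h (t + of_nat N)) holomorphic_on UNIV" if "h holomorphic_on UNIV" for h
    using holomorphic_on_compose_gen[OF _ that, of "\<lambda>t. t + of_nat N" UNIV]
    by (simp add: o_def holomorphic_on_add holomorphic_on_ident holomorphic_on_const)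
  have "g t * (g (t + of_nat N) * (F (t + of_nat N) - F t)) = 0" for t
    using per[of t] by (auto simp: F(2))
  then have *: "g (t + of_nat N) * (F (t + of_nat N) - F t) = 0" for t
    by (intro holomorphic_UNIV_mult_eq_0[OF g _ _ ga,
          where g = "\<lambda>t. g (t + of_nat N) * (F (t + of_nat N) - F t)"]
        holomorphic_intros sh g F(1))
  have "F (t + of_nat N) - F t = 0" for t
    by (rule holomorphic_UNIV_mult_eq_0[OF sh[OF g], where g = "\<lambda>t. F (t + of_nat N) - F t"
          and a = "a - of_nat N"])
      (use * ga in \<open>auto intro!: holomorphic_intros sh F(1)\<close>)
  then have "F (t + of_nat N) = F t" for t by (metis eq_iff_diff_eq_0)
  from periodic_growth_imp_trig_polynomial[OF F(1) N this F(3)] obtain c where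
    "\<And>t. F t = (\<Sum>m\<le>2 * M. c m * harmonic N (int m - int M) t)"
    unfolding harmonic_def by blast
  then show thesis using that[of c] F(2) by simp
qed

section \<open>Trigonometric polynomials in several variables\<close>

lemma holomorphic_prod_nonzero:
  assumes "finite A" "\<And>x. x \<in> A \<Longrightarrow> f x holomorphic_on UNIV" "\<And>x. x \<in> A \<Longrightarrow> \<exists>z. f x z \<noteq> (0::complex)"
  shows "\<exists>z. (\<Prod>x\<in>A. f x z) \<noteq> 0"
  using assms
proof (induction A rule: finite_induct)
  case (insert x A)
  then obtain a where a: "(\<Prod>x\<in>A. f x a) \<noteq> 0" by auto
  obtain b where b: "f x b \<noteq> 0" using insert.prems by auto
  show ?case
  proof (rule ccontr)
    assume "\<nexists>z. (\<Prod>x\<in>insert x A. f x z) \<noteq> 0"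
    then have "(\<Prod>x\<in>A. f x z) * f x z = 0" for z using insert.hyps by (auto simp: mult.commute)
    moreover have "(\<lambda>z. \<Prod>x\<in>A. f x z) holomorphic_on UNIV"
      using insert.prems by (intro holomorphic_on_prod) auto
    ultimately have "f x b = 0"
      using holomorphic_UNIV_mult_eq_0[of "\<lambda>z. \<Prod>x\<in>A. f x z" "f x" a b] a insert.prems by blast
    with b show False by simp
  qed
qed auto

text \<open>The Laurent polynomials in the \<open>exp (2 pi i k_i / N)\<close> with \<open>i\<close>
  in \<open>J\<close>. Closure rules are chosen so that growth, periodicity and membership in fields
  can be proved by induction.\<close>

inductive_set trig :: "nat \<Rightarrow> 'i set \<Rightarrow> (('i \<Rightarrow> complex) \<Rightarrow> complex) set"
  for N :: nat and J :: "'i set" where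
    const: "(\<lambda>k. c) \<in> trig N J"
  | harmonic: "i \<in> J \<Longrightarrow> (\<lambda>k. harmonic N m (k i)) \<in> trig N J"
  | add: "P \<in> trig N J \<Longrightarrow> Q \<in> trig N J \<Longrightarrow> (\<lambda>k. P k + Q k) \<in> trig N J"
  | mult: "P \<in> trig N J \<Longrightarrow> Q \<in> trig N J \<Longrightarrow> (\<lambda>k. P k * Q k) \<in> trig N J"

lemma trig_mono: "P \<in> trig N J \<Longrightarrow> J \<subseteq> J' \<Longrightarrow> P \<in> trig N J'"
  by (induction rule: trig.induct) (auto intro: trig.intros)

lemma trig_sum: "(\<And>x. x \<in> A \<Longrightarrow> P x \<in> trig N J) \<Longrightarrow> (\<lambda>k. \<Sum>x\<in>A. P x k) \<in> trig N J"
  by (induction A rule: infinite_finite_induct) (auto intro: trig.intros)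

lemma entire_harmonic: "finite J \<Longrightarrow> i \<in> J \<Longrightarrow> entire_on_coords J (\<lambda>k. harmonic N m (k i))"
  using entire_exp[of J i "2 * pi * \<i> * of_int m / of_nat N"] by (simp add: harmonic_def)

lemma entire_trig: "P \<in> trig N J \<Longrightarrow> finite J \<Longrightarrow> entire_on_coords J P"
  by (induction rule: trig.induct)
    (auto intro: entire_const entire_harmonic entire_add entire_mult)

text \<open>Induction on the coordinates. In coordinate \<open>i\<close> the one-variable result
  expands \<open>f / g\<close> with coefficients depending on the other coordinates. Fourier
  inversion turns the \<open>m\<close>-th coefficient into a quotient of entire functions,
  \<open>Fm m / G\<close>, where \<open>G\<close> multiplies the slices of \<open>g\<close> at the
  nodes. This quotient inherits periodicity and growth, so the induction hypothesis makes it a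
  trigonometric polynomial.\<close>

theorem periodic_quotient_trig:
  fixes f g :: "('i \<Rightarrow> complex) \<Rightarrow> complex"
  assumes "finite J" and N: "N > 0"
    and "entire_on_coords J f" "entire_on_coords J g" "g a \<noteq> 0"
    and "\<And>i k. i \<in> J \<Longrightarrow> f k * g (k(i := k i + of_nat N)) = f (k(i := k i + of_nat N)) * g k"
    and "\<And>k. cmod (f k) \<le> cmod (g k) * (A * exp (2 * pi * real M / real N * (\<Sum>i\<in>J. \<bar>Im (k i)\<bar>)))"
  shows "\<exists>P\<in>trig N J. \<forall>k. f k = g k * P k"
  using assms(1,3-)
proof (induction J arbitrary: f g A a rule: finite_induct)
  case empty
  have "f k = f a" "g k = g a" for k
    by (rule entire_cong_coords[OF empty(1)] entire_cong_coords[OF empty(2)], simp)+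
  then have "f k = g k * (f a / g a)" for k using empty(3) by (metis nonzero_mult_div_cancel_left times_divide_eq_right)
  then show ?case by (intro bexI[of _ "\<lambda>k. f a / g a"] allI trig.const)
next
  case (insert i J)
  note f = insert.prems(1) and g = insert.prems(2) and ga = insert.prems(3)
  have fin: "finite (insert i J)" using insert.hyps by simp
  define B where "B = 2 * pi * real M / real N"
  define L where "L = 2 * M + 1"
  have "0 \<le> cmod (g a) * (A * exp (B * (\<Sum>i\<in>insert i J. \<bar>Im (a i)\<bar>)))"
    using insert.prems(5)[of a] norm_ge_zero[of "f a"] unfolding B_def by linarith
  then have A: "A \<ge> 0" using ga by (simp add: zero_le_mult_iff)
  \<comment> \<open>An offset for which \<open>g\<close>, with the other coordinates as in
    \<open>a\<close>, vanishes at none of the nodes. It exists because no factor is identically zero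
    in \<open>s\<close>.\<close>
  obtain s where s: "(\<Prod>j<L. g (a(i := s + of_nat N * of_nat j / of_nat L))) \<noteq> 0"
  proof -
    have "\<exists>s. (\<Prod>j\<in>{..<L}. g (a(i := s + of_nat N * of_nat j / of_nat L))) \<noteq> 0"
    proof (rule holomorphic_prod_nonzero)
      fix j
      show "(\<lambda>s. g (a(i := s + of_nat N * of_nat j / of_nat L))) holomorphic_on UNIV"
        using holomorphic_on_compose_gen[OF _ entire_coord_holomorphic[OF fin g, of a i UNIV],
            of "\<lambda>t. t + of_nat N * of_nat j / of_nat L" UNIV]
        by (simp only: o_def holomorphic_on_add holomorphic_on_ident holomorphic_on_const subset_UNIV)
      show "\<exists>s. g (a(i := s + of_nat N * of_nat j / of_nat L)) \<noteq> 0"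
        using ga by (intro exI[of _ "a i - of_nat N * of_nat j / of_nat L"]) simp
    qed simp
    then show thesis using that by blast
  qed
  define t where "t = (\<lambda>j. s + of_nat N * of_nat j / of_nat L :: complex)"
  define fj where "fj = (\<lambda>j k. f (k(i := t j)))"
  define gj where "gj = (\<lambda>j k. g (k(i := t j)))"
  define G where "G = (\<lambda>k. \<Prod>j<L. gj j k)"
  define E where "E = (\<lambda>m t. harmonic N (int m - int M) t)"
  \<comment> \<open>The inversion formula for the \<open>m\<close>-th coefficient of
    \<open>f / g\<close>, multiplied by the common denominator \<open>G\<close>.\<close>
  define Fm where "Fm = (\<lambda>m k. \<Sum>j<L. 1 / (of_nat L * E m (t j)) * fj j k * (\<Prod>l\<in>{..<L} - {j}. gj l k))"
  have G_split: "G k = gj j k * (\<Prod>l\<in>{..<L} - {j}. gj l k)" if "j < L" for j k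
    unfolding G_def using that by (subst prod.remove[of _ j]) auto
  have ent_fj: "entire_on_coords J (fj j)" and ent_gj: "entire_on_coords J (gj j)" for j
    unfolding fj_def gj_def
    by (intro entire_slice insert.hyps f g)+
  have ent_G: "entire_on_coords J G"
    unfolding G_def by (intro entire_prod insert.hyps ent_gj)
  have ent_Fm: "entire_on_coords J (Fm m)" for m
    unfolding Fm_def
    by (intro entire_sum entire_mult entire_prod entire_const insert.hyps ent_gj ent_fj)
  have Ga: "G a \<noteq> 0" using s by (simp add: G_def gj_def t_def)
  have "\<exists>P\<in>trig N J. \<forall>k. Fm m k = G k * P k" for m
  proof (rule insert.IH[OF ent_Fm ent_G Ga])
    fix i' and k :: "'i \<Rightarrow> complex" assume i': "i' \<in> J"
    then have ne: "i' \<noteq> i" using insert.hyps by auto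
    let ?k = "k(i' := k i' + of_nat N)"
    have upd: "?k(i := t j) = (k(i := t j))(i' := (k(i := t j)) i' + of_nat N)" for j
      using ne by (auto simp: fun_eq_iff)
    have per: "fj j k * gj j ?k = fj j ?k * gj j k" for j
      unfolding fj_def gj_def upd by (rule insert.prems(4)) (use i' in simp)
    \<comment> \<open>Periodicity is checked summand by summand: the slices at node \<open>j\<close>
      satisfy \<open>per\<close>, and the other factors of the two products agree.\<close>
    have term_eq: "1 / (of_nat L * E m (t j)) * fj j k * (\<Prod>l\<in>{..<L} - {j}. gj l k) * G ?k
       = 1 / (of_nat L * E m (t j)) * fj j ?k * (\<Prod>l\<in>{..<L} - {j}. gj l ?k) * G k"
      if "j < L" for j
      using arg_cong[OF per[of j], of "\<lambda>x. 1 / (of_nat L * E m (t j)) * x *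
          (\<Prod>l\<in>{..<L} - {j}. gj l k) * (\<Prod>l\<in>{..<L} - {j}. gj l ?k)"]
      unfolding G_split[OF that] by (simp only: mult_ac)
    show "Fm m k * G ?k = Fm m ?k * G k"
      unfolding Fm_def sum_distrib_right by (intro sum.cong HOL.refl term_eq) simp
  next
    fix k :: "'i \<Rightarrow> complex"
    let ?A = "\<Sum>j<L. cmod (1 / (of_nat L * E m (t j))) * (A * exp (B * \<bar>Im (t j)\<bar>))"
    let ?e = "exp (B * (\<Sum>i\<in>J. \<bar>Im (k i)\<bar>))"
    have "cmod (Fm m k) \<le> (\<Sum>j<L. cmod (1 / (of_nat L * E m (t j))) * cmod (fj j k) *
        cmod (\<Prod>l\<in>{..<L} - {j}. gj l k))"
      unfolding Fm_def by (rule order_trans[OF norm_sum]) (simp only: norm_mult order_refl)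
    also have "\<dots> \<le> (\<Sum>j<L. cmod (1 / (of_nat L * E m (t j))) *
        (cmod (gj j k) * (A * exp (B * \<bar>Im (t j)\<bar>) * ?e)) * cmod (\<Prod>l\<in>{..<L} - {j}. gj l k))"
    proof (intro sum_mono mult_right_mono mult_left_mono norm_ge_zero)
      fix j
      have "(\<Sum>x\<in>J. \<bar>Im ((k(i := t j)) x)\<bar>) = (\<Sum>x\<in>J. \<bar>Im (k x)\<bar>)"
        using insert.hyps by (intro sum.cong) auto
      then have "B * (\<Sum>x\<in>insert i J. \<bar>Im ((k(i := t j)) x)\<bar>)
          = B * \<bar>Im (t j)\<bar> + B * (\<Sum>x\<in>J. \<bar>Im (k x)\<bar>)"
        using insert.hyps by (simp add: distrib_left)
      then show "cmod (fj j k) \<le> cmod (gj j k) * (A * exp (B * \<bar>Im (t j)\<bar>) * ?e)"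
        using insert.prems(5)[of "k(i := t j)", folded B_def]
        unfolding fj_def gj_def by (simp only: exp_add mult_ac)
    qed
    also have "\<dots> = (\<Sum>j<L. cmod (G k) *
        (cmod (1 / (of_nat L * E m (t j))) * (A * exp (B * \<bar>Im (t j)\<bar>)) * ?e))"
    proof (intro sum.cong HOL.refl)
      fix j assume "j \<in> {..<L}"
      then have "cmod (G k) = cmod (gj j k) * cmod (\<Prod>l\<in>{..<L} - {j}. gj l k)"
        using G_split[of j k] by (simp only: norm_mult lessThan_iff)
      then show "cmod (1 / (of_nat L * E m (t j))) *
        (cmod (gj j k) * (A * exp (B * \<bar>Im (t j)\<bar>) * ?e)) * cmod (\<Prod>l\<in>{..<L} - {j}. gj l k)
        = cmod (G k) * (cmod (1 / (of_nat L * E m (t j))) * (A * exp (B * \<bar>Im (t j)\<bar>)) * ?e)"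
        by (simp only: mult_ac)
    qed
    finally show "cmod (Fm m k) \<le> cmod (G k) * (?A * exp (2 * pi * real M / real N * (\<Sum>i\<in>J. \<bar>Im (k i)\<bar>)))"
      unfolding B_def by (simp only: sum_distrib_left sum_distrib_right)
  qed
  then obtain P where P: "\<And>m. P m \<in> trig N J" "\<And>m k. Fm m k = G k * P m k" by metis
  define Q where "Q = (\<lambda>k. \<Sum>m\<le>2 * M. P m k * E m (k i))"
  have Q: "Q \<in> trig N (insert i J)"
    unfolding Q_def E_def
    by (intro trig_sum trig.mult trig.harmonic trig_mono[OF P(1)]) auto
  \<comment> \<open>Where \<open>G k\<close> is non-zero no slice of \<open>g\<close> vanishes, so
    the coefficients can be computed by division. The factor \<open>G k\<close> is cancelled
    afterwards.\<close>
  have "G k * (f k - g k * Q k) = 0" for k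
  proof (cases "G k = 0")
    case False
    then have gj0: "gj j k \<noteq> 0" if "j < L" for j using that by (auto simp: G_def)
    let ?f = "\<lambda>t. f (k(i := t))" and ?g = "\<lambda>t. g (k(i := t))"
    have "cmod (?f u) \<le> cmod (?g u) * (A * exp (B * (\<Sum>x\<in>J. \<bar>Im (k x)\<bar>)) * exp (B * \<bar>Im u\<bar>))" for u
    proof -
      have "(\<Sum>x\<in>J. \<bar>Im ((k(i := u)) x)\<bar>) = (\<Sum>x\<in>J. \<bar>Im (k x)\<bar>)"
        using insert.hyps by (intro sum.cong) auto
      then have "B * (\<Sum>x\<in>insert i J. \<bar>Im ((k(i := u)) x)\<bar>)
          = B * \<bar>Im u\<bar> + B * (\<Sum>x\<in>J. \<bar>Im (k x)\<bar>)"
        using insert.hyps by (simp add: distrib_left)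
      then show ?thesis
        using insert.prems(5)[of "k(i := u)", folded B_def] by (simp only: exp_add mult_ac)
    qed
    moreover have "?f u * ?g (u + of_nat N) = ?f (u + of_nat N) * ?g u" for u
      using insert.prems(4)[of i "k(i := u)"] by (simp only: fun_upd_same fun_upd_upd insertI1)
    moreover have "?g (t 0) \<noteq> 0" using gj0[of 0] by (simp add: gj_def L_def)
    ultimately obtain c where c: "\<And>u. ?f u = ?g u * (\<Sum>m\<le>2 * M. c m * harmonic N (int m - int M) u)"
      using quotient_trig_polynomial[of ?f ?g "t 0" N
          "A * exp (B * (\<Sum>x\<in>J. \<bar>Im (k x)\<bar>))" M, folded B_def]
        entire_coord_holomorphic[OF fin f] entire_coord_holomorphic[OF fin g] N by blast
    have "c m = P m k" if m: "m \<le> 2 * M" for m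
    proof -
      have "of_nat L * c m = (\<Sum>j<L. (fj j k / gj j k) / E m (t j))"
      proof -
        have "fj j k / gj j k = (\<Sum>n\<le>2 * M. c n * harmonic N (int n - int M) (t j))" if "j < L" for j
          using c[of "t j"] gj0[OF that] by (simp add: fj_def gj_def)
        then show ?thesis
          using trig_polynomial_coefficient[OF N m, of c s] unfolding E_def t_def L_def by simp
      qed
      moreover have "Fm m k = G k * (\<Sum>j<L. (fj j k / gj j k) / E m (t j)) / of_nat L"
      proof -
        have "1 / (of_nat L * E m (t j)) * fj j k * (\<Prod>l\<in>{..<L} - {j}. gj l k)
            = G k * ((fj j k / gj j k) / E m (t j)) / of_nat L" if "j < L" for j
          using G_split[OF that, of k] gj0[OF that] by (simp add: field_simps)
        then show ?thesis
          unfolding Fm_def by (simp add: sum_distrib_left sum_divide_distrib)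
      qed
      moreover have "(of_nat L :: complex) \<noteq> 0" unfolding L_def of_nat_eq_0_iff by simp
      ultimately have "Fm m k = G k * c m" by (metis nonzero_mult_div_cancel_left times_divide_eq_right mult.left_commute)
      then show ?thesis using P(2)[of m k] False by simp
    qed
    then have "f k = g k * Q k"
      using c[of "k i"] by (simp add: Q_def E_def)
    then show ?thesis by simp
  qed simp
  moreover have "entire_on_coords (insert i J) G"
    by (rule entire_mono[OF fin _ ent_G]) auto
  moreover have "entire_on_coords (insert i J) (\<lambda>k. f k - g k * Q k)"
    by (intro entire_diff entire_mult fin f g entire_trig[OF Q fin])
  ultimately have "f k - g k * Q k = 0" for k
    using entire_mult_eq_0[OF fin, of G "\<lambda>k. f k - g k * Q k" a k] Ga by blast
  then have "f k = g k * Q k" for k by (metis eq_iff_diff_eq_0)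
  with Q show ?case by blast
qed

section \<open>Laurent polynomials as functions\<close>

definition monom_eval :: "('i \<Rightarrow> complex) \<Rightarrow> ('i \<Rightarrow>\<^sub>0 int) \<Rightarrow> complex" where
  "monom_eval u m = (\<Prod>i\<in>Poly_Mapping.keys m. u i powi Poly_Mapping.lookup m i)"

lemma monom_eval_superset:
  assumes "finite A" "Poly_Mapping.keys m \<subseteq> A"
  shows "monom_eval u m = (\<Prod>i\<in>A. u i powi Poly_Mapping.lookup m i)"
  unfolding monom_eval_def using assms
  by (intro prod.mono_neutral_left) (auto simp: in_keys_iff)

lemma monom_eval_add:
  assumes "\<And>i. u i \<noteq> 0"
  shows "monom_eval u (m + m') = monom_eval u m * monom_eval u m'"
proof -
  let ?A = "Poly_Mapping.keys m \<union> Poly_Mapping.keys m'"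
  have "monom_eval u (m + m') = (\<Prod>i\<in>?A. u i powi Poly_Mapping.lookup (m + m') i)"
    by (intro monom_eval_superset Poly_Mapping.keys_add) auto
  also have "\<dots> = (\<Prod>i\<in>?A. u i powi Poly_Mapping.lookup m i * u i powi Poly_Mapping.lookup m' i)"
    using assms by (simp add: lookup_add power_int_add)
  also have "\<dots> = monom_eval u m * monom_eval u m'"
    by (simp add: prod.distrib monom_eval_superset[of ?A m] monom_eval_superset[of ?A m'])
  finally show ?thesis .
qed

lemma monom_eval_0 [simp]: "monom_eval u 0 = 1"
  by (simp add: monom_eval_def)

lemma laurent_eval_superset:
  assumes "finite A" "Poly_Mapping.keys p \<subseteq> A"
  shows "laurent_eval u p = (\<Sum>m\<in>A. of_int (Poly_Mapping.lookup p m) * monom_eval u m)"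
  unfolding laurent_eval_def monom_eval_def using assms
  by (intro sum.mono_neutral_left) (auto simp: in_keys_iff)

lemma laurent_eval_0 [simp]: "laurent_eval u 0 = 0"
  by (simp add: laurent_eval_def)

lemma laurent_eval_single: "laurent_eval u (Poly_Mapping.single m c) = of_int c * monom_eval u m"
  by (subst laurent_eval_superset[of "{m}"]) auto

lemma laurent_eval_1 [simp]: "laurent_eval u 1 = 1"
  using laurent_eval_single[of u 0 1] by simp

lemma laurent_eval_add: "laurent_eval u (p + q) = laurent_eval u p + laurent_eval u q"
proof -
  let ?A = "Poly_Mapping.keys p \<union> Poly_Mapping.keys q"
  have "laurent_eval u (p + q) = (\<Sum>m\<in>?A. of_int (Poly_Mapping.lookup (p + q) m) * monom_eval u m)"
    by (intro laurent_eval_superset Poly_Mapping.keys_add) auto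
  then show ?thesis
    by (simp add: lookup_add distrib_right sum.distrib
        laurent_eval_superset[of ?A p] laurent_eval_superset[of ?A q])
qed

lemma laurent_eval_sum: "laurent_eval u (\<Sum>x\<in>A. f x) = (\<Sum>x\<in>A. laurent_eval u (f x))"
  by (induction A rule: infinite_finite_induct) (auto simp: laurent_eval_add)

lemma laurent_eval_mult:
  assumes "\<And>i. u i \<noteq> 0"
  shows "laurent_eval u (p * q) = laurent_eval u p * laurent_eval u q"
proof -
  have repr: "r = (\<Sum>m\<in>Poly_Mapping.keys r. Poly_Mapping.single m (Poly_Mapping.lookup r m))"
    for r :: "('a \<Rightarrow>\<^sub>0 int) \<Rightarrow>\<^sub>0 int"
    by (rule poly_mapping_eqI) (auto simp: lookup_sum lookup_single when_def in_keys_iff)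
  have "laurent_eval u (p * q) = (\<Sum>m\<in>Poly_Mapping.keys p. \<Sum>m'\<in>Poly_Mapping.keys q.
      laurent_eval u (Poly_Mapping.single (m + m') (Poly_Mapping.lookup p m * Poly_Mapping.lookup q m')))"
    by (subst repr[of p], subst repr[of q])
      (simp add: sum_distrib_left sum_distrib_right mult_single laurent_eval_sum, rule sum.swap)
  also have "\<dots> = laurent_eval u p * laurent_eval u q"
    unfolding laurent_eval_superset[OF finite_keys order_refl, of u p]
      laurent_eval_superset[OF finite_keys order_refl, of u q]
    by (simp add: laurent_eval_single monom_eval_add[OF assms] sum_product mult_ac)
  finally show ?thesis .
qed

text \<open>The parameters as functions of \<open>k\<close>, with general constants
  \<open>z i\<close> in place of the roots of unity \<open>zeta_C ^ j\<close>.\<close>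

definition u_eval :: "('i \<Rightarrow> complex) \<Rightarrow> ('i \<Rightarrow> complex) \<Rightarrow> 'i \<Rightarrow> complex" where
  "u_eval z k = (\<lambda>i. z i * exp (- 2 * pi * \<i> * k i))"

lemma u_eval_nonzero: "(\<And>i. z i \<noteq> 0) \<Longrightarrow> u_eval z k i \<noteq> 0"
  by (simp add: u_eval_def)

lemma u_eval_powi: "u_eval z k i powi m = z i powi m * harmonic 1 (- m) (k i)"
proof -
  have "exp (- 2 * pi * \<i> * k i) powi m = exp (of_int m * (- 2 * pi * \<i> * k i))"
    by (rule exp_power_int)
  then show ?thesis
    by (simp add: u_eval_def power_int_mult_distrib harmonic_def mult_ac)
qed

lemma laurent_eval_trig:
  assumes I: "finite I" and p: "p \<in> carrier (laurent_ring I)"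
  shows "(\<lambda>k. laurent_eval (u_eval z k) p) \<in> trig 1 I"
proof -
  have prod: "(\<lambda>k. \<Prod>i\<in>A. Q i k) \<in> trig 1 I" if "\<And>i. i \<in> A \<Longrightarrow> Q i \<in> trig 1 I" for A :: "'a set" and Q
    using that by (induction A rule: infinite_finite_induct) (auto intro: trig.intros)
  show ?thesis
    unfolding laurent_eval_def u_eval_powi
    using p by (intro trig_sum trig.mult trig.const prod trig.harmonic) (auto simp: laurent_ring_def)
qed

text \<open>The exponent is measured in multiples of \<open>2 * pi / N\<close>, the unit in which an
  order of growth bounds the frequencies.\<close>

lemma trig_growth:
  assumes "P \<in> trig N J" "finite J"
  shows "\<exists>A\<ge>0. \<exists>M. \<forall>k. cmod (P k) \<le> A * exp (2 * pi * real M / real N * (\<Sum>i\<in>J. \<bar>Im (k i)\<bar>))"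
  using assms
proof (induction rule: trig.induct)
  case (const c)
  show ?case by (intro exI[of _ "cmod c"] conjI exI[of _ 0]) auto
next
  case (harmonic i m)
  show ?case
  proof (intro exI[of _ "1::real"] conjI exI[of _ "nat \<bar>m\<bar>"] allI)
    fix k :: "'a \<Rightarrow> complex"
    have "cmod (harmonic N m (k i)) = exp (- (2 * pi * real_of_int m / real N * Im (k i)))"
      by (simp add: harmonic_def Re_divide_of_nat)
    also have "- (2 * pi * real_of_int m / real N * Im (k i)) \<le> 2 * pi * \<bar>real_of_int m\<bar> / real N * \<bar>Im (k i)\<bar>"
      by (rule order_trans[OF abs_ge_self]) (simp add: abs_mult)
    also have "\<dots> \<le> 2 * pi * \<bar>real_of_int m\<bar> / real N * (\<Sum>i\<in>J. \<bar>Im (k i)\<bar>)"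
      using harmonic by (intro mult_left_mono member_le_sum) auto
    finally show "cmod (harmonic N m (k i)) \<le> 1 * exp (2 * pi * real (nat \<bar>m\<bar>) / real N * (\<Sum>i\<in>J. \<bar>Im (k i)\<bar>))"
      by simp
  qed simp
next
  case (add P Q)
  then obtain A M A' M' where *: "A \<ge> 0" "A' \<ge> 0"
    "\<And>k. cmod (P k) \<le> A * exp (2 * pi * real M / real N * (\<Sum>i\<in>J. \<bar>Im (k i)\<bar>))"
    "\<And>k. cmod (Q k) \<le> A' * exp (2 * pi * real M' / real N * (\<Sum>i\<in>J. \<bar>Im (k i)\<bar>))" by metis
  show ?case
  proof (intro exI[of _ "A + A'"] conjI exI[of _ "M + M'"] allI)
    fix k :: "'a \<Rightarrow> complex"
    let ?s = "\<Sum>i\<in>J. \<bar>Im (k i)\<bar>"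
    let ?e = "exp (2 * pi * real (M + M') / real N * ?s)"
    have s: "?s \<ge> 0" by (simp add: sum_nonneg)
    have "exp (2 * pi * real M / real N * ?s) \<le> ?e" "exp (2 * pi * real M' / real N * ?s) \<le> ?e"
      unfolding exp_le_cancel_iff by (intro mult_right_mono divide_right_mono s; simp)+
    then have "A * exp (2 * pi * real M / real N * ?s) \<le> A * ?e"
      "A' * exp (2 * pi * real M' / real N * ?s) \<le> A' * ?e"
      using * by (auto intro: mult_left_mono)
    then show "cmod (P k + Q k) \<le> (A + A') * ?e"
      using *(3,4)[of k] norm_triangle_ineq[of "P k" "Q k"] unfolding distrib_right by linarith
  qed (use * in auto)
next
  case (mult P Q)
  then obtain A M A' M' where *: "A \<ge> 0" "A' \<ge> 0"
    "\<And>k. cmod (P k) \<le> A * exp (2 * pi * real M / real N * (\<Sum>i\<in>J. \<bar>Im (k i)\<bar>))"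
    "\<And>k. cmod (Q k) \<le> A' * exp (2 * pi * real M' / real N * (\<Sum>i\<in>J. \<bar>Im (k i)\<bar>))" by metis
  show ?case
  proof (intro exI[of _ "A * A'"] conjI exI[of _ "M + M'"] allI)
    fix k :: "'a \<Rightarrow> complex"
    let ?s = "\<Sum>i\<in>J. \<bar>Im (k i)\<bar>"
    have "cmod (P k * Q k) \<le> (A * exp (2 * pi * real M / real N * ?s)) * (A' * exp (2 * pi * real M' / real N * ?s))"
      unfolding norm_mult using * by (intro mult_mono) auto
    also have "\<dots> = A * A' * exp (2 * pi * real M / real N * ?s + 2 * pi * real M' / real N * ?s)"
      by (simp add: exp_add)
    also have "2 * pi * real M / real N * ?s + 2 * pi * real M' / real N * ?s = 2 * pi * real (M + M') / real N * ?s"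
      by (simp add: add_divide_distrib distrib_left distrib_right)
    finally show "cmod (P k * Q k) \<le> A * A' * exp (2 * pi * real (M + M') / real N * ?s)" .
  qed (use * in auto)
qed

lemma harmonic_shift: "N > 0 \<Longrightarrow> harmonic N m (t + of_int a) = exp (2 * pi * \<i> * of_int (m * a) / of_nat N) * harmonic N m t"
  unfolding harmonic_def exp_add[symmetric]
  by (rule arg_cong[of _ _ exp]) (simp add: field_simps)

lemma trig_periodic:
  assumes "P \<in> trig N J" "N > 0" "\<And>i. i \<in> J \<Longrightarrow> \<exists>a::int. w i = of_int (a * int N)"
  shows "P (\<lambda>i. k i + w i) = P k"
  using assms
proof (induction rule: trig.induct)
  case (harmonic i m)
  then obtain a where a: "w i = of_int (a * int N)" by blast
  have "harmonic N m (k i + of_int (a * int N)) = harmonic N m (k i)"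
    using harmonic_shift[OF harmonic(2), of m "k i" "a * int N"]
      exp_2pi_int_eq_1_iff[OF harmonic(2), of "m * (a * int N)"] by simp
  then show ?case using a by simp
qed auto

text \<open>Artin's argument: distinct characters of the additive group of parameters are linearly
  independent.\<close>

lemma characters_independent:
  fixes ch :: "'b \<Rightarrow> ('i \<Rightarrow> complex) \<Rightarrow> complex"
  assumes "finite Y"
    and add_mult: "\<And>x k k'. ch x (\<lambda>i. k i + k' i) = ch x k * ch x k'" and nz: "\<And>x k. ch x k \<noteq> 0"
    and distinct: "\<And>x x'. x \<noteq> x' \<Longrightarrow> \<exists>k. ch x k \<noteq> ch x' k"
    and "\<And>k. (\<Sum>x\<in>Y. c x * ch x k) = 0" and "x \<in> Y"
  shows "c x = 0"
  using assms(1,5,6)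
proof (induction Y arbitrary: c x rule: finite_induct)
  case (insert x0 Y)
  have Y0: "c x = 0" if x: "x \<in> Y" for x
  proof -
    have "x \<noteq> x0" using x insert.hyps by auto
    then obtain k0 where k0: "ch x k0 \<noteq> ch x0 k0" using distinct by blast
    have "(\<Sum>x\<in>Y. c x * (ch x k0 - ch x0 k0) * ch x k) = 0" for k
    proof -
      have "(\<Sum>x\<in>insert x0 Y. c x * ch x (\<lambda>i. k i + k0 i)) - ch x0 k0 * (\<Sum>x\<in>insert x0 Y. c x * ch x k) = 0"
        by (simp only: insert.prems(1)) simp
      then have "(\<Sum>x\<in>insert x0 Y. c x * (ch x k0 - ch x0 k0) * ch x k) = 0"
        unfolding add_mult sum_distrib_left sum_subtractf[symmetric] by (simp add: algebra_simps)
      then show ?thesis using insert.hyps by simp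
    qed
    from insert.IH[OF this x] k0 show ?thesis by simp
  qed
  then have "(\<Sum>x\<in>insert x0 Y. c x * ch x k) = c x0 * ch x0 k" for k
    using insert.hyps by simp
  with insert.prems(1)[of undefined] nz[of x0 undefined] have "c x0 = 0" by simp
  then show ?case using Y0 insert.prems(2) by auto
qed simp

text \<open>Monomials evaluate to non-zero constants times pairwise distinct characters of the
  additive group of parameters, so independence of characters kills every coefficient. The Laurent
  ring is a domain, and \<open>\<theta>\<close> has trivial kernel, for this reason.\<close>

lemma laurent_eval_injective:
  assumes z: "\<And>i. z i \<noteq> 0" and zero: "\<And>k. laurent_eval (u_eval z k) p = 0"
  shows "p = 0"
proof -
  define ch where "ch = (\<lambda>(m :: 'a \<Rightarrow>\<^sub>0 int) k. \<Prod>i\<in>Poly_Mapping.keys m. harmonic 1 (- Poly_Mapping.lookup m i) (k i :: complex))"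
  define c where "c = (\<lambda>m. \<Prod>i\<in>Poly_Mapping.keys m. z i powi Poly_Mapping.lookup m i)"
  have me: "monom_eval (u_eval z k) m = c m * ch m k" for k m
    by (simp add: monom_eval_def c_def ch_def u_eval_powi prod.distrib)
  have hadd: "harmonic 1 a (s + t) = harmonic 1 a s * harmonic 1 a t" for a s t
    by (simp add: harmonic_def exp_add[symmetric] distrib_left)
  have "of_int (Poly_Mapping.lookup p m) * c m = 0" if m: "m \<in> Poly_Mapping.keys p" for m
  proof (rule characters_independent[where ch = ch and Y = "Poly_Mapping.keys p"])
    show "ch m (\<lambda>i. k i + k' i) = ch m k * ch m k'" for m k k'
      by (simp only: ch_def hadd prod.distrib)
    show "ch m k \<noteq> 0" for m k by (simp add: ch_def)
    show "(\<Sum>m\<in>Poly_Mapping.keys p. of_int (Poly_Mapping.lookup p m) * c m * ch m k) = 0" for k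
      using zero[of k] by (simp add: laurent_eval_superset[OF finite_keys order_refl] me mult_ac)
    fix m m' :: "'a \<Rightarrow>\<^sub>0 int" assume "m \<noteq> m'"
    then obtain i where i: "Poly_Mapping.lookup m i \<noteq> Poly_Mapping.lookup m' i"
      by (metis poly_mapping_eqI)
    define d where "d = Poly_Mapping.lookup m i - Poly_Mapping.lookup m' i"
    have d: "d \<noteq> 0" using i by (simp add: d_def)
    \<comment> \<open>\<open>d\<close> is the difference of the two exponents at \<open>i\<close>.
      With \<open>k i = 1 / (2 * d)\<close> and all other coordinates 0, the characters differ by
      the factor \<open>exp (- pi i) = - 1\<close>.\<close>
    define t where "t = (1 / (2 * of_int d) :: complex)"
    let ?k = "\<lambda>j. if j = i then t else 0"
    have chi: "ch m ?k = harmonic 1 (- Poly_Mapping.lookup m i) t" for m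
    proof -
      have "ch m ?k = (\<Prod>j\<in>insert i (Poly_Mapping.keys m). harmonic 1 (- Poly_Mapping.lookup m j) (?k j))"
        unfolding ch_def by (intro prod.mono_neutral_left) (auto simp: in_keys_iff harmonic_def)
      also have "\<dots> = (\<Prod>j\<in>{i}. harmonic 1 (- Poly_Mapping.lookup m j) (?k j))"
        by (intro prod.mono_neutral_right) (auto simp: harmonic_def)
      finally show ?thesis by simp
    qed
    have "harmonic 1 (- Poly_Mapping.lookup m i) t / harmonic 1 (- Poly_Mapping.lookup m' i) t = harmonic 1 (- d) t"
      unfolding harmonic_divide d_def by simp
    also have "\<dots> = - 1"
    proof -
      have "2 * pi * \<i> * of_int (- d) * t / of_nat 1 = - (complex_of_real pi * \<i>)"
        using d by (simp add: t_def)
      then show ?thesis unfolding harmonic_def by (simp only: exp_minus exp_pi_i) simp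
    qed
    finally show "\<exists>k. ch m k \<noteq> ch m' k"
      by (intro exI[of _ ?k]) (auto simp: chi)
  qed (use m in auto)
  moreover have "c m \<noteq> 0" for m by (simp add: c_def z)
  ultimately show ?thesis by (metis mult_eq_0_iff of_int_eq_0_iff in_keys_iff poly_mapping_eqI lookup_zero)
qed

section \<open>Eigenvalues\<close>

text \<open>The eigenvalues of the transposed matrix, in the index convention of
  \<open>h b_j = sum_i C i j b_i\<close>.\<close>

definition spec :: "nat \<Rightarrow> (nat \<Rightarrow> nat \<Rightarrow> complex) \<Rightarrow> complex set" where
  "spec n C = {\<mu>. \<exists>y. (\<exists>j<n. y j \<noteq> 0) \<and> (\<forall>j<n. \<mu> * y j = (\<Sum>i<n. C i j * y i))}"

lemma spec_subset_roots:
  "spec n C \<subseteq> {\<mu>. poly (char_poly (mat n n (\<lambda>(j, i). C i j))) \<mu> = 0}"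
proof
  fix \<mu> assume "\<mu> \<in> spec n C"
  then obtain y where y: "\<exists>j<n. y j \<noteq> 0" "\<And>j. j < n \<Longrightarrow> \<mu> * y j = (\<Sum>i<n. C i j * y i)"
    unfolding spec_def by blast
  let ?A = "mat n n (\<lambda>(j, i). C i j)"
  have A: "?A \<in> carrier_mat n n" by simp
  have "eigenvector ?A (Matrix.vec n y) \<mu>"
    unfolding eigenvector_def
  proof (intro conjI)
    show "Matrix.vec n y \<noteq> 0\<^sub>v (dim_row ?A)"
      using y(1) by (auto simp: vec_eq_iff)
    show "?A *\<^sub>v Matrix.vec n y = \<mu> \<cdot>\<^sub>v Matrix.vec n y"
      by (rule eq_vecI) (auto simp: scalar_prod_def y(2) atLeast0LessThan)
  qed simp
  then show "\<mu> \<in> {\<mu>. poly (char_poly ?A) \<mu> = 0}"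
    using eigenvalue_root_char_poly[OF A] by (auto simp: eigenvalue_def)
qed

lemma spec_finite: "finite (spec n C)" and spec_card: "card (spec n C) \<le> n"
proof -
  let ?p = "char_poly (mat n n (\<lambda>(j, i). C i j))"
  have d: "Polynomial.degree ?p = n" "Polynomial.coeff ?p n = 1"
    using degree_monic_char_poly[of "mat n n (\<lambda>(j, i). C i j)" n] by auto
  then have p: "?p \<noteq> 0" by auto
  then have fin: "finite {\<mu>. poly ?p \<mu> = 0}" by (rule poly_roots_finite)
  show "finite (spec n C)" using finite_subset[OF spec_subset_roots fin] .
  have "card {\<mu>. poly ?p \<mu> = 0} \<le> n"
    using card_poly_roots_bound[OF p] d by simp
  then show "card (spec n C) \<le> n"
    using card_mono[OF fin spec_subset_roots] by linarith
qed

text \<open>Compare both sides of the eigenvalue equation at an entry of largest modulus. This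
  carries the growth of the matrix entries over to the eigenvalues, which need not depend
  holomorphically on \<open>k\<close>.\<close>

lemma spec_bound:
  assumes "\<mu> \<in> spec n C"
  shows "cmod \<mu> \<le> (\<Sum>i<n. \<Sum>j<n. cmod (C i j))"
proof -
  obtain y where y: "\<exists>j<n. y j \<noteq> 0" "\<And>j. j < n \<Longrightarrow> \<mu> * y j = (\<Sum>i<n. C i j * y i)"
    using assms unfolding spec_def by blast
  have ne: "finite ((\<lambda>j. cmod (y j)) ` {..<n})" "(\<lambda>j. cmod (y j)) ` {..<n} \<noteq> {}"
    using y(1) by auto
  from Max_in[OF ne] obtain j where j: "j < n" "Max ((\<lambda>j. cmod (y j)) ` {..<n}) = cmod (y j)" by auto
  have le: "cmod (y i) \<le> cmod (y j)" if "i < n" for i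
    using Max_ge[OF ne(1), of "cmod (y i)"] that j by auto
  have pos: "cmod (y j) > 0" using y(1) le by force
  have "cmod \<mu> * cmod (y j) = cmod (\<Sum>i<n. C i j * y i)"
    using y(2)[OF j(1)] by (simp add: norm_mult[symmetric])
  also have "\<dots> \<le> (\<Sum>i<n. cmod (C i j) * cmod (y j))"
    by (rule order_trans[OF norm_sum]) (auto intro!: sum_mono mult_left_mono le simp: norm_mult)
  finally have "cmod \<mu> \<le> (\<Sum>i<n. cmod (C i j))"
    using pos by (simp add: sum_distrib_right[symmetric])
  also have "\<dots> \<le> (\<Sum>i<n. \<Sum>j<n. cmod (C i j))"
    by (intro sum_mono member_le_sum) (use j in auto)
  finally show ?thesis .
qed

text \<open>Schur triangularisation: the trace is invariant under conjugation, and the diagonal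
  lists the roots of the characteristic polynomial with multiplicity.\<close>

lemma trace_eq_sum_eigenvalues:
  fixes A :: "complex mat"
  assumes A: "A \<in> carrier_mat d d"
  obtains es where "length es = d" "(\<Sum>a<d. A $$ (a, a)) = sum_list es"
    "\<And>\<mu>. \<mu> \<in> set es \<Longrightarrow> poly (char_poly A) \<mu> = 0"
proof -
  obtain es where es: "char_poly A = (\<Prod>a\<leftarrow>es. [:- a, 1:])" "length es = d"
    using char_poly_factorized[OF A] by blast
  obtain B P Q where BPQ: "schur_decomposition A es = (B, P, Q)" by (cases "schur_decomposition A es")
  from schur_decomposition[OF A es(1) BPQ]
  have sim: "similar_mat_wit A B P Q" and diag: "diag_mat B = es" by auto
  from sim A have c: "B \<in> carrier_mat d d" "P \<in> carrier_mat d d" "Q \<in> carrier_mat d d"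
    and QP: "Q * P = 1\<^sub>m d" and ABP: "A = P * B * Q"
    unfolding similar_mat_wit_def Let_def by auto
  have tr_comm: "(\<Sum>a<d. (S * T) $$ (a, a)) = (\<Sum>a<d. (T * S) $$ (a, a))"
    if S: "S \<in> carrier_mat d d" and T: "T \<in> carrier_mat d d" for S T :: "complex mat"
  proof -
    have "(\<Sum>a<d. (S * T) $$ (a, a)) = (\<Sum>a<d. \<Sum>b<d. S $$ (a, b) * T $$ (b, a))"
      using S T by (intro sum.cong) (auto simp: scalar_prod_def atLeast0LessThan)
    also have "\<dots> = (\<Sum>a<d. \<Sum>b<d. T $$ (a, b) * S $$ (b, a))"
      by (subst sum.swap) (simp add: mult.commute)
    also have "\<dots> = (\<Sum>a<d. (T * S) $$ (a, a))"
      using S T by (intro sum.cong) (auto simp: scalar_prod_def atLeast0LessThan)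
    finally show ?thesis .
  qed
  have "(\<Sum>a<d. A $$ (a, a)) = (\<Sum>a<d. (Q * (P * B)) $$ (a, a))"
    unfolding ABP by (rule tr_comm) (use c in auto)
  also have "Q * (P * B) = B" using c QP by (simp flip: assoc_mult_mat[of Q d d P d B d])
  also have "(\<Sum>a<d. B $$ (a, a)) = sum_list (diag_mat B)"
    unfolding diag_mat_def using c by (simp add: sum_list_sum_nth atLeast0LessThan)
  finally have tr: "(\<Sum>a<d. A $$ (a, a)) = sum_list es" by (simp add: diag)
  have "poly (char_poly A) \<mu> = 0" if "\<mu> \<in> set es" for \<mu>
    using that unfolding es(1) by (auto simp: poly_prod_list prod_list_zero_iff)
  with that[of es] es(2) tr show thesis by blast
qed

text \<open>A left eigenvector of \<open>A\<close> turns the identity \<open>A B\<^sub>j = \<Sum>\<^sub>i C\<^sub>i\<^sub>j B\<^sub>i\<close> into an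
  eigenvector of \<open>C\<close>; it is nonzero because the \<open>B\<^sub>j\<close> span the identity matrix.\<close>

lemma trace_eq_sum_spec:
  fixes A :: "nat \<Rightarrow> nat \<Rightarrow> complex" and B :: "nat \<Rightarrow> nat \<Rightarrow> nat \<Rightarrow> complex"
  assumes AB: "\<And>j a b. j < n \<Longrightarrow> a < d \<Longrightarrow> b < d \<Longrightarrow> (\<Sum>m<d. A a m * B j m b) = (\<Sum>i<n. C i j * B i a b)"
    and unit: "\<And>a b. a < d \<Longrightarrow> b < d \<Longrightarrow> (\<Sum>j<n. e j * B j a b) = (if a = b then 1 else 0)"
  obtains es where "length es = d" "set es \<subseteq> spec n C" "(\<Sum>a<d. A a a) = sum_list es"
proof -
  let ?A = "mat d d (\<lambda>(a, b). A a b)"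
  have A: "?A \<in> carrier_mat d d" by simp
  from trace_eq_sum_eigenvalues[OF A] obtain es where es: "length es = d"
    "(\<Sum>a<d. ?A $$ (a, a)) = sum_list es" "\<And>\<mu>. \<mu> \<in> set es \<Longrightarrow> poly (char_poly ?A) \<mu> = 0" by blast
  have "set es \<subseteq> spec n C"
  proof
    fix \<mu> assume "\<mu> \<in> set es"
    then have "poly (char_poly (transpose_mat ?A)) \<mu> = 0"
      using es(3) char_poly_transpose_mat[OF A] by simp
    then have "eigenvalue (transpose_mat ?A) \<mu>"
      by (subst eigenvalue_root_char_poly[of _ d]) auto
    then obtain w where w: "w \<in> carrier_vec d" "w \<noteq> 0\<^sub>v d" "transpose_mat ?A *\<^sub>v w = \<mu> \<cdot>\<^sub>v w"
      by (auto simp: eigenvalue_def eigenvector_def)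
    have wA: "(\<Sum>a<d. vec_index w a * A a b) = \<mu> * vec_index w b" if b: "b < d" for b
    proof -
      have "(\<Sum>a<d. vec_index w a * A a b) = vec_index (transpose_mat ?A *\<^sub>v w) b"
        using b w(1) by (auto simp: scalar_prod_def atLeast0LessThan mult.commute intro!: sum.cong)
      then show ?thesis using w b by simp
    qed
    obtain b where b: "b < d" "vec_index w b \<noteq> 0"
      using w(1,2) by (metis carrier_vecD eq_vecI index_zero_vec(1) index_zero_vec(2))
    define y where "y = (\<lambda>j. \<Sum>a<d. vec_index w a * B j a b)"
    have "\<mu> * y j = (\<Sum>i<n. C i j * y i)" if j: "j < n" for j
    proof -
      have "\<mu> * y j = (\<Sum>m<d. (\<Sum>a<d. vec_index w a * A a m) * B j m b)"
        by (simp add: y_def sum_distrib_left wA mult.assoc)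
      also have "\<dots> = (\<Sum>a<d. vec_index w a * (\<Sum>m<d. A a m * B j m b))"
        unfolding sum_distrib_left sum_distrib_right by (subst sum.swap) (simp add: mult.assoc)
      also have "\<dots> = (\<Sum>a<d. vec_index w a * (\<Sum>i<n. C i j * B i a b))"
        using AB[OF j _ b(1)] by simp
      also have "\<dots> = (\<Sum>i<n. C i j * y i)"
        unfolding y_def sum_distrib_left by (subst sum.swap) (simp add: mult.left_commute)
      finally show ?thesis .
    qed
    moreover have "\<exists>j<n. y j \<noteq> 0"
    proof (rule ccontr)
      assume "\<not> (\<exists>j<n. y j \<noteq> 0)"
      then have "0 = (\<Sum>j<n. e j * y j)" by simp
      also have "\<dots> = (\<Sum>a<d. vec_index w a * (\<Sum>j<n. e j * B j a b))"
        unfolding y_def sum_distrib_left by (subst sum.swap) (simp add: mult.left_commute)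
      also have "\<dots> = (\<Sum>a<d. if a = b then vec_index w b else 0)"
        using unit b by (intro sum.cong) auto
      also have "\<dots> = vec_index w b" using b by simp
      finally show False using b by simp
    qed
    ultimately show "\<mu> \<in> spec n C" unfolding spec_def by blast
  qed
  moreover have "(\<Sum>a<d. A a a) = sum_list es" using es(2) by simp
  ultimately show thesis using that es(1) by blast
qed

text \<open>If \<open>n < d\<close>, padding both factors with zeros to size \<open>d\<close>
  factors the identity into square matrices, one of which has a zero row and hence determinant
  0.\<close>

lemma identity_factor_dimension:
  fixes P Q :: "nat \<Rightarrow> nat \<Rightarrow> complex"
  assumes PQ: "\<And>a b. a < d \<Longrightarrow> b < d \<Longrightarrow> (\<Sum>i<n. P a i * Q i b) = (if a = b then 1 else 0)"
  shows "d \<le> n"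
proof (rule ccontr)
  assume "\<not> d \<le> n"
  then have n: "n < d" by simp
  define P' where "P' = mat d d (\<lambda>(a, i). if i < n then P a i else 0)"
  define Q' where "Q' = mat d d (\<lambda>(i, b). if i < n then Q i b else 0)"
  have c: "P' \<in> carrier_mat d d" "Q' \<in> carrier_mat d d" by (auto simp: P'_def Q'_def)
  have "P' * Q' = 1\<^sub>m d"
  proof (rule eq_matI)
    fix a b assume "a < dim_row (1\<^sub>m d :: complex mat)" "b < dim_col (1\<^sub>m d :: complex mat)"
    then have ab: "a < d" "b < d" by auto
    have "(P' * Q') $$ (a, b) = (\<Sum>i<d. if i < n then P a i * Q i b else 0)"
      using ab by (auto simp: P'_def Q'_def scalar_prod_def atLeast0LessThan intro!: sum.cong)
    also have "\<dots> = (\<Sum>i<n. P a i * Q i b)"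
      using n by (intro sum.mono_neutral_cong_right) auto
    finally show "(P' * Q') $$ (a, b) = 1\<^sub>m d $$ (a, b)" using PQ ab by simp
  qed (use c in auto)
  then have "Determinant.det P' * Determinant.det Q' = 1"
    using det_mult[OF c] by simp
  moreover have "Determinant.det Q' = 0"
  proof -
    have "Q' = mat\<^sub>r d d (\<lambda>i. if i = n then 0\<^sub>v d else Matrix.row Q' i)"
      using n by (intro eq_matI) (auto simp: Q'_def)
    then show ?thesis using det_row_0[OF n, of "Matrix.row Q'"] c by (simp add: Pi_def)
  qed
  ultimately show False by simp
qed

lemma cmod_sum_list_le:
  "(\<And>x. x \<in> set es \<Longrightarrow> cmod x \<le> S) \<Longrightarrow> cmod (sum_list es) \<le> real (length es) * S"
proof (induction es)
  case (Cons e es)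
  have "cmod (e + sum_list es) \<le> cmod e + cmod (sum_list es)" by (rule norm_triangle_ineq)
  also have "\<dots> \<le> S + real (length es) * S" using Cons by (intro add_mono) auto
  finally show ?case by (simp add: algebra_simps)
qed simp

section \<open>Periods under shifts of one coordinate\<close>

definition coord_shift :: "'i \<Rightarrow> nat \<Rightarrow> ('i \<Rightarrow> complex) \<Rightarrow> 'i \<Rightarrow> complex" where
  "coord_shift i a k = k(i := k i + of_nat a)"

lemma coord_shift_alt: "coord_shift i a k = (\<lambda>j. k j + (if j = i then of_nat a else 0))"
  by (auto simp: coord_shift_def)

lemma coord_shift_add: "coord_shift i a (coord_shift i b k) = coord_shift i (b + a) k"
  by (auto simp: coord_shift_def)

lemma entire_coord_shift: "entire_on_coords I f \<Longrightarrow> entire_on_coords I (\<lambda>k. f (coord_shift i a k))"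
  unfolding coord_shift_alt by (rule entire_translate)

lemma coord_shift_surj: "\<exists>k'. coord_shift i a k' = k"
  by (rule exI[of _ "k(i := k i - of_nat a)"]) (simp add: coord_shift_def)

text \<open>In cross-multiplied form the passage through the intermediate point
  \<open>?s m k\<close> costs a factor \<open>g (?s m k)\<close>, which is then cancelled. The lemma
  replaces a period by its multiple \<open>N\<close>, common to all coordinates.\<close>

lemma coord_shift_period_multiple:
  assumes fin: "finite I" and f: "entire_on_coords I f" and g: "entire_on_coords I g" "g k0 \<noteq> 0"
    and per: "\<And>k. f k * g (coord_shift i p k) = f (coord_shift i p k) * g k"
  shows "f k * g (coord_shift i (m * p) k) = f (coord_shift i (m * p) k) * g k"
proof (induction m arbitrary: k)
  case 0
  show ?case by (simp add: coord_shift_def)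
next
  case (Suc m)
  let ?s = "\<lambda>m k. coord_shift i (m * p) k"
  obtain k1 where k1: "?s m k1 = k0" using coord_shift_surj by metis
  have s: "?s (Suc m) k = coord_shift i p (?s m k)" for k
    by (simp add: coord_shift_add add.commute)
  have "g (?s m k) * (f k * g (?s (Suc m) k) - f (?s (Suc m) k) * g k) = 0" for k
  proof -
    have "g (?s m k) * (f k * g (?s (Suc m) k) - f (?s (Suc m) k) * g k)
      = (f k * g (?s m k)) * g (?s (Suc m) k) - (f (?s (Suc m) k) * g (?s m k)) * g k"
      by (simp add: algebra_simps)
    also have "\<dots> = (f (?s m k) * g k) * g (?s (Suc m) k) - (f (?s m k) * g (?s (Suc m) k)) * g k"
      unfolding Suc.IH[of k] s per[of "?s m k"] ..
    finally show ?thesis by (simp add: algebra_simps)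
  qed
  then have "f k * g (?s (Suc m) k) - f (?s (Suc m) k) * g k = 0"
    using g(2) k1
    by (intro entire_mult_eq_0[OF fin, of "\<lambda>k. g (?s m k)"
          "\<lambda>k. f k * g (?s (Suc m) k) - f (?s (Suc m) k) * g k" k1]
        entire_coord_shift entire_diff entire_mult fin f g) auto
  then show ?case by simp
qed

text \<open>Off the zeros of \<open>G\<close>, \<open>f / g\<close> is the sum of a list of
  \<open>d\<close> elements of the spectrum. The spectrum has at most \<open>n\<close> elements and
  is unchanged by unit shifts, because Laurent polynomials in the parameters have period 1. Hence
  among the shifts by \<open>0, ..., n ^ d\<close> two give the same list, which leads to a period
  dividing \<open>N\<close>; \<open>spec_bound\<close> supplies the growth.\<close>

theorem eigenvalue_sum_trig:
  fixes f g :: "('i \<Rightarrow> complex) \<Rightarrow> complex" and c :: "nat \<Rightarrow> nat \<Rightarrow> 'i laurent"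
  assumes fin: "finite I" and z: "\<And>i. z i \<noteq> 0"
    and f: "entire_on_coords I f" and g: "entire_on_coords I g" "g a0 \<noteq> 0"
    and G: "entire_on_coords I G" "G b0 \<noteq> 0"
    and c: "\<And>i j. i < n \<Longrightarrow> j < n \<Longrightarrow> c i j \<in> carrier (laurent_ring I)"
    and eig: "\<And>k. G k \<noteq> 0 \<Longrightarrow> \<exists>es. length es = d \<and>
        set es \<subseteq> spec n (\<lambda>i j. laurent_eval (u_eval z k) (c i j)) \<and> f k = g k * sum_list es"
    and N: "N > 0" "\<And>p. 0 < p \<Longrightarrow> p \<le> n ^ d \<Longrightarrow> p dvd N"
  shows "\<exists>P\<in>trig N I. \<forall>k. f k = g k * P k"
proof -
  define Sp where "Sp = (\<lambda>k. spec n (\<lambda>i j. laurent_eval (u_eval z k) (c i j)))"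
  have shift: "laurent_eval (u_eval z (coord_shift i a k)) p = laurent_eval (u_eval z k) p"
    if "p \<in> carrier (laurent_ring I)" for i a k p
    unfolding coord_shift_alt
    by (rule trig_periodic[OF laurent_eval_trig[OF fin that]])
      (auto intro: exI[of _ "int a"] exI[of _ 0])
  have Sp_shift: "Sp (coord_shift i a k) = Sp k" for i a k
  proof -
    have "(\<Sum>i'<n. laurent_eval (u_eval z (coord_shift i a k)) (c i' j) * y i')
        = (\<Sum>i'<n. laurent_eval (u_eval z k) (c i' j) * y i')" if "j < n" for j y
      using that by (intro sum.cong) (auto simp: shift c)
    then show ?thesis unfolding Sp_def spec_def by auto
  qed
  let ?D = "n ^ d"
  have per: "f k * g (coord_shift i N k) = f (coord_shift i N k) * g k" for i k
  proof -
    \<comment> \<open>The cross-multiplied difference of the values of \<open>f / g\<close> after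
      two shifts; \<open>T\<close> collects the pairs to be compared.\<close>
    define R where "R = (\<lambda>(a, b) k. f (coord_shift i a k) * g (coord_shift i b k)
        - f (coord_shift i b k) * g (coord_shift i a k))"
    define T where "T = {(a, b). a < b \<and> b \<le> ?D}"
    have finT: "finite T"
      by (rule finite_subset[of _ "{..?D} \<times> {..?D}"]) (auto simp: T_def)
    have entR: "entire_on_coords I (R x)" for x
      unfolding R_def by (cases x) (simp, intro entire_diff entire_mult entire_coord_shift fin f g)
    have entG: "entire_on_coords I (\<lambda>k. \<Prod>a\<le>?D. G (coord_shift i a k))"
      by (intro entire_prod entire_coord_shift fin G)
    \<comment> \<open>At a given \<open>k\<close> some \<open>R (a, b)\<close> vanishes, for a pair
      depending on \<open>k\<close>. The factor in front confines the argument to points all of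
      whose shifts avoid the zeros of \<open>G\<close>.\<close>
    have "(\<Prod>a\<le>?D. G (coord_shift i a k)) * (\<Prod>x\<in>T. R x k) = 0" for k
    proof (cases "\<exists>a\<le>?D. G (coord_shift i a k) = 0")
      case False
      then have "\<forall>a\<in>{..?D}. \<exists>es. length es = d \<and> set es \<subseteq> Sp k \<and>
          f (coord_shift i a k) = g (coord_shift i a k) * sum_list es"
        using eig[of "coord_shift i a k" for a] Sp_shift[of i _ k, unfolded Sp_def] unfolding Sp_def
        by (metis atMost_iff)
      then obtain es where es: "\<And>a. a \<le> ?D \<Longrightarrow> length (es a) = d \<and> set (es a) \<subseteq> Sp k \<and>
          f (coord_shift i a k) = g (coord_shift i a k) * sum_list (es a)"
        by (metis atMost_iff)
      let ?L = "{xs. set xs \<subseteq> Sp k \<and> length xs = d}"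
      have finSp: "finite (Sp k)" and cardSp: "card (Sp k) \<le> n"
        unfolding Sp_def by (rule spec_finite, rule spec_card)
      have "card ?L \<le> ?D"
        using card_lists_length_eq[OF finSp, of d] power_mono[OF cardSp] by simp
      moreover have "es ` {..?D} \<subseteq> ?L" using es by auto
      ultimately have "card (es ` {..?D}) \<le> ?D"
        using card_mono[OF finite_lists_length_eq[OF finSp]] order_trans by meson
      \<comment> \<open>Pigeonhole: \<open>n ^ d + 1\<close> shifts, but at most
        \<open>n ^ d\<close> lists.\<close>
      then have "\<not> inj_on es {..?D}" using card_image[of es "{..?D}"] by auto
      then obtain a b where ab: "a \<le> ?D" "b \<le> ?D" "a < b" "es a = es b"
        unfolding inj_on_def by (metis atMost_iff linorder_neqE_nat)
      then have "R (a, b) k = 0" using es[of a] es[of b] by (simp add: R_def)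
      moreover have "(a, b) \<in> T" using ab by (simp add: T_def)
      ultimately have "(\<Prod>x\<in>T. R x k) = 0" using finT by (intro prod_zero) auto
      then show ?thesis by simp
    qed auto
    moreover have "\<exists>k. (\<Prod>a\<le>?D. G (coord_shift i a k)) \<noteq> 0"
    proof (intro entire_prod_nonzero[OF fin] entire_coord_shift G)
      show "\<exists>k. G (coord_shift i a k) \<noteq> 0" for a
        using G(2) coord_shift_surj[of i a b0] by auto
    qed simp
    moreover have "entire_on_coords I (\<lambda>k. \<Prod>x\<in>T. R x k)"
      by (intro entire_prod fin entR)
    ultimately have "(\<Prod>x\<in>T. R x k) = 0" for k
      using entire_mult_eq_0[OF fin entG, of "\<lambda>k. \<Prod>x\<in>T. R x k"] by blast
    \<comment> \<open>From here on a single pair of shifts serves for all \<open>k\<close>.\<close>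
    then obtain a b where ab: "(a, b) \<in> T" "\<And>k. R (a, b) k = 0"
      using entire_prod_nonzero[OF fin finT entR] by force
    define p where "p = b - a"
    have p: "0 < p" "p \<le> ?D" "b = a + p" using ab(1) by (auto simp: T_def p_def)
    have "f k * g (coord_shift i p k) = f (coord_shift i p k) * g k" for k
    proof -
      obtain k' where "coord_shift i a k' = k" using coord_shift_surj by metis
      then show ?thesis
        using ab(2)[of k'] p(3) coord_shift_add[of i p a k'] by (simp add: R_def)
    qed
    from coord_shift_period_multiple[OF fin f g this, of k "N div p"]
    show ?thesis using N(2)[OF p(1,2)] by simp
  qed
  have "\<forall>i j. \<exists>A M. i < n \<longrightarrow> j < n \<longrightarrow> A \<ge> 0 \<and> (\<forall>k. cmod (laurent_eval (u_eval z k) (c i j))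
      \<le> A * exp (2 * pi * real M / real 1 * (\<Sum>i\<in>I. \<bar>Im (k i)\<bar>)))"
    using trig_growth[OF laurent_eval_trig[OF fin c] fin] by metis
  then obtain Ac :: "nat \<Rightarrow> nat \<Rightarrow> real" and Mc :: "nat \<Rightarrow> nat \<Rightarrow> nat" where AM:
    "\<And>i j. i < n \<Longrightarrow> j < n \<Longrightarrow> Ac i j \<ge> 0"
    "\<And>i j k. i < n \<Longrightarrow> j < n \<Longrightarrow> cmod (laurent_eval (u_eval z k) (c i j))
      \<le> Ac i j * exp (2 * pi * real (Mc i j) * (\<Sum>i\<in>I. \<bar>Im (k i)\<bar>))"
    by (simp add: choice_iff) metis
  define M where "M = (\<Sum>i<n. \<Sum>j<n. Mc i j)"
  define A where "A = (\<Sum>i<n. \<Sum>j<n. Ac i j)"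
  have spec_le: "cmod \<mu> \<le> A * exp (2 * pi * real M * (\<Sum>i\<in>I. \<bar>Im (k i)\<bar>))" if "\<mu> \<in> Sp k" for \<mu> k
  proof -
    let ?s = "\<Sum>i\<in>I. \<bar>Im (k i)\<bar>"
    have s: "?s \<ge> 0" by (simp add: sum_nonneg)
    have "cmod \<mu> \<le> (\<Sum>i<n. \<Sum>j<n. cmod (laurent_eval (u_eval z k) (c i j)))"
      using that unfolding Sp_def by (rule spec_bound)
    also have "\<dots> \<le> (\<Sum>i<n. \<Sum>j<n. Ac i j * exp (2 * pi * real M * ?s))"
    proof (intro sum_mono)
      fix i j assume ij: "i \<in> {..<n}" "j \<in> {..<n}"
      have "Mc i j \<le> (\<Sum>j<n. Mc i j)" using ij by (intro member_le_sum) auto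
      also have "\<dots> \<le> M" unfolding M_def
        using ij by (intro member_le_sum[of i _ "\<lambda>i. \<Sum>j<n. Mc i j"]) auto
      finally have "exp (2 * pi * real (Mc i j) * ?s) \<le> exp (2 * pi * real M * ?s)"
        using s by (auto intro!: mult_right_mono mult_left_mono)
      then have "Ac i j * exp (2 * pi * real (Mc i j) * ?s) \<le> Ac i j * exp (2 * pi * real M * ?s)"
        using AM(1) ij by (intro mult_left_mono) auto
      then show "cmod (laurent_eval (u_eval z k) (c i j)) \<le> Ac i j * exp (2 * pi * real M * ?s)"
        using AM(2)[of i j k] ij by auto
    qed
    finally show ?thesis by (simp add: A_def sum_distrib_right)
  qed
  have fbound: "cmod (f k) \<le> cmod (g k) * (real d * A * exp (2 * pi * real M * (\<Sum>i\<in>I. \<bar>Im (k i)\<bar>)))"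
    if Gk: "G k \<noteq> 0" for k
  proof -
    obtain es where es: "length es = d" "set es \<subseteq> Sp k" "f k = g k * sum_list es"
      using eig[OF Gk] unfolding Sp_def by blast
    have "cmod (sum_list es) \<le> real d * (A * exp (2 * pi * real M * (\<Sum>i\<in>I. \<bar>Im (k i)\<bar>)))"
      using cmod_sum_list_le[of es] es(1,2) spec_le by blast
    then show ?thesis using es(3) by (simp add: norm_mult mult_left_mono mult.assoc)
  qed
  obtain a1 where a1: "g a1 * G a1 \<noteq> 0"
    using entire_mult_eq_0[OF fin g(1) G(1) _ g(2), of b0] G(2) by blast
  \<comment> \<open>Multiplying both functions by \<open>G\<close> extends the growth bound to all
    \<open>k\<close>. The order becomes \<open>M * N\<close> because it is counted in multiples of
    \<open>2 * pi / N\<close>.\<close>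
  have "\<exists>P\<in>trig N I. \<forall>k. f k * G k = (g k * G k) * P k"
  proof (rule periodic_quotient_trig[OF fin N(1), where M = "M * N" and A = "real d * A" and a = a1])
    show "entire_on_coords I (\<lambda>k. f k * G k)" "entire_on_coords I (\<lambda>k. g k * G k)"
      by (intro entire_mult fin f g G)+
    show "f k * G k * (g (k(i := k i + of_nat N)) * G (k(i := k i + of_nat N)))
        = f (k(i := k i + of_nat N)) * G (k(i := k i + of_nat N)) * (g k * G k)" for i k
      using arg_cong[OF per[of k i], of "\<lambda>x. x * G k * G (coord_shift i N k)"]
      unfolding coord_shift_def by (simp only: mult_ac)
    show "cmod (f k * G k) \<le> cmod (g k * G k) *
        (real d * A * exp (2 * pi * real (M * N) / real N * (\<Sum>i\<in>I. \<bar>Im (k i)\<bar>)))" for k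
    proof (cases "G k = 0")
      case False
      have "2 * pi * real (M * N) / real N = 2 * pi * real M" using N by simp
      then show ?thesis
        using mult_right_mono[OF fbound[OF False], of "cmod (G k)"]
        by (simp only: norm_mult norm_ge_zero mult_ac)
    qed simp
  qed (rule a1)
  then obtain P where P: "P \<in> trig N I" "\<And>k. f k * G k = (g k * G k) * P k" by blast
  have "G k * (f k - g k * P k) = 0" for k using P(2)[of k] by (simp add: algebra_simps)
  then have "f k - g k * P k = 0" for k
    using entire_mult_eq_0[OF fin G(1) entire_diff[OF fin f entire_mult[OF fin g(1) entire_trig[OF P(1) fin]]] _ G(2)]
    by blast
  then have "f k = g k * P k" for k by (metis eq_iff_diff_eq_0)
  with P(1) show ?thesis by blast
qed

section \<open>Fields of fractions\<close>

context domain
begin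

lemma fraction_mem:
  assumes "a \<in> carrier R" "b \<in> carrier R - {\<zero>}"
  shows "(a, b) \<in> fraction R a b"
  using assms by (simp add: fraction_def)

lemma fraction_eq_iff:
  assumes "a \<in> carrier R" "b \<in> carrier R - {\<zero>}" "c \<in> carrier R" "d \<in> carrier R - {\<zero>}"
  shows "fraction R a b = fraction R c d \<longleftrightarrow> a \<otimes> d = c \<otimes> b"
proof
  assume "fraction R a b = fraction R c d"
  then have "(a, b) \<in> fraction R c d" using fraction_mem[OF assms(1,2)] by simp
  then show "a \<otimes> d = c \<otimes> b" by (simp add: fraction_def)
next
  assume eq: "a \<otimes> d = c \<otimes> b"
  have *: "x \<otimes> w = v \<otimes> y \<Longrightarrow> x \<otimes> q = p \<otimes> y \<Longrightarrow> v \<otimes> q = p \<otimes> w"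
    if "x \<in> carrier R" "y \<in> carrier R - {\<zero>}" "v \<in> carrier R" "w \<in> carrier R - {\<zero>}"
      "p \<in> carrier R" "q \<in> carrier R - {\<zero>}" for x y v w p q
  proof -
    assume h: "x \<otimes> w = v \<otimes> y" "x \<otimes> q = p \<otimes> y"
    have "y \<otimes> (v \<otimes> q) = (v \<otimes> y) \<otimes> q" using that by (simp add: m_ac)
    also have "\<dots> = (x \<otimes> q) \<otimes> w" using that by (simp add: h(1)[symmetric] m_ac)
    also have "\<dots> = y \<otimes> (p \<otimes> w)" using that by (simp add: h(2) m_ac)
    finally show ?thesis using that by (subst (asm) m_lcancel) auto
  qed
  have eq': "c \<otimes> b = a \<otimes> d" using eq by simp
  show "fraction R a b = fraction R c d"
    unfolding fraction_def using *[OF assms(1,2,3,4) _ _ eq] *[OF assms(3,4,1,2) _ _ eq'] by blast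
qed

text \<open>The operations of \<open>Frac\<close> are unions over all representatives; such a union
  collapses to one set once the result is independent of the representatives.\<close>

lemma Frac_UN:
  assumes "(a, b) \<in> Y" "(c, d) \<in> Z"
    and "\<And>a' b' c' d'. (a', b') \<in> Y \<Longrightarrow> (c', d') \<in> Z \<Longrightarrow> h a' b' c' d' = h a b c d"
  shows "(\<Union>(a, b)\<in>Y. \<Union>(c, d)\<in>Z. h a b c d) = h a b c d"
  using assms by fast

lemma Frac_mult:
  assumes "a \<in> carrier R" "b \<in> carrier R - {\<zero>}" "c \<in> carrier R" "d \<in> carrier R - {\<zero>}"
  shows "fraction R a b \<otimes>\<^bsub>Frac R\<^esub> fraction R c d = fraction R (a \<otimes> c) (b \<otimes> d)"
proof -
  have "fraction R (a' \<otimes> c') (b' \<otimes> d') = fraction R (a \<otimes> c) (b \<otimes> d)"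
    if "(a', b') \<in> fraction R a b" "(c', d') \<in> fraction R c d" for a' b' c' d'
  proof -
    from that have h: "a' \<in> carrier R" "b' \<in> carrier R" "b' \<noteq> \<zero>" "a \<otimes> b' = a' \<otimes> b"
      "c' \<in> carrier R" "d' \<in> carrier R" "d' \<noteq> \<zero>" "c \<otimes> d' = c' \<otimes> d"
      by (auto simp: fraction_def)
    have "(a' \<otimes> c') \<otimes> (b \<otimes> d) = (a' \<otimes> b) \<otimes> (c' \<otimes> d)" using h assms by (simp add: m_ac)
    also have "\<dots> = (a \<otimes> c) \<otimes> (b' \<otimes> d')" using h assms by (simp add: h(4,8)[symmetric] m_ac)
    finally show ?thesis using h assms by (subst fraction_eq_iff) (auto simp: integral_iff)
  qed
  then show ?thesis
    unfolding Frac_def by (simp, intro Frac_UN fraction_mem assms)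
qed

lemma Frac_add:
  assumes "a \<in> carrier R" "b \<in> carrier R - {\<zero>}" "c \<in> carrier R" "d \<in> carrier R - {\<zero>}"
  shows "fraction R a b \<oplus>\<^bsub>Frac R\<^esub> fraction R c d = fraction R ((a \<otimes> d) \<oplus> (c \<otimes> b)) (b \<otimes> d)"
proof -
  have "fraction R ((a' \<otimes> d') \<oplus> (c' \<otimes> b')) (b' \<otimes> d') = fraction R ((a \<otimes> d) \<oplus> (c \<otimes> b)) (b \<otimes> d)"
    if "(a', b') \<in> fraction R a b" "(c', d') \<in> fraction R c d" for a' b' c' d'
  proof -
    from that have h: "a' \<in> carrier R" "b' \<in> carrier R" "b' \<noteq> \<zero>" "a \<otimes> b' = a' \<otimes> b"
      "c' \<in> carrier R" "d' \<in> carrier R" "d' \<noteq> \<zero>" "c \<otimes> d' = c' \<otimes> d"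
      by (auto simp: fraction_def)
    have "((a' \<otimes> d') \<oplus> (c' \<otimes> b')) \<otimes> (b \<otimes> d) = (a' \<otimes> b) \<otimes> (d' \<otimes> d) \<oplus> (c' \<otimes> d) \<otimes> (b' \<otimes> b)"
      using h assms by (simp add: l_distr r_distr m_ac)
    also have "\<dots> = ((a \<otimes> d) \<oplus> (c \<otimes> b)) \<otimes> (b' \<otimes> d')"
      using h assms by (simp add: h(4,8)[symmetric] l_distr r_distr m_ac)
    finally show ?thesis using h assms by (subst fraction_eq_iff) (auto simp: integral_iff)
  qed
  then show ?thesis
    unfolding Frac_def by (simp, intro Frac_UN fraction_mem assms)
qed

lemma Frac_carrier: "carrier (Frac R) = {fraction R a b | a b. a \<in> carrier R \<and> b \<in> carrier R - {\<zero>}}"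
  by (simp add: Frac_def)

lemma Frac_carrierE:
  assumes "x \<in> carrier (Frac R)"
  obtains a b where "a \<in> carrier R" "b \<in> carrier R - {\<zero>}" "x = fraction R a b"
  using assms by (auto simp: Frac_carrier)

lemma fraction_closed: "a \<in> carrier R \<Longrightarrow> b \<in> carrier R - {\<zero>} \<Longrightarrow> fraction R a b \<in> carrier (Frac R)"
  by (auto simp: Frac_carrier)

lemma Frac_zero: "\<zero>\<^bsub>Frac R\<^esub> = fraction R \<zero> \<one>" and Frac_one: "\<one>\<^bsub>Frac R\<^esub> = fraction R \<one> \<one>"
  by (simp_all add: Frac_def)

lemma mult_nonzero: "b \<in> carrier R - {\<zero>} \<Longrightarrow> d \<in> carrier R - {\<zero>} \<Longrightarrow> b \<otimes> d \<in> carrier R - {\<zero>}"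
  by (auto simp: integral_iff)

lemma one_nonzero: "\<one> \<in> carrier R - {\<zero>}" by simp

lemma Frac_is_field: "field (Frac R)"
proof -
  note fsimps = Frac_mult Frac_add Frac_zero Frac_one
  have cring: "cring (Frac R)"
  proof (rule cringI)
    show "abelian_group (Frac R)"
    proof (rule abelian_groupI)
      show "\<zero>\<^bsub>Frac R\<^esub> \<in> carrier (Frac R)" by (auto simp: Frac_zero intro: fraction_closed)
    next
      fix x y assume "x \<in> carrier (Frac R)" "y \<in> carrier (Frac R)"
      then show "x \<oplus>\<^bsub>Frac R\<^esub> y \<in> carrier (Frac R)"
        by (elim Frac_carrierE) (simp add: Frac_add, intro fraction_closed mult_nonzero; simp)
    next
      fix x y z assume "x \<in> carrier (Frac R)" "y \<in> carrier (Frac R)" "z \<in> carrier (Frac R)"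
      then obtain a b c d p q where xyz:
        "a \<in> carrier R" "b \<in> carrier R - {\<zero>}" "x = fraction R a b"
        "c \<in> carrier R" "d \<in> carrier R - {\<zero>}" "y = fraction R c d"
        "p \<in> carrier R" "q \<in> carrier R - {\<zero>}" "z = fraction R p q"
        by (metis Frac_carrierE)
      show "x \<oplus>\<^bsub>Frac R\<^esub> y \<oplus>\<^bsub>Frac R\<^esub> z = x \<oplus>\<^bsub>Frac R\<^esub> (y \<oplus>\<^bsub>Frac R\<^esub> z)"
        unfolding xyz using xyz
        by (simp add: Frac_add mult_nonzero[simplified] del: DiffD1 DiffD2)
          (simp add: fraction_eq_iff mult_nonzero[simplified] l_distr r_distr m_ac a_ac integral_iff)
      show "x \<oplus>\<^bsub>Frac R\<^esub> y = y \<oplus>\<^bsub>Frac R\<^esub> x"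
        unfolding xyz using xyz by (simp add: Frac_add a_comm m_comm)
    next
      fix x assume "x \<in> carrier (Frac R)"
      then obtain a b where x: "a \<in> carrier R" "b \<in> carrier R - {\<zero>}" "x = fraction R a b"
        by (rule Frac_carrierE)
      show "\<zero>\<^bsub>Frac R\<^esub> \<oplus>\<^bsub>Frac R\<^esub> x = x"
        unfolding x Frac_zero using x by (simp add: Frac_add)
      have "fraction R (\<ominus> a) b \<oplus>\<^bsub>Frac R\<^esub> x = \<zero>\<^bsub>Frac R\<^esub>"
        unfolding x Frac_zero using x
        by (simp add: Frac_add) (simp add: fraction_eq_iff integral_iff l_minus l_neg)
      then show "\<exists>y\<in>carrier (Frac R). y \<oplus>\<^bsub>Frac R\<^esub> x = \<zero>\<^bsub>Frac R\<^esub>"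
        using x by (intro bexI[of _ "fraction R (\<ominus> a) b"] fraction_closed) auto
    qed
    show "Group.comm_monoid (Frac R)"
    proof (rule comm_monoidI)
      fix x y assume "x \<in> carrier (Frac R)" "y \<in> carrier (Frac R)"
      then show "x \<otimes>\<^bsub>Frac R\<^esub> y \<in> carrier (Frac R)"
        by (elim Frac_carrierE) (simp add: Frac_mult, intro fraction_closed mult_nonzero; simp)
    next
      show "\<one>\<^bsub>Frac R\<^esub> \<in> carrier (Frac R)" by (auto simp: Frac_one intro: fraction_closed)
    next
      fix x y z assume "x \<in> carrier (Frac R)" "y \<in> carrier (Frac R)" "z \<in> carrier (Frac R)"
      then obtain a b c d p q where xyz:
        "a \<in> carrier R" "b \<in> carrier R - {\<zero>}" "x = fraction R a b"
        "c \<in> carrier R" "d \<in> carrier R - {\<zero>}" "y = fraction R c d"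
        "p \<in> carrier R" "q \<in> carrier R - {\<zero>}" "z = fraction R p q"
        by (metis Frac_carrierE)
      show "x \<otimes>\<^bsub>Frac R\<^esub> y \<otimes>\<^bsub>Frac R\<^esub> z = x \<otimes>\<^bsub>Frac R\<^esub> (y \<otimes>\<^bsub>Frac R\<^esub> z)"
        unfolding xyz using xyz by (simp add: Frac_mult integral_iff m_assoc)
      show "x \<otimes>\<^bsub>Frac R\<^esub> y = y \<otimes>\<^bsub>Frac R\<^esub> x"
        unfolding xyz using xyz by (simp add: Frac_mult m_comm)
    next
      fix x assume "x \<in> carrier (Frac R)"
      then show "\<one>\<^bsub>Frac R\<^esub> \<otimes>\<^bsub>Frac R\<^esub> x = x"
        by (elim Frac_carrierE) (simp add: Frac_mult Frac_one)
    qed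
    fix x y z assume "x \<in> carrier (Frac R)" "y \<in> carrier (Frac R)" "z \<in> carrier (Frac R)"
    then obtain a b c d p q where xyz:
      "a \<in> carrier R" "b \<in> carrier R - {\<zero>}" "x = fraction R a b"
      "c \<in> carrier R" "d \<in> carrier R - {\<zero>}" "y = fraction R c d"
      "p \<in> carrier R" "q \<in> carrier R - {\<zero>}" "z = fraction R p q"
      by (metis Frac_carrierE)
    show "(x \<oplus>\<^bsub>Frac R\<^esub> y) \<otimes>\<^bsub>Frac R\<^esub> z = x \<otimes>\<^bsub>Frac R\<^esub> z \<oplus>\<^bsub>Frac R\<^esub> y \<otimes>\<^bsub>Frac R\<^esub> z"
      unfolding xyz using xyz
      by (simp add: Frac_add Frac_mult integral_iff)
        (simp add: fraction_eq_iff l_distr r_distr m_ac integral_iff)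
  qed
  show ?thesis
  proof (rule cring.cring_fieldI2[OF cring])
    show "\<zero>\<^bsub>Frac R\<^esub> \<noteq> \<one>\<^bsub>Frac R\<^esub>"
      unfolding Frac_zero Frac_one by (simp add: fraction_eq_iff)
    fix x assume "x \<in> carrier (Frac R)" "x \<noteq> \<zero>\<^bsub>Frac R\<^esub>"
    then obtain a b where x: "a \<in> carrier R" "b \<in> carrier R - {\<zero>}" "x = fraction R a b"
      by (metis Frac_carrierE)
    have a: "a \<noteq> \<zero>" using \<open>x \<noteq> \<zero>\<^bsub>Frac R\<^esub>\<close> x by (auto simp: Frac_zero fraction_eq_iff)
    have "x \<otimes>\<^bsub>Frac R\<^esub> fraction R b a = \<one>\<^bsub>Frac R\<^esub>"
      unfolding x Frac_one using x a by (simp add: Frac_mult) (simp add: fraction_eq_iff integral_iff m_comm)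
    then show "\<exists>y\<in>carrier (Frac R). x \<otimes>\<^bsub>Frac R\<^esub> y = \<one>\<^bsub>Frac R\<^esub>"
      using x a by (intro bexI[of _ "fraction R b a"] fraction_closed) auto
  qed
qed

lemma to_Frac_hom: "to_Frac R \<in> Ring.ring_hom R (Frac R)"
  by (rule ring_hom_memI)
    (auto simp: to_Frac_def Frac_mult Frac_add Frac_one intro: fraction_closed)

lemma to_Frac_eq_zero_iff: "a \<in> carrier R \<Longrightarrow> to_Frac R a = \<zero>\<^bsub>Frac R\<^esub> \<longleftrightarrow> a = \<zero>"
  by (simp add: to_Frac_def Frac_zero fraction_eq_iff)

end

section \<open>Monoid algebras\<close>

text \<open>Stated for monoids because the tensor product is a quotient of the algebra over the
  multiplicative monoid of the Hecke algebra.\<close>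

locale monoid_ring = R: cring R + G: Group.monoid G for R :: "('r, 'p) ring_scheme" (structure)
  and G :: "('g, 'q) monoid_scheme" (structure)
begin

abbreviation "M \<equiv> monoid_algebra R G"

lemma carrier_iff:
  "f \<in> carrier M \<longleftrightarrow> (\<forall>x. f x \<in> carrier R) \<and> finite {x. f x \<noteq> \<zero>\<^bsub>R\<^esub>} \<and> {x. f x \<noteq> \<zero>\<^bsub>R\<^esub>} \<subseteq> carrier G"
  by (simp add: monoid_algebra_def)

lemma add_eq: "f \<oplus>\<^bsub>M\<^esub> g = (\<lambda>x. f x \<oplus>\<^bsub>R\<^esub> g x)" and zero_eq: "\<zero>\<^bsub>M\<^esub> = (\<lambda>x. \<zero>\<^bsub>R\<^esub>)"
  and one_eq: "\<one>\<^bsub>M\<^esub> = monoid_elem R \<one>\<^bsub>G\<^esub> \<one>\<^bsub>R\<^esub>" and smult_eq: "r \<odot>\<^bsub>M\<^esub> f = (\<lambda>x. r \<otimes>\<^bsub>R\<^esub> f x)"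
  by (simp_all add: monoid_algebra_def)

lemma elem_closed [intro]: "a \<in> carrier G \<Longrightarrow> r \<in> carrier R \<Longrightarrow> monoid_elem R a r \<in> carrier M"
  by (auto simp: carrier_iff monoid_elem_def)

lemma add_closed: 
  assumes "f \<in> carrier M" "g \<in> carrier M"
  shows "f \<oplus>\<^bsub>M\<^esub> g \<in> carrier M"
proof -
  have "{x. f x \<oplus>\<^bsub>R\<^esub> g x \<noteq> \<zero>\<^bsub>R\<^esub>} \<subseteq> {x. f x \<noteq> \<zero>\<^bsub>R\<^esub>} \<union> {x. g x \<noteq> \<zero>\<^bsub>R\<^esub>}" by auto
  then show ?thesis
    using assms by (auto simp: carrier_iff add_eq dest: finite_subset)
qed

lemma smult_closed: "r \<in> carrier R \<Longrightarrow> f \<in> carrier M \<Longrightarrow> r \<odot>\<^bsub>M\<^esub> f \<in> carrier M"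
  by (auto simp: carrier_iff smult_eq elim!: rev_finite_subset)

lemma abelian_group_M: "abelian_group M"
proof (rule abelian_groupI)
  fix f assume f: "f \<in> carrier M"
  then have "(\<lambda>x. \<ominus>\<^bsub>R\<^esub> f x) \<in> carrier M"
    by (auto simp: carrier_iff elim!: rev_finite_subset)
  then show "\<exists>g\<in>carrier M. g \<oplus>\<^bsub>M\<^esub> f = \<zero>\<^bsub>M\<^esub>"
    using f by (intro bexI[of _ "\<lambda>x. \<ominus>\<^bsub>R\<^esub> f x"]) (auto simp: add_eq zero_eq carrier_iff R.l_neg)
qed (auto simp: add_closed, auto simp: add_eq zero_eq carrier_iff R.a_ac)

text \<open>Identities that are additive in an argument need only be checked on elements supported
  at one point; the support is removed point by point.\<close>

lemma monoid_algebra_induct [consumes 1, case_names zero elem add]: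
  assumes f: "f \<in> carrier M" and zero: "P \<zero>\<^bsub>M\<^esub>"
    and elem: "\<And>a r. a \<in> carrier G \<Longrightarrow> r \<in> carrier R \<Longrightarrow> P (monoid_elem R a r)"
    and add: "\<And>f g. f \<in> carrier M \<Longrightarrow> g \<in> carrier M \<Longrightarrow> P f \<Longrightarrow> P g \<Longrightarrow> P (f \<oplus>\<^bsub>M\<^esub> g)"
  shows "P f"
proof -
  have "finite {x. f x \<noteq> \<zero>\<^bsub>R\<^esub>}" using f by (simp add: carrier_iff)
  moreover have "P f" if "finite A" "{x. f x \<noteq> \<zero>\<^bsub>R\<^esub>} = A" "f \<in> carrier M" for A f
    using that
  proof (induction A arbitrary: f rule: finite_induct)
    case empty
    then have "f = \<zero>\<^bsub>M\<^esub>" by (auto simp: zero_eq)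
    with zero show ?case by simp
  next
    case (insert a A)
    let ?f = "f(a := \<zero>\<^bsub>R\<^esub>)"
    have A: "{x. ?f x \<noteq> \<zero>\<^bsub>R\<^esub>} = A" using insert.prems(1) insert.hyps by auto
    have c: "?f \<in> carrier M"
      unfolding carrier_iff A using insert.prems insert.hyps by (auto simp: carrier_iff)
    have "P ?f" by (rule insert.IH[OF A c])
    moreover have a: "a \<in> carrier G" "f a \<in> carrier R" using insert.prems by (auto simp: carrier_iff)
    moreover have "f = ?f \<oplus>\<^bsub>M\<^esub> monoid_elem R a (f a)"
      using insert.prems by (auto simp: add_eq monoid_elem_def carrier_iff fun_eq_iff)
    ultimately show ?case using add[OF c elem_closed[OF a]] elem[OF a] by metis
  qed
  ultimately show ?thesis using f by blast
qed

text \<open>The defining sum runs over the exact supports, which change under addition. Fixed larger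
  index sets make different products comparable.\<close>

lemma mult_superset:
  assumes f: "f \<in> carrier M" and g: "g \<in> carrier M"
    and A: "finite A" "{x. f x \<noteq> \<zero>\<^bsub>R\<^esub>} \<subseteq> A" and B: "finite B" "{x. g x \<noteq> \<zero>\<^bsub>R\<^esub>} \<subseteq> B"
  shows "(f \<otimes>\<^bsub>M\<^esub> g) x = (\<Oplus>\<^bsub>R\<^esub>p\<in>A \<times> B. if fst p \<otimes>\<^bsub>G\<^esub> snd p = x then f (fst p) \<otimes>\<^bsub>R\<^esub> g (snd p) else \<zero>\<^bsub>R\<^esub>)"
proof -
  have c: "f y \<in> carrier R" "g y \<in> carrier R" for y using f g by (auto simp: carrier_iff)
  have "(f \<otimes>\<^bsub>M\<^esub> g) x = (\<Oplus>\<^bsub>R\<^esub>p\<in>{(y, z). f y \<noteq> \<zero>\<^bsub>R\<^esub> \<and> g z \<noteq> \<zero>\<^bsub>R\<^esub> \<and> y \<otimes>\<^bsub>G\<^esub> z = x}. f (fst p) \<otimes>\<^bsub>R\<^esub> g (snd p))"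
    by (simp add: monoid_algebra_def)
  also have "\<dots> = (\<Oplus>\<^bsub>R\<^esub>p\<in>A \<times> B. if fst p \<otimes>\<^bsub>G\<^esub> snd p = x then f (fst p) \<otimes>\<^bsub>R\<^esub> g (snd p) else \<zero>\<^bsub>R\<^esub>)"
    using A B c by (intro R.add.finprod_mono_neutral_cong_left) auto
  finally show ?thesis .
qed

lemma mult_closed:
  assumes f: "f \<in> carrier M" and g: "g \<in> carrier M"
  shows "f \<otimes>\<^bsub>M\<^esub> g \<in> carrier M"
proof -
  let ?A = "{x. f x \<noteq> \<zero>\<^bsub>R\<^esub>}" and ?B = "{x. g x \<noteq> \<zero>\<^bsub>R\<^esub>}"
  have fin: "finite ?A" "finite ?B" and sub: "?A \<subseteq> carrier G" "?B \<subseteq> carrier G"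
    and c: "\<And>y. f y \<in> carrier R" "\<And>y. g y \<in> carrier R" using f g by (auto simp: carrier_iff)
  note m = mult_superset[OF f g fin(1) order_refl fin(2) order_refl]
  have "(f \<otimes>\<^bsub>M\<^esub> g) x \<in> carrier R" for x
    unfolding m by (intro R.finsum_closed) (auto simp: c)
  moreover have supp: "{x. (f \<otimes>\<^bsub>M\<^esub> g) x \<noteq> \<zero>\<^bsub>R\<^esub>} \<subseteq> (\<lambda>p. fst p \<otimes>\<^bsub>G\<^esub> snd p) ` (?A \<times> ?B)"
  proof (rule ccontr)
    assume "\<not> ?thesis"
    then obtain x where x: "(f \<otimes>\<^bsub>M\<^esub> g) x \<noteq> \<zero>\<^bsub>R\<^esub>" "x \<notin> (\<lambda>p. fst p \<otimes>\<^bsub>G\<^esub> snd p) ` (?A \<times> ?B)" by blast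
    have "(f \<otimes>\<^bsub>M\<^esub> g) x = (\<Oplus>\<^bsub>R\<^esub>p\<in>?A \<times> ?B. \<zero>\<^bsub>R\<^esub>)"
      unfolding m using x(2) by (intro R.finsum_cong') (force simp: c image_iff)+
    with x(1) show False by simp
  qed
  moreover have "finite ((\<lambda>p. fst p \<otimes>\<^bsub>G\<^esub> snd p) ` (?A \<times> ?B))" using fin by simp
  moreover have "(\<lambda>p. fst p \<otimes>\<^bsub>G\<^esub> snd p) ` (?A \<times> ?B) \<subseteq> carrier G" using sub by (auto intro!: G.m_closed)
  ultimately show ?thesis unfolding carrier_iff by (meson finite_subset order_trans)
qed

lemma l_distr_M:
  assumes f: "f \<in> carrier M" "f' \<in> carrier M" and g: "g \<in> carrier M"
  shows "(f \<oplus>\<^bsub>M\<^esub> f') \<otimes>\<^bsub>M\<^esub> g = f \<otimes>\<^bsub>M\<^esub> g \<oplus>\<^bsub>M\<^esub> f' \<otimes>\<^bsub>M\<^esub> g"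
proof
  fix x
  let ?A = "{x. f x \<noteq> \<zero>\<^bsub>R\<^esub>} \<union> {x. f' x \<noteq> \<zero>\<^bsub>R\<^esub>}" and ?B = "{x. g x \<noteq> \<zero>\<^bsub>R\<^esub>}"
  have fin: "finite ?A" "finite ?B"
    and c: "\<And>y. f y \<in> carrier R" "\<And>y. f' y \<in> carrier R" "\<And>y. g y \<in> carrier R"
    using f g by (auto simp: carrier_iff)
  have "((f \<oplus>\<^bsub>M\<^esub> f') \<otimes>\<^bsub>M\<^esub> g) x = (\<Oplus>\<^bsub>R\<^esub>p\<in>?A \<times> ?B.
      (if fst p \<otimes>\<^bsub>G\<^esub> snd p = x then f (fst p) \<otimes>\<^bsub>R\<^esub> g (snd p) else \<zero>\<^bsub>R\<^esub>) \<oplus>\<^bsub>R\<^esub>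
      (if fst p \<otimes>\<^bsub>G\<^esub> snd p = x then f' (fst p) \<otimes>\<^bsub>R\<^esub> g (snd p) else \<zero>\<^bsub>R\<^esub>))"
  proof (subst mult_superset[OF add_closed[OF f] g fin(1) _ fin(2)])
    show "{x. (f \<oplus>\<^bsub>M\<^esub> f') x \<noteq> \<zero>\<^bsub>R\<^esub>} \<subseteq> ?A" by (auto simp: add_eq)
  qed (rule order_refl, rule R.finsum_cong', auto simp: add_eq c R.l_distr)
  also have "\<dots> = (f \<otimes>\<^bsub>M\<^esub> g) x \<oplus>\<^bsub>R\<^esub> (f' \<otimes>\<^bsub>M\<^esub> g) x"
    unfolding mult_superset[OF f(1) g fin(1) Un_upper1 fin(2) order_refl]
      mult_superset[OF f(2) g fin(1) Un_upper2 fin(2) order_refl]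
    by (rule R.finsum_addf) (auto simp: c)
  finally show "((f \<oplus>\<^bsub>M\<^esub> f') \<otimes>\<^bsub>M\<^esub> g) x = (f \<otimes>\<^bsub>M\<^esub> g \<oplus>\<^bsub>M\<^esub> f' \<otimes>\<^bsub>M\<^esub> g) x" by (simp add: add_eq)
qed

lemma r_distr_M:
  assumes f: "f \<in> carrier M" "f' \<in> carrier M" and g: "g \<in> carrier M"
  shows "g \<otimes>\<^bsub>M\<^esub> (f \<oplus>\<^bsub>M\<^esub> f') = g \<otimes>\<^bsub>M\<^esub> f \<oplus>\<^bsub>M\<^esub> g \<otimes>\<^bsub>M\<^esub> f'"
proof
  fix x
  let ?A = "{x. f x \<noteq> \<zero>\<^bsub>R\<^esub>} \<union> {x. f' x \<noteq> \<zero>\<^bsub>R\<^esub>}" and ?B = "{x. g x \<noteq> \<zero>\<^bsub>R\<^esub>}"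
  have fin: "finite ?A" "finite ?B"
    and c: "\<And>y. f y \<in> carrier R" "\<And>y. f' y \<in> carrier R" "\<And>y. g y \<in> carrier R"
    using f g by (auto simp: carrier_iff)
  have "(g \<otimes>\<^bsub>M\<^esub> (f \<oplus>\<^bsub>M\<^esub> f')) x = (\<Oplus>\<^bsub>R\<^esub>p\<in>?B \<times> ?A.
      (if fst p \<otimes>\<^bsub>G\<^esub> snd p = x then g (fst p) \<otimes>\<^bsub>R\<^esub> f (snd p) else \<zero>\<^bsub>R\<^esub>) \<oplus>\<^bsub>R\<^esub>
      (if fst p \<otimes>\<^bsub>G\<^esub> snd p = x then g (fst p) \<otimes>\<^bsub>R\<^esub> f' (snd p) else \<zero>\<^bsub>R\<^esub>))"
  proof (subst mult_superset[OF g add_closed[OF f] fin(2) order_refl fin(1)])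
    show "{x. (f \<oplus>\<^bsub>M\<^esub> f') x \<noteq> \<zero>\<^bsub>R\<^esub>} \<subseteq> ?A" by (auto simp: add_eq)
  qed (rule R.finsum_cong', auto simp: add_eq c R.r_distr)
  also have "\<dots> = (g \<otimes>\<^bsub>M\<^esub> f) x \<oplus>\<^bsub>R\<^esub> (g \<otimes>\<^bsub>M\<^esub> f') x"
    unfolding mult_superset[OF g f(1) fin(2) order_refl fin(1) Un_upper1]
      mult_superset[OF g f(2) fin(2) order_refl fin(1) Un_upper2]
    by (rule R.finsum_addf) (auto simp: c)
  finally show "(g \<otimes>\<^bsub>M\<^esub> (f \<oplus>\<^bsub>M\<^esub> f')) x = (g \<otimes>\<^bsub>M\<^esub> f \<oplus>\<^bsub>M\<^esub> g \<otimes>\<^bsub>M\<^esub> f') x" by (simp add: add_eq)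
qed

lemma elem_mult:
  assumes "a \<in> carrier G" "b \<in> carrier G" "r \<in> carrier R" "s \<in> carrier R"
  shows "monoid_elem R a r \<otimes>\<^bsub>M\<^esub> monoid_elem R b s = monoid_elem R (a \<otimes>\<^bsub>G\<^esub> b) (r \<otimes>\<^bsub>R\<^esub> s)"
proof
  fix x
  have "(monoid_elem R a r \<otimes>\<^bsub>M\<^esub> monoid_elem R b s) x = (\<Oplus>\<^bsub>R\<^esub>p\<in>{a} \<times> {b}.
      if fst p \<otimes>\<^bsub>G\<^esub> snd p = x then monoid_elem R a r (fst p) \<otimes>\<^bsub>R\<^esub> monoid_elem R b s (snd p) else \<zero>\<^bsub>R\<^esub>)"
    using assms by (intro mult_superset elem_closed) (auto simp: monoid_elem_def split: if_splits)
  also have "{a} \<times> {b} = {(a, b)}" by simp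
  finally show "(monoid_elem R a r \<otimes>\<^bsub>M\<^esub> monoid_elem R b s) x = monoid_elem R (a \<otimes>\<^bsub>G\<^esub> b) (r \<otimes>\<^bsub>R\<^esub> s) x"
    using assms by (simp add: monoid_elem_def)
qed

lemma ring_M: "ring M"
proof -
  interpret A: abelian_group M by (rule abelian_group_M)
  have zero_l: "\<zero>\<^bsub>M\<^esub> \<otimes>\<^bsub>M\<^esub> f = \<zero>\<^bsub>M\<^esub>" if "f \<in> carrier M" for f
    using l_distr_M[OF A.zero_closed A.zero_closed that] mult_closed[OF A.zero_closed that]
    by (metis A.add.l_cancel_one' A.l_zero A.zero_closed)
  have zero_r: "f \<otimes>\<^bsub>M\<^esub> \<zero>\<^bsub>M\<^esub> = \<zero>\<^bsub>M\<^esub>" if "f \<in> carrier M" for f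
    using r_distr_M[OF A.zero_closed A.zero_closed that] mult_closed[OF that A.zero_closed]
    by (metis A.add.l_cancel_one' A.l_zero A.zero_closed)
  have one: "\<one>\<^bsub>M\<^esub> \<in> carrier M" unfolding one_eq by auto
  \<comment> \<open>Associativity is extended from one-point elements to general ones one argument
    at a time, beginning with the last.\<close>
  have assoc1: "monoid_elem R a r \<otimes>\<^bsub>M\<^esub> monoid_elem R b s \<otimes>\<^bsub>M\<^esub> h = monoid_elem R a r \<otimes>\<^bsub>M\<^esub> (monoid_elem R b s \<otimes>\<^bsub>M\<^esub> h)"
    if "a \<in> carrier G" "b \<in> carrier G" "r \<in> carrier R" "s \<in> carrier R" "h \<in> carrier M" for a r b s h
    using that(5)
  proof (induction h rule: monoid_algebra_induct)
    case zero
    then show ?case using that by (simp add: zero_r mult_closed elem_closed)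
  next
    case (elem c t)
    then show ?case using that by (simp add: elem_mult G.m_assoc R.m_assoc)
  next
    case (add f g)
    then show ?case using that by (simp add: r_distr_M mult_closed elem_closed)
  qed
  have assoc2: "monoid_elem R a r \<otimes>\<^bsub>M\<^esub> g \<otimes>\<^bsub>M\<^esub> h = monoid_elem R a r \<otimes>\<^bsub>M\<^esub> (g \<otimes>\<^bsub>M\<^esub> h)"
    if "a \<in> carrier G" "r \<in> carrier R" "g \<in> carrier M" "h \<in> carrier M" for a r g h
    using that(3)
  proof (induction g rule: monoid_algebra_induct)
    case zero
    then show ?case using that by (simp add: zero_r zero_l mult_closed elem_closed)
  next
    case (elem c t)
    then show ?case using that by (simp add: assoc1)
  next
    case (add f g)
    then show ?case using that by (simp add: r_distr_M l_distr_M mult_closed elem_closed)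
  qed
  have assoc: "f \<otimes>\<^bsub>M\<^esub> g \<otimes>\<^bsub>M\<^esub> h = f \<otimes>\<^bsub>M\<^esub> (g \<otimes>\<^bsub>M\<^esub> h)"
    if "f \<in> carrier M" "g \<in> carrier M" "h \<in> carrier M" for f g h
    using that(1)
  proof (induction f rule: monoid_algebra_induct)
    case zero
    then show ?case using that by (simp add: zero_l mult_closed)
  next
    case (elem c t)
    then show ?case using that by (simp add: assoc2)
  next
    case (add f f')
    then show ?case using that by (simp add: l_distr_M mult_closed)
  qed
  have one_l: "\<one>\<^bsub>M\<^esub> \<otimes>\<^bsub>M\<^esub> f = f" and one_r: "f \<otimes>\<^bsub>M\<^esub> \<one>\<^bsub>M\<^esub> = f" if "f \<in> carrier M" for f
    using that
  proof (induction f rule: monoid_algebra_induct)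
    case zero case 1 show ?case by (rule zero_r[OF one]) next
    case zero case 2 show ?case by (rule zero_l[OF one]) next
    case (elem a r) case 1 then show ?case using elem by (simp add: one_eq elem_mult) next
    case (elem a r) case 2 then show ?case using elem by (simp add: one_eq elem_mult) next
    case (add f g) case 1 then show ?case using add by (simp add: r_distr_M one) next
    case (add f g) case 2 then show ?case using add by (simp add: l_distr_M one)
  qed
  show ?thesis
    by (intro ringI abelian_group_M monoidI mult_closed assoc one one_l one_r l_distr_M r_distr_M)
qed

lemma smult_elem: "a \<in> carrier G \<Longrightarrow> r \<in> carrier R \<Longrightarrow> s \<in> carrier R \<Longrightarrow>
    r \<odot>\<^bsub>M\<^esub> monoid_elem R a s = monoid_elem R a (r \<otimes>\<^bsub>R\<^esub> s)"
  by (auto simp: smult_eq monoid_elem_def)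

text \<open>Since scalars act as left multiplication by elements of the algebra, ideals are stable
  under them.\<close>

lemma smult_as_mult:
  assumes r: "r \<in> carrier R" and f: "f \<in> carrier M"
  shows "r \<odot>\<^bsub>M\<^esub> f = monoid_elem R \<one>\<^bsub>G\<^esub> r \<otimes>\<^bsub>M\<^esub> f"
proof -
  interpret M: ring M by (rule ring_M)
  have e: "monoid_elem R \<one>\<^bsub>G\<^esub> r \<in> carrier M" using r by auto
  show ?thesis
    using f
  proof (induction f rule: monoid_algebra_induct)
    case zero
    show ?case using M.r_null[OF e] r by (simp add: smult_eq zero_eq)
  next
    case (elem a s)
    then show ?case using r by (simp add: smult_elem elem_mult)
  next
    case (add f g)
    have "r \<odot>\<^bsub>M\<^esub> (f \<oplus>\<^bsub>M\<^esub> g) = r \<odot>\<^bsub>M\<^esub> f \<oplus>\<^bsub>M\<^esub> r \<odot>\<^bsub>M\<^esub> g"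
      using add(1,2) r by (auto simp: smult_eq add_eq carrier_iff R.r_distr)
    then show ?case using add by (simp add: M.r_distr[OF _ _ e])
  qed
qed

end

section \<open>Quotient algebras\<close>

lemma ring_record_cong:
  assumes A: "ring A"
    and eq: "carrier B = carrier A" "mult B = mult A" "one B = one A" "ring.zero B = ring.zero A" "add B = add A"
  shows "ring B"
proof -
  interpret ring A by (rule A)
  have "\<exists>y\<in>carrier A. y \<oplus>\<^bsub>A\<^esub> x = \<zero>\<^bsub>A\<^esub>" if "x \<in> carrier A" for x
    using that l_neg a_inv_closed by blast
  then show ?thesis
    by (intro ringI abelian_groupI monoidI) (auto simp: eq m_assoc l_distr r_distr a_ac)
qed

lemma quot_algebra_simps:
  "carrier (quot_algebra A I) = carrier (A Quot I)" "mult (quot_algebra A I) = mult (A Quot I)"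
  "one (quot_algebra A I) = one (A Quot I)" "ring.zero (quot_algebra A I) = ring.zero (A Quot I)"
  "add (quot_algebra A I) = add (A Quot I)"
  by (simp_all add: quot_algebra_def)

text \<open>\<open>quot_algebra A I\<close> and \<open>A Quot I\<close> are records of different
  types with the same ring operations, so the axioms are carried over.\<close>

lemma ring_quot_algebra: "ideal I A \<Longrightarrow> ring (quot_algebra A I)"
  by (rule ring_record_cong[OF ideal.quotient_is_ring]) (auto simp: quot_algebra_simps)

lemma rcos_hom_quot_algebra:
  "ideal I A \<Longrightarrow> (\<lambda>x. I +>\<^bsub>A\<^esub> x) \<in> Ring.ring_hom A (quot_algebra A I)"
  using ideal.rcos_ring_hom[of I A] by (simp add: Ring.ring_hom_def quot_algebra_simps)

lemma quot_algebra_carrierE: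
  assumes "Y \<in> carrier (quot_algebra A I)"
  obtains x where "x \<in> carrier A" "Y = I +>\<^bsub>A\<^esub> x"
  using assms by (auto simp: quot_algebra_simps FactRing_simps)

lemma quot_algebra_rcos_closed: "x \<in> carrier A \<Longrightarrow> I +>\<^bsub>A\<^esub> x \<in> carrier (quot_algebra A I)"
  by (auto simp: quot_algebra_simps FactRing_simps)

lemma (in ideal) rcos_eq_iff:
  assumes "x \<in> carrier R" "y \<in> carrier R"
  shows "I +> x = I +> y \<longleftrightarrow> x \<ominus> y \<in> I"
  using quotient_eq_iff_same_a_r_cos[OF ideal_axioms] assms by simp

text \<open>The union over representatives is constant because multiplication by \<open>r\<close> is
  additive and maps \<open>I\<close> into itself.\<close>

lemma smult_quot_algebra:
  fixes A :: "('r, 'a, 'm) module_scheme"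
  assumes "ideal I A"
    and closed: "\<And>x. x \<in> carrier A \<Longrightarrow> r \<odot>\<^bsub>A\<^esub> x \<in> carrier A"
    and add: "\<And>x y. x \<in> carrier A \<Longrightarrow> y \<in> carrier A \<Longrightarrow> r \<odot>\<^bsub>A\<^esub> (x \<oplus>\<^bsub>A\<^esub> y) = r \<odot>\<^bsub>A\<^esub> x \<oplus>\<^bsub>A\<^esub> r \<odot>\<^bsub>A\<^esub> y"
    and I: "\<And>x. x \<in> I \<Longrightarrow> r \<odot>\<^bsub>A\<^esub> x \<in> I" and x: "x \<in> carrier A"
  shows "r \<odot>\<^bsub>quot_algebra A I\<^esub> (I +>\<^bsub>A\<^esub> x) = I +>\<^bsub>A\<^esub> (r \<odot>\<^bsub>A\<^esub> x)"
proof -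
  interpret ideal I A by fact
  have "I +>\<^bsub>A\<^esub> (r \<odot>\<^bsub>A\<^esub> y) = I +>\<^bsub>A\<^esub> (r \<odot>\<^bsub>A\<^esub> x)" if y: "y \<in> I +>\<^bsub>A\<^esub> x" for y
  proof -
    from y obtain i where i: "i \<in> I" "y = i \<oplus>\<^bsub>A\<^esub> x" by (auto simp: a_r_coset_def')
    then have "r \<odot>\<^bsub>A\<^esub> y = r \<odot>\<^bsub>A\<^esub> i \<oplus>\<^bsub>A\<^esub> r \<odot>\<^bsub>A\<^esub> x" using add x Icarr by simp
    moreover have "r \<odot>\<^bsub>A\<^esub> i \<in> I" using I i by simp
    ultimately have "r \<odot>\<^bsub>A\<^esub> y \<in> I +>\<^bsub>A\<^esub> (r \<odot>\<^bsub>A\<^esub> x)" by (auto simp: a_r_coset_def')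
    from a_repr_independence[OF this closed[OF x]] show ?thesis
      using a_subgroup by simp
  qed
  moreover have "x \<in> I +>\<^bsub>A\<^esub> x" by (rule a_rcos_self[OF x])
  ultimately have "(\<Union>y\<in>I +>\<^bsub>A\<^esub> x. I +>\<^bsub>A\<^esub> (r \<odot>\<^bsub>A\<^esub> y)) = I +>\<^bsub>A\<^esub> (r \<odot>\<^bsub>A\<^esub> x)" by blast
  then show ?thesis by (simp add: quot_algebra_def)
qed

subsection \<open>The Hecke algebra as a ring\<close>

lemma laurent_ring_simps:
  "carrier (laurent_ring I) = {p. \<forall>m \<in> Poly_Mapping.keys p. Poly_Mapping.keys m \<subseteq> I}"
  "mult (laurent_ring I) = (*)" "one (laurent_ring I) = 1" "ring.zero (laurent_ring I) = 0"
  "add (laurent_ring I) = (+)"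
  by (simp_all add: laurent_ring_def)

text \<open>Evaluation (with all \<open>z i = 1\<close>) embeds the Laurent ring into the entire
  functions, where there are no zero divisors.\<close>

lemma laurent_ring_domain:
  fixes I :: "'i set"
  assumes I: "finite I"
  shows "domain (laurent_ring I)"
proof -
  have mult_cl: "p * q \<in> carrier (laurent_ring I)"
    if p: "p \<in> carrier (laurent_ring I)" and q: "q \<in> carrier (laurent_ring I)" for p q :: "'i laurent"
  proof -
    have "Poly_Mapping.keys m \<subseteq> I" if "m \<in> Poly_Mapping.keys (p * q)" for m
    proof -
      have "m \<in> {a + b |a b. a \<in> Poly_Mapping.keys p \<and> b \<in> Poly_Mapping.keys q}"
        using that Poly_Mapping.keys_mult[of p q] by (rule rev_subsetD)
      then obtain a b where
        ab: "m = a + b" "a \<in> Poly_Mapping.keys p" "b \<in> Poly_Mapping.keys q" by auto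
      have "Poly_Mapping.keys a \<subseteq> I" "Poly_Mapping.keys b \<subseteq> I"
        using p q ab by (auto simp: laurent_ring_simps)
      then show ?thesis unfolding ab(1) using Poly_Mapping.keys_add[of a b] by (meson Un_least order_trans)
    qed
    then show ?thesis by (simp add: laurent_ring_simps)
  qed
  have cring: "cring (laurent_ring I)"
  proof (rule cringI)
    show "abelian_group (laurent_ring I)"
    proof (rule abelian_groupI)
      fix p :: "'i laurent" assume "p \<in> carrier (laurent_ring I)"
      then show "\<exists>q\<in>carrier (laurent_ring I). q \<oplus>\<^bsub>laurent_ring I\<^esub> p = \<zero>\<^bsub>laurent_ring I\<^esub>"
        by (intro bexI[of _ "- p"]) (auto simp: laurent_ring_simps)
    next
      fix p q :: "'i laurent" assume "p \<in> carrier (laurent_ring I)" "q \<in> carrier (laurent_ring I)"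
      then show "p \<oplus>\<^bsub>laurent_ring I\<^esub> q \<in> carrier (laurent_ring I)"
        using Poly_Mapping.keys_add[of p q] by (auto simp: laurent_ring_simps)
    qed (simp_all add: laurent_ring_simps add_ac)
    show "Group.comm_monoid (laurent_ring I)"
    proof (rule comm_monoidI)
      show "p \<otimes>\<^bsub>laurent_ring I\<^esub> q \<in> carrier (laurent_ring I)"
        if "p \<in> carrier (laurent_ring I)" "q \<in> carrier (laurent_ring I)" for p q
        unfolding laurent_ring_simps(2) by (rule mult_cl[OF that])
    qed (simp_all add: laurent_ring_simps mult_ac)
  qed (simp add: laurent_ring_simps distrib_right)
  have "p = 0 \<or> q = 0" if p: "p \<in> carrier (laurent_ring I)" and q: "q \<in> carrier (laurent_ring I)"
    and pq: "p * q = 0" for p q :: "'i laurent"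
  proof (rule ccontr)
    assume "\<not> (p = 0 \<or> q = 0)"
    let ?e = "\<lambda>p k. laurent_eval (u_eval (\<lambda>_. 1) k) p"
    have "\<exists>k. ?e p k \<noteq> 0"
    proof (rule ccontr)
      assume "\<nexists>k. ?e p k \<noteq> 0"
      then have "p = 0" by (intro laurent_eval_injective[of "\<lambda>_. 1" p]) simp_all
      with \<open>\<not> (p = 0 \<or> q = 0)\<close> show False by simp
    qed
    then obtain k where k: "?e p k \<noteq> 0" by (elim exE)
    have "?e q k' = 0" for k'
    proof (rule entire_mult_eq_0[of I "?e p" "?e q" k])
      show "entire_on_coords I (?e p)" "entire_on_coords I (?e q)"
        by (rule entire_trig[OF laurent_eval_trig[OF I p] I], rule entire_trig[OF laurent_eval_trig[OF I q] I])
      show "?e p k * ?e q k = 0" for k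
        by (subst laurent_eval_mult[symmetric]) (simp_all add: pq u_eval_nonzero)
    qed (use I k in simp_all)
    then have "q = 0" by (intro laurent_eval_injective[of "\<lambda>_. 1" q]) simp_all
    with \<open>\<not> (p = 0 \<or> q = 0)\<close> show False by simp
  qed
  then show ?thesis
    by (intro domain.intro cring domain_axioms.intro) (auto simp: laurent_ring_simps(2-4))
qed

text \<open>\<open>G\<close> is an arbitrary record, so the braid group can be inserted as it is. In
  a domain a non-zero scalar preserves the support, over which the product is summed.\<close>

lemma (in domain) monoid_algebra_smult_mult:
  assumes r: "r \<in> carrier R" and f: "f \<in> carrier (monoid_algebra R G)" and g: "g \<in> carrier (monoid_algebra R G)"
  shows "(r \<odot>\<^bsub>monoid_algebra R G\<^esub> f) \<otimes>\<^bsub>monoid_algebra R G\<^esub> g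
    = r \<odot>\<^bsub>monoid_algebra R G\<^esub> (f \<otimes>\<^bsub>monoid_algebra R G\<^esub> g)"
proof (cases "r = \<zero>")
  case True
  then show ?thesis using f g r by (auto simp: monoid_algebra_def intro!: finsum_closed)
next
  case False
  have c: "f x \<in> carrier R" "g x \<in> carrier R" for x using f g by (auto simp: monoid_algebra_def)
  have fin: "finite {x. f x \<noteq> \<zero>}" "finite {x. g x \<noteq> \<zero>}" using f g by (auto simp: monoid_algebra_def)
  have iff: "r \<otimes> f x \<noteq> \<zero> \<longleftrightarrow> f x \<noteq> \<zero>" for x using r c False by (simp add: integral_iff)
  have "finite {(y, z). f y \<noteq> \<zero> \<and> g z \<noteq> \<zero> \<and> y \<otimes>\<^bsub>G\<^esub> z = x}" for x
    by (rule finite_subset[OF _ finite_cartesian_product[OF fin]]) auto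
  then show ?thesis
    by (auto simp: monoid_algebra_def iff fun_eq_iff finsum_rdistr r c m_assoc intro!: finsum_cong')
qed

text \<open>\<open>genideal\<close> is the intersection of all ideals containing the generators. If
  there is such an ideal, its existence already says that the group algebra is a ring, and the
  quotient construction applies. Otherwise the quotient degenerates to a single element. Either way
  the ring axioms follow without a verification of the group axioms for the braid group.\<close>

lemma hecke_algebra_ring:
  fixes l :: "(complex ^ 'n) set \<Rightarrow> 'n braid"
  assumes fin: "finite (param_index W)"
  shows "ring (hecke_algebra W v0 l) \<and>
    (\<forall>r\<in>carrier (ring_R W). \<forall>x\<in>carrier (hecke_algebra W v0 l).
       r \<odot>\<^bsub>hecke_algebra W v0 l\<^esub> x \<in> carrier (hecke_algebra W v0 l))"
proof -
  interpret R: domain "ring_R W" unfolding ring_R_def by (rule laurent_ring_domain[OF fin])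
  define A where "A = monoid_algebra (ring_R W) (braid_group W v0)"
  define S where "S = hecke_element W v0 l ` hyperplanes W"
  define J where "J = genideal A S"
  have H: "hecke_algebra W v0 l = quot_algebra A J"
    by (simp add: hecke_algebra_def A_def S_def J_def Let_def)
  have sm: "r \<odot>\<^bsub>A\<^esub> f = (\<lambda>x. r \<otimes>\<^bsub>ring_R W\<^esub> f x)" for r f by (simp add: A_def monoid_algebra_def)
  have sm_closed: "r \<odot>\<^bsub>A\<^esub> f \<in> carrier A" if "r \<in> carrier (ring_R W)" "f \<in> carrier A" for r f
    using that unfolding sm by (auto simp: A_def monoid_algebra_def elim!: rev_finite_subset)
  have sm_add: "r \<odot>\<^bsub>A\<^esub> (f \<oplus>\<^bsub>A\<^esub> g) = r \<odot>\<^bsub>A\<^esub> f \<oplus>\<^bsub>A\<^esub> r \<odot>\<^bsub>A\<^esub> g"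
    if "r \<in> carrier (ring_R W)" "f \<in> carrier A" "g \<in> carrier A" for r f g
    using that by (auto simp: A_def monoid_algebra_def R.r_distr)
  show ?thesis
  proof (cases "\<exists>I. ideal I A \<and> S \<subseteq> I")
    case True
    then obtain I where I: "ideal I A" "S \<subseteq> I" by blast
    interpret I: ideal I A by fact
    have "S \<subseteq> carrier A" using I(2) I.a_subset by blast
    then have J: "ideal J A" unfolding J_def by (rule I.genideal_ideal)
    interpret J: ideal J A by fact
    have "r \<odot>\<^bsub>A\<^esub> x \<in> J" if r: "r \<in> carrier (ring_R W)" and x: "x \<in> J" for r x
    proof -
      \<comment> \<open>Multiplication by \<open>r\<close> is multiplication by the algebra element
        \<open>r\<close> times the unit, so it preserves the ideal \<open>J\<close>.\<close>
      have "(r \<odot>\<^bsub>A\<^esub> \<one>\<^bsub>A\<^esub>) \<otimes>\<^bsub>A\<^esub> x = r \<odot>\<^bsub>A\<^esub> (\<one>\<^bsub>A\<^esub> \<otimes>\<^bsub>A\<^esub> x)"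
        using R.monoid_algebra_smult_mult[OF r, of "\<one>\<^bsub>A\<^esub>" "braid_group W v0" x] I.one_closed J.Icarr[OF x]
        by (simp add: A_def)
      then have "r \<odot>\<^bsub>A\<^esub> x = (r \<odot>\<^bsub>A\<^esub> \<one>\<^bsub>A\<^esub>) \<otimes>\<^bsub>A\<^esub> x" using J.Icarr[OF x] by simp
      then show ?thesis using J.I_l_closed[OF x sm_closed[OF r I.one_closed]] by simp
    qed
    then have "r \<odot>\<^bsub>quot_algebra A J\<^esub> Y \<in> carrier (quot_algebra A J)"
      if "r \<in> carrier (ring_R W)" "Y \<in> carrier (quot_algebra A J)" for r Y
      using that by (elim quot_algebra_carrierE)
        (simp add: smult_quot_algebra[OF J] sm_closed sm_add quot_algebra_rcos_closed)
    then show ?thesis unfolding H using ring_quot_algebra[OF J] by blast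
  next
    case False
    \<comment> \<open>The intersection of the empty family. The only coset is then
      \<open>UNIV\<close>, and the quotient is the zero ring.\<close>
    then have J: "J = UNIV" by (auto simp: J_def genideal_def)
    have add: "(f \<oplus>\<^bsub>A\<^esub> g) = (\<lambda>x. f x + g x)" for f g
      by (simp add: A_def monoid_algebra_def ring_R_def laurent_ring_simps)
    have U: "UNIV +>\<^bsub>A\<^esub> f = UNIV" for f
    proof -
      have "g = (\<lambda>x. g x - f x) \<oplus>\<^bsub>A\<^esub> f" for g by (simp add: add)
      then show ?thesis unfolding a_r_coset_def' by blast
    qed
    have ne: "(\<lambda>_. 0) \<in> carrier A"
      by (simp add: A_def monoid_algebra_def ring_R_def laurent_ring_simps)
    have carr: "carrier (quot_algebra A J) = {UNIV}"
      unfolding J quot_algebra_simps FactRing_simps using U ne by auto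
    have ops: "UNIV \<otimes>\<^bsub>quot_algebra A J\<^esub> UNIV = UNIV" "UNIV \<oplus>\<^bsub>quot_algebra A J\<^esub> UNIV = UNIV"
      "\<one>\<^bsub>quot_algebra A J\<^esub> = UNIV" "\<zero>\<^bsub>quot_algebra A J\<^esub> = UNIV"
      "r \<odot>\<^bsub>quot_algebra A J\<^esub> UNIV = UNIV" for r
    proof -
      have "g = (\<lambda>x. g x - g x) \<oplus>\<^bsub>A\<^esub> g" for g by (simp add: add)
      then show "UNIV \<oplus>\<^bsub>quot_algebra A J\<^esub> UNIV = UNIV"
        by (auto simp: quot_algebra_simps FactRing_def set_add_def')
    qed (simp_all add: J quot_algebra_def FactRing_def rcoset_mult_def U)
    have "ring (quot_algebra A J)"
      by (intro ringI abelian_groupI monoidI) (auto simp: carr ops)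
    then show ?thesis unfolding H by (auto simp: carr ops)
  qed
qed

section \<open>The field of meromorphic functions\<close>

lemma entire_ring_simps:
  "carrier (entire_ring I) = {f. entire_on_coords I f}" "f \<otimes>\<^bsub>entire_ring I\<^esub> g = (\<lambda>k. f k * g k)"
  "\<one>\<^bsub>entire_ring I\<^esub> = (\<lambda>k. 1)" "\<zero>\<^bsub>entire_ring I\<^esub> = (\<lambda>k. 0)"
  "f \<oplus>\<^bsub>entire_ring I\<^esub> g = (\<lambda>k. f k + g k)"
  by (simp_all add: entire_ring_def)

lemma entire_ring_domain:
  assumes I: "finite I"
  shows "domain (entire_ring I)"
proof -
  have "cring (entire_ring I)"
  proof (rule cringI)
    show "abelian_group (entire_ring I)"
    proof (rule abelian_groupI)
      fix f assume "f \<in> carrier (entire_ring I)"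
      then show "\<exists>g\<in>carrier (entire_ring I). g \<oplus>\<^bsub>entire_ring I\<^esub> f = \<zero>\<^bsub>entire_ring I\<^esub>"
        by (intro bexI[of _ "\<lambda>k. - f k"]) (auto simp: entire_ring_simps entire_minus[OF I])
    qed (auto simp: entire_ring_simps entire_add[OF I] entire_const add_ac)
    show "Group.comm_monoid (entire_ring I)"
      by (rule comm_monoidI) (auto simp: entire_ring_simps entire_mult[OF I] entire_const mult_ac)
  qed (auto simp: entire_ring_simps distrib_right)
  moreover have "f = (\<lambda>k. 0) \<or> g = (\<lambda>k. 0)"
    if f: "entire_on_coords I f" and g: "entire_on_coords I g" and fg: "(\<lambda>k. f k * g k) = (\<lambda>k. 0)" for f g
  proof (rule disjCI, rule ext)
    fix k
    assume "g \<noteq> (\<lambda>k. 0)"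
    then obtain a where "g a \<noteq> 0" by (auto simp: fun_eq_iff)
    show "f k = 0"
      using entire_mult_eq_0[OF I g f _ \<open>g a \<noteq> 0\<close>] fun_cong[OF fg] by (simp add: mult.commute)
  qed
  ultimately show ?thesis
    by (intro domain.intro domain_axioms.intro) (auto simp: entire_ring_simps fun_eq_iff)
qed

definition shift :: "('i \<Rightarrow> complex) \<Rightarrow> (('i \<Rightarrow> complex) \<Rightarrow> complex) \<Rightarrow> ('i \<Rightarrow> complex) \<Rightarrow> complex" where
  "shift w f = (\<lambda>k. f (\<lambda>i. k i + w i))"

text \<open>An element of the fraction field is the set of its representations, so a translation
  acts by taking images of sets.\<close>

definition translate :: "('i \<Rightarrow> complex) \<Rightarrow> 'i fun_quot \<Rightarrow> 'i fun_quot" where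
  "translate w x = (\<lambda>(f, g). (shift w f, shift w g)) ` x"

lemma shift_shift: "shift w (shift v f) = shift (\<lambda>i. w i + v i) f"
  by (simp add: shift_def add.assoc)

lemma shift_0 [simp]: "shift (\<lambda>i. 0) f = f"
  by (simp add: shift_def)

locale entire_field =
  fixes I :: "'i set"
  assumes finite_I: "finite I"
begin

abbreviation "S \<equiv> entire_ring I"
abbreviation "K \<equiv> Frac S"

sublocale S: domain S by (rule entire_ring_domain[OF finite_I])
sublocale K: Ring.field K by (rule S.Frac_is_field)

lemma S_carrier: "f \<in> carrier S \<longleftrightarrow> entire_on_coords I f" by (simp add: entire_ring_simps)

lemma S_nonzero: "g \<in> carrier S \<Longrightarrow> g k \<noteq> 0 \<Longrightarrow> g \<in> carrier S - {\<zero>\<^bsub>S\<^esub>}"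
  by (auto simp: entire_ring_simps)

lemma S_nonzeroE:
  assumes "g \<in> carrier S - {\<zero>\<^bsub>S\<^esub>}"
  obtains k where "g k \<noteq> 0"
  using assms by (auto simp: entire_ring_simps fun_eq_iff)

subsection \<open>Evaluation at generic points\<close>

text \<open>Membership in the local ring at \<open>k\<close>: some representation has a denominator
  that does not vanish at \<open>k\<close>, although others may vanish there. \<open>ev\<close> is
  the residue map of this ring.\<close>

definition regular :: "('i \<Rightarrow> complex) \<Rightarrow> 'i fun_quot \<Rightarrow> bool" where
  "regular k x \<longleftrightarrow> (\<exists>f g. f \<in> carrier S \<and> g \<in> carrier S \<and> g k \<noteq> 0 \<and> x = fraction S f g)"

definition ev :: "('i \<Rightarrow> complex) \<Rightarrow> 'i fun_quot \<Rightarrow> complex" where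
  "ev k x = (THE c. \<exists>f g. f \<in> carrier S \<and> g \<in> carrier S \<and> g k \<noteq> 0 \<and> x = fraction S f g \<and> c = f k / g k)"

lemma regularI: "f \<in> carrier S \<Longrightarrow> g \<in> carrier S \<Longrightarrow> g k \<noteq> 0 \<Longrightarrow> regular k (fraction S f g)"
  unfolding regular_def by blast

lemma fraction_eq_iff_fun:
  assumes "f \<in> carrier S" "g \<in> carrier S - {\<zero>\<^bsub>S\<^esub>}" "f' \<in> carrier S" "g' \<in> carrier S - {\<zero>\<^bsub>S\<^esub>}"
  shows "fraction S f g = fraction S f' g' \<longleftrightarrow> (\<forall>k. f k * g' k = f' k * g k)"
  using S.fraction_eq_iff[OF assms] by (simp add: entire_ring_simps fun_eq_iff)

lemma ev_fraction:
  assumes "f \<in> carrier S" "g \<in> carrier S" "g k \<noteq> 0"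
  shows "ev k (fraction S f g) = f k / g k"
  unfolding ev_def
proof (rule the_equality)
  fix c assume "\<exists>f' g'. f' \<in> carrier S \<and> g' \<in> carrier S \<and> g' k \<noteq> 0 \<and> fraction S f g = fraction S f' g' \<and> c = f' k / g' k"
  then obtain f' g' where *: "f' \<in> carrier S" "g' \<in> carrier S" "g' k \<noteq> 0" "fraction S f g = fraction S f' g'" "c = f' k / g' k"
    by blast
  then have "f k * g' k = f' k * g k"
    using fraction_eq_iff_fun[OF assms(1) S_nonzero[OF assms(2,3)] *(1) S_nonzero[OF *(2,3)]] by simp
  then show "c = f k / g k" using *(3,5) assms(3) by (simp add: frac_eq_eq)
qed (use assms in blast)

text \<open>A given representation may have \<open>g k = 0\<close> although the element is regular
  at \<open>k\<close>, and then \<open>f k = 0\<close> too. The formula thus holds for the one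
  representation of the trace that is fixed for all \<open>k\<close>.\<close>

lemma ev_numerator:
  assumes "f \<in> carrier S" "g \<in> carrier S - {\<zero>\<^bsub>S\<^esub>}" "regular k (fraction S f g)"
  shows "f k = g k * ev k (fraction S f g)"
proof -
  obtain f' g' where *: "f' \<in> carrier S" "g' \<in> carrier S" "g' k \<noteq> 0" "fraction S f g = fraction S f' g'"
    using assms(3) unfolding regular_def by blast
  then have "f k * g' k = f' k * g k"
    using fraction_eq_iff_fun[OF assms(1,2) *(1) S_nonzero[OF *(2,3)]] by simp
  moreover have "ev k (fraction S f g) = f' k / g' k" unfolding *(4) by (rule ev_fraction[OF *(1-3)])
  ultimately have "f k * g' k = (g k * ev k (fraction S f g)) * g' k" using *(3) by simp
  then show ?thesis using *(3) by simp
qed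

lemma regular_to_Frac: "f \<in> carrier S \<Longrightarrow> regular k (to_Frac S f)"
  and ev_to_Frac: "f \<in> carrier S \<Longrightarrow> ev k (to_Frac S f) = f k"
proof -
  assume f: "f \<in> carrier S"
  have one: "\<one>\<^bsub>S\<^esub> k = 1" by (simp add: entire_ring_simps)
  then have "\<one>\<^bsub>S\<^esub> k \<noteq> 0" by simp
  from regularI[OF f S.one_closed this] ev_fraction[OF f S.one_closed this]
  show "regular k (to_Frac S f)" "ev k (to_Frac S f) = f k" by (simp_all add: to_Frac_def one)
qed

lemma regular_mult: "regular k x \<Longrightarrow> regular k y \<Longrightarrow> regular k (x \<otimes>\<^bsub>K\<^esub> y)"
  and ev_mult: "regular k x \<Longrightarrow> regular k y \<Longrightarrow> ev k (x \<otimes>\<^bsub>K\<^esub> y) = ev k x * ev k y"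
  and regular_add: "regular k x \<Longrightarrow> regular k y \<Longrightarrow> regular k (x \<oplus>\<^bsub>K\<^esub> y)"
  and ev_add: "regular k x \<Longrightarrow> regular k y \<Longrightarrow> ev k (x \<oplus>\<^bsub>K\<^esub> y) = ev k x + ev k y"
proof -
  assume "regular k x" "regular k y"
  then obtain f g f' g' where *: "f \<in> carrier S" "g \<in> carrier S" "g k \<noteq> 0" "x = fraction S f g"
    "f' \<in> carrier S" "g' \<in> carrier S" "g' k \<noteq> 0" "y = fraction S f' g'" unfolding regular_def by blast
  note nz = S_nonzero[OF *(2,3)] S_nonzero[OF *(6,7)]
  have m: "x \<otimes>\<^bsub>K\<^esub> y = fraction S (f \<otimes>\<^bsub>S\<^esub> f') (g \<otimes>\<^bsub>S\<^esub> g')"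
    and a: "x \<oplus>\<^bsub>K\<^esub> y = fraction S ((f \<otimes>\<^bsub>S\<^esub> g') \<oplus>\<^bsub>S\<^esub> (f' \<otimes>\<^bsub>S\<^esub> g)) (g \<otimes>\<^bsub>S\<^esub> g')"
    unfolding *(4,8) using * nz by (simp_all add: S.Frac_mult S.Frac_add)
  have c: "f \<otimes>\<^bsub>S\<^esub> f' \<in> carrier S" "(f \<otimes>\<^bsub>S\<^esub> g') \<oplus>\<^bsub>S\<^esub> (f' \<otimes>\<^bsub>S\<^esub> g) \<in> carrier S" "g \<otimes>\<^bsub>S\<^esub> g' \<in> carrier S"
    using * by simp_all
  have g: "(g \<otimes>\<^bsub>S\<^esub> g') k \<noteq> 0" using * by (simp add: entire_ring_simps)
  show "regular k (x \<otimes>\<^bsub>K\<^esub> y)" "regular k (x \<oplus>\<^bsub>K\<^esub> y)"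
    unfolding m a by (intro regularI c g)+
  show "ev k (x \<otimes>\<^bsub>K\<^esub> y) = ev k x * ev k y" "ev k (x \<oplus>\<^bsub>K\<^esub> y) = ev k x + ev k y"
    unfolding m a ev_fraction[OF c(1,3) g] ev_fraction[OF c(2,3) g]
    unfolding *(4,8) ev_fraction[OF *(1-3)] ev_fraction[OF *(5-7)]
    using *(3,7) by (simp_all add: entire_ring_simps(2,5) add_frac_eq)
qed

lemma regular_carrier: "regular k x \<Longrightarrow> x \<in> carrier K"
  unfolding regular_def using S.fraction_closed S_nonzero by metis

lemma Frac_zero_to_Frac: "\<zero>\<^bsub>K\<^esub> = to_Frac S \<zero>\<^bsub>S\<^esub>" and Frac_one_to_Frac: "\<one>\<^bsub>K\<^esub> = to_Frac S \<one>\<^bsub>S\<^esub>"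
  unfolding to_Frac_def by (rule S.Frac_zero, rule S.Frac_one)

lemma regular_zero: "regular k \<zero>\<^bsub>K\<^esub>"
  by (subst Frac_zero_to_Frac) (rule regular_to_Frac[OF S.zero_closed])

lemma ev_zero: "ev k \<zero>\<^bsub>K\<^esub> = 0"
proof -
  have "ev k \<zero>\<^bsub>K\<^esub> = ev k (to_Frac S \<zero>\<^bsub>S\<^esub>)" by (rule arg_cong[OF Frac_zero_to_Frac])
  also have "\<dots> = \<zero>\<^bsub>S\<^esub> k" by (rule ev_to_Frac[OF S.zero_closed])
  finally show ?thesis by (simp only: entire_ring_simps(4))
qed

lemma ev_one: "ev k \<one>\<^bsub>K\<^esub> = 1"
proof -
  have "ev k \<one>\<^bsub>K\<^esub> = ev k (to_Frac S \<one>\<^bsub>S\<^esub>)" by (rule arg_cong[OF Frac_one_to_Frac])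
  also have "\<dots> = \<one>\<^bsub>S\<^esub> k" by (rule ev_to_Frac[OF S.one_closed])
  finally show ?thesis by (simp only: entire_ring_simps(3))
qed

lemma ev_finsum:
  assumes "finite A" "\<And>a. a \<in> A \<Longrightarrow> regular k (h a)"
  shows "regular k (finsum K h A) \<and> ev k (finsum K h A) = (\<Sum>a\<in>A. ev k (h a))"
  using assms
proof (induction A rule: finite_induct)
  case empty
  then show ?case by (simp add: regular_zero ev_zero)
next
  case (insert a A)
  then have "h a \<in> carrier K" "h \<in> A \<rightarrow> carrier K" using regular_carrier by auto
  then have "finsum K h (insert a A) = h a \<oplus>\<^bsub>K\<^esub> finsum K h A"
    using insert.hyps by (intro K.finsum_insert)
  then show ?case using insert by (simp add: regular_add ev_add)
qed

text \<open>\<open>G\<close> is a product of denominators, one for each element; it is not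
  identically zero because there are no zero divisors.\<close>

lemma generic_regular:
  assumes "finite Y" "Y \<subseteq> carrier K"
  shows "\<exists>G a. entire_on_coords I G \<and> G a \<noteq> 0 \<and> (\<forall>k. G k \<noteq> 0 \<longrightarrow> (\<forall>x\<in>Y. regular k x))"
  using assms
proof (induction Y rule: finite_induct)
  case empty
  show ?case by (intro exI[of _ "\<lambda>k. 1"]) (simp add: entire_const)
next
  case (insert x Y)
  then obtain G a where G: "entire_on_coords I G" "G a \<noteq> 0" "\<And>k. G k \<noteq> 0 \<Longrightarrow> \<forall>x\<in>Y. regular k x"
    by auto
  have "x \<in> carrier K" using insert.prems by simp
  then obtain f g where fg: "f \<in> carrier S" "g \<in> carrier S - {\<zero>\<^bsub>S\<^esub>}" "x = fraction S f g"
    by (rule S.Frac_carrierE)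
  have g: "entire_on_coords I g" "g \<in> carrier S" using fg(2) by (simp_all add: S_carrier)
  obtain b where b: "g b \<noteq> 0" using S_nonzeroE[OF fg(2)] .
  have "\<exists>a. G a * g a \<noteq> 0"
  proof (rule ccontr)
    assume "\<nexists>a. G a * g a \<noteq> 0"
    then have "G k * g k = 0" for k by simp
    from entire_mult_eq_0[OF finite_I G(1) g(1) this G(2), of b] b show False by simp
  qed
  then obtain a' where "G a' * g a' \<noteq> 0" ..
  moreover have "\<forall>y\<in>insert x Y. regular k y" if "G k * g k \<noteq> 0" for k
    using that G(3)[of k] regularI[OF fg(1) g(2), of k] fg(3) by simp
  ultimately show ?case
    by (intro exI[of _ "\<lambda>k. G k * g k"] exI[of _ a'] conjI entire_mult finite_I G(1) g(1)) simp_all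
qed

lemma laurent_eval_carrier:
  "p \<in> carrier (laurent_ring I) \<Longrightarrow> (\<lambda>k. laurent_eval (u_eval z k) p) \<in> carrier S"
  unfolding S_carrier by (rule entire_trig[OF laurent_eval_trig[OF finite_I] finite_I])

text \<open>At a point where all matrix entries are regular, evaluation turns the identities over
  \<open>K\<close> into complex ones, and \<open>trace_eq_sum_spec\<close> produces the list of
  eigenvalues that \<open>eigenvalue_sum_trig\<close> asks for.\<close>

theorem trace_trig:
  fixes A :: "nat \<times> nat \<Rightarrow> 'i fun_quot" and B :: "nat \<Rightarrow> nat \<times> nat \<Rightarrow> 'i fun_quot"
    and c :: "nat \<Rightarrow> nat \<Rightarrow> 'i laurent" and e :: "nat \<Rightarrow> 'i laurent"
    and z :: "'i \<Rightarrow> complex" and d n N :: nat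
  defines "\<theta> \<equiv> \<lambda>p. to_Frac S (\<lambda>k. laurent_eval (u_eval z k) p)"
  assumes z: "\<And>i. z i \<noteq> 0"
    and A: "\<And>a b. a < d \<Longrightarrow> b < d \<Longrightarrow> A (a, b) \<in> carrier K"
    and B: "\<And>j a b. j < n \<Longrightarrow> a < d \<Longrightarrow> b < d \<Longrightarrow> B j (a, b) \<in> carrier K"
    and c: "\<And>i j. i < n \<Longrightarrow> j < n \<Longrightarrow> c i j \<in> carrier (laurent_ring I)"
    and e: "\<And>j. j < n \<Longrightarrow> e j \<in> carrier (laurent_ring I)"
    and AB: "\<And>j a b. j < n \<Longrightarrow> a < d \<Longrightarrow> b < d \<Longrightarrow>
      (\<Oplus>\<^bsub>K\<^esub>m\<in>{..<d}. A (a, m) \<otimes>\<^bsub>K\<^esub> B j (m, b)) = (\<Oplus>\<^bsub>K\<^esub>i\<in>{..<n}. \<theta> (c i j) \<otimes>\<^bsub>K\<^esub> B i (a, b))"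
    and unit: "\<And>a b. a < d \<Longrightarrow> b < d \<Longrightarrow>
      (\<Oplus>\<^bsub>K\<^esub>j\<in>{..<n}. \<theta> (e j) \<otimes>\<^bsub>K\<^esub> B j (a, b)) = (if a = b then \<one>\<^bsub>K\<^esub> else \<zero>\<^bsub>K\<^esub>)"
    and N: "N > 0" "\<And>p. 0 < p \<Longrightarrow> p \<le> n ^ d \<Longrightarrow> p dvd N"
  shows "\<exists>P\<in>trig N I. (\<Oplus>\<^bsub>K\<^esub>a\<in>{..<d}. A (a, a)) = to_Frac S P"
proof -
  let ?D = "{..<d} \<times> {..<d}"
  define Y where "Y = A ` ?D \<union> (\<Union>j<n. B j ` ?D)"
  have "finite Y" "Y \<subseteq> carrier K" using A B by (auto simp: Y_def)
  from generic_regular[OF this]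
  obtain G b0 where G: "entire_on_coords I G" "G b0 \<noteq> 0" "\<And>k x. G k \<noteq> 0 \<Longrightarrow> x \<in> Y \<Longrightarrow> regular k x"
    by auto
  let ?t = "\<Oplus>\<^bsub>K\<^esub>a\<in>{..<d}. A (a, a)"
  have "?t \<in> carrier K" using A by (intro K.finsum_closed) auto
  then obtain f g where fg: "f \<in> carrier S" "g \<in> carrier S - {\<zero>\<^bsub>S\<^esub>}" "?t = fraction S f g"
    by (rule S.Frac_carrierE)
  obtain a0 where a0: "g a0 \<noteq> 0" using S_nonzeroE[OF fg(2)] .
  have "\<exists>P\<in>trig N I. \<forall>k. f k = g k * P k"
  proof (rule eigenvalue_sum_trig[of I z f g a0 G b0 n c d N])
    show "entire_on_coords I f" "entire_on_coords I g" using fg(1,2) by (auto simp: S_carrier)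
    show "finite I" "z i \<noteq> 0" "g a0 \<noteq> 0" "entire_on_coords I G" "G b0 \<noteq> 0" "N > 0" for i
      by (fact finite_I z a0 G N)+
    show "c i j \<in> carrier (laurent_ring I)" if "i < n" "j < n" for i j by (rule c[OF that])
    show "p dvd N" if "0 < p" "p \<le> n ^ d" for p by (rule N(2)[OF that])
    fix k assume k: "G k \<noteq> 0"
    have regA: "regular k (A (a, b))" if "a < d" "b < d" for a b
      using that by (intro G(3)[OF k]) (auto simp: Y_def)
    have regB: "regular k (B j (a, b))" if "j < n" "a < d" "b < d" for j a b
      using that by (intro G(3)[OF k]) (auto simp: Y_def)
    have reg\<theta>: "regular k (\<theta> p)" "ev k (\<theta> p) = laurent_eval (u_eval z k) p"
      if "p \<in> carrier (laurent_ring I)" for p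
      unfolding \<theta>_def using laurent_eval_carrier[OF that, of z]
      by (auto simp: regular_to_Frac ev_to_Frac simp del: entire_ring_simps)
    have "(\<Sum>m<d. ev k (A (a, m)) * ev k (B j (m, b))) =
        (\<Sum>i<n. laurent_eval (u_eval z k) (c i j) * ev k (B i (a, b)))"
      if j: "j < n" and a: "a < d" and b: "b < d" for j a b
    proof -
      have "ev k (\<Oplus>\<^bsub>K\<^esub>m\<in>{..<d}. A (a, m) \<otimes>\<^bsub>K\<^esub> B j (m, b)) = (\<Sum>m<d. ev k (A (a, m)) * ev k (B j (m, b)))"
        using ev_finsum[of "{..<d}" k "\<lambda>m. A (a, m) \<otimes>\<^bsub>K\<^esub> B j (m, b)"] j a b
        by (simp add: regular_mult ev_mult regA regB)
      moreover have "ev k (\<Oplus>\<^bsub>K\<^esub>i\<in>{..<n}. \<theta> (c i j) \<otimes>\<^bsub>K\<^esub> B i (a, b))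
          = (\<Sum>i<n. laurent_eval (u_eval z k) (c i j) * ev k (B i (a, b)))"
        using ev_finsum[of "{..<n}" k "\<lambda>i. \<theta> (c i j) \<otimes>\<^bsub>K\<^esub> B i (a, b)"] j a b
        by (simp add: regular_mult ev_mult reg\<theta> regB c)
      ultimately show ?thesis using AB[OF j a b] by simp
    qed
    moreover have "(\<Sum>j<n. laurent_eval (u_eval z k) (e j) * ev k (B j (a, b))) = (if a = b then 1 else 0)"
      if a: "a < d" and b: "b < d" for a b
    proof -
      have "ev k (\<Oplus>\<^bsub>K\<^esub>j\<in>{..<n}. \<theta> (e j) \<otimes>\<^bsub>K\<^esub> B j (a, b))
          = (\<Sum>j<n. laurent_eval (u_eval z k) (e j) * ev k (B j (a, b)))"
        using ev_finsum[of "{..<n}" k "\<lambda>j. \<theta> (e j) \<otimes>\<^bsub>K\<^esub> B j (a, b)"] a b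
        by (simp add: regular_mult ev_mult reg\<theta> regB e)
      then show ?thesis using unit[OF a b] by (simp add: ev_one ev_zero split: if_splits)
    qed
    ultimately obtain es where es: "length es = d" "set es \<subseteq> spec n (\<lambda>i j. laurent_eval (u_eval z k) (c i j))"
      "(\<Sum>a<d. ev k (A (a, a))) = sum_list es"
      by (rule trace_eq_sum_spec[where A = "\<lambda>a b. ev k (A (a, b))" and B = "\<lambda>j a b. ev k (B j (a, b))"]) blast+
    have "regular k ?t" "ev k ?t = sum_list es"
      using ev_finsum[of "{..<d}" k "\<lambda>a. A (a, a)"] regA es(3) by auto
    then have "f k = g k * sum_list es"
      using ev_numerator[OF fg(1,2), of k] fg(3) by simp
    then show "\<exists>es. length es = d \<and> set es \<subseteq> spec n (\<lambda>i j. laurent_eval (u_eval z k) (c i j)) \<and>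
        f k = g k * sum_list es" using es by blast
  qed
  then obtain P where P: "P \<in> trig N I" "\<And>k. f k = g k * P k" by blast
  have "P \<in> carrier S" unfolding S_carrier by (rule entire_trig[OF P(1) finite_I])
  then have "?t = to_Frac S P"
    unfolding fg(3) to_Frac_def using P(2)
    by (subst fraction_eq_iff_fun[OF fg(1,2) _ S.one_nonzero]) (simp_all add: entire_ring_simps(3) mult.commute)
  with P(1) show ?thesis by blast
qed

text \<open>Evaluation at one generic point reduces this to complex matrices.\<close>

lemma identity_factor_dimension_K:
  fixes d n :: nat
  assumes P: "\<And>a i. a < d \<Longrightarrow> i < n \<Longrightarrow> P a i \<in> carrier K" and Q: "\<And>i b. i < n \<Longrightarrow> b < d \<Longrightarrow> Q i b \<in> carrier K"
    and PQ: "\<And>a b. a < d \<Longrightarrow> b < d \<Longrightarrow>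
      (\<Oplus>\<^bsub>K\<^esub>i\<in>{..<n}. P a i \<otimes>\<^bsub>K\<^esub> Q i b) = (if a = b then \<one>\<^bsub>K\<^esub> else \<zero>\<^bsub>K\<^esub>)"
  shows "d \<le> n"
proof -
  define Y where "Y = (\<lambda>(a, i). P a i) ` ({..<d} \<times> {..<n}) \<union> (\<lambda>(i, b). Q i b) ` ({..<n} \<times> {..<d})"
  have "finite Y" "Y \<subseteq> carrier K" using P Q by (auto simp: Y_def)
  from generic_regular[OF this]
  obtain k where G: "\<forall>x\<in>Y. regular k x" by blast
  have reg: "regular k (P a i)" "regular k (Q i a)" if "a < d" "i < n" for a i
  proof -
    have "P a i \<in> Y" unfolding Y_def
      by (rule UnI1, rule image_eqI[of _ _ "(a, i)"]) (use that in simp_all)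
    moreover have "Q i a \<in> Y" unfolding Y_def
      by (rule UnI2, rule image_eqI[of _ _ "(i, a)"]) (use that in simp_all)
    ultimately show "regular k (P a i)" "regular k (Q i a)" using G by auto
  qed
  have "(\<Sum>i<n. ev k (P a i) * ev k (Q i b)) = (if a = b then 1 else 0)" if ab: "a < d" "b < d" for a b
  proof -
    have "ev k (\<Oplus>\<^bsub>K\<^esub>i\<in>{..<n}. P a i \<otimes>\<^bsub>K\<^esub> Q i b) = (\<Sum>i<n. ev k (P a i) * ev k (Q i b))"
      using ev_finsum[of "{..<n}" k "\<lambda>i. P a i \<otimes>\<^bsub>K\<^esub> Q i b"] ab by (simp add: regular_mult ev_mult reg)
    then show ?thesis using PQ[OF ab] by (simp add: ev_one ev_zero split: if_splits)
  qed
  then show ?thesis by (rule identity_factor_dimension)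
qed

subsection \<open>Translations\<close>

lemma shift_closed: "f \<in> carrier S \<Longrightarrow> shift w f \<in> carrier S"
  unfolding S_carrier shift_def by (rule entire_translate)

lemma shift_nonzero:
  assumes "g \<in> carrier S - {\<zero>\<^bsub>S\<^esub>}"
  shows "shift w g \<in> carrier S - {\<zero>\<^bsub>S\<^esub>}"
proof -
  obtain k where "g k \<noteq> 0" using S_nonzeroE[OF assms] .
  then have "shift w g (\<lambda>i. k i - w i) \<noteq> 0" by (simp add: shift_def)
  then show ?thesis using assms by (intro S_nonzero shift_closed) auto
qed

text \<open>One inclusion holds for every shift; applied to the inverse shift it gives the
  other.\<close>

lemma translate_fraction:
  assumes f: "f \<in> carrier S" and g: "g \<in> carrier S - {\<zero>\<^bsub>S\<^esub>}"
  shows "translate w (fraction S f g) = fraction S (shift w f) (shift w g)"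
proof -
  have sub: "translate w (fraction S f g) \<subseteq> fraction S (shift w f) (shift w g)" for w f g
  proof
    fix x assume "x \<in> translate w (fraction S f g)"
    then obtain c d where cd: "x = (shift w c, shift w d)" "c \<in> carrier S" "d \<in> carrier S - {\<zero>\<^bsub>S\<^esub>}"
      "f \<otimes>\<^bsub>S\<^esub> d = c \<otimes>\<^bsub>S\<^esub> g" unfolding translate_def fraction_def by auto
    have "shift w f \<otimes>\<^bsub>S\<^esub> shift w d = shift w c \<otimes>\<^bsub>S\<^esub> shift w g"
      using cd(4) by (simp add: entire_ring_simps(2) shift_def fun_eq_iff)
    then show "x \<in> fraction S (shift w f) (shift w g)"
      using cd(1) shift_closed[OF cd(2)] shift_nonzero[OF cd(3)] by (simp add: fraction_def)
  qed
  show ?thesis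
  proof (rule antisym[OF sub], rule subsetI)
    fix x assume x: "x \<in> fraction S (shift w f) (shift w g)"
    let ?v = "\<lambda>i. - w i"
    obtain c d where cd: "x = (c, d)" by (cases x)
    have "(shift ?v c, shift ?v d) \<in> translate ?v (fraction S (shift w f) (shift w g))"
      unfolding translate_def using x cd by (intro image_eqI[of _ _ "(c, d)"]) simp_all
    then have "(shift ?v c, shift ?v d) \<in> fraction S (shift ?v (shift w f)) (shift ?v (shift w g))"
      using sub by (rule subsetD[rotated])
    then have "(shift ?v c, shift ?v d) \<in> fraction S f g" by (simp add: shift_shift)
    moreover have "x = (shift w (shift ?v c), shift w (shift ?v d))" by (simp add: cd shift_shift)
    ultimately show "x \<in> translate w (fraction S f g)"
      unfolding translate_def by (intro image_eqI[of _ _ "(shift ?v c, shift ?v d)"]) simp_all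
  qed
qed

lemma translate_closed: "x \<in> carrier K \<Longrightarrow> translate w x \<in> carrier K"
  by (elim S.Frac_carrierE)
    (simp add: translate_fraction, intro S.fraction_closed shift_closed shift_nonzero, auto)

lemma shift_ring_simps:
  "shift w (f \<otimes>\<^bsub>S\<^esub> g) = shift w f \<otimes>\<^bsub>S\<^esub> shift w g" "shift w (f \<oplus>\<^bsub>S\<^esub> g) = shift w f \<oplus>\<^bsub>S\<^esub> shift w g"
  "shift w \<one>\<^bsub>S\<^esub> = \<one>\<^bsub>S\<^esub>"
  by (simp_all add: entire_ring_simps shift_def)

lemma translate_hom: "translate w \<in> Ring.ring_hom K K"
proof (rule ring_hom_memI)
  fix x y assume "x \<in> carrier K" "y \<in> carrier K"
  then obtain f g f' g' where *: "f \<in> carrier S" "g \<in> carrier S - {\<zero>\<^bsub>S\<^esub>}" "x = fraction S f g"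
    "f' \<in> carrier S" "g' \<in> carrier S - {\<zero>\<^bsub>S\<^esub>}" "y = fraction S f' g'" by (metis S.Frac_carrierE)
  note sh = shift_closed[OF *(1)] shift_nonzero[OF *(2)] shift_closed[OF *(4)] shift_nonzero[OF *(5)]
  have gg: "g \<otimes>\<^bsub>S\<^esub> g' \<in> carrier S - {\<zero>\<^bsub>S\<^esub>}" by (rule S.mult_nonzero[OF *(2,5)])
  have ff: "f \<otimes>\<^bsub>S\<^esub> f' \<in> carrier S" "(f \<otimes>\<^bsub>S\<^esub> g') \<oplus>\<^bsub>S\<^esub> (f' \<otimes>\<^bsub>S\<^esub> g) \<in> carrier S" using * by auto
  show "translate w (x \<otimes>\<^bsub>K\<^esub> y) = translate w x \<otimes>\<^bsub>K\<^esub> translate w y"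
    unfolding *(3,6) S.Frac_mult[OF *(1,2,4,5)] translate_fraction[OF *(1,2)] translate_fraction[OF *(4,5)]
      translate_fraction[OF ff(1) gg] S.Frac_mult[OF sh] shift_ring_simps ..
  show "translate w (x \<oplus>\<^bsub>K\<^esub> y) = translate w x \<oplus>\<^bsub>K\<^esub> translate w y"
    unfolding *(3,6) S.Frac_add[OF *(1,2,4,5)] translate_fraction[OF *(1,2)] translate_fraction[OF *(4,5)]
      translate_fraction[OF ff(2) gg] S.Frac_add[OF sh] shift_ring_simps ..
qed (simp_all add: translate_closed, simp add: S.Frac_one translate_fraction shift_ring_simps)

lemma translate_translate: "translate w (translate v x) = translate (\<lambda>i. w i + v i) x"
  unfolding translate_def image_image by (rule image_cong) (auto simp: shift_shift)

lemma translate_0: "translate (\<lambda>i. 0) x = x"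
  unfolding translate_def by simp

lemma translate_to_Frac: "f \<in> carrier S \<Longrightarrow> translate w (to_Frac S f) = to_Frac S (shift w f)"
  unfolding to_Frac_def by (subst translate_fraction) (auto simp: shift_ring_simps)

end

locale param_field = entire_field I for I :: "'i set" +
  fixes z :: "'i \<Rightarrow> complex"
  assumes z: "z i \<noteq> 0"
begin

definition \<theta> :: "'i laurent \<Rightarrow> 'i fun_quot" where
  "\<theta> p = to_Frac S (\<lambda>k. laurent_eval (u_eval z k) p)"

lemma \<theta>_closed: "p \<in> carrier (laurent_ring I) \<Longrightarrow> \<theta> p \<in> carrier K"
  unfolding \<theta>_def by (rule ring_hom_closed[OF S.to_Frac_hom laurent_eval_carrier])

text \<open>These translations of \<open>k\<close> fix all parameters \<open>u_i\<close>; they are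
  the source of automorphisms over the base field.\<close>

definition integral_shift :: "('i \<Rightarrow> complex) \<Rightarrow> bool" where
  "integral_shift w \<longleftrightarrow> (\<forall>i\<in>I. \<exists>a::int. w i = of_int a)"

lemma integral_shift_uminus:
  assumes "integral_shift w"
  shows "integral_shift (\<lambda>i. - w i)"
  unfolding integral_shift_def
proof
  fix i assume "i \<in> I"
  then obtain a :: int where "w i = of_int a" using assms unfolding integral_shift_def by blast
  then have "- w i = of_int (- a)" by simp
  then show "\<exists>a::int. - w i = of_int a" ..
qed

lemma translate_\<theta>:
  assumes w: "integral_shift w" and p: "p \<in> carrier (laurent_ring I)"
  shows "translate w (\<theta> p) = \<theta> p"
proof -
  have "shift w (\<lambda>k. laurent_eval (u_eval z k) p) = (\<lambda>k. laurent_eval (u_eval z k) p)"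
    unfolding shift_def
    by (rule ext, rule trig_periodic[OF laurent_eval_trig[OF finite_I p]]) (use w in \<open>auto simp: integral_shift_def\<close>)
  then show ?thesis unfolding \<theta>_def by (simp only: translate_to_Frac[OF laurent_eval_carrier[OF p]])
qed

lemmas translate_mult = ring_hom_mult[OF translate_hom]
  and translate_add = ring_hom_add[OF translate_hom]
  and translate_one = ring_hom_one[OF translate_hom]

lemma translate_ring_hom_cring: "ring_hom_cring K K (translate w)"
  by (intro ring_hom_cringI translate_hom K.is_cring)

lemma translate_zero: "translate w \<zero>\<^bsub>K\<^esub> = \<zero>\<^bsub>K\<^esub>"
proof -
  interpret t: ring_hom_cring K K "translate w" by (rule translate_ring_hom_cring)
  show ?thesis by (rule t.hom_zero)
qed

lemma translate_uminus_cancel: "translate w (translate (\<lambda>i. - w i) x) = x"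
  by (simp add: translate_translate translate_0)

lemma translate_uminus_cancel': "translate (\<lambda>i. - w i) (translate w x) = x"
  by (simp add: translate_translate translate_0)

lemma translate_eq_zero_iff: "translate w x = \<zero>\<^bsub>K\<^esub> \<longleftrightarrow> x = \<zero>\<^bsub>K\<^esub>"
  by (metis translate_zero translate_uminus_cancel')

lemma translate_finsum:
  assumes "f \<in> A \<rightarrow> carrier K"
  shows "translate w (\<Oplus>\<^bsub>K\<^esub>i\<in>A. f i) = (\<Oplus>\<^bsub>K\<^esub>i\<in>A. translate w (f i))"
proof -
  interpret t: ring_hom_cring K K "translate w" by (rule translate_ring_hom_cring)
  show ?thesis using t.hom_finsum[OF assms] by (simp add: o_def)
qed

end

section \<open>Representations of the extended algebra\<close>

lemma mat_algebra_simps: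
  "carrier (mat_algebra K d) = ({..<d} \<times> {..<d}) \<rightarrow>\<^sub>E carrier K"
  "\<And>i j. i < d \<Longrightarrow> j < d \<Longrightarrow> (A \<otimes>\<^bsub>mat_algebra K d\<^esub> B) (i, j) = (\<Oplus>\<^bsub>K\<^esub>m\<in>{..<d}. A (i, m) \<otimes>\<^bsub>K\<^esub> B (m, j))"
  "\<And>i j. i < d \<Longrightarrow> j < d \<Longrightarrow> \<one>\<^bsub>mat_algebra K d\<^esub> (i, j) = (if i = j then \<one>\<^bsub>K\<^esub> else \<zero>\<^bsub>K\<^esub>)"
  "\<And>i j. i < d \<Longrightarrow> j < d \<Longrightarrow> (A \<oplus>\<^bsub>mat_algebra K d\<^esub> B) (i, j) = A (i, j) \<oplus>\<^bsub>K\<^esub> B (i, j)"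
  "\<And>i j. i < d \<Longrightarrow> j < d \<Longrightarrow> (c \<odot>\<^bsub>mat_algebra K d\<^esub> A) (i, j) = c \<otimes>\<^bsub>K\<^esub> A (i, j)"
  by (simp_all add: mat_algebra_def)

text \<open>\<open>H\<close> contributes its ring structure and closure under scalars; the
  compatibility of addition and scalars with \<open>K\<close> comes from the tensor
  relations.\<close>

locale extended_algebra = param_field I z + H: ring H
  for I :: "'i set" and z and H :: "('i laurent, 'h, 'm) module_scheme" +
  assumes smult_H: "r \<in> carrier (laurent_ring I) \<Longrightarrow> h \<in> carrier H \<Longrightarrow> r \<odot>\<^bsub>H\<^esub> h \<in> carrier H"
begin

definition J where "J = tensor_ideal (laurent_ring I) K \<theta> H"

definition KH where "KH = scalar_extension (laurent_ring I) K \<theta> H"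

sublocale MR: monoid_ring K H
  by (intro monoid_ring.intro) (rule K.is_cring, rule H.monoid_axioms)

sublocale M: ring MR.M by (rule MR.ring_M)

definition coset :: "('h \<Rightarrow> 'i fun_quot) \<Rightarrow> ('h \<Rightarrow> 'i fun_quot) set" where
  "coset f = J +>\<^bsub>MR.M\<^esub> f"

definition tensor :: "'i fun_quot \<Rightarrow> 'h \<Rightarrow> ('h \<Rightarrow> 'i fun_quot) set" where
  "tensor x h = coset (monoid_elem K h x)"

lemma pure_tensor_eq: "pure_tensor (laurent_ring I) K \<theta> H x h = tensor x h"
  by (simp add: pure_tensor_def tensor_def coset_def J_def)

lemma KH_eq: "KH = quot_algebra MR.M J"
  by (simp add: KH_def scalar_extension_def J_def)

lemma tensor_relations_closed: "tensor_relations (laurent_ring I) K \<theta> H \<subseteq> carrier MR.M"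
proof -
  have "monoid_elem K (a \<oplus>\<^bsub>H\<^esub> b) \<one>\<^bsub>K\<^esub> \<ominus>\<^bsub>MR.M\<^esub> (monoid_elem K a \<one>\<^bsub>K\<^esub> \<oplus>\<^bsub>MR.M\<^esub> monoid_elem K b \<one>\<^bsub>K\<^esub>) \<in> carrier MR.M"
    if "a \<in> carrier H" "b \<in> carrier H" for a b
    by (intro M.minus_closed M.add.m_closed MR.elem_closed H.add.m_closed K.one_closed that)
  moreover have "monoid_elem K (r \<odot>\<^bsub>H\<^esub> a) \<one>\<^bsub>K\<^esub> \<ominus>\<^bsub>MR.M\<^esub> monoid_elem K a (\<theta> r) \<in> carrier MR.M"
    if "r \<in> carrier (laurent_ring I)" "a \<in> carrier H" for r a
    by (intro M.minus_closed MR.elem_closed smult_H \<theta>_closed K.one_closed that)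
  ultimately show ?thesis unfolding tensor_relations_def Let_def by blast
qed

lemma J_ideal: "ideal J MR.M"
  unfolding J_def tensor_ideal_def by (rule M.genideal_ideal[OF tensor_relations_closed])

lemma tensor_relations_J: "tensor_relations (laurent_ring I) K \<theta> H \<subseteq> J"
  unfolding J_def tensor_ideal_def by (rule M.genideal_self[OF tensor_relations_closed])

sublocale J: ideal J MR.M by (rule J_ideal)

sublocale KH: ring KH unfolding KH_eq by (rule ring_quot_algebra[OF J_ideal])

lemma coset_hom: "coset \<in> Ring.ring_hom MR.M KH"
  unfolding coset_def KH_eq by (rule rcos_hom_quot_algebra[OF J_ideal])

lemmas coset_closed = ring_hom_closed[OF coset_hom]
  and coset_mult = ring_hom_mult[OF coset_hom]
  and coset_add = ring_hom_add[OF coset_hom]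
  and coset_one = ring_hom_one[OF coset_hom]

lemma KH_carrierE:
  assumes "Y \<in> carrier KH" obtains f where "f \<in> carrier MR.M" "Y = coset f"
  using assms unfolding KH_eq coset_def by (rule quot_algebra_carrierE)

lemma coset_eq_iff: "f \<in> carrier MR.M \<Longrightarrow> g \<in> carrier MR.M \<Longrightarrow> coset f = coset g \<longleftrightarrow> f \<ominus>\<^bsub>MR.M\<^esub> g \<in> J"
  unfolding coset_def by (rule J.rcos_eq_iff)

lemma coset_smult:
  assumes c: "c \<in> carrier K" and f: "f \<in> carrier MR.M"
  shows "c \<odot>\<^bsub>KH\<^esub> coset f = coset (c \<odot>\<^bsub>MR.M\<^esub> f)"
  unfolding coset_def KH_eq
proof (rule smult_quot_algebra[OF J_ideal _ _ _ f])
  fix x y assume xy: "x \<in> carrier MR.M" "y \<in> carrier MR.M"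
  show "c \<odot>\<^bsub>MR.M\<^esub> (x \<oplus>\<^bsub>MR.M\<^esub> y) = c \<odot>\<^bsub>MR.M\<^esub> x \<oplus>\<^bsub>MR.M\<^esub> c \<odot>\<^bsub>MR.M\<^esub> y"
    using c xy by (simp add: MR.smult_as_mult M.r_distr MR.elem_closed)
next
  fix x assume "x \<in> J"
  then show "c \<odot>\<^bsub>MR.M\<^esub> x \<in> J"
    using c by (simp add: MR.smult_as_mult J.Icarr J.I_l_closed MR.elem_closed)
qed (rule MR.smult_closed[OF c])

lemma smult_KH_closed: "c \<in> carrier K \<Longrightarrow> Y \<in> carrier KH \<Longrightarrow> c \<odot>\<^bsub>KH\<^esub> Y \<in> carrier KH"
  by (elim KH_carrierE) (simp add: coset_smult coset_closed MR.smult_closed)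

lemma tensor_closed: "x \<in> carrier K \<Longrightarrow> h \<in> carrier H \<Longrightarrow> tensor x h \<in> carrier KH"
  unfolding tensor_def by (intro coset_closed MR.elem_closed)

lemma tensor_smult: "x \<in> carrier K \<Longrightarrow> h \<in> carrier H \<Longrightarrow> tensor x h = x \<odot>\<^bsub>KH\<^esub> tensor \<one>\<^bsub>K\<^esub> h"
  unfolding tensor_def by (simp add: coset_smult MR.elem_closed MR.smult_elem)

lemma tensor_add:
  assumes "h \<in> carrier H" "h' \<in> carrier H"
  shows "tensor \<one>\<^bsub>K\<^esub> (h \<oplus>\<^bsub>H\<^esub> h') = tensor \<one>\<^bsub>K\<^esub> h \<oplus>\<^bsub>KH\<^esub> tensor \<one>\<^bsub>K\<^esub> h'"
proof -
  have "monoid_elem K (h \<oplus>\<^bsub>H\<^esub> h') \<one>\<^bsub>K\<^esub> \<ominus>\<^bsub>MR.M\<^esub> (monoid_elem K h \<one>\<^bsub>K\<^esub> \<oplus>\<^bsub>MR.M\<^esub> monoid_elem K h' \<one>\<^bsub>K\<^esub>) \<in> J"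
    by (rule subsetD[OF tensor_relations_J]) (use assms in \<open>unfold tensor_relations_def Let_def, blast\<close>)
  then have "coset (monoid_elem K (h \<oplus>\<^bsub>H\<^esub> h') \<one>\<^bsub>K\<^esub>)
      = coset (monoid_elem K h \<one>\<^bsub>K\<^esub> \<oplus>\<^bsub>MR.M\<^esub> monoid_elem K h' \<one>\<^bsub>K\<^esub>)"
    by (subst coset_eq_iff) (intro M.add.m_closed MR.elem_closed H.add.m_closed K.one_closed assms)+
  then show ?thesis unfolding tensor_def using assms by (simp add: coset_add MR.elem_closed)
qed

lemma tensor_scalar:
  assumes "r \<in> carrier (laurent_ring I)" "h \<in> carrier H"
  shows "tensor \<one>\<^bsub>K\<^esub> (r \<odot>\<^bsub>H\<^esub> h) = tensor (\<theta> r) h"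
proof -
  have "monoid_elem K (r \<odot>\<^bsub>H\<^esub> h) \<one>\<^bsub>K\<^esub> \<ominus>\<^bsub>MR.M\<^esub> monoid_elem K h (\<theta> r) \<in> J"
    by (rule subsetD[OF tensor_relations_J]) (use assms in \<open>unfold tensor_relations_def Let_def, blast\<close>)
  then show ?thesis
    unfolding tensor_def
    by (subst coset_eq_iff) (intro MR.elem_closed smult_H \<theta>_closed K.one_closed assms)+
qed

lemma tensor_mult: "h \<in> carrier H \<Longrightarrow> h' \<in> carrier H \<Longrightarrow>
    tensor \<one>\<^bsub>K\<^esub> (h \<otimes>\<^bsub>H\<^esub> h') = tensor \<one>\<^bsub>K\<^esub> h \<otimes>\<^bsub>KH\<^esub> tensor \<one>\<^bsub>K\<^esub> h'"
  unfolding tensor_def by (simp add: coset_mult[symmetric] MR.elem_mult MR.elem_closed)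

lemma tensor_one: "tensor \<one>\<^bsub>K\<^esub> \<one>\<^bsub>H\<^esub> = \<one>\<^bsub>KH\<^esub>"
  unfolding tensor_def MR.one_eq[symmetric] by (rule coset_one)

lemma KH_induct [consumes 1, case_names tensor add]:
  assumes Y: "Y \<in> carrier KH"
    and tensor: "\<And>h x. h \<in> carrier H \<Longrightarrow> x \<in> carrier K \<Longrightarrow> P (tensor x h)"
    and add: "\<And>Y Z. Y \<in> carrier KH \<Longrightarrow> Z \<in> carrier KH \<Longrightarrow> P Y \<Longrightarrow> P Z \<Longrightarrow> P (Y \<oplus>\<^bsub>KH\<^esub> Z)"
  shows "P Y"
proof -
  obtain f where f: "f \<in> carrier MR.M" "Y = coset f" using KH_carrierE[OF Y] .
  have "P (coset f)"
    using f(1)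
  proof (induction f rule: MR.monoid_algebra_induct)
    case zero
    \<comment> \<open>Zero is itself a pure tensor, so the induction rule gets by without a separate
      case for it.\<close>
    have "\<zero>\<^bsub>MR.M\<^esub> = monoid_elem K \<one>\<^bsub>H\<^esub> \<zero>\<^bsub>K\<^esub>" by (auto simp: MR.zero_eq monoid_elem_def)
    then show ?case using tensor[of "\<one>\<^bsub>H\<^esub>" "\<zero>\<^bsub>K\<^esub>"] by (simp add: tensor_def)
  next
    case (elem a r)
    then show ?case using tensor by (simp add: tensor_def)
  next
    case (add f g)
    then show ?case using assms(3) by (simp add: coset_add coset_closed)
  qed
  then show ?thesis using f(2) by simp
qed

end

section \<open>Matrix representations: traces and dimension\<close>

locale extended_algebra_rep = extended_algebra I z H
  for I :: "'i set" and z and H :: "('i laurent, 'h, 'm) module_scheme" +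
  fixes d :: nat and \<rho> :: "('h \<Rightarrow> 'i fun_quot) set \<Rightarrow> nat \<times> nat \<Rightarrow> 'i fun_quot"
  assumes rep: "matrix_rep K KH d \<rho>"
begin

lemma rep_closed: "Y \<in> carrier KH \<Longrightarrow> a < d \<Longrightarrow> b < d \<Longrightarrow> \<rho> Y (a, b) \<in> carrier K"
proof -
  assume "Y \<in> carrier KH" "a < d" "b < d"
  moreover have "\<rho> Y \<in> carrier (mat_algebra K d)" if "Y \<in> carrier KH"
    using rep that ring_hom_closed[of \<rho> KH "mat_algebra K d" Y] unfolding matrix_rep_def by simp
  ultimately show ?thesis by (auto simp: mat_algebra_simps(1))
qed

lemma rep_mult: "Y \<in> carrier KH \<Longrightarrow> Z \<in> carrier KH \<Longrightarrow> a < d \<Longrightarrow> b < d \<Longrightarrow>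
    \<rho> (Y \<otimes>\<^bsub>KH\<^esub> Z) (a, b) = (\<Oplus>\<^bsub>K\<^esub>m\<in>{..<d}. \<rho> Y (a, m) \<otimes>\<^bsub>K\<^esub> \<rho> Z (m, b))"
  using rep unfolding matrix_rep_def by (simp add: Ring.ring_hom_def mat_algebra_simps)

lemma rep_add: "Y \<in> carrier KH \<Longrightarrow> Z \<in> carrier KH \<Longrightarrow> a < d \<Longrightarrow> b < d \<Longrightarrow>
    \<rho> (Y \<oplus>\<^bsub>KH\<^esub> Z) (a, b) = \<rho> Y (a, b) \<oplus>\<^bsub>K\<^esub> \<rho> Z (a, b)"
  using rep unfolding matrix_rep_def by (simp add: Ring.ring_hom_def mat_algebra_simps)

lemma rep_one: "a < d \<Longrightarrow> b < d \<Longrightarrow> \<rho> \<one>\<^bsub>KH\<^esub> (a, b) = (if a = b then \<one>\<^bsub>K\<^esub> else \<zero>\<^bsub>K\<^esub>)"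
  using rep unfolding matrix_rep_def by (simp add: Ring.ring_hom_def mat_algebra_simps)

lemma rep_smult: "c \<in> carrier K \<Longrightarrow> Y \<in> carrier KH \<Longrightarrow> a < d \<Longrightarrow> b < d \<Longrightarrow>
    \<rho> (c \<odot>\<^bsub>KH\<^esub> Y) (a, b) = c \<otimes>\<^bsub>K\<^esub> \<rho> Y (a, b)"
  using rep unfolding matrix_rep_def by (simp add: mat_algebra_simps)

definition \<phi> where "\<phi> h = \<rho> (tensor \<one>\<^bsub>K\<^esub> h)"

lemma \<phi>_closed: "h \<in> carrier H \<Longrightarrow> a < d \<Longrightarrow> b < d \<Longrightarrow> \<phi> h (a, b) \<in> carrier K"
  unfolding \<phi>_def by (intro rep_closed tensor_closed K.one_closed)

lemma rep_tensor: "x \<in> carrier K \<Longrightarrow> h \<in> carrier H \<Longrightarrow> a < d \<Longrightarrow> b < d \<Longrightarrow>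
    \<rho> (tensor x h) (a, b) = x \<otimes>\<^bsub>K\<^esub> \<phi> h (a, b)"
  by (simp add: tensor_smult[of x h] rep_smult tensor_closed \<phi>_def)

lemma \<phi>_smult: "r \<in> carrier (laurent_ring I) \<Longrightarrow> h \<in> carrier H \<Longrightarrow> a < d \<Longrightarrow> b < d \<Longrightarrow>
    \<phi> (r \<odot>\<^bsub>H\<^esub> h) (a, b) = \<theta> r \<otimes>\<^bsub>K\<^esub> \<phi> h (a, b)"
  using rep_tensor[of "\<theta> r" h] by (simp add: \<phi>_def tensor_scalar \<theta>_closed)

lemma \<phi>_add: "h \<in> carrier H \<Longrightarrow> h' \<in> carrier H \<Longrightarrow> a < d \<Longrightarrow> b < d \<Longrightarrow>
    \<phi> (h \<oplus>\<^bsub>H\<^esub> h') (a, b) = \<phi> h (a, b) \<oplus>\<^bsub>K\<^esub> \<phi> h' (a, b)"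
  by (simp add: \<phi>_def tensor_add rep_add tensor_closed)

lemma \<phi>_zero: "a < d \<Longrightarrow> b < d \<Longrightarrow> \<phi> \<zero>\<^bsub>H\<^esub> (a, b) = \<zero>\<^bsub>K\<^esub>"
  using \<phi>_add[OF H.zero_closed H.zero_closed, of a b] \<phi>_closed[OF H.zero_closed, of a b]
    K.add.l_cancel_one'[of "\<phi> \<zero>\<^bsub>H\<^esub> (a, b)" "\<phi> \<zero>\<^bsub>H\<^esub> (a, b)"] by simp

lemma \<phi>_mult: "h \<in> carrier H \<Longrightarrow> h' \<in> carrier H \<Longrightarrow> a < d \<Longrightarrow> b < d \<Longrightarrow>
    \<phi> (h \<otimes>\<^bsub>H\<^esub> h') (a, b) = (\<Oplus>\<^bsub>K\<^esub>m\<in>{..<d}. \<phi> h (a, m) \<otimes>\<^bsub>K\<^esub> \<phi> h' (m, b))"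
  by (simp add: \<phi>_def tensor_mult rep_mult tensor_closed)

lemma \<phi>_combination:
  assumes "finite A" "r \<in> A \<rightarrow> carrier (laurent_ring I)" "g \<in> A \<rightarrow> carrier H" "a < d" "b < d"
  shows "\<phi> (\<Oplus>\<^bsub>H\<^esub>i\<in>A. r i \<odot>\<^bsub>H\<^esub> g i) (a, b) = (\<Oplus>\<^bsub>K\<^esub>i\<in>A. \<theta> (r i) \<otimes>\<^bsub>K\<^esub> \<phi> (g i) (a, b))"
  using assms(1-3)
proof (induction A rule: finite_induct)
  case empty
  then show ?case using assms by (simp add: \<phi>_zero)
next
  case (insert i A)
  have c: "(\<lambda>i. r i \<odot>\<^bsub>H\<^esub> g i) \<in> A \<rightarrow> carrier H" "r i \<odot>\<^bsub>H\<^esub> g i \<in> carrier H"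
    using insert.prems by (auto intro: smult_H)
  have c': "(\<lambda>i. \<theta> (r i) \<otimes>\<^bsub>K\<^esub> \<phi> (g i) (a, b)) \<in> A \<rightarrow> carrier K" "\<theta> (r i) \<otimes>\<^bsub>K\<^esub> \<phi> (g i) (a, b) \<in> carrier K"
    using insert.prems assms(4,5) by (auto intro!: K.m_closed \<theta>_closed \<phi>_closed)
  show ?case
    using insert assms(4,5) c c' by (simp add: \<phi>_add H.finsum_closed \<phi>_smult)
qed

text \<open>Left multiplication by \<open>h\<close> on the generators of \<open>H\<close> is
  described by a matrix \<open>c\<close> over the Laurent ring. The generators may be dependent; any
  such \<open>c\<close> will do. The expansion \<open>e\<close> of the unit guarantees that the
  eigenvectors of \<open>c\<close> derived from the representation are non-zero.\<close>

lemma trace_trig_rep: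
  assumes gen: "module_generated_by (laurent_ring I) H n" and h: "h \<in> carrier H"
    and N: "N > 0" "\<And>p. 0 < p \<Longrightarrow> p \<le> n ^ d \<Longrightarrow> p dvd N"
  shows "\<exists>P\<in>trig N I. mat_trace K d (\<phi> h) = to_Frac S P"
proof -
  obtain g where g: "g \<in> {..<n} \<rightarrow> carrier H"
    "\<And>x. x \<in> carrier H \<Longrightarrow> \<exists>c \<in> {..<n} \<rightarrow> carrier (laurent_ring I). x = (\<Oplus>\<^bsub>H\<^esub>i\<in>{..<n}. c i \<odot>\<^bsub>H\<^esub> g i)"
    using gen unfolding module_generated_by_def by blast
  have "\<exists>c. j < n \<longrightarrow> c \<in> {..<n} \<rightarrow> carrier (laurent_ring I) \<and> h \<otimes>\<^bsub>H\<^esub> g j = (\<Oplus>\<^bsub>H\<^esub>i\<in>{..<n}. c i \<odot>\<^bsub>H\<^esub> g i)" for j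
  proof (cases "j < n")
    case True
    then have "h \<otimes>\<^bsub>H\<^esub> g j \<in> carrier H" using h g(1) by auto
    from g(2)[OF this] show ?thesis by blast
  qed simp
  then have "\<forall>j. \<exists>c. j < n \<longrightarrow> c \<in> {..<n} \<rightarrow> carrier (laurent_ring I) \<and>
      h \<otimes>\<^bsub>H\<^esub> g j = (\<Oplus>\<^bsub>H\<^esub>i\<in>{..<n}. c i \<odot>\<^bsub>H\<^esub> g i)" by (rule allI)
  from choice[OF this] obtain c where "\<forall>j. j < n \<longrightarrow> c j \<in> {..<n} \<rightarrow> carrier (laurent_ring I) \<and>
      h \<otimes>\<^bsub>H\<^esub> g j = (\<Oplus>\<^bsub>H\<^esub>i\<in>{..<n}. c j i \<odot>\<^bsub>H\<^esub> g i)" by (elim exE)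
  then have c: "\<And>j. j < n \<Longrightarrow> c j \<in> {..<n} \<rightarrow> carrier (laurent_ring I)"
    "\<And>j. j < n \<Longrightarrow> h \<otimes>\<^bsub>H\<^esub> g j = (\<Oplus>\<^bsub>H\<^esub>i\<in>{..<n}. c j i \<odot>\<^bsub>H\<^esub> g i)" by simp_all
  obtain e where e: "e \<in> {..<n} \<rightarrow> carrier (laurent_ring I)" "\<one>\<^bsub>H\<^esub> = (\<Oplus>\<^bsub>H\<^esub>i\<in>{..<n}. e i \<odot>\<^bsub>H\<^esub> g i)"
    using g(2)[OF H.one_closed] by blast
  have "\<exists>P\<in>trig N I. (\<Oplus>\<^bsub>K\<^esub>a\<in>{..<d}. \<phi> h (a, a)) = to_Frac S P"
  \<comment> \<open>\<open>c j i\<close> is the coefficient of generator \<open>i\<close> in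
    \<open>h\<close> times generator \<open>j\<close>, hence the exchange of indices.\<close>
  proof (rule trace_trig[of z d "\<phi> h" n "\<lambda>j. \<phi> (g j)" "\<lambda>i j. c j i" e N, folded \<theta>_def])
    show "\<phi> h (a, b) \<in> carrier K" if "a < d" "b < d" for a b by (rule \<phi>_closed[OF h that])
    show "\<phi> (g j) (a, b) \<in> carrier K" if "j < n" "a < d" "b < d" for j a b
      using g(1) that by (intro \<phi>_closed) auto
    show "c j i \<in> carrier (laurent_ring I)" if "i < n" "j < n" for i j using c(1)[OF that(2)] that by auto
    show "e j \<in> carrier (laurent_ring I)" if "j < n" for j using e(1) that by auto
    show "p dvd N" if "0 < p" "p \<le> n ^ d" for p by (rule N(2)[OF that])
    show "(\<Oplus>\<^bsub>K\<^esub>m\<in>{..<d}. \<phi> h (a, m) \<otimes>\<^bsub>K\<^esub> \<phi> (g j) (m, b)) = (\<Oplus>\<^bsub>K\<^esub>i\<in>{..<n}. \<theta> (c j i) \<otimes>\<^bsub>K\<^esub> \<phi> (g i) (a, b))"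
      if "j < n" "a < d" "b < d" for j a b
    proof -
      have "g j \<in> carrier H" using g(1) that by auto
      then have "(\<Oplus>\<^bsub>K\<^esub>m\<in>{..<d}. \<phi> h (a, m) \<otimes>\<^bsub>K\<^esub> \<phi> (g j) (m, b)) = \<phi> (h \<otimes>\<^bsub>H\<^esub> g j) (a, b)"
        using \<phi>_mult[OF h _ that(2,3)] by simp
      also have "\<dots> = (\<Oplus>\<^bsub>K\<^esub>i\<in>{..<n}. \<theta> (c j i) \<otimes>\<^bsub>K\<^esub> \<phi> (g i) (a, b))"
        unfolding c(2)[OF that(1)] by (rule \<phi>_combination[OF _ c(1)[OF that(1)] g(1) that(2,3)]) simp
      finally show ?thesis .
    qed
    show "(\<Oplus>\<^bsub>K\<^esub>j\<in>{..<n}. \<theta> (e j) \<otimes>\<^bsub>K\<^esub> \<phi> (g j) (a, b)) = (if a = b then \<one>\<^bsub>K\<^esub> else \<zero>\<^bsub>K\<^esub>)"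
      if "a < d" "b < d" for a b
      using \<phi>_combination[OF _ e(1) g(1) that] rep_one[OF that] unfolding e(2)[symmetric] by (simp add: \<phi>_def tensor_one)
  qed (rule z, rule N(1))
  then show ?thesis unfolding mat_trace_def .
qed

text \<open>Expand the second factor of each pure tensor through the generators of \<open>H\<close>;
  the Laurent coefficients become scalars of \<open>K\<close>.\<close>

lemma rep_span:
  assumes g: "g \<in> {..<n} \<rightarrow> carrier H"
    "\<And>x. x \<in> carrier H \<Longrightarrow> \<exists>c \<in> {..<n} \<rightarrow> carrier (laurent_ring I). x = (\<Oplus>\<^bsub>H\<^esub>i\<in>{..<n}. c i \<odot>\<^bsub>H\<^esub> g i)"
    and Y: "Y \<in> carrier KH"
  shows "\<exists>c \<in> {..<n::nat} \<rightarrow> carrier K. \<forall>a<d. \<forall>b<d. \<rho> Y (a, b) = (\<Oplus>\<^bsub>K\<^esub>i\<in>{..<n}. c i \<otimes>\<^bsub>K\<^esub> \<phi> (g i) (a, b))"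
  using Y
proof (induction Y rule: KH_induct)
  case (tensor h x)
  obtain c where c: "c \<in> {..<n} \<rightarrow> carrier (laurent_ring I)" "h = (\<Oplus>\<^bsub>H\<^esub>i\<in>{..<n}. c i \<odot>\<^bsub>H\<^esub> g i)"
    using g(2)[OF tensor(1)] by blast
  show ?case
  proof (intro bexI[of _ "\<lambda>i. x \<otimes>\<^bsub>K\<^esub> \<theta> (c i)"] allI impI)
    fix a b assume ab: "a < d" "b < d"
    have cl: "\<theta> (c i) \<in> carrier K" "\<phi> (g i) (a, b) \<in> carrier K" if "i < n" for i
      using c(1) g(1) that ab by (auto intro!: \<theta>_closed \<phi>_closed)
    have "\<rho> (tensor x h) (a, b) = x \<otimes>\<^bsub>K\<^esub> (\<Oplus>\<^bsub>K\<^esub>i\<in>{..<n}. \<theta> (c i) \<otimes>\<^bsub>K\<^esub> \<phi> (g i) (a, b))"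
      using rep_tensor[OF tensor(2,1) ab] \<phi>_combination[OF _ c(1) g(1) ab] c(2) by simp
    also have "\<dots> = (\<Oplus>\<^bsub>K\<^esub>i\<in>{..<n}. x \<otimes>\<^bsub>K\<^esub> (\<theta> (c i) \<otimes>\<^bsub>K\<^esub> \<phi> (g i) (a, b)))"
      using tensor(2) cl by (intro K.finsum_rdistr) auto
    also have "\<dots> = (\<Oplus>\<^bsub>K\<^esub>i\<in>{..<n}. x \<otimes>\<^bsub>K\<^esub> \<theta> (c i) \<otimes>\<^bsub>K\<^esub> \<phi> (g i) (a, b))"
      using tensor(2) cl by (intro K.finsum_cong') (auto simp: K.m_assoc)
    finally show "\<rho> (tensor x h) (a, b) = (\<Oplus>\<^bsub>K\<^esub>i\<in>{..<n}. x \<otimes>\<^bsub>K\<^esub> \<theta> (c i) \<otimes>\<^bsub>K\<^esub> \<phi> (g i) (a, b))" .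
  next
    show "(\<lambda>i. x \<otimes>\<^bsub>K\<^esub> \<theta> (c i)) \<in> {..<n} \<rightarrow> carrier K" using tensor(2) c(1) by (auto intro!: K.m_closed \<theta>_closed)
  qed
next
  case (add Y Z)
  from add(3) obtain c where c1: "c \<in> {..<n} \<rightarrow> carrier K"
    "\<forall>a<d. \<forall>b<d. \<rho> Y (a, b) = (\<Oplus>\<^bsub>K\<^esub>i\<in>{..<n}. c i \<otimes>\<^bsub>K\<^esub> \<phi> (g i) (a, b))" by (elim bexE)
  from add(4) obtain c' where c2: "c' \<in> {..<n} \<rightarrow> carrier K"
    "\<forall>a<d. \<forall>b<d. \<rho> Z (a, b) = (\<Oplus>\<^bsub>K\<^esub>i\<in>{..<n}. c' i \<otimes>\<^bsub>K\<^esub> \<phi> (g i) (a, b))" by (elim bexE)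
  note c = c1(1) c2(1) c1(2)[rule_format] c2(2)[rule_format]
  show ?case
  proof (intro bexI[of _ "\<lambda>i. c i \<oplus>\<^bsub>K\<^esub> c' i"] allI impI)
    fix a b assume ab: "a < d" "b < d"
    have cl: "\<phi> (g i) (a, b) \<in> carrier K" "c i \<in> carrier K" "c' i \<in> carrier K" if "i < n" for i
      using c(1,2) g(1) that ab by (auto intro!: \<phi>_closed)
    have "\<rho> (Y \<oplus>\<^bsub>KH\<^esub> Z) (a, b) = (\<Oplus>\<^bsub>K\<^esub>i\<in>{..<n}. c i \<otimes>\<^bsub>K\<^esub> \<phi> (g i) (a, b)) \<oplus>\<^bsub>K\<^esub> (\<Oplus>\<^bsub>K\<^esub>i\<in>{..<n}. c' i \<otimes>\<^bsub>K\<^esub> \<phi> (g i) (a, b))"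
      using rep_add[OF add(1,2) ab] c(3,4)[OF ab] by simp
    also have "\<dots> = (\<Oplus>\<^bsub>K\<^esub>i\<in>{..<n}. c i \<otimes>\<^bsub>K\<^esub> \<phi> (g i) (a, b) \<oplus>\<^bsub>K\<^esub> c' i \<otimes>\<^bsub>K\<^esub> \<phi> (g i) (a, b))"
      using cl by (intro K.finsum_addf[symmetric]) auto
    also have "\<dots> = (\<Oplus>\<^bsub>K\<^esub>i\<in>{..<n}. (c i \<oplus>\<^bsub>K\<^esub> c' i) \<otimes>\<^bsub>K\<^esub> \<phi> (g i) (a, b))"
      using cl by (intro K.finsum_cong') (auto simp: K.l_distr)
    finally show "\<rho> (Y \<oplus>\<^bsub>KH\<^esub> Z) (a, b) = (\<Oplus>\<^bsub>K\<^esub>i\<in>{..<n}. (c i \<oplus>\<^bsub>K\<^esub> c' i) \<otimes>\<^bsub>K\<^esub> \<phi> (g i) (a, b))" .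
  qed (use c in auto)
qed

text \<open>The first columns of the matrices in the image form a non-zero invariant subspace, hence
  the whole space by irreducibility, and they are spanned by the first columns of the
  \<open>n\<close> generators. The bound makes the final \<open>N\<close> independent of the
  representation.\<close>

lemma irreducible_dimension:
  assumes irr: "irreducible_matrix_rep K KH d \<rho>" and gen: "module_generated_by (laurent_ring I) H n"
  shows "d \<le> n"
proof -
  have d: "0 < d" using irr by (simp add: irreducible_matrix_rep_def)
  obtain g where g: "g \<in> {..<n} \<rightarrow> carrier H"
    "\<And>x. x \<in> carrier H \<Longrightarrow> \<exists>c \<in> {..<n} \<rightarrow> carrier (laurent_ring I). x = (\<Oplus>\<^bsub>H\<^esub>i\<in>{..<n}. c i \<odot>\<^bsub>H\<^esub> g i)"
    using gen unfolding module_generated_by_def by blast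
  define col where "col Y = (\<lambda>a\<in>{..<d}. \<rho> Y (a, 0))" for Y
  define U where "U = col ` carrier KH"
  have act: "mat_act K d (\<rho> Y) (col Z) = col (Y \<otimes>\<^bsub>KH\<^esub> Z)" if YZ: "Y \<in> carrier KH" "Z \<in> carrier KH" for Y Z
  proof -
    have "(\<Oplus>\<^bsub>K\<^esub>j\<in>{..<d}. \<rho> Y (a, j) \<otimes>\<^bsub>K\<^esub> col Z j) = \<rho> (Y \<otimes>\<^bsub>KH\<^esub> Z) (a, 0)" if a: "a < d" for a
      unfolding rep_mult[OF YZ a d]
      by (rule K.finsum_cong') (use YZ a d in \<open>auto simp: col_def rep_closed\<close>)
    then show ?thesis by (auto simp: mat_act_def col_def intro!: restrict_ext)
  qed
  have col_smult: "(\<lambda>i\<in>{..<d}. c \<otimes>\<^bsub>K\<^esub> col Y i) = col (c \<odot>\<^bsub>KH\<^esub> Y)"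
    if "c \<in> carrier K" "Y \<in> carrier KH" for c Y
    using that d by (auto simp: col_def rep_smult intro!: restrict_ext)
  have col_add: "(\<lambda>i\<in>{..<d}. col Y i \<oplus>\<^bsub>K\<^esub> col Z i) = col (Y \<oplus>\<^bsub>KH\<^esub> Z)"
    if "Y \<in> carrier KH" "Z \<in> carrier KH" for Y Z
    using that d by (auto simp: col_def rep_add intro!: restrict_ext)
  have sub: "U \<subseteq> {..<d} \<rightarrow>\<^sub>E carrier K"
    using d by (auto simp: U_def col_def rep_closed)
  have smult_U: "\<forall>c\<in>carrier K. \<forall>u\<in>U. (\<lambda>i\<in>{..<d}. c \<otimes>\<^bsub>K\<^esub> u i) \<in> U"
    unfolding U_def by (intro ballI, elim imageE) (simp add: col_smult smult_KH_closed)
  have add_U: "\<forall>u\<in>U. \<forall>v\<in>U. (\<lambda>i\<in>{..<d}. u i \<oplus>\<^bsub>K\<^esub> v i) \<in> U"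
    unfolding U_def by (intro ballI, elim imageE) (simp add: col_add)
  have "(\<lambda>i\<in>{..<d}. \<zero>\<^bsub>K\<^esub>) = (\<lambda>i\<in>{..<d}. \<zero>\<^bsub>K\<^esub> \<otimes>\<^bsub>K\<^esub> col \<one>\<^bsub>KH\<^esub> i)"
    using d by (intro restrict_ext) (simp add: col_def rep_closed)
  then have zero_U: "(\<lambda>i\<in>{..<d}. \<zero>\<^bsub>K\<^esub>) \<in> U"
    using col_smult[of "\<zero>\<^bsub>K\<^esub>" "\<one>\<^bsub>KH\<^esub>"] by (simp add: U_def smult_KH_closed)
  have "coord_subspace K d U"
    unfolding coord_subspace_def by (intro conjI sub zero_U add_U smult_U)
  moreover have "\<forall>Y\<in>carrier KH. \<forall>u\<in>U. mat_act K d (\<rho> Y) u \<in> U"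
    using act by (auto simp: U_def)
  moreover have "U \<noteq> {\<lambda>i\<in>{..<d}. \<zero>\<^bsub>K\<^esub>}"
  proof
    assume "U = {\<lambda>i\<in>{..<d}. \<zero>\<^bsub>K\<^esub>}"
    moreover have "col \<one>\<^bsub>KH\<^esub> \<in> U" by (simp add: U_def)
    ultimately have "col \<one>\<^bsub>KH\<^esub> 0 = \<zero>\<^bsub>K\<^esub>" using d by simp
    then show False using d by (simp add: col_def rep_one)
  qed
  ultimately have U: "U = {..<d} \<rightarrow>\<^sub>E carrier K"
    using irr unfolding irreducible_matrix_rep_def by blast
  \<comment> \<open>Each unit vector is a combination of the \<open>n\<close> first columns, so the
    identity of size \<open>d\<close> factors through dimension \<open>n\<close>.\<close>
  have "\<exists>c. b < d \<longrightarrow> c \<in> {..<n} \<rightarrow> carrier K \<and>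
      (\<forall>a<d. (\<Oplus>\<^bsub>K\<^esub>i\<in>{..<n}. c i \<otimes>\<^bsub>K\<^esub> \<phi> (g i) (a, 0)) = (if a = b then \<one>\<^bsub>K\<^esub> else \<zero>\<^bsub>K\<^esub>))" for b
  proof -
    have "(\<lambda>a\<in>{..<d}. if a = b then \<one>\<^bsub>K\<^esub> else \<zero>\<^bsub>K\<^esub>) \<in> U" unfolding U by auto
    then obtain Y where Y: "Y \<in> carrier KH" "(\<lambda>a\<in>{..<d}. if a = b then \<one>\<^bsub>K\<^esub> else \<zero>\<^bsub>K\<^esub>) = col Y"
      unfolding U_def by blast
    have eq: "\<rho> Y (a, 0) = (if a = b then \<one>\<^bsub>K\<^esub> else \<zero>\<^bsub>K\<^esub>)" if "a < d" for a
      using fun_cong[OF Y(2), of a] that by (simp add: col_def)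
    have "\<exists>c\<in>{..<n} \<rightarrow> carrier K. \<forall>a<d. \<forall>b<d.
        \<rho> Y (a, b) = (\<Oplus>\<^bsub>K\<^esub>i\<in>{..<n}. c i \<otimes>\<^bsub>K\<^esub> \<phi> (g i) (a, b))"
      by (rule rep_span[OF g(1) _ Y(1)]) (rule g(2))
    then obtain c where "c \<in> {..<n} \<rightarrow> carrier K"
      "\<forall>a<d. \<forall>b<d. \<rho> Y (a, b) = (\<Oplus>\<^bsub>K\<^esub>i\<in>{..<n}. c i \<otimes>\<^bsub>K\<^esub> \<phi> (g i) (a, b))" by (elim bexE)
    then show ?thesis using eq d by (intro exI[of _ c]) auto
  qed
  then have "\<forall>b. \<exists>c. b < d \<longrightarrow> c \<in> {..<n} \<rightarrow> carrier K \<and>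
      (\<forall>a<d. (\<Oplus>\<^bsub>K\<^esub>i\<in>{..<n}. c i \<otimes>\<^bsub>K\<^esub> \<phi> (g i) (a, 0)) = (if a = b then \<one>\<^bsub>K\<^esub> else \<zero>\<^bsub>K\<^esub>))" by (rule allI)
  from choice[OF this] obtain c where "\<forall>b. b < d \<longrightarrow> c b \<in> {..<n} \<rightarrow> carrier K \<and>
      (\<forall>a<d. (\<Oplus>\<^bsub>K\<^esub>i\<in>{..<n}. c b i \<otimes>\<^bsub>K\<^esub> \<phi> (g i) (a, 0)) = (if a = b then \<one>\<^bsub>K\<^esub> else \<zero>\<^bsub>K\<^esub>))"
    by (elim exE)
  then have c: "\<And>b. b < d \<Longrightarrow> c b \<in> {..<n} \<rightarrow> carrier K"
    "\<And>a b. a < d \<Longrightarrow> b < d \<Longrightarrow> (\<Oplus>\<^bsub>K\<^esub>i\<in>{..<n}. c b i \<otimes>\<^bsub>K\<^esub> \<phi> (g i) (a, 0)) = (if a = b then \<one>\<^bsub>K\<^esub> else \<zero>\<^bsub>K\<^esub>)"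
    by simp_all
  show "d \<le> n"
  proof (rule identity_factor_dimension_K[of d n "\<lambda>b i. c b i" "\<lambda>i a. \<phi> (g i) (a, 0)"])
    show "(\<Oplus>\<^bsub>K\<^esub>i\<in>{..<n}. c a i \<otimes>\<^bsub>K\<^esub> \<phi> (g i) (b, 0)) = (if a = b then \<one>\<^bsub>K\<^esub> else \<zero>\<^bsub>K\<^esub>)" if "a < d" "b < d" for a b
      using c(2)[OF that(2,1)] by auto
  qed (use c(1) g(1) d in \<open>auto intro!: \<phi>_closed\<close>)
qed

end

section \<open>Twisting representations by translations\<close>

context extended_algebra
begin

text \<open>Only the coefficients are translated; the map induced on the extended algebra is
  semilinear over \<open>K\<close>.\<close>

definition lift :: "('i \<Rightarrow> complex) \<Rightarrow> ('h \<Rightarrow> 'i fun_quot) \<Rightarrow> 'h \<Rightarrow> 'i fun_quot" where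
  "lift w f = (\<lambda>x. translate w (f x))"

lemma lift_closed: "f \<in> carrier MR.M \<Longrightarrow> lift w f \<in> carrier MR.M"
  by (simp add: MR.carrier_iff lift_def translate_eq_zero_iff translate_closed)

lemma lift_uminus_cancel: "lift w (lift (\<lambda>i. - w i) f) = f"
  by (simp add: lift_def translate_uminus_cancel)

lemma lift_uminus_cancel': "lift (\<lambda>i. - w i) (lift w f) = f"
  by (simp add: lift_def translate_uminus_cancel')

lemma lift_elem: "lift w (monoid_elem K a x) = monoid_elem K a (translate w x)"
proof
  fix y
  show "lift w (monoid_elem K a x) y = monoid_elem K a (translate w x) y"
    unfolding lift_def monoid_elem_def by (rule HOL.trans[OF if_distrib[of "translate w"]]) (simp only: translate_zero)
qed

lemma lift_add: "f \<in> carrier MR.M \<Longrightarrow> g \<in> carrier MR.M \<Longrightarrow> lift w (f \<oplus>\<^bsub>MR.M\<^esub> g) = lift w f \<oplus>\<^bsub>MR.M\<^esub> lift w g"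
  by (simp add: lift_def MR.add_eq translate_add MR.carrier_iff)

lemma lift_smult: "c \<in> carrier K \<Longrightarrow> f \<in> carrier MR.M \<Longrightarrow> lift w (c \<odot>\<^bsub>MR.M\<^esub> f) = translate w c \<odot>\<^bsub>MR.M\<^esub> lift w f"
  by (simp add: lift_def MR.smult_eq translate_mult MR.carrier_iff)

lemma lift_mult:
  assumes f: "f \<in> carrier MR.M" and g: "g \<in> carrier MR.M"
  shows "lift w (f \<otimes>\<^bsub>MR.M\<^esub> g) = lift w f \<otimes>\<^bsub>MR.M\<^esub> lift w g"
proof
  fix x
  let ?A = "{x. f x \<noteq> \<zero>\<^bsub>K\<^esub>}" and ?B = "{x. g x \<noteq> \<zero>\<^bsub>K\<^esub>}"
  have fin: "finite ?A" "finite ?B" and c: "\<And>y. f y \<in> carrier K" "\<And>y. g y \<in> carrier K"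
    using f g by (simp_all add: MR.carrier_iff)
  let ?t = "\<lambda>f g p. if fst p \<otimes>\<^bsub>H\<^esub> snd p = x then f (fst p) \<otimes>\<^bsub>K\<^esub> g (snd p) else \<zero>\<^bsub>K\<^esub>"
  have t_closed: "?t f g p \<in> carrier K" if "\<And>y. f y \<in> carrier K" "\<And>y. g y \<in> carrier K" for f g p
    by (cases "fst p \<otimes>\<^bsub>H\<^esub> snd p = x") (simp_all only: simp_thms if_True if_False K.m_closed that K.zero_closed)
  have tr: "translate w (?t f g p) = ?t (lift w f) (lift w g) p" for p
    unfolding lift_def
    by (cases "fst p \<otimes>\<^bsub>H\<^esub> snd p = x") (simp_all only: simp_thms if_True if_False translate_mult[OF c] translate_zero)
  have cl: "lift w f y \<in> carrier K" "lift w g y \<in> carrier K" for y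
    unfolding lift_def by (rule translate_closed[OF c(1)], rule translate_closed[OF c(2)])
  have "lift w (f \<otimes>\<^bsub>MR.M\<^esub> g) x = translate w (\<Oplus>\<^bsub>K\<^esub>p\<in>?A \<times> ?B. ?t f g p)"
    unfolding lift_def MR.mult_superset[OF f g fin(1) order_refl fin(2) order_refl] ..
  also have "\<dots> = (\<Oplus>\<^bsub>K\<^esub>p\<in>?A \<times> ?B. translate w (?t f g p))"
    by (rule translate_finsum) (rule Pi_I, rule t_closed[OF c])
  also have "\<dots> = (\<Oplus>\<^bsub>K\<^esub>p\<in>?A \<times> ?B. ?t (lift w f) (lift w g) p)"
    unfolding tr ..
  also have "\<dots> = (lift w f \<otimes>\<^bsub>MR.M\<^esub> lift w g) x"
  proof (rule MR.mult_superset[symmetric, OF lift_closed[OF f] lift_closed[OF g] fin(1) _ fin(2)])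
    show "{x. lift w f x \<noteq> \<zero>\<^bsub>K\<^esub>} \<subseteq> ?A" "{x. lift w g x \<noteq> \<zero>\<^bsub>K\<^esub>} \<subseteq> ?B"
      unfolding lift_def translate_eq_zero_iff by (rule subset_refl)+
  qed
  finally show "lift w (f \<otimes>\<^bsub>MR.M\<^esub> g) x = (lift w f \<otimes>\<^bsub>MR.M\<^esub> lift w g) x" .
qed

lemma lift_zero: "lift w \<zero>\<^bsub>MR.M\<^esub> = \<zero>\<^bsub>MR.M\<^esub>"
  by (simp add: lift_def MR.zero_eq translate_zero)

lemma lift_one: "lift w \<one>\<^bsub>MR.M\<^esub> = \<one>\<^bsub>MR.M\<^esub>"
  by (simp only: MR.one_eq lift_elem translate_one)

lemma lift_uminus:
  assumes f: "f \<in> carrier MR.M"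
  shows "lift w (\<ominus>\<^bsub>MR.M\<^esub> f) = \<ominus>\<^bsub>MR.M\<^esub> lift w f"
proof (rule M.minus_equality[symmetric])
  show "lift w (\<ominus>\<^bsub>MR.M\<^esub> f) \<oplus>\<^bsub>MR.M\<^esub> lift w f = \<zero>\<^bsub>MR.M\<^esub>"
    using lift_add[OF M.a_inv_closed[OF f] f, of w] by (simp add: M.l_neg f lift_zero)
qed (intro lift_closed M.a_inv_closed f)+

text \<open>The elements sent into \<open>J\<close> form an ideal. It contains the tensor relations,
  whose coefficients \<open>1\<close>, \<open>- 1\<close> and \<open>\<theta> r\<close> are fixed by
  integral translations, so it contains \<open>J\<close> by minimality.\<close>

lemma lift_J:
  assumes w: "integral_shift w" and f: "f \<in> J"
  shows "lift w f \<in> J"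
proof -
  let ?J = "{f \<in> carrier MR.M. lift w f \<in> J}"
  have id: "ideal ?J MR.M"
  proof (rule idealI[OF M.ring_axioms])
    show "subgroup ?J (add_monoid MR.M)"
    proof (rule group.subgroupI[OF M.a_group])
      show "?J \<subseteq> carrier (add_monoid MR.M)" by auto
      have "\<zero>\<^bsub>MR.M\<^esub> \<in> ?J" by (simp add: J.zero_closed lift_zero)
      then show "?J \<noteq> {}" by blast
      show "inv\<^bsub>add_monoid MR.M\<^esub> a \<in> ?J" if "a \<in> ?J" for a
      proof -
        have a: "a \<in> carrier MR.M" "lift w a \<in> J" using that by simp_all
        then have "lift w (\<ominus>\<^bsub>MR.M\<^esub> a) \<in> J" using J.a_inv_closed by (simp add: lift_uminus)
        then show ?thesis using a by (simp add: a_inv_def[symmetric])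
      qed
      show "a \<otimes>\<^bsub>add_monoid MR.M\<^esub> b \<in> ?J" if "a \<in> ?J" "b \<in> ?J" for a b
        using that J.a_closed by (simp add: lift_add)
    qed
    show "x \<otimes>\<^bsub>MR.M\<^esub> a \<in> ?J" if "a \<in> ?J" "x \<in> carrier MR.M" for a x
      using that by (simp add: lift_mult J.I_l_closed lift_closed)
    show "a \<otimes>\<^bsub>MR.M\<^esub> x \<in> ?J" if "a \<in> ?J" "x \<in> carrier MR.M" for a x
      using that by (simp add: lift_mult J.I_r_closed lift_closed)
  qed
  have rel: "tensor_relations (laurent_ring I) K \<theta> H \<subseteq> ?J"
  proof
    fix x assume x: "x \<in> tensor_relations (laurent_ring I) K \<theta> H"
    have xM: "x \<in> carrier MR.M" and xJ: "x \<in> J"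
      using x tensor_relations_closed tensor_relations_J by blast+
    have minus: "lift w (a \<ominus>\<^bsub>MR.M\<^esub> b) = lift w a \<ominus>\<^bsub>MR.M\<^esub> lift w b"
      if "a \<in> carrier MR.M" "b \<in> carrier MR.M" for a b
      using that by (simp add: M.minus_eq lift_add lift_uminus)
    have "lift w x = x"
      using x unfolding tensor_relations_def Let_def
    proof
      assume "x \<in> {monoid_elem K (a \<oplus>\<^bsub>H\<^esub> b) \<one>\<^bsub>K\<^esub> \<ominus>\<^bsub>MR.M\<^esub> (monoid_elem K a \<one>\<^bsub>K\<^esub> \<oplus>\<^bsub>MR.M\<^esub> monoid_elem K b \<one>\<^bsub>K\<^esub>) |a b.
          a \<in> carrier H \<and> b \<in> carrier H}"
      then show ?thesis
        by (elim CollectE exE conjE) (simp add: minus lift_add lift_elem translate_one MR.elem_closed)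
    next
      assume "x \<in> {monoid_elem K (r \<odot>\<^bsub>H\<^esub> a) \<one>\<^bsub>K\<^esub> \<ominus>\<^bsub>MR.M\<^esub> monoid_elem K a (\<theta> r) |r a.
          r \<in> carrier (laurent_ring I) \<and> a \<in> carrier H}"
      then show ?thesis
        by (elim CollectE exE conjE)
          (simp add: minus lift_elem translate_one MR.elem_closed smult_H \<theta>_closed translate_\<theta>[OF w])
    qed
    then show "x \<in> ?J" using xM xJ by simp
  qed
  have "f \<in> Idl\<^bsub>MR.M\<^esub> (tensor_relations (laurent_ring I) K \<theta> H)"
    using f by (simp only: J_def tensor_ideal_def)
  then have "f \<in> ?J" by (rule subsetD[OF M.genideal_minimal[OF id rel]])
  then show ?thesis by simp
qed

end

context extended_algebra
begin

definition lift_coset where "lift_coset w Y = lift w ` Y"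

text \<open>One inclusion uses that lifts preserve \<open>J\<close>; the other is the same inclusion
  for \<open>- w\<close>.\<close>

lemma lift_coset:
  assumes w: "integral_shift w" and f: "f \<in> carrier MR.M"
  shows "lift_coset w (coset f) = coset (lift w f)"
proof -
  have sub: "lift_coset w (coset f) \<subseteq> coset (lift w f)" if "integral_shift w" "f \<in> carrier MR.M" for w f
  proof
    fix x assume "x \<in> lift_coset w (coset f)"
    then obtain j where j: "j \<in> J" "x = lift w (j \<oplus>\<^bsub>MR.M\<^esub> f)"
      unfolding lift_coset_def coset_def a_r_coset_def' by blast
    then have "x = lift w j \<oplus>\<^bsub>MR.M\<^esub> lift w f" using that J.Icarr by (simp add: lift_add)
    then show "x \<in> coset (lift w f)"
      unfolding coset_def a_r_coset_def' using lift_J[OF that(1) j(1)] by blast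
  qed
  show ?thesis
  proof (rule antisym[OF sub[OF w f]], rule subsetI)
    fix x assume x: "x \<in> coset (lift w f)"
    have "lift (\<lambda>i. - w i) x \<in> lift_coset (\<lambda>i. - w i) (coset (lift w f))"
      unfolding lift_coset_def using x by (rule imageI)
    then have "lift (\<lambda>i. - w i) x \<in> coset f"
      using sub[OF integral_shift_uminus[OF w] lift_closed[OF f, of w]] by (simp add: lift_uminus_cancel' subset_iff)
    then have "lift w (lift (\<lambda>i. - w i) x) \<in> lift_coset w (coset f)"
      unfolding lift_coset_def by (rule imageI)
    then show "x \<in> lift_coset w (coset f)" by (simp add: lift_uminus_cancel)
  qed
qed

lemma lift_coset_uminus_cancel: "lift_coset w (lift_coset (\<lambda>i. - w i) Y) = Y"
  by (simp add: lift_coset_def image_image lift_uminus_cancel)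

lemma lift_coset_closed: "integral_shift w \<Longrightarrow> Y \<in> carrier KH \<Longrightarrow> lift_coset w Y \<in> carrier KH"
  by (elim KH_carrierE) (simp add: lift_coset coset_closed lift_closed)

lemma lift_coset_ops:
  assumes w: "integral_shift w" and Y: "Y \<in> carrier KH" and Z: "Z \<in> carrier KH"
  shows "lift_coset w (Y \<otimes>\<^bsub>KH\<^esub> Z) = lift_coset w Y \<otimes>\<^bsub>KH\<^esub> lift_coset w Z"
    and "lift_coset w (Y \<oplus>\<^bsub>KH\<^esub> Z) = lift_coset w Y \<oplus>\<^bsub>KH\<^esub> lift_coset w Z"
    and "c \<in> carrier K \<Longrightarrow> lift_coset w (c \<odot>\<^bsub>KH\<^esub> Y) = translate w c \<odot>\<^bsub>KH\<^esub> lift_coset w Y"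
proof -
  obtain f where f: "f \<in> carrier MR.M" "Y = coset f" using KH_carrierE[OF Y] .
  obtain g where g: "g \<in> carrier MR.M" "Z = coset g" using KH_carrierE[OF Z] .
  show "lift_coset w (Y \<otimes>\<^bsub>KH\<^esub> Z) = lift_coset w Y \<otimes>\<^bsub>KH\<^esub> lift_coset w Z"
    using f g by (simp add: lift_coset[OF w] coset_mult[symmetric] lift_mult lift_closed)
  show "lift_coset w (Y \<oplus>\<^bsub>KH\<^esub> Z) = lift_coset w Y \<oplus>\<^bsub>KH\<^esub> lift_coset w Z"
    using f g by (simp add: lift_coset[OF w] coset_add[symmetric] lift_add lift_closed)
  show "lift_coset w (c \<odot>\<^bsub>KH\<^esub> Y) = translate w c \<odot>\<^bsub>KH\<^esub> lift_coset w Y" if "c \<in> carrier K"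
    using f that by (simp add: lift_coset[OF w] coset_smult lift_smult lift_closed MR.smult_closed translate_closed)
qed

lemma lift_coset_one: "integral_shift w \<Longrightarrow> lift_coset w \<one>\<^bsub>KH\<^esub> = \<one>\<^bsub>KH\<^esub>"
  using lift_coset[OF _ M.one_closed, of w] by (simp only: lift_one coset_one)

lemma lift_coset_tensor:
  "integral_shift w \<Longrightarrow> x \<in> carrier K \<Longrightarrow> h \<in> carrier H \<Longrightarrow> lift_coset w (tensor x h) = tensor (translate w x) h"
  by (simp add: tensor_def lift_coset MR.elem_closed lift_elem)

end

context extended_algebra_rep
begin

text \<open>The lift by \<open>- w\<close> translates scalars one way and the translation of the
  entries moves them back, so the composite is linear over \<open>K\<close>.\<close>

definition twist where
  "twist w Y = (\<lambda>p\<in>{..<d} \<times> {..<d}. translate w (\<rho> (lift_coset (\<lambda>i. - w i) Y) p))"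

lemma twist_rep:
  assumes w: "integral_shift w"
  shows "matrix_rep K KH d (twist w)"
proof -
  let ?v = "\<lambda>i. - w i"
  have v: "integral_shift ?v" by (rule integral_shift_uminus[OF w])
  note cl = lift_coset_closed[OF v]
  have hom: "twist w \<in> Ring.ring_hom KH (mat_algebra K d)"
  proof (rule ring_hom_memI)
    fix Y assume Y: "Y \<in> carrier KH"
    show "twist w Y \<in> carrier (mat_algebra K d)"
      unfolding mat_algebra_simps(1) twist_def using Y
      by (auto intro!: translate_closed rep_closed cl)
    fix Z assume Z: "Z \<in> carrier KH"
    have "translate w (\<rho> (lift_coset ?v (Y \<otimes>\<^bsub>KH\<^esub> Z)) (a, b)) =
        (\<Oplus>\<^bsub>K\<^esub>m\<in>{..<d}. twist w Y (a, m) \<otimes>\<^bsub>K\<^esub> twist w Z (m, b))" if ab: "a < d" "b < d" for a b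
    proof -
      have r: "\<rho> (lift_coset ?v Y) (a, m) \<in> carrier K" "\<rho> (lift_coset ?v Z) (m, b) \<in> carrier K" if "m < d" for m
        using rep_closed[OF cl[OF Y] ab(1) that] rep_closed[OF cl[OF Z] that ab(2)] by simp_all
      have t: "twist w Y (a, m) = translate w (\<rho> (lift_coset ?v Y) (a, m))"
        "twist w Z (m, b) = translate w (\<rho> (lift_coset ?v Z) (m, b))" if "m < d" for m
        using that ab by (simp_all add: twist_def)
      have "translate w (\<rho> (lift_coset ?v (Y \<otimes>\<^bsub>KH\<^esub> Z)) (a, b)) =
          (\<Oplus>\<^bsub>K\<^esub>m\<in>{..<d}. translate w (\<rho> (lift_coset ?v Y) (a, m) \<otimes>\<^bsub>K\<^esub> \<rho> (lift_coset ?v Z) (m, b)))"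
        unfolding lift_coset_ops(1)[OF v Y Z] rep_mult[OF cl[OF Y] cl[OF Z] ab]
        by (rule translate_finsum, rule Pi_I) (use r in simp)
      also have "\<dots> = (\<Oplus>\<^bsub>K\<^esub>m\<in>{..<d}. twist w Y (a, m) \<otimes>\<^bsub>K\<^esub> twist w Z (m, b))"
        by (rule K.finsum_cong'[OF HOL.refl]) (use r t in \<open>simp_all add: translate_mult translate_closed\<close>)
      finally show ?thesis .
    qed
    then show "twist w (Y \<otimes>\<^bsub>KH\<^esub> Z) = twist w Y \<otimes>\<^bsub>mat_algebra K d\<^esub> twist w Z"
      by (auto simp: twist_def[of w "Y \<otimes>\<^bsub>KH\<^esub> Z"] mat_algebra_def intro!: restrict_ext)
    show "twist w (Y \<oplus>\<^bsub>KH\<^esub> Z) = twist w Y \<oplus>\<^bsub>mat_algebra K d\<^esub> twist w Z"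
      by (auto simp: twist_def mat_algebra_def lift_coset_ops(2)[OF v Y Z] rep_add cl Y Z translate_add rep_closed
          intro!: restrict_ext)
  next
    show "twist w \<one>\<^bsub>KH\<^esub> = \<one>\<^bsub>mat_algebra K d\<^esub>"
      by (auto simp: twist_def mat_algebra_def lift_coset_one[OF v] rep_one translate_one translate_zero
          intro!: restrict_ext)
  qed
  have smult: "twist w (c \<odot>\<^bsub>KH\<^esub> Y) = c \<odot>\<^bsub>mat_algebra K d\<^esub> twist w Y" if c: "c \<in> carrier K" and Y: "Y \<in> carrier KH" for c Y
  proof -
    have "translate w (\<rho> (lift_coset ?v (c \<odot>\<^bsub>KH\<^esub> Y)) (a, b)) = c \<otimes>\<^bsub>K\<^esub> translate w (\<rho> (lift_coset ?v Y) (a, b))"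
      if "a < d" "b < d" for a b
      using that c Y
      by (simp add: lift_coset_ops(3)[OF v Y Y c] rep_smult cl translate_closed translate_mult rep_closed
          translate_uminus_cancel)
    then show ?thesis by (auto simp: twist_def mat_algebra_def intro!: restrict_ext)
  qed
  show ?thesis unfolding matrix_rep_def using hom smult by simp
qed

text \<open>On elements fixed by the lift this identifies the character of the twist with the
  translate of the original character, so the set of character values is stable under
  translation.\<close>

lemma twist_trace:
  assumes w: "integral_shift w" and Y: "Y \<in> carrier KH"
  shows "mat_trace K d (twist w Y) = translate w (mat_trace K d (\<rho> (lift_coset (\<lambda>i. - w i) Y)))"
proof -
  note cl = lift_coset_closed[OF integral_shift_uminus[OF w] Y]
  have "translate w (mat_trace K d (\<rho> (lift_coset (\<lambda>i. - w i) Y)))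
      = (\<Oplus>\<^bsub>K\<^esub>i\<in>{..<d}. translate w (\<rho> (lift_coset (\<lambda>i. - w i) Y) (i, i)))"
    unfolding mat_trace_def by (rule translate_finsum) (auto intro!: rep_closed cl)
  also have "\<dots> = mat_trace K d (twist w Y)"
    unfolding mat_trace_def by (rule K.finsum_cong') (auto simp: twist_def intro!: translate_closed rep_closed cl)
  finally show ?thesis ..
qed

lemma twist_row:
  assumes w: "integral_shift w" and Y: "Y \<in> carrier KH" and a: "a < d" and u: "\<And>j. j < d \<Longrightarrow> u j \<in> carrier K"
  shows "(\<Oplus>\<^bsub>K\<^esub>j\<in>{..<d}. \<rho> Y (a, j) \<otimes>\<^bsub>K\<^esub> translate (\<lambda>i. - w i) (u j))
      = translate (\<lambda>i. - w i) (\<Oplus>\<^bsub>K\<^esub>j\<in>{..<d}. twist w (lift_coset w Y) (a, j) \<otimes>\<^bsub>K\<^esub> u j)" (is "?l = translate ?v _")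
proof -
  have LL: "lift_coset ?v (lift_coset w Y) = Y"
    using lift_coset_uminus_cancel[of ?v Y] by simp
  have tc: "twist w (lift_coset w Y) (a, j) = translate w (\<rho> Y (a, j))" if "j < d" for j
    using that a by (simp add: twist_def LL)
  have rj: "\<rho> Y (a, j) \<in> carrier K" if "j < d" for j
    using rep_closed[OF Y a that] .
  have tj: "twist w (lift_coset w Y) (a, j) \<otimes>\<^bsub>K\<^esub> u j \<in> carrier K" if "j < d" for j
    unfolding tc[OF that] by (rule K.m_closed[OF translate_closed[OF rj[OF that]] u[OF that]])
  have tm: "translate ?v (twist w (lift_coset w Y) (a, j) \<otimes>\<^bsub>K\<^esub> u j) = \<rho> Y (a, j) \<otimes>\<^bsub>K\<^esub> translate ?v (u j)"
    if "j < d" for j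
    by (simp only: tc[OF that] translate_mult[OF translate_closed[OF rj[OF that]] u[OF that]]
      translate_uminus_cancel')
  have "translate ?v (\<Oplus>\<^bsub>K\<^esub>j\<in>{..<d}. twist w (lift_coset w Y) (a, j) \<otimes>\<^bsub>K\<^esub> u j)
      = (\<Oplus>\<^bsub>K\<^esub>j\<in>{..<d}. translate ?v (twist w (lift_coset w Y) (a, j) \<otimes>\<^bsub>K\<^esub> u j))"
    by (rule translate_finsum, rule Pi_I, rule tj) simp
  also have "\<dots> = ?l"
  proof (rule K.finsum_cong'[OF HOL.refl])
    show "(\<lambda>j. \<rho> Y (a, j) \<otimes>\<^bsub>K\<^esub> translate ?v (u j)) \<in> {..<d} \<rightarrow> carrier K"
      by (rule Pi_I) (simp add: rj translate_closed u)
  qed (simp only: lessThan_iff tm)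
  finally show ?thesis by (rule HOL.sym)
qed

text \<open>The semilinear bijection of coordinate spaces given by translation by \<open>- w\<close>
  carries subspaces invariant under the twist to subspaces invariant under
  \<open>\<rho>\<close>.\<close>

lemma twist_irreducible:
  assumes w: "integral_shift w" and irr: "irreducible_matrix_rep K KH d \<rho>"
  shows "irreducible_matrix_rep K KH d (twist w)"
proof -
  let ?v = "\<lambda>i. - w i"
  have v: "integral_shift ?v" by (rule integral_shift_uminus[OF w])
  define tv where "tv u w = (\<lambda>i\<in>{..<d}. translate w (u i))" for u :: "nat \<Rightarrow> 'i fun_quot" and w
  have tv_tv: "tv (tv u ?v) w = u" "tv (tv u w) ?v = u" if "u \<in> {..<d} \<rightarrow>\<^sub>E carrier K" for u
  proof -
    have "tv (tv u ?v) w i = u i \<and> tv (tv u w) ?v i = u i" for i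
    proof (cases "i < d")
      case True
      then show ?thesis by (simp add: tv_def translate_uminus_cancel translate_uminus_cancel')
    next
      case False
      then show ?thesis using PiE_arb[OF that, of i] by (simp add: tv_def)
    qed
    note pointwise = this
    show "tv (tv u ?v) w = u" by (rule ext) (rule pointwise[THEN conjunct1])
    show "tv (tv u w) ?v = u" by (rule ext) (rule pointwise[THEN conjunct2])
  qed
  have tv_closed: "tv u w \<in> {..<d} \<rightarrow>\<^sub>E carrier K" if "u \<in> {..<d} \<rightarrow>\<^sub>E carrier K" for u w
    unfolding tv_def by (rule restrict_PiE_iff[THEN iffD2], rule ballI, rule translate_closed, rule PiE_mem[OF that])
  have tv_zero: "tv (\<lambda>i\<in>{..<d}. \<zero>\<^bsub>K\<^esub>) w = (\<lambda>i\<in>{..<d}. \<zero>\<^bsub>K\<^esub>)" for w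
    unfolding tv_def by (rule restrict_ext) (simp only: restrict_apply' translate_zero)
  have "U = {\<lambda>i\<in>{..<d}. \<zero>\<^bsub>K\<^esub>} \<or> U = ({..<d} \<rightarrow>\<^sub>E carrier K)"
    if U: "coord_subspace K d U" and inv: "\<forall>Y\<in>carrier KH. \<forall>u\<in>U. mat_act K d (twist w Y) u \<in> U" for U
  proof -
    define V where "V = (\<lambda>u. tv u ?v) ` U"
    have U1: "U \<subseteq> {..<d} \<rightarrow>\<^sub>E carrier K" and U2: "(\<lambda>i\<in>{..<d}. \<zero>\<^bsub>K\<^esub>) \<in> U"
      and U3: "\<forall>u\<in>U. \<forall>v\<in>U. (\<lambda>i\<in>{..<d}. u i \<oplus>\<^bsub>K\<^esub> v i) \<in> U"
      and U4: "\<forall>c\<in>carrier K. \<forall>u\<in>U. (\<lambda>i\<in>{..<d}. c \<otimes>\<^bsub>K\<^esub> u i) \<in> U"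
      using U unfolding coord_subspace_def by simp_all
    have Uc: "u i \<in> carrier K" if "u \<in> U" "i < d" for u i using that U1 by auto
    have V1: "V \<subseteq> {..<d} \<rightarrow>\<^sub>E carrier K"
      unfolding V_def by (rule image_subsetI, rule tv_closed, rule subsetD[OF U1])
    have V2: "(\<lambda>i\<in>{..<d}. \<zero>\<^bsub>K\<^esub>) \<in> V"
      unfolding V_def by (rule image_eqI[where f = "\<lambda>u. tv u ?v", OF tv_zero[symmetric] U2])
    have V3: "\<forall>u\<in>V. \<forall>v\<in>V. (\<lambda>i\<in>{..<d}. u i \<oplus>\<^bsub>K\<^esub> v i) \<in> V"
    proof (intro ballI)
      fix x y assume "x \<in> V" "y \<in> V"
      then obtain u u' where u: "u \<in> U" "u' \<in> U" "x = tv u ?v" "y = tv u' ?v" unfolding V_def by blast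
      have eq: "(\<lambda>i\<in>{..<d}. x i \<oplus>\<^bsub>K\<^esub> y i) = tv (\<lambda>i\<in>{..<d}. u i \<oplus>\<^bsub>K\<^esub> u' i) ?v"
        unfolding u(3,4) tv_def
        by (rule restrict_ext) (simp only: restrict_apply' lessThan_iff translate_add[OF Uc[OF u(1)] Uc[OF u(2)]])
      show "(\<lambda>i\<in>{..<d}. x i \<oplus>\<^bsub>K\<^esub> y i) \<in> V"
        unfolding V_def by (rule image_eqI[where f = "\<lambda>u. tv u ?v", OF eq]) (rule U3[rule_format, OF u(1,2)])
    qed
    have V4: "\<forall>c\<in>carrier K. \<forall>u\<in>V. (\<lambda>i\<in>{..<d}. c \<otimes>\<^bsub>K\<^esub> u i) \<in> V"
    proof (intro ballI)
      fix c x assume c: "c \<in> carrier K" and "x \<in> V"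
      then obtain u where u: "u \<in> U" "x = tv u ?v" unfolding V_def by blast
      \<comment> \<open>A scalar passes through the semilinear map as its translate, which is again
        a scalar in \<open>K\<close>.\<close>
      have eq: "(\<lambda>i\<in>{..<d}. c \<otimes>\<^bsub>K\<^esub> x i) = tv (\<lambda>i\<in>{..<d}. translate w c \<otimes>\<^bsub>K\<^esub> u i) ?v"
        unfolding u(2) tv_def
        by (rule restrict_ext)
          (simp only: restrict_apply' lessThan_iff translate_mult[OF translate_closed[OF c] Uc[OF u(1)]]
            translate_uminus_cancel')
      show "(\<lambda>i\<in>{..<d}. c \<otimes>\<^bsub>K\<^esub> x i) \<in> V"
        unfolding V_def by (rule image_eqI[where f = "\<lambda>u. tv u ?v", OF eq]) (rule U4[rule_format, OF translate_closed[OF c] u(1)])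
    qed
    have V5: "\<forall>Y\<in>carrier KH. \<forall>u\<in>V. mat_act K d (\<rho> Y) u \<in> V"
    proof (intro ballI)
      fix Y x assume Y: "Y \<in> carrier KH" and "x \<in> V"
      then obtain u where u: "u \<in> U" "x = tv u ?v" unfolding V_def by blast
      have Y': "lift_coset w Y \<in> carrier KH" by (rule lift_coset_closed[OF w Y])
      have row: "(\<Oplus>\<^bsub>K\<^esub>j\<in>{..<d}. \<rho> Y (a, j) \<otimes>\<^bsub>K\<^esub> x j)
          = translate ?v (\<Oplus>\<^bsub>K\<^esub>j\<in>{..<d}. twist w (lift_coset w Y) (a, j) \<otimes>\<^bsub>K\<^esub> u j)" if a: "a < d" for a
      proof -
        have "(\<Oplus>\<^bsub>K\<^esub>j\<in>{..<d}. \<rho> Y (a, j) \<otimes>\<^bsub>K\<^esub> x j) = (\<Oplus>\<^bsub>K\<^esub>j\<in>{..<d}. \<rho> Y (a, j) \<otimes>\<^bsub>K\<^esub> translate ?v (u j))"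
        proof (rule K.finsum_cong'[OF HOL.refl])
          show "(\<lambda>j. \<rho> Y (a, j) \<otimes>\<^bsub>K\<^esub> translate ?v (u j)) \<in> {..<d} \<rightarrow> carrier K"
            by (rule Pi_I) (simp add: rep_closed[OF Y a] translate_closed Uc[OF u(1)])
        qed (simp only: u(2) tv_def restrict_apply')
        also have "\<dots> = translate ?v (\<Oplus>\<^bsub>K\<^esub>j\<in>{..<d}. twist w (lift_coset w Y) (a, j) \<otimes>\<^bsub>K\<^esub> u j)"
          by (rule twist_row[OF w Y a Uc[OF u(1)]])
        finally show ?thesis .
      qed
      have eq: "mat_act K d (\<rho> Y) x = tv (mat_act K d (twist w (lift_coset w Y)) u) ?v"
        unfolding mat_act_def tv_def
        by (rule restrict_ext) (simp only: restrict_apply' lessThan_iff row)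
      show "mat_act K d (\<rho> Y) x \<in> V"
        unfolding V_def by (rule image_eqI[where f = "\<lambda>u. tv u ?v", OF eq]) (rule inv[rule_format, OF Y' u(1)])
    qed
    have sub_V: "coord_subspace K d V"
      unfolding coord_subspace_def by (rule conjI[OF V1 conjI[OF V2 conjI[OF V3 V4]]])
    have V: "V = {\<lambda>i\<in>{..<d}. \<zero>\<^bsub>K\<^esub>} \<or> V = ({..<d} \<rightarrow>\<^sub>E carrier K)"
      by (rule irr[unfolded irreducible_matrix_rep_def, THEN conjunct2, THEN conjunct2, rule_format,
            OF conjI[OF sub_V V5]])
    have UV: "U = (\<lambda>u. tv u w) ` V"
    proof -
      have "(\<lambda>u. tv (tv u ?v) w) ` U = (\<lambda>u. u) ` U"
        by (rule image_cong[OF HOL.refl], rule tv_tv(1), rule subsetD[OF U1])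
      then show ?thesis unfolding V_def image_image image_ident by (rule HOL.sym)
    qed
    from V show ?thesis
    proof
      assume "V = {\<lambda>i\<in>{..<d}. \<zero>\<^bsub>K\<^esub>}"
      then have "U = {\<lambda>i\<in>{..<d}. \<zero>\<^bsub>K\<^esub>}" unfolding UV by (simp add: tv_zero)
      then show ?thesis ..
    next
      assume V: "V = ({..<d} \<rightarrow>\<^sub>E carrier K)"
      have "({..<d} \<rightarrow>\<^sub>E carrier K) \<subseteq> U"
      proof
        fix u assume u: "u \<in> {..<d} \<rightarrow>\<^sub>E carrier K"
        have "tv u ?v \<in> V" unfolding V by (rule tv_closed[OF u])
        then have "tv (tv u ?v) w \<in> U" unfolding UV by (rule imageI[where f = "\<lambda>u. tv u w"])
        then show "u \<in> U" by (simp only: tv_tv(1)[OF u])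
      qed
      then show ?thesis using U1 by blast
    qed
  qed
  note main = this
  show ?thesis
    unfolding irreducible_matrix_rep_def
  proof (intro conjI allI impI)
    show "matrix_rep K KH d (twist w)" by (rule twist_rep[OF w])
    show "0 < d" by (rule irr[unfolded irreducible_matrix_rep_def, THEN conjunct2, THEN conjunct1])
  next
    fix U
    assume "coord_subspace K d U \<and> (\<forall>Y\<in>carrier KH. \<forall>u\<in>U. mat_act K d (twist w Y) u \<in> U)"
    then show "U = {\<lambda>i\<in>{..<d}. \<zero>\<^bsub>K\<^esub>} \<or> U = ({..<d} \<rightarrow>\<^sub>E carrier K)"
      by (elim conjE) (rule main)
  qed
qed

end

section \<open>The rational form of the extended algebra and its traces\<close>

context extended_algebra
begin

definition rational_span where
  "rational_span Q = generate (add_monoid KH) {tensor q h | q h. q \<in> Q \<and> h \<in> carrier H}"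

text \<open>The conclusion carries membership in \<open>KH\<close> along because the closure steps
  ask for it.\<close>

lemma rational_span_induct [consumes 2, case_names tensor add zero uminus]:
  assumes Y: "Y \<in> rational_span Q" and Q: "Q \<subseteq> carrier K"
    and tensor: "\<And>q h. q \<in> Q \<Longrightarrow> h \<in> carrier H \<Longrightarrow> P (tensor q h)"
    and add: "\<And>Y Z. Y \<in> carrier KH \<Longrightarrow> Z \<in> carrier KH \<Longrightarrow> P Y \<Longrightarrow> P Z \<Longrightarrow> P (Y \<oplus>\<^bsub>KH\<^esub> Z)"
    and zero: "P \<zero>\<^bsub>KH\<^esub>"
    and uminus: "\<And>Y. Y \<in> carrier KH \<Longrightarrow> P Y \<Longrightarrow> P (\<ominus>\<^bsub>KH\<^esub> Y)"
  shows "Y \<in> carrier KH \<and> P Y"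
  using Y unfolding rational_span_def
proof (induction rule: generate.induct)
  case one
  then show ?case using zero by simp
next
  case (incl h)
  then show ?case using tensor Q by (auto intro: tensor_closed)
next
  case (inv h)
  then obtain q h' where h: "h = tensor q h'" "q \<in> Q" "h' \<in> carrier H" by blast
  then have "h \<in> carrier KH" "P h" using tensor Q by (auto intro: tensor_closed)
  then show ?case using uminus[of h] by (simp add: a_inv_def[symmetric])
next
  case (eng h1 h2)
  then show ?case using add by simp
qed

text \<open>A lift is additive, and it fixes a pure tensor whose scalar is fixed by the
  translation.\<close>

lemma lift_coset_rational:
  assumes w: "integral_shift w" and Q: "Q \<subseteq> carrier K" and fixed: "\<And>q. q \<in> Q \<Longrightarrow> translate w q = q"
    and Y: "Y \<in> rational_span Q"
  shows "lift_coset w Y = Y"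
proof -
  have lift_zero: "lift_coset w \<zero>\<^bsub>KH\<^esub> = \<zero>\<^bsub>KH\<^esub>"
    using lift_coset_ops(2)[OF w KH.zero_closed KH.zero_closed] lift_coset_closed[OF w KH.zero_closed]
      KH.add.l_cancel_one'[of "lift_coset w \<zero>\<^bsub>KH\<^esub>" "lift_coset w \<zero>\<^bsub>KH\<^esub>"] by simp
  have "Y \<in> carrier KH \<and> lift_coset w Y = Y"
    using Y Q
  proof (induction rule: rational_span_induct)
    case (tensor q h)
    then show ?case using lift_coset_tensor[OF w, of q h] fixed Q by auto
  next
    case (add Y Z)
    then show ?case using lift_coset_ops(2)[OF w] by simp
  next
    case (uminus Y)
    have "lift_coset w (\<ominus>\<^bsub>KH\<^esub> Y) \<oplus>\<^bsub>KH\<^esub> Y = \<zero>\<^bsub>KH\<^esub>"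
      using lift_coset_ops(2)[OF w KH.a_inv_closed[OF uminus(1)] uminus(1)] uminus lift_zero by (simp add: KH.l_neg)
    then have "\<ominus>\<^bsub>KH\<^esub> Y = lift_coset w (\<ominus>\<^bsub>KH\<^esub> Y)"
      by (rule KH.minus_equality) (use uminus(1) in \<open>simp_all add: lift_coset_closed[OF w]\<close>)
    then show ?case by simp
  next
    case zero
    show ?case by (rule lift_zero)
  qed
  then show ?thesis ..
qed

end

context extended_algebra_rep
begin

text \<open>The trace is additive and scalars can be taken out of it, so its values on
  \<open>H\<close> itself decide.\<close>

lemma trace_rational:
  assumes Q: "Q \<subseteq> carrier K" and L: "subfield L K" "Q \<subseteq> L"
    and tr: "\<And>h. h \<in> carrier H \<Longrightarrow> mat_trace K d (\<phi> h) \<in> L" and Y: "Y \<in> rational_span Q"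
  shows "mat_trace K d (\<rho> Y) \<in> L"
proof -
  note L_sub = subringE[OF subfieldE(1)[OF L(1)]]
  have tr_add: "mat_trace K d (\<rho> (Y \<oplus>\<^bsub>KH\<^esub> Z)) = mat_trace K d (\<rho> Y) \<oplus>\<^bsub>K\<^esub> mat_trace K d (\<rho> Z)"
    if YZ: "Y \<in> carrier KH" "Z \<in> carrier KH" for Y Z
  proof -
    have "(\<Oplus>\<^bsub>K\<^esub>i\<in>{..<d}. \<rho> (Y \<oplus>\<^bsub>KH\<^esub> Z) (i, i)) = (\<Oplus>\<^bsub>K\<^esub>i\<in>{..<d}. \<rho> Y (i, i) \<oplus>\<^bsub>K\<^esub> \<rho> Z (i, i))"
      by (rule K.finsum_cong') (use YZ in \<open>auto simp: rep_add rep_closed\<close>)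
    also have "\<dots> = (\<Oplus>\<^bsub>K\<^esub>i\<in>{..<d}. \<rho> Y (i, i)) \<oplus>\<^bsub>K\<^esub> (\<Oplus>\<^bsub>K\<^esub>i\<in>{..<d}. \<rho> Z (i, i))"
      by (rule K.finsum_addf) (use YZ in \<open>auto simp: rep_closed\<close>)
    finally show ?thesis unfolding mat_trace_def .
  qed
  have cl: "mat_trace K d (\<rho> Y) \<in> carrier K" if "Y \<in> carrier KH" for Y
    unfolding mat_trace_def using that by (intro K.finsum_closed) (auto simp: rep_closed)
  have tr_zero: "mat_trace K d (\<rho> \<zero>\<^bsub>KH\<^esub>) = \<zero>\<^bsub>K\<^esub>"
    using tr_add[OF KH.zero_closed KH.zero_closed] cl[OF KH.zero_closed]
      K.add.l_cancel_one'[of "mat_trace K d (\<rho> \<zero>\<^bsub>KH\<^esub>)" "mat_trace K d (\<rho> \<zero>\<^bsub>KH\<^esub>)"] by simp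
  have "Y \<in> carrier KH \<and> mat_trace K d (\<rho> Y) \<in> L"
    using Y Q
  proof (induction rule: rational_span_induct)
    case (tensor q h)
    have q: "q \<in> carrier K" using tensor Q by blast
    have "mat_trace K d (\<rho> (tensor q h)) = (\<Oplus>\<^bsub>K\<^esub>i\<in>{..<d}. q \<otimes>\<^bsub>K\<^esub> \<phi> h (i, i))"
      unfolding mat_trace_def
      by (rule K.finsum_cong') (use q tensor in \<open>auto simp: rep_tensor \<phi>_closed\<close>)
    also have "\<dots> = q \<otimes>\<^bsub>K\<^esub> mat_trace K d (\<phi> h)"
      unfolding mat_trace_def by (rule K.finsum_rdistr[symmetric]) (use q tensor in \<open>auto simp: \<phi>_closed\<close>)
    finally show ?case using tensor L(2) tr L_sub(6) by auto
  next
    case (add Y Z)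
    then show ?case using tr_add L_sub(7) by simp
  next
    case (uminus Y)
    have "mat_trace K d (\<rho> (\<ominus>\<^bsub>KH\<^esub> Y)) \<oplus>\<^bsub>K\<^esub> mat_trace K d (\<rho> Y) = \<zero>\<^bsub>K\<^esub>"
      using tr_add[OF KH.a_inv_closed[OF uminus(1)] uminus(1)] uminus(1) tr_zero by (simp add: KH.l_neg)
    then have "mat_trace K d (\<rho> (\<ominus>\<^bsub>KH\<^esub> Y)) = \<ominus>\<^bsub>K\<^esub> mat_trace K d (\<rho> Y)"
      by (rule K.minus_equality[symmetric]) (use uminus(1) in \<open>simp_all add: cl\<close>)
    then show ?case using uminus(2) L_sub(5) by simp
  next
    case zero
    show ?case using tr_zero L_sub(2) by simp
  qed
  then show ?thesis ..
qed

end

section \<open>Kummer theory of the radicals of the parameters\<close>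

context Ring.field
begin

lemma finsum_mem:
  assumes L: "L \<subseteq> carrier R" "\<zero> \<in> L" "\<And>x y. x \<in> L \<Longrightarrow> y \<in> L \<Longrightarrow> x \<oplus> y \<in> L"
    and B: "finite B" and c: "\<And>b. b \<in> B \<Longrightarrow> c b \<in> L"
  shows "(\<Oplus>b\<in>B. c b) \<in> L"
  using B c
proof (induction B rule: finite_induct)
  case (insert b B)
  then have "c \<in> B \<rightarrow> carrier R" "c b \<in> carrier R" using L(1) by auto
  then show ?case using insert L(3) by simp
qed (simp add: L(2))

text \<open>Dedekind's argument: applying \<open>T j - lam j b\<close> removes the summand \<open>b\<close> and rescales the others.\<close>

lemma eigenvector_summands:
  fixes T :: "'j \<Rightarrow> 'a \<Rightarrow> 'a" and lam :: "'j \<Rightarrow> 'c \<Rightarrow> 'a" and c :: "'c \<Rightarrow> 'a"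
  assumes E: "subfield E R"
    and L: "L \<subseteq> carrier R" "\<And>x y. x \<in> L \<Longrightarrow> y \<in> L \<Longrightarrow> x \<ominus> y \<in> L" "\<And>e x. e \<in> E \<Longrightarrow> x \<in> L \<Longrightarrow> e \<otimes> x \<in> L"
      "\<And>j x. x \<in> L \<Longrightarrow> T j x \<in> L"
    and T: "\<And>j. T j \<in> Ring.ring_hom R R" "\<And>j e. e \<in> E \<Longrightarrow> T j e = e"
    and B: "finite B" and c: "\<And>b. b \<in> B \<Longrightarrow> c b \<in> carrier R"
    and ev: "\<And>j b. b \<in> B \<Longrightarrow> T j (c b) = lam j b \<otimes> c b" "\<And>j b. b \<in> B \<Longrightarrow> lam j b \<in> E"
    and sep: "\<And>a b. a \<in> B \<Longrightarrow> b \<in> B \<Longrightarrow> a \<noteq> b \<Longrightarrow> \<exists>j. lam j a \<noteq> lam j b"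
    and x: "(\<Oplus>b\<in>B. c b) \<in> L"
  shows "\<forall>b\<in>B. c b \<in> L"
  using B c ev sep x
proof (induction B arbitrary: c rule: finite_induct)
  case (insert b B)
  note prems = insert.prems
  have E_sub: "E \<subseteq> carrier R" by (rule subfieldE(3)[OF E])
  have zero: "\<zero> \<in> L" using L(2)[OF prems(5) prems(5)] prems(5) L(1) by (auto simp: minus_eq r_neg)
  have add: "x \<oplus> y \<in> L" if "x \<in> L" "y \<in> L" for x y
  proof -
    have xy: "x \<in> carrier R" "y \<in> carrier R" using that L(1) by auto
    then have "x \<ominus> (\<zero> \<ominus> y) = x \<oplus> y" by (simp add: minus_eq)
    then show ?thesis using L(2)[OF that(1) L(2)[OF zero that(2)]] by simp
  qed
  have cB: "c a \<in> carrier R" if "a \<in> B" for a using prems(1) that by simp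
  have cb: "c b \<in> carrier R" using prems(1) by simp
  have lamc: "lam j a \<in> carrier R" if "a \<in> insert b B" for j a using prems(3)[OF that, of j] E_sub by blast
  have others: "c a \<in> L" if a: "a \<in> B" for a
  proof -
    have "a \<noteq> b" using a insert.hyps by blast
    then obtain j where j: "lam j a \<noteq> lam j b" using prems(4)[of a b] a by blast
    interpret t: ring_hom_cring R R "T j" by (intro ring_hom_cringI T is_cring)
    let ?c = "\<lambda>a. (lam j a \<ominus> lam j b) \<otimes> c a"
    have dE: "lam j a \<ominus> lam j b \<in> E" if "a \<in> B" for a
      unfolding minus_eq
      by (intro subringE(5,7)[OF subfieldE(1)[OF E]] prems(3)) (use that in auto)
    let ?x = "\<Oplus>b\<in>insert b B. c b"
    have x_eq: "?x = c b \<oplus> (\<Oplus>a\<in>B. c a)"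
      by (rule finsum_insert) (use insert.hyps cb cB in auto)
    have sumc: "(\<Oplus>a\<in>B. c a) \<in> carrier R" by (rule finsum_closed) (use cB in auto)
    define P where "P = (\<Oplus>a\<in>B. ?c a)"
    define Q where "Q = (\<Oplus>a\<in>B. lam j b \<otimes> c a)"
    have Q: "Q = lam j b \<otimes> (\<Oplus>a\<in>B. c a)" unfolding Q_def
      by (rule finsum_rdistr[symmetric]) (use insert.hyps cB lamc in auto)
    have PQ_cl: "P \<in> carrier R" "Q \<in> carrier R"
      unfolding P_def Q_def by (intro finsum_closed Pi_I; use cB lamc in simp)+
    have "P \<oplus> Q = (\<Oplus>a\<in>B. ?c a \<oplus> lam j b \<otimes> c a)"
      unfolding P_def Q_def by (rule finsum_addf[symmetric]) (use cB lamc in auto)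
    also have "\<dots> = (\<Oplus>a\<in>B. T j (c a))"
    proof (rule finsum_cong'[OF HOL.refl])
      fix a assume a: "a \<in> B"
      have "?c a \<oplus> lam j b \<otimes> c a = ((lam j a \<ominus> lam j b) \<oplus> lam j b) \<otimes> c a"
        using a cB lamc by (intro l_distr[symmetric]) auto
      also have "(lam j a \<ominus> lam j b) \<oplus> lam j b = lam j a"
        using a lamc by (simp add: minus_eq a_assoc l_neg)
      finally show "?c a \<oplus> lam j b \<otimes> c a = T j (c a)" using prems(2)[of a j] a by simp
    qed (use cB in auto)
    also have "\<dots> = T j (\<Oplus>a\<in>B. c a)" using cB by (subst t.hom_finsum) (auto simp: comp_def)
    finally have TB: "T j (\<Oplus>a\<in>B. c a) = P \<oplus> Q" by simp
    have "T j ?x = lam j b \<otimes> c b \<oplus> (P \<oplus> Q)"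
      unfolding x_eq using cb sumc TB prems(2)[of b j] by simp
    also have "\<dots> = P \<oplus> lam j b \<otimes> ?x"
      unfolding x_eq Q using cb sumc lamc[of b j] PQ_cl by (simp add: r_distr a_lcomm)
    finally have "T j ?x \<ominus> lam j b \<otimes> ?x = P"
      using PQ_cl lamc[of b j] prems(5) L(1) by (simp add: minus_eq a_assoc r_neg subset_iff)
    moreover have "T j ?x \<ominus> lam j b \<otimes> ?x \<in> L"
      by (intro L(2,3,4) prems(3,5) insertI1)
    ultimately have P: "P \<in> L" by simp
    have "\<forall>a\<in>B. ?c a \<in> L"
    proof (rule insert.IH)
      show "?c a \<in> carrier R" if "a \<in> B" for a using that cB dE E_sub by blast
      show "T i (?c a) = lam i a \<otimes> ?c a" if "a \<in> B" for i a
      proof -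
        interpret ti: ring_hom_cring R R "T i" by (intro ring_hom_cringI T is_cring)
        have d: "lam j a \<ominus> lam j b \<in> carrier R" using dE[OF that] E_sub by blast
        have "T i (?c a) = (lam j a \<ominus> lam j b) \<otimes> (lam i a \<otimes> c a)"
          using d cB[OF that] T(2)[OF dE[OF that]] prems(2)[of a i] that by simp
        then show ?thesis using d cB[OF that] lamc[of a i] that by (simp add: m_lcomm)
      qed
      show "lam i a \<in> E" if "a \<in> B" for i a using that prems(3) by simp
      show "\<exists>i. lam i a \<noteq> lam i a'" if "a \<in> B" "a' \<in> B" "a \<noteq> a'" for a a' using that prems(4)[of a a'] by simp
      show "(\<Oplus>a\<in>B. ?c a) \<in> L" using P by (simp only: P_def)
    qed
    then have "?c a \<in> L" using a by (rule bspec)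
    moreover have d: "lam j a \<ominus> lam j b \<in> E - {\<zero>}"
      using dE[OF a] j lamc a by (simp add: r_right_minus_eq)
    then have i: "inv (lam j a \<ominus> lam j b) \<in> E"
      using subfield_m_inv(1)[OF E] by blast
    ultimately have "inv (lam j a \<ominus> lam j b) \<otimes> ?c a \<in> L" using L(3) by blast
    moreover have "inv (lam j a \<ominus> lam j b) \<otimes> ?c a = c a"
      using subfield_m_inv(3)[OF E d] i d E_sub cB[OF a]
      by (simp add: m_assoc[symmetric] subset_iff)
    ultimately show ?thesis by simp
  qed
  have S: "(\<Oplus>a\<in>B. c a) \<in> L" by (rule finsum_mem[OF L(1) zero add insert.hyps(1) others])
  have "(\<Oplus>b\<in>insert b B. c b) = c b \<oplus> (\<Oplus>a\<in>B. c a)"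
    by (rule finsum_insert) (use insert.hyps cb cB in auto)
  then have "(\<Oplus>b\<in>insert b B. c b) \<ominus> (\<Oplus>a\<in>B. c a) = c b"
    using cb S L(1) by (simp add: minus_eq a_assoc r_neg subset_iff)
  then have "c b \<in> L" using L(2)[OF prems(5) S] by simp
  then show ?case using others by simp
qed simp

end

section \<open>Translations, constants and the base field\<close>

context param_field
begin

lemma translate_minus_closed: "x \<in> carrier K \<Longrightarrow> y \<in> carrier K \<Longrightarrow>
    translate w (x \<ominus>\<^bsub>K\<^esub> y) = translate w x \<ominus>\<^bsub>K\<^esub> translate w y"
proof -
  interpret t: ring_hom_cring K K "translate w" by (rule translate_ring_hom_cring)
  show "x \<in> carrier K \<Longrightarrow> y \<in> carrier K \<Longrightarrow> ?thesis" by (simp add: K.minus_eq)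
qed

text \<open>With the minimality of generated fields, stability of such a field under a translation
  is reduced to its generators.\<close>

lemma translate_subfield:
  assumes L: "subfield L K"
  shows "subfield {x \<in> carrier K. translate w x \<in> L} K"
proof -
  interpret t: ring_hom_cring K K "translate w" by (rule translate_ring_hom_cring)
  note L_sub = subringE[OF subfieldE(1)[OF L]]
  show ?thesis
  proof (rule K.subfieldI'[OF K.subringI])
    fix x assume x: "x \<in> {x \<in> carrier K. translate w x \<in> L} - {\<zero>\<^bsub>K\<^esub>}"
    have xU: "x \<in> Units K" using x K.field_Units by simp
    have nz: "translate w x \<in> L - {\<zero>\<^bsub>K\<^esub>}" using x by (simp add: translate_eq_zero_iff)
    have "translate w x \<otimes>\<^bsub>K\<^esub> translate w (inv\<^bsub>K\<^esub> x) = translate w (x \<otimes>\<^bsub>K\<^esub> inv\<^bsub>K\<^esub> x)"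
      using x xU by (intro translate_mult[symmetric]) (simp_all add: K.Units_inv_closed)
    also have "\<dots> = \<one>\<^bsub>K\<^esub>" by (simp only: K.Units_r_inv[OF xU] translate_one)
    finally have "inv\<^bsub>K\<^esub> (translate w x) = translate w (inv\<^bsub>K\<^esub> x)"
      using x xU by (intro K.comm_inv_char) (simp_all add: K.Units_inv_closed translate_closed)
    then show "inv\<^bsub>K\<^esub> x \<in> {x \<in> carrier K. translate w x \<in> L}"
      using K.subfield_m_inv(1)[OF L nz] K.Units_inv_closed[OF xU] by auto
  qed (use L_sub in auto)
qed

lemma translate_fixed_subfield: "subfield {x \<in> carrier K. translate w x = x} K"
proof -
  interpret t: ring_hom_cring K K "translate w" by (rule translate_ring_hom_cring)
  show ?thesis
  proof (rule K.subfieldI'[OF K.subringI])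
    fix x assume x: "x \<in> {x \<in> carrier K. translate w x = x} - {\<zero>\<^bsub>K\<^esub>}"
    have xU: "x \<in> Units K" using x K.field_Units by simp
    have "x \<otimes>\<^bsub>K\<^esub> translate w (inv\<^bsub>K\<^esub> x) = translate w (x \<otimes>\<^bsub>K\<^esub> inv\<^bsub>K\<^esub> x)"
      using x xU by (subst translate_mult) (simp_all add: K.Units_inv_closed)
    also have "\<dots> = \<one>\<^bsub>K\<^esub>" by (simp only: K.Units_r_inv[OF xU] translate_one)
    finally have "inv\<^bsub>K\<^esub> x = translate w (inv\<^bsub>K\<^esub> x)"
      using x xU by (intro K.comm_inv_char) (simp_all add: K.Units_inv_closed translate_closed)
    then show "inv\<^bsub>K\<^esub> x \<in> {x \<in> carrier K. translate w x = x}"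
      using K.Units_inv_closed[OF xU] by simp
  qed auto
qed

definition con :: "complex \<Rightarrow> 'i fun_quot" where "con c = to_Frac S (\<lambda>k. c)"

lemma const_S: "(\<lambda>k. c) \<in> carrier S" unfolding S_carrier by (rule entire_const)

lemma to_Frac_S_closed: "f \<in> carrier S \<Longrightarrow> to_Frac S f \<in> carrier K"
  by (rule ring_hom_closed[OF S.to_Frac_hom])

lemma to_Frac_S_mult: "f \<in> carrier S \<Longrightarrow> g \<in> carrier S \<Longrightarrow>
    to_Frac S (\<lambda>k. f k * g k) = to_Frac S f \<otimes>\<^bsub>K\<^esub> to_Frac S g"
  using ring_hom_mult[OF S.to_Frac_hom, of f g] by (simp only: entire_ring_simps(2))

lemma to_Frac_S_add: "f \<in> carrier S \<Longrightarrow> g \<in> carrier S \<Longrightarrow>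
    to_Frac S (\<lambda>k. f k + g k) = to_Frac S f \<oplus>\<^bsub>K\<^esub> to_Frac S g"
  using ring_hom_add[OF S.to_Frac_hom, of f g] by (simp only: entire_ring_simps(5))

lemma to_Frac_S_one: "to_Frac S (\<lambda>k. 1) = \<one>\<^bsub>K\<^esub>"
  using ring_hom_one[OF S.to_Frac_hom] by (simp only: entire_ring_simps(3))

lemma S_mult_closed: "f \<in> carrier S \<Longrightarrow> g \<in> carrier S \<Longrightarrow> (\<lambda>k. f k * g k) \<in> carrier S"
  using S.m_closed[of f g] by (simp only: entire_ring_simps(2))

lemma S_pow_closed: "f \<in> carrier S \<Longrightarrow> (\<lambda>k. f k ^ n) \<in> carrier S"
  by (induction n) (simp_all add: const_S S_mult_closed)

lemma to_Frac_S_pow: "f \<in> carrier S \<Longrightarrow> to_Frac S f [^]\<^bsub>K\<^esub> (n::nat) = to_Frac S (\<lambda>k. f k ^ n)"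
proof (induction n)
  case 0
  show ?case by (simp only: K.nat_pow_0 power_0 to_Frac_S_one)
next
  case (Suc n)
  have "to_Frac S (\<lambda>k. f k ^ Suc n) = to_Frac S (\<lambda>k. f k ^ n * f k)" by (simp only: power_Suc2)
  also have "\<dots> = to_Frac S (\<lambda>k. f k ^ n) \<otimes>\<^bsub>K\<^esub> to_Frac S f"
    by (rule to_Frac_S_mult[OF S_pow_closed[OF Suc.prems] Suc.prems])
  finally show ?case using Suc by (simp only: K.nat_pow_Suc)
qed

lemma con_closed: "con c \<in> carrier K"
  unfolding con_def by (rule to_Frac_S_closed[OF const_S])

lemma con_mult: "con c \<otimes>\<^bsub>K\<^esub> con c' = con (c * c')"
  unfolding con_def by (rule to_Frac_S_mult[OF const_S const_S, symmetric])

lemma to_Frac_S_inject: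
  assumes f: "f \<in> carrier S" and g: "g \<in> carrier S" and eq: "to_Frac S f = to_Frac S g"
  shows "f = g"
proof
  fix k
  have "\<forall>k. f k * \<one>\<^bsub>S\<^esub> k = g k * \<one>\<^bsub>S\<^esub> k"
    using fraction_eq_iff_fun[of f "\<one>\<^bsub>S\<^esub>" g "\<one>\<^bsub>S\<^esub>"] f g eq by (simp add: to_Frac_def)
  then show "f k = g k" by (simp only: entire_ring_simps(3) mult_1_right)
qed

lemma S_add_closed: "f \<in> carrier S \<Longrightarrow> g \<in> carrier S \<Longrightarrow> (\<lambda>k. f k + g k) \<in> carrier S"
  using S.a_closed[of f g] by (simp only: entire_ring_simps(5))

lemma con_inject: "con c = con c' \<Longrightarrow> c = c'"
  unfolding con_def by (drule to_Frac_S_inject[OF const_S const_S], drule fun_cong)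

lemma translate_con: "translate w (con c) = con c"
  unfolding con_def by (simp only: translate_to_Frac[OF const_S] shift_def)

lemma \<theta>_eq_zero_iff:
  assumes p: "p \<in> carrier (laurent_ring I)"
  shows "\<theta> p = \<zero>\<^bsub>K\<^esub> \<longleftrightarrow> p = 0"
proof -
  have "\<theta> p = \<zero>\<^bsub>K\<^esub> \<longleftrightarrow> (\<lambda>k. laurent_eval (u_eval z k) p) = \<zero>\<^bsub>S\<^esub>"
    unfolding \<theta>_def by (rule S.to_Frac_eq_zero_iff[OF laurent_eval_carrier[OF p]])
  also have "\<dots> \<longleftrightarrow> p = 0"
    unfolding entire_ring_simps(4) fun_eq_iff using laurent_eval_injective[of z p, OF z] by auto
  finally show ?thesis .
qed

definition Q_field :: "'i fun_quot set" where
  "Q_field = {\<theta> a \<otimes>\<^bsub>K\<^esub> inv\<^bsub>K\<^esub> (\<theta> b) | a b.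
     a \<in> carrier (laurent_ring I) \<and> b \<in> carrier (laurent_ring I) - {\<zero>\<^bsub>laurent_ring I\<^esub>}}"

lemma \<theta>_unit: "b \<in> carrier (laurent_ring I) - {\<zero>\<^bsub>laurent_ring I\<^esub>} \<Longrightarrow> \<theta> b \<in> carrier K - {\<zero>\<^bsub>K\<^esub>}"
  using \<theta>_eq_zero_iff[of b] \<theta>_closed[of b] by (simp add: laurent_ring_simps)

lemma Q_field_closed: "Q_field \<subseteq> carrier K"
proof
  fix q assume "q \<in> Q_field"
  then obtain a b where ab: "q = \<theta> a \<otimes>\<^bsub>K\<^esub> inv\<^bsub>K\<^esub> (\<theta> b)" "a \<in> carrier (laurent_ring I)"
    "b \<in> carrier (laurent_ring I) - {\<zero>\<^bsub>laurent_ring I\<^esub>}" unfolding Q_field_def by blast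
  have "\<theta> b \<in> Units K" using \<theta>_unit[OF ab(3)] K.field_Units by simp
  then show "q \<in> carrier K" unfolding ab(1) by (intro K.m_closed \<theta>_closed ab K.Units_inv_closed)
qed

lemma \<theta>_Q_field:
  assumes "p \<in> carrier (laurent_ring I)"
  shows "\<theta> p \<in> Q_field"
proof -
  interpret R: domain "laurent_ring I" by (rule laurent_ring_domain[OF finite_I])
  have "\<theta> \<one>\<^bsub>laurent_ring I\<^esub> = \<one>\<^bsub>K\<^esub>"
    unfolding \<theta>_def laurent_ring_simps laurent_eval_1 by (rule to_Frac_S_one)
  then have "\<theta> p = \<theta> p \<otimes>\<^bsub>K\<^esub> inv\<^bsub>K\<^esub> (\<theta> \<one>\<^bsub>laurent_ring I\<^esub>)" using \<theta>_closed[OF assms] by simp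
  moreover have "\<one>\<^bsub>laurent_ring I\<^esub> \<in> carrier (laurent_ring I) - {\<zero>\<^bsub>laurent_ring I\<^esub>}"
    using R.one_closed R.one_not_zero by blast
  ultimately show ?thesis unfolding Q_field_def mem_Collect_eq using assms by (intro exI conjI)
qed

lemma translate_Q_field:
  assumes w: "integral_shift w" and q: "q \<in> Q_field"
  shows "translate w q = q"
proof -
  obtain a b where ab: "q = \<theta> a \<otimes>\<^bsub>K\<^esub> inv\<^bsub>K\<^esub> (\<theta> b)" "a \<in> carrier (laurent_ring I)"
    "b \<in> carrier (laurent_ring I) - {\<zero>\<^bsub>laurent_ring I\<^esub>}" using q unfolding Q_field_def by blast
  let ?F = "{x \<in> carrier K. translate w x = x}"
  have b: "\<theta> b \<in> ?F - {\<zero>\<^bsub>K\<^esub>}" using \<theta>_unit[OF ab(3)] ab(3) by (simp add: translate_\<theta>[OF w])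
  have a: "\<theta> a \<in> ?F" using ab(2) by (simp add: translate_\<theta>[OF w] \<theta>_closed)
  have "q \<in> ?F" unfolding ab(1)
    by (rule subringE(6)[OF subfieldE(1)[OF translate_fixed_subfield] a
          DiffD1[OF K.subfield_m_inv(1)[OF translate_fixed_subfield b]]])
  then show ?thesis by simp
qed

definition base_field :: "'i fun_quot set" where
  "base_field = generate_field K (range con \<union> Q_field)"

lemma base_field_subfield: "subfield base_field K"
  unfolding base_field_def using Q_field_closed con_closed by (intro K.generate_field_is_subfield) auto

lemma base_field_mem: "con c \<in> base_field" "Q_field \<subseteq> base_field"
proof -
  show "con c \<in> base_field" unfolding base_field_def by (rule generate_field.incl[OF UnI1[OF rangeI]])
  show "Q_field \<subseteq> base_field" unfolding base_field_def by (rule subsetI) (rule generate_field.incl[OF UnI2])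
qed

lemma translate_base_field:
  assumes w: "integral_shift w" and x: "x \<in> base_field"
  shows "translate w x = x"
proof -
  have "base_field \<subseteq> {x \<in> carrier K. translate w x = x}"
    unfolding base_field_def
  proof (rule K.generate_field_min_subfield1[OF _ translate_fixed_subfield])
    show "range con \<union> Q_field \<subseteq> carrier K" using Q_field_closed con_closed by auto
    then show "range con \<union> Q_field \<subseteq> {x \<in> carrier K. translate w x = x}"
      using translate_con translate_Q_field[OF w] by auto
  qed
  then show ?thesis using x by blast
qed

end

section \<open>Roots of unity in the field of meromorphic functions\<close>

lemma (in entire_field) numerator_denominator:
  assumes q: "q \<in> carrier K"
  obtains f g where "f \<in> carrier S" "g \<in> carrier S" "to_Frac S g \<noteq> \<zero>\<^bsub>K\<^esub>" "q \<otimes>\<^bsub>K\<^esub> to_Frac S g = to_Frac S f"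
proof -
  obtain f g where f: "f \<in> carrier S" and g: "g \<in> carrier S - {\<zero>\<^bsub>S\<^esub>}" and q: "q = fraction S f g"
    by (rule S.Frac_carrierE[OF q])
  have gS: "g \<in> carrier S" by (rule DiffD1[OF g])
  have one: "\<one>\<^bsub>S\<^esub> \<in> carrier S - {\<zero>\<^bsub>S\<^esub>}" using S.one_closed S.one_not_zero by simp
  have "q \<otimes>\<^bsub>K\<^esub> to_Frac S g = fraction S (f \<otimes>\<^bsub>S\<^esub> g) (g \<otimes>\<^bsub>S\<^esub> \<one>\<^bsub>S\<^esub>)"
    unfolding q to_Frac_def by (rule S.Frac_mult[OF f g gS one])
  also have "g \<otimes>\<^bsub>S\<^esub> \<one>\<^bsub>S\<^esub> = g" by (rule S.r_one[OF gS])
  also have "fraction S (f \<otimes>\<^bsub>S\<^esub> g) g = fraction S f \<one>\<^bsub>S\<^esub>"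
    by (rule S.fraction_eq_iff[OF S.m_closed[OF f gS] g f one, THEN iffD2]) (rule S.r_one[OF S.m_closed[OF f gS]])
  finally have "q \<otimes>\<^bsub>K\<^esub> to_Frac S g = to_Frac S f" unfolding to_Frac_def .
  moreover have "to_Frac S g \<noteq> \<zero>\<^bsub>K\<^esub>" using g unfolding S.to_Frac_eq_zero_iff[OF gS] by simp
  ultimately show thesis using that[OF f gS] by simp
qed

text \<open>At each point \<open>f k = u * g k\<close> for some \<open>N\<close>-th root of unity
  \<open>u\<close> depending on the point. The product of all \<open>f - u * g\<close> therefore
  vanishes identically, and so does one factor.\<close>

lemma entire_equal_powers:
  assumes I: "finite I" and N: "N > 0" and ent: "\<And>u. entire_on_coords I (\<lambda>k. f k - u * g k)"
    and pow: "\<And>k. f k ^ N = g k ^ N"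
  shows "\<exists>u. \<forall>k. f k = u * g k"
proof (rule ccontr)
  assume no: "\<nexists>u. \<forall>k. f k = u * g k"
  let ?U = "{u::complex. u ^ N = 1}"
  have U: "finite ?U" by (rule finite_roots_unity) (use N in simp)
  have nz: "\<exists>k. f k - u * g k \<noteq> 0" for u using no by (simp add: eq_iff_diff_eq_0[symmetric])
  have "\<exists>k. (\<Prod>u\<in>?U. f k - u * g k) \<noteq> 0"
    by (rule entire_prod_nonzero[where f = "\<lambda>u k. f k - u * g k", OF I U ent nz])
  then obtain k where k: "(\<Prod>u\<in>?U. f k - u * g k) \<noteq> 0" by (elim exE)
  define a b where "a = f k" and "b = g k"
  have ab: "a ^ N = b ^ N" unfolding a_def b_def by (rule pow)
  have "\<exists>u\<in>?U. a - u * b = 0"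
  proof (cases "b = 0")
    case True
    then have "a = 0" using ab N by (simp add: zero_power)
    then show ?thesis using True by (intro bexI[where x = 1]) simp_all
  next
    case False
    then have "(a / b) ^ N = 1" using ab by (simp add: power_divide)
    moreover have "a - a / b * b = 0" using False by simp
    ultimately show ?thesis by (intro bexI[where x = "a / b"] CollectI)
  qed
  then have "(\<Prod>u\<in>?U. a - u * b) = 0" by (subst prod_zero_iff[OF U])
  then show False using k unfolding a_def b_def by (rule notE[rotated])
qed

context param_field
begin

text \<open>Automorphisms will multiply eigenvectors by roots of unity of \<open>K\<close>. As
  constants these lie in the base field and are fixed by all automorphisms, which is what makes
  automorphisms commute.\<close>

lemma root_of_unity_constant:
  assumes N: "N > 0" and q: "q \<in> carrier K" and q1: "q [^]\<^bsub>K\<^esub> (N::nat) = \<one>\<^bsub>K\<^esub>"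
  shows "\<exists>c. q = con c"
proof -
  obtain f g where f: "f \<in> carrier S" and g: "g \<in> carrier S" and g0: "to_Frac S g \<noteq> \<zero>\<^bsub>K\<^esub>"
    and qg: "q \<otimes>\<^bsub>K\<^esub> to_Frac S g = to_Frac S f"
    by (rule numerator_denominator[OF q])
  note gK = to_Frac_S_closed[OF g]
  have "to_Frac S (\<lambda>k. f k ^ N) = (q \<otimes>\<^bsub>K\<^esub> to_Frac S g) [^]\<^bsub>K\<^esub> N"
    unfolding qg by (rule to_Frac_S_pow[OF f, symmetric])
  also have "\<dots> = \<one>\<^bsub>K\<^esub> \<otimes>\<^bsub>K\<^esub> to_Frac S g [^]\<^bsub>K\<^esub> N"
    unfolding K.nat_pow_distrib[OF q gK] q1 ..
  also have "\<dots> = to_Frac S (\<lambda>k. g k ^ N)"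
    unfolding to_Frac_S_pow[OF g] by (rule K.l_one[OF to_Frac_S_closed[OF S_pow_closed[OF g]]])
  finally have "(\<lambda>k. f k ^ N) = (\<lambda>k. g k ^ N)"
    by (rule to_Frac_S_inject[OF S_pow_closed[OF f] S_pow_closed[OF g]])
  then have pow: "f k ^ N = g k ^ N" for k by (rule fun_cong)
  have ent: "entire_on_coords I (\<lambda>k. f k - u * g k)" for u
    using S_add_closed[OF f S_mult_closed[OF const_S[of "- u"] g]] unfolding S_carrier by simp
  obtain u where "\<forall>k. f k = u * g k"
    using entire_equal_powers[of I N f g, OF finite_I N ent pow] by (elim exE)
  then have fk: "f k = u * g k" for k by (rule spec)
  have "f = (\<lambda>k. u * g k)" by (rule ext) (rule fk)
  then have "to_Frac S f = to_Frac S (\<lambda>k. u * g k)" by (rule arg_cong)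
  also have "\<dots> = con u \<otimes>\<^bsub>K\<^esub> to_Frac S g"
    unfolding con_def by (rule to_Frac_S_mult[OF const_S g])
  finally have "q \<otimes>\<^bsub>K\<^esub> to_Frac S g = con u \<otimes>\<^bsub>K\<^esub> to_Frac S g" unfolding qg .
  then have "q = con u" by (rule K.m_rcancel[OF g0 gK q con_closed, THEN iffD1])
  then show ?thesis ..
qed

end

section \<open>Monomials in the radicals as eigenvectors of translations\<close>

lemma harmonic_add: "harmonic N m t * harmonic N m' t = harmonic N (m + m') t"
  unfolding harmonic_def exp_add[symmetric]
  by (rule arg_cong[of _ _ exp]) (simp add: algebra_simps add_divide_distrib)

lemma harmonic_zero [simp]: "harmonic N 0 t = 1"
  by (simp add: harmonic_def)

lemma harmonic_power: "harmonic N m t ^ n = harmonic N (int n * m) t"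
  by (induction n) (simp_all add: harmonic_add algebra_simps)

lemma harmonic_multiple: "N > 0 \<Longrightarrow> harmonic N (int N * m) t = harmonic 1 m t"
  by (simp add: harmonic_def mult.assoc)

lemma monom_eval_single: "monom_eval u (Poly_Mapping.single i m) = u i powi m"
  by (cases "m = 0") (simp_all add: monom_eval_def)

locale kummer_field = param_field I z for I :: "'i set" and z +
  fixes N :: nat
  assumes N: "N > 0"
begin

definition mon_fun :: "('i \<Rightarrow> int) \<Rightarrow> ('i \<Rightarrow> complex) \<Rightarrow> complex" where
  "mon_fun a k = (\<Prod>i\<in>I. harmonic N (a i) (k i))"

text \<open>The monomial with exponents \<open>a i / N\<close> in the
  \<open>exp (2 pi i k_i)\<close>: a simultaneous eigenvector of the unit translations.\<close>

definition mon :: "('i \<Rightarrow> int) \<Rightarrow> 'i fun_quot" where "mon a = to_Frac S (mon_fun a)"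

lemma mon_fun_S: "mon_fun a \<in> carrier S"
  unfolding mon_fun_def S_carrier by (intro entire_prod[OF finite_I] entire_harmonic[OF finite_I])

lemma mon_closed: "mon a \<in> carrier K"
  unfolding mon_def by (rule to_Frac_S_closed[OF mon_fun_S])

lemma mon_cong: "(\<And>i. i \<in> I \<Longrightarrow> a i = b i) \<Longrightarrow> mon a = mon b"
  unfolding mon_def mon_fun_def by (intro arg_cong[of _ _ "to_Frac S"] ext prod.cong) auto

lemma mon_mult: "mon a \<otimes>\<^bsub>K\<^esub> mon b = mon (\<lambda>i. a i + b i)"
proof -
  have "mon_fun (\<lambda>i. a i + b i) = (\<lambda>k. mon_fun a k * mon_fun b k)"
    by (rule ext) (simp add: mon_fun_def prod.distrib[symmetric] harmonic_add)
  then show ?thesis unfolding mon_def by (simp only: to_Frac_S_mult[OF mon_fun_S mon_fun_S])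
qed

lemma mon_zero: "mon (\<lambda>i. 0) = \<one>\<^bsub>K\<^esub>"
  unfolding mon_def mon_fun_def harmonic_zero prod.neutral_const by (rule to_Frac_S_one)

lemma mon_power: "mon a [^]\<^bsub>K\<^esub> n = mon (\<lambda>i. int n * a i)"
proof -
  have "(\<lambda>k. mon_fun a k ^ n) = mon_fun (\<lambda>i. int n * a i)"
    by (rule ext) (simp add: mon_fun_def prod_power_distrib harmonic_power)
  then show ?thesis unfolding mon_def by (simp only: to_Frac_S_pow[OF mon_fun_S])
qed

definition root :: "int \<Rightarrow> complex" where "root m = exp (2 * pi * \<i> * of_int m / of_nat N)"

lemma root_zero: "root 0 = 1"
  by (simp add: root_def)

lemma root_eqD:
  assumes "root m = root m'" "0 \<le> m" "m < int N" "0 \<le> m'" "m' < int N"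
  shows "m = m'"
proof -
  have "root (m - m') = root m / root m'"
    unfolding root_def exp_diff[symmetric]
    by (rule arg_cong[of _ _ exp]) (simp add: algebra_simps diff_divide_distrib)
  then have "root (m - m') = 1" using assms(1) by (simp add: root_def)
  then have "int N dvd m - m'" using exp_2pi_int_eq_1_iff[of N "m - m'"] N by (simp add: root_def)
  then have "m mod int N = m' mod int N" by (simp add: mod_eq_dvd_iff)
  then show ?thesis using assms by simp
qed

text \<open>For \<open>j\<close> outside \<open>I\<close> the shift is 0, and
  \<open>eigenvalue\<close> is 1 accordingly, so the families can be indexed by all
  \<open>j\<close>.\<close>

definition basis_shift :: "'i \<Rightarrow> 'i \<Rightarrow> complex" where
  "basis_shift j = (\<lambda>i. if i = j \<and> j \<in> I then 1 else 0)"

lemma integral_basis_shift: "integral_shift (basis_shift j)"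
  unfolding integral_shift_def basis_shift_def
proof
  fix i show "\<exists>a::int. (if i = j \<and> j \<in> I then 1 else 0 :: complex) = of_int a"
    by (rule exI[of _ "if i = j \<and> j \<in> I then 1 else 0"]) simp
qed

definition eigenvalue :: "'i \<Rightarrow> ('i \<Rightarrow> int) \<Rightarrow> complex" where
  "eigenvalue j a = (if j \<in> I then root (a j) else 1)"

lemma translate_mon: "translate (basis_shift j) (mon a) = con (eigenvalue j a) \<otimes>\<^bsub>K\<^esub> mon a"
proof -
  have "shift (basis_shift j) (mon_fun a) = (\<lambda>k. eigenvalue j a * mon_fun a k)"
  proof
    fix k :: "'i \<Rightarrow> complex"
    have h: "harmonic N (a i) (k i + basis_shift j i)
        = (if i = j then root (a j) else 1) * harmonic N (a i) (k i)" if "i \<in> I" for i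
      using harmonic_shift[OF N, of "a i" "k i" 1] that by (auto simp: basis_shift_def root_def)
    have "shift (basis_shift j) (mon_fun a) k
        = (\<Prod>i\<in>I. (if i = j then root (a j) else 1) * harmonic N (a i) (k i))"
      unfolding shift_def mon_fun_def by (rule prod.cong[OF HOL.refl h])
    also have "\<dots> = eigenvalue j a * mon_fun a k"
      unfolding prod.distrib eigenvalue_def mon_fun_def using finite_I by (simp add: prod.delta)
    finally show "shift (basis_shift j) (mon_fun a) k = eigenvalue j a * mon_fun a k" .
  qed
  then show ?thesis
    unfolding mon_def con_def
    by (simp only: translate_to_Frac[OF mon_fun_S] to_Frac_S_mult[OF const_S mon_fun_S])
qed

text \<open>\<open>exp (2 pi i m k_i)\<close> is \<open>u_i\<close> to the power \<open>- m\<close>,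
  up to the constant \<open>z i powi m\<close>.\<close>

lemma harmonic_base_field:
  assumes i: "i \<in> I"
  shows "to_Frac S (\<lambda>k. harmonic N (int N * m) (k i)) \<in> base_field"
proof -
  let ?p = "Poly_Mapping.single (Poly_Mapping.single i (- m)) 1 :: 'i laurent"
  have p: "?p \<in> carrier (laurent_ring I)"
    using i by (simp add: laurent_ring_simps)
  have "z i powi m * laurent_eval (u_eval z k) ?p = harmonic N (int N * m) (k i)" for k
  proof -
    have "z i powi m * z i powi (- m) = 1" using power_int_add[of "z i" m "- m"] z[of i] by simp
    then show ?thesis
      unfolding laurent_eval_single monom_eval_single u_eval_powi harmonic_multiple[OF N]
      by (simp only: of_int_1 mult_1_left minus_minus mult.assoc[symmetric])
  qed
  note pointwise = this
  have "(\<lambda>k. harmonic N (int N * m) (k i)) = (\<lambda>k. z i powi m * laurent_eval (u_eval z k) ?p)"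
    by (rule ext) (rule pointwise[symmetric])
  then have "to_Frac S (\<lambda>k. harmonic N (int N * m) (k i)) = to_Frac S (\<lambda>k. z i powi m * laurent_eval (u_eval z k) ?p)"
    by (rule arg_cong[where f = "to_Frac S"])
  also have "\<dots> = con (z i powi m) \<otimes>\<^bsub>K\<^esub> \<theta> ?p"
    unfolding con_def \<theta>_def by (rule to_Frac_S_mult[OF const_S laurent_eval_carrier[OF p]])
  also have "\<dots> \<in> base_field"
    by (rule subringE(6)[OF subfieldE(1)[OF base_field_subfield] base_field_mem(1)
        subsetD[OF base_field_mem(2) \<theta>_Q_field[OF p]]])
  finally show ?thesis .
qed

lemma mon_base_field: "mon (\<lambda>i. int N * b i) \<in> base_field"
proof -
  have "to_Frac S (\<lambda>k. \<Prod>i\<in>J. harmonic N (int N * b i) (k i)) \<in> base_field" if "finite J" "J \<subseteq> I" for J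
    using that
  proof (induction J rule: finite_induct)
    case empty
    have "\<one>\<^bsub>K\<^esub> \<in> base_field" by (rule subringE(3)[OF subfieldE(1)[OF base_field_subfield]])
    then show ?case unfolding prod.empty to_Frac_S_one .
  next
    case (insert i J)
    have h: "(\<lambda>k. harmonic N (int N * b i) (k i)) \<in> carrier S"
      unfolding S_carrier using insert.prems by (intro entire_harmonic[OF finite_I]) simp
    have J: "(\<lambda>k. \<Prod>i\<in>J. harmonic N (int N * b i) (k i)) \<in> carrier S"
      unfolding S_carrier using insert.prems
      by (intro entire_prod[OF finite_I] entire_harmonic[OF finite_I]) auto
    have "to_Frac S (\<lambda>k. \<Prod>i\<in>insert i J. harmonic N (int N * b i) (k i))
        = to_Frac S (\<lambda>k. harmonic N (int N * b i) (k i)) \<otimes>\<^bsub>K\<^esub> to_Frac S (\<lambda>k. \<Prod>i\<in>J. harmonic N (int N * b i) (k i))"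
      by (simp only: prod.insert[OF insert.hyps] to_Frac_S_mult[OF h J])
    also have "\<dots> \<in> base_field"
    proof (rule subringE(6)[OF subfieldE(1)[OF base_field_subfield]])
      show "to_Frac S (\<lambda>k. harmonic N (int N * b i) (k i)) \<in> base_field"
        by (rule harmonic_base_field) (use insert.prems in simp)
      show "to_Frac S (\<lambda>k. \<Prod>i\<in>J. harmonic N (int N * b i) (k i)) \<in> base_field"
        by (rule insert.IH) (use insert.prems in simp)
    qed
    finally show ?case .
  qed
  from this[OF finite_I order_refl] show ?thesis unfolding mon_def mon_fun_def .
qed

text \<open>Exponents modulo \<open>N\<close>. With extensional functions the set is finite, and
  distinct elements differ at an index in \<open>I\<close>.\<close>

definition box :: "('i \<Rightarrow> int) set" where "box = PiE I (\<lambda>_. {0..<int N})"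

lemma finite_box: "finite box"
  unfolding box_def by (rule finite_PiE[OF finite_I]) simp

definition span :: "'i fun_quot set" where
  "span = {\<Oplus>\<^bsub>K\<^esub>b\<in>box. e b \<otimes>\<^bsub>K\<^esub> mon b | e. e \<in> box \<rightarrow> base_field}"

lemma spanI: "e \<in> box \<rightarrow> base_field \<Longrightarrow> (\<Oplus>\<^bsub>K\<^esub>b\<in>box. e b \<otimes>\<^bsub>K\<^esub> mon b) \<in> span"
  unfolding span_def by (rule CollectI, rule exI[where x = e]) simp

lemmas base_ring = subringE[OF subfieldE(1)[OF base_field_subfield]]

lemma base_closed: "e \<in> base_field \<Longrightarrow> e \<in> carrier K"
  using base_ring(1) by blast

lemma span_add: "x \<in> span \<Longrightarrow> y \<in> span \<Longrightarrow> x \<oplus>\<^bsub>K\<^esub> y \<in> span"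
proof -
  assume "x \<in> span" "y \<in> span"
  then obtain e f where e: "e \<in> box \<rightarrow> base_field" "x = (\<Oplus>\<^bsub>K\<^esub>b\<in>box. e b \<otimes>\<^bsub>K\<^esub> mon b)"
    and f: "f \<in> box \<rightarrow> base_field" "y = (\<Oplus>\<^bsub>K\<^esub>b\<in>box. f b \<otimes>\<^bsub>K\<^esub> mon b)" unfolding span_def by blast
  have c: "e b \<in> carrier K" "f b \<in> carrier K" if "b \<in> box" for b using e(1) f(1) that base_closed by blast+
  have "x \<oplus>\<^bsub>K\<^esub> y = (\<Oplus>\<^bsub>K\<^esub>b\<in>box. e b \<otimes>\<^bsub>K\<^esub> mon b \<oplus>\<^bsub>K\<^esub> f b \<otimes>\<^bsub>K\<^esub> mon b)"
    unfolding e(2) f(2) by (rule K.finsum_addf[symmetric]; rule Pi_I; simp add: c mon_closed)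
  also have "\<dots> = (\<Oplus>\<^bsub>K\<^esub>b\<in>box. (e b \<oplus>\<^bsub>K\<^esub> f b) \<otimes>\<^bsub>K\<^esub> mon b)"
    by (rule K.finsum_cong'[OF HOL.refl]) (simp_all add: c mon_closed K.l_distr)
  also have "\<dots> \<in> span"
    by (rule spanI, rule Pi_I, rule base_ring(7)) (use e(1) f(1) in \<open>simp_all add: Pi_iff\<close>)
  finally show ?thesis .
qed

lemma span_smult: "c \<in> base_field \<Longrightarrow> x \<in> span \<Longrightarrow> c \<otimes>\<^bsub>K\<^esub> x \<in> span"
proof -
  assume c: "c \<in> base_field" and "x \<in> span"
  then obtain e where e: "e \<in> box \<rightarrow> base_field" "x = (\<Oplus>\<^bsub>K\<^esub>b\<in>box. e b \<otimes>\<^bsub>K\<^esub> mon b)" unfolding span_def by blast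
  have ec: "e b \<in> carrier K" if "b \<in> box" for b using e(1) that base_closed by blast
  have "c \<otimes>\<^bsub>K\<^esub> x = (\<Oplus>\<^bsub>K\<^esub>b\<in>box. c \<otimes>\<^bsub>K\<^esub> (e b \<otimes>\<^bsub>K\<^esub> mon b))"
    unfolding e(2) by (rule K.finsum_rdistr[OF finite_box base_closed[OF c]]) (simp add: ec mon_closed)
  also have "\<dots> = (\<Oplus>\<^bsub>K\<^esub>b\<in>box. (c \<otimes>\<^bsub>K\<^esub> e b) \<otimes>\<^bsub>K\<^esub> mon b)"
    by (rule K.finsum_cong'[OF HOL.refl]) (simp_all add: ec mon_closed base_closed[OF c] K.m_assoc)
  also have "\<dots> \<in> span"
    by (rule spanI, rule Pi_I, rule base_ring(6)[OF c]) (use e(1) in \<open>simp add: Pi_iff\<close>)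
  finally show ?thesis .
qed

text \<open>Reduce the exponents modulo \<open>N\<close>: the multiples of \<open>N\<close>
  contribute an element of the base field, which is absorbed into the coefficient.\<close>

lemma span_single:
  assumes e: "e \<in> base_field"
  shows "e \<otimes>\<^bsub>K\<^esub> mon a \<in> span"
proof -
  let ?a = "\<lambda>i\<in>I. a i mod int N" and ?b = "\<lambda>i. a i div int N"
  have box: "?a \<in> box" using N by (auto simp: box_def)
  define e' where "e' = e \<otimes>\<^bsub>K\<^esub> mon (\<lambda>i. int N * ?b i)"
  have e': "e' \<in> base_field" unfolding e'_def by (rule base_ring(6)[OF e mon_base_field])
  have "mon a = mon (\<lambda>i. int N * ?b i) \<otimes>\<^bsub>K\<^esub> mon ?a"
    unfolding mon_mult by (rule mon_cong) simp
  then have eq: "e \<otimes>\<^bsub>K\<^esub> mon a = e' \<otimes>\<^bsub>K\<^esub> mon ?a"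
    unfolding e'_def by (simp add: K.m_assoc mon_closed base_closed[OF e])
  have "(\<Oplus>\<^bsub>K\<^esub>b\<in>box. if ?a = b then e' \<otimes>\<^bsub>K\<^esub> mon b else \<zero>\<^bsub>K\<^esub>) = e' \<otimes>\<^bsub>K\<^esub> mon ?a"
    by (rule K.finsum_singleton[OF box finite_box]) (simp add: base_closed[OF e'] mon_closed)
  moreover have "(\<Oplus>\<^bsub>K\<^esub>b\<in>box. (if ?a = b then e' else \<zero>\<^bsub>K\<^esub>) \<otimes>\<^bsub>K\<^esub> mon b)
      = (\<Oplus>\<^bsub>K\<^esub>b\<in>box. if ?a = b then e' \<otimes>\<^bsub>K\<^esub> mon b else \<zero>\<^bsub>K\<^esub>)"
    by (rule K.finsum_cong'[OF HOL.refl]) (simp_all add: base_closed[OF e'] mon_closed)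
  ultimately have "e' \<otimes>\<^bsub>K\<^esub> mon ?a = (\<Oplus>\<^bsub>K\<^esub>b\<in>box. (if ?a = b then e' else \<zero>\<^bsub>K\<^esub>) \<otimes>\<^bsub>K\<^esub> mon b)" by simp
  moreover have "(\<lambda>b. if ?a = b then e' else \<zero>\<^bsub>K\<^esub>) \<in> box \<rightarrow> base_field" using e' base_ring(2) by simp
  ultimately show ?thesis unfolding eq using spanI[of "\<lambda>b. if ?a = b then e' else \<zero>\<^bsub>K\<^esub>"] by (simp only:)
qed

lemma mon_closed': "e \<in> base_field \<Longrightarrow> e \<otimes>\<^bsub>K\<^esub> mon b \<in> carrier K"
  by (intro K.m_closed base_closed mon_closed)

lemma span_closed: "span \<subseteq> carrier K"
proof
  fix x assume "x \<in> span"
  then obtain e where e: "e \<in> box \<rightarrow> base_field" "x = (\<Oplus>\<^bsub>K\<^esub>b\<in>box. e b \<otimes>\<^bsub>K\<^esub> mon b)" unfolding span_def by blast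
  show "x \<in> carrier K" unfolding e(2)
    by (intro K.finsum_closed Pi_I mon_closed') (use e(1) in blast)
qed

lemma base_field_span: "base_field \<subseteq> span"
proof
  fix e assume e: "e \<in> base_field"
  show "e \<in> span" using span_single[OF e, of "\<lambda>i. 0"] base_closed[OF e] by (simp add: mon_zero)
qed

lemma span_mon_mult:
  assumes "y \<in> span"
  shows "mon a \<otimes>\<^bsub>K\<^esub> y \<in> span"
proof -
  obtain e where e: "e \<in> box \<rightarrow> base_field" "y = (\<Oplus>\<^bsub>K\<^esub>b\<in>box. e b \<otimes>\<^bsub>K\<^esub> mon b)"
    using assms unfolding span_def by blast
  have ec: "e b \<in> base_field" if "b \<in> box" for b using e(1) that by blast
  have "mon a \<otimes>\<^bsub>K\<^esub> y = (\<Oplus>\<^bsub>K\<^esub>b\<in>box. mon a \<otimes>\<^bsub>K\<^esub> (e b \<otimes>\<^bsub>K\<^esub> mon b))"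
    unfolding e(2) by (rule K.finsum_rdistr[OF finite_box mon_closed]) (simp add: ec mon_closed')
  also have "\<dots> \<in> span"
  proof (rule K.finsum_mem[OF span_closed subsetD[OF base_field_span base_ring(2)] span_add finite_box])
    fix b assume b: "b \<in> box"
    have "mon a \<otimes>\<^bsub>K\<^esub> (e b \<otimes>\<^bsub>K\<^esub> mon b) = e b \<otimes>\<^bsub>K\<^esub> mon (\<lambda>i. a i + b i)"
      unfolding mon_mult[symmetric] by (rule K.m_lcomm[OF mon_closed base_closed[OF ec[OF b]] mon_closed])
    then show "mon a \<otimes>\<^bsub>K\<^esub> (e b \<otimes>\<^bsub>K\<^esub> mon b) \<in> span" by (simp only: span_single[OF ec[OF b]])
  qed
  finally show ?thesis .
qed

lemma span_mult:
  assumes "x \<in> span" and y: "y \<in> span"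
  shows "x \<otimes>\<^bsub>K\<^esub> y \<in> span"
proof -
  have yc: "y \<in> carrier K" using y span_closed by blast
  obtain e where e: "e \<in> box \<rightarrow> base_field" "x = (\<Oplus>\<^bsub>K\<^esub>b\<in>box. e b \<otimes>\<^bsub>K\<^esub> mon b)"
    using assms unfolding span_def by blast
  have ec: "e b \<in> base_field" if "b \<in> box" for b using e(1) that by blast
  have "x \<otimes>\<^bsub>K\<^esub> y = (\<Oplus>\<^bsub>K\<^esub>b\<in>box. (e b \<otimes>\<^bsub>K\<^esub> mon b) \<otimes>\<^bsub>K\<^esub> y)"
    unfolding e(2) by (rule K.finsum_ldistr[OF finite_box yc]) (simp add: ec mon_closed')
  also have "\<dots> \<in> span"
  proof (rule K.finsum_mem[OF span_closed subsetD[OF base_field_span base_ring(2)] span_add finite_box])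
    fix b assume b: "b \<in> box"
    have "(e b \<otimes>\<^bsub>K\<^esub> mon b) \<otimes>\<^bsub>K\<^esub> y = e b \<otimes>\<^bsub>K\<^esub> (mon b \<otimes>\<^bsub>K\<^esub> y)"
      by (rule K.m_assoc[OF base_closed[OF ec[OF b]] mon_closed yc])
    then show "(e b \<otimes>\<^bsub>K\<^esub> mon b) \<otimes>\<^bsub>K\<^esub> y \<in> span"
      by (simp only: span_smult[OF ec[OF b] span_mon_mult[OF y]])
  qed
  finally show ?thesis .
qed

lemma span_subring: "subring span K"
proof (rule K.subringI[OF span_closed])
  show "\<one>\<^bsub>K\<^esub> \<in> span" by (rule subsetD[OF base_field_span base_ring(3)])
next
  fix x assume x: "x \<in> span"
  then have "x \<in> carrier K" using span_closed by blast
  then have "(\<ominus>\<^bsub>K\<^esub> \<one>\<^bsub>K\<^esub>) \<otimes>\<^bsub>K\<^esub> x = \<ominus>\<^bsub>K\<^esub> x" by (simp add: K.l_minus)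
  then show "\<ominus>\<^bsub>K\<^esub> x \<in> span" using span_smult[OF base_ring(5)[OF base_ring(3)] x] by simp
qed (fact span_mult span_add)+

text \<open>Distinct exponents in \<open>box\<close> have distinct systems of eigenvalues under the
  unit translations, so \<open>eigenvector_summands\<close> separates the terms within any
  translation-stable \<open>L\<close>.\<close>

lemma span_components:
  assumes L: "L \<subseteq> carrier K" "\<And>x y. x \<in> L \<Longrightarrow> y \<in> L \<Longrightarrow> x \<ominus>\<^bsub>K\<^esub> y \<in> L"
      "\<And>e x. e \<in> base_field \<Longrightarrow> x \<in> L \<Longrightarrow> e \<otimes>\<^bsub>K\<^esub> x \<in> L" "\<And>j x. x \<in> L \<Longrightarrow> translate (basis_shift j) x \<in> L"
    and e: "e \<in> box \<rightarrow> base_field" and x: "(\<Oplus>\<^bsub>K\<^esub>b\<in>box. e b \<otimes>\<^bsub>K\<^esub> mon b) \<in> L" and b: "b \<in> box"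
  shows "e b \<otimes>\<^bsub>K\<^esub> mon b \<in> L"
proof -
  have ec: "e b \<in> base_field" if "b \<in> box" for b using e that by blast
  have "\<forall>b\<in>box. e b \<otimes>\<^bsub>K\<^esub> mon b \<in> L"
  proof (rule K.eigenvector_summands[where T = "\<lambda>j. translate (basis_shift j)" and lam = "\<lambda>j b. con (eigenvalue j b)",
        OF base_field_subfield L translate_hom _ finite_box])
    fix j b assume b: "b \<in> box"
    show "translate (basis_shift j) (e b \<otimes>\<^bsub>K\<^esub> mon b) = con (eigenvalue j b) \<otimes>\<^bsub>K\<^esub> (e b \<otimes>\<^bsub>K\<^esub> mon b)"
      unfolding translate_mult[OF base_closed[OF ec[OF b]] mon_closed] translate_mon
        translate_base_field[OF integral_basis_shift ec[OF b]]
      by (rule K.m_lcomm[OF base_closed[OF ec[OF b]] con_closed mon_closed])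
  next
    fix a b assume ab: "a \<in> box" "b \<in> box" "a \<noteq> b"
    have "\<exists>j\<in>I. a j \<noteq> b j"
    proof (rule ccontr)
      assume no: "\<not> (\<exists>j\<in>I. a j \<noteq> b j)"
      have "a = b"
        by (rule PiE_ext[OF ab(1)[unfolded box_def] ab(2)[unfolded box_def]]) (use no in simp)
      then show False using ab(3) by simp
    qed
    then obtain j where j: "j \<in> I" "a j \<noteq> b j" by (elim bexE)
    have "a j \<in> {0..<int N}" "b j \<in> {0..<int N}"
      by (rule PiE_mem[OF ab(1)[unfolded box_def] j(1)], rule PiE_mem[OF ab(2)[unfolded box_def] j(1)])
    then have "root (a j) \<noteq> root (b j)" using root_eqD[of "a j" "b j"] j(2) by auto
    then have "con (eigenvalue j a) \<noteq> con (eigenvalue j b)"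
      using con_inject[of "root (a j)" "root (b j)"] j(1) by (auto simp: eigenvalue_def)
    then show "\<exists>j. con (eigenvalue j a) \<noteq> con (eigenvalue j b)" ..
  qed (use x in \<open>simp_all add: translate_base_field integral_basis_shift ec mon_closed' base_field_mem(1)\<close>)
  then show ?thesis using b by (rule bspec)
qed

end

section \<open>The radicals of the parameters\<close>

context kummer_field
begin

definition \<zeta> :: "'i \<Rightarrow> complex" where "\<zeta> i = exp (Ln (z i) / of_nat N)"

definition unit_exponent :: "'i \<Rightarrow> int \<Rightarrow> 'i \<Rightarrow> int" where
  "unit_exponent i m = (\<lambda>j. if j = i then m else 0)"

text \<open>The exponent is \<open>- 1\<close> because
  \<open>u_i = z i * exp (- 2 pi i k_i)\<close>; the factor \<open>\<zeta> i\<close> is an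
  \<open>N\<close>-th root of \<open>z i\<close>.\<close>

definition radical :: "'i \<Rightarrow> 'i fun_quot" where
  "radical i = con (\<zeta> i) \<otimes>\<^bsub>K\<^esub> mon (unit_exponent i (- 1))"

lemma \<zeta>_power: "\<zeta> i ^ N = z i"
  using z[of i] N by (simp add: \<zeta>_def exp_of_nat_mult[symmetric])

lemma mon_fun_unit_exponent:
  assumes "i \<in> I"
  shows "mon_fun (unit_exponent i m) k = harmonic N m (k i)"
proof -
  have "mon_fun (unit_exponent i m) k = (\<Prod>j\<in>I. if j = i then harmonic N m (k j) else 1)"
    unfolding mon_fun_def by (rule prod.cong) (simp_all add: unit_exponent_def)
  then show ?thesis using assms finite_I by simp
qed

lemma radical_closed: "radical i \<in> carrier K"
  unfolding radical_def by (intro K.m_closed con_closed mon_closed)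

lemma laurent_var_carrier: "i \<in> I \<Longrightarrow> laurent_var i \<in> carrier (laurent_ring I)"
  by (simp add: laurent_var_def laurent_ring_simps)

lemma radical_power:
  assumes i: "i \<in> I"
  shows "radical i [^]\<^bsub>K\<^esub> N = \<theta> (laurent_var i)"
proof -
  have fS: "(\<lambda>k. \<zeta> i * mon_fun (unit_exponent i (- 1)) k) \<in> carrier S"
    by (rule S_mult_closed[OF const_S mon_fun_S])
  have "radical i = to_Frac S (\<lambda>k. \<zeta> i * mon_fun (unit_exponent i (- 1)) k)"
    unfolding radical_def con_def mon_def by (rule to_Frac_S_mult[OF const_S mon_fun_S, symmetric])
  then have "radical i [^]\<^bsub>K\<^esub> N = to_Frac S (\<lambda>k. (\<zeta> i * mon_fun (unit_exponent i (- 1)) k) ^ N)"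
    by (simp only: to_Frac_S_pow[OF fS])
  moreover have "(\<zeta> i * mon_fun (unit_exponent i (- 1)) k) ^ N = laurent_eval (u_eval z k) (laurent_var i)" for k
    unfolding mon_fun_unit_exponent[OF i] power_mult_distrib \<zeta>_power harmonic_power harmonic_multiple[OF N]
      laurent_var_def laurent_eval_single monom_eval_single u_eval_powi by simp
  ultimately show ?thesis unfolding \<theta>_def by simp
qed

lemma radical_algebraic:
  assumes i: "i \<in> I"
  shows "(ring.algebraic K over base_field) (radical i)"
proof -
  let ?u = "\<theta> (laurent_var i)"
  \<comment> \<open>The polynomial \<open>X ^ N - u_i\<close>: leading coefficient first, then
    \<open>N - 1\<close> zeros, then the constant term.\<close>
  let ?p = "\<one>\<^bsub>K\<^esub> # (replicate (N - 1) \<zero>\<^bsub>K\<^esub> @ [\<ominus>\<^bsub>K\<^esub> ?u])"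
  have u: "?u \<in> base_field" by (rule subsetD[OF base_field_mem(2) \<theta>_Q_field[OF laurent_var_carrier[OF i]]])
  have uc: "\<ominus>\<^bsub>K\<^esub> ?u \<in> carrier K" by (intro K.a_inv_closed base_closed u)
  have ev: "K.eval (replicate m \<zero>\<^bsub>K\<^esub> @ [\<ominus>\<^bsub>K\<^esub> ?u]) (radical i) = \<ominus>\<^bsub>K\<^esub> ?u" for m
    by (induction m) (use uc radical_closed in simp_all)
  show ?thesis
  proof (rule K.algebraicI[of ?p])
    show "?p \<in> carrier (univ_poly K base_field)"
      unfolding univ_poly_def polynomial_def using base_ring(2,3) base_ring(5)[OF u] by auto
    show "?p \<noteq> []" by simp
    show "K.eval ?p (radical i) = \<zero>\<^bsub>K\<^esub>"
      using N base_closed[OF u] radical_closed[of i]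
      by (simp add: ev radical_power[OF i] K.r_neg)
  qed
qed

end

lemma (in Ring.field) automorphism_finsum:
  assumes L: "subfield L R" and \<alpha>: "\<alpha> \<in> ring_iso (R\<lparr>carrier := L\<rparr>) (R\<lparr>carrier := L\<rparr>)"
    and B: "finite B" and c: "\<And>b. b \<in> B \<Longrightarrow> c b \<in> L"
  shows "\<alpha> (\<Oplus>b\<in>B. c b) = (\<Oplus>b\<in>B. \<alpha> (c b))"
proof -
  note L_sub = subringE[OF subfieldE(1)[OF L]]
  have hom: "\<alpha> \<in> Ring.ring_hom (R\<lparr>carrier := L\<rparr>) (R\<lparr>carrier := L\<rparr>)" using \<alpha> by (simp add: ring_iso_def)
  have cl: "\<alpha> x \<in> L" if "x \<in> L" for x using ring_hom_closed[OF hom, of x] that by simp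
  have add: "\<alpha> (x \<oplus> y) = \<alpha> x \<oplus> \<alpha> y" if "x \<in> L" "y \<in> L" for x y
    using ring_hom_add[OF hom, of x y] that by simp
  have z: "\<alpha> \<zero> = \<zero>"
  proof -
    have "\<alpha> \<zero> \<oplus> \<alpha> \<zero> = \<alpha> \<zero>" using add[OF L_sub(2) L_sub(2)] by simp
    then show ?thesis using add.l_cancel_one[of "\<alpha> \<zero>" "\<alpha> \<zero>"] cl[OF L_sub(2)] L_sub(1) by blast
  qed
  show ?thesis
    using B c
  proof (induction B rule: finite_induct)
    case (insert b B)
    have "c \<in> B \<rightarrow> carrier R" "c b \<in> carrier R" using insert.prems L_sub(1) by auto
    moreover have "(\<lambda>b. \<alpha> (c b)) \<in> B \<rightarrow> carrier R" "\<alpha> (c b) \<in> carrier R"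
      using insert.prems cl L_sub(1) by auto
    moreover have "(\<Oplus>b\<in>B. c b) \<in> L"
      by (rule finsum_mem[OF L_sub(1,2,7) insert.hyps(1)]) (use insert.prems in simp_all)
    ultimately show ?case using insert add[of "c b" "\<Oplus>b\<in>B. c b"] by simp
  qed (simp add: z)
qed

section \<open>The Galois action on a translation-stable extension\<close>

context kummer_field
begin

text \<open>\<open>\<Omega>\<close> stands for the set of character values. The assumptions record
  what is used about it: stability under integral translations, and containment in every subfield
  that contains \<open>Q_field\<close> and the trigonometric polynomials of period
  \<open>N\<close>.\<close>

context
  fixes \<Omega> :: "'i fun_quot set"
  assumes \<Omega>_translate: "\<And>w x. integral_shift w \<Longrightarrow> x \<in> \<Omega> \<Longrightarrow> translate w x \<in> \<Omega>"
    and \<Omega>_trig: "\<And>L. subfield L K \<Longrightarrow> Q_field \<subseteq> L \<Longrightarrow> (\<And>P. P \<in> trig N I \<Longrightarrow> to_Frac S P \<in> L) \<Longrightarrow> \<Omega> \<subseteq> L"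
begin

definition index_list :: "'i list" where "index_list = (SOME xs. set xs = I)"

lemma set_index_list: "set index_list = I"
  unfolding index_list_def using finite_list[OF finite_I] by (rule someI_ex)

text \<open>Built by \<open>finite_extension\<close>: an iterated polynomial extension by algebraic
  elements is algebraic, and it lies in every subring containing the base field and the radicals, in
  particular in \<open>span\<close>.\<close>

definition big_field :: "'i fun_quot set" where
  "big_field = K.finite_extension base_field (map radical index_list)"

lemma radicals_closed: "set (map radical index_list) \<subseteq> carrier K"
  using radical_closed by auto

lemma radicals_algebraic: "x \<in> set (map radical index_list) \<Longrightarrow> (ring.algebraic K over base_field) x"
  using radical_algebraic set_index_list by auto

lemma big_field_subfield: "subfield big_field K"
  unfolding big_field_def
  by (rule K.finite_extension_is_subfield[OF base_field_subfield radicals_closed radicals_algebraic])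

lemmas big_ring = subringE[OF subfieldE(1)[OF big_field_subfield]]

lemma base_big: "base_field \<subseteq> big_field"
  unfolding big_field_def by (rule K.finite_extension_incl[OF subfieldE(3)[OF base_field_subfield] radicals_closed])

lemma radical_big: "i \<in> I \<Longrightarrow> radical i \<in> big_field"
  using K.finite_extension_mem[OF subfieldE(1)[OF base_field_subfield] radicals_closed] set_index_list
  unfolding big_field_def by auto

lemma big_span: "big_field \<subseteq> span"
  unfolding big_field_def
proof (rule K.finite_extension_subring_incl[OF span_subring base_field_span])
  show "set (map radical index_list) \<subseteq> span"
    unfolding radical_def using span_single[OF base_field_mem(1)] by auto
qed

lemma big_generated: "big_field \<subseteq> generate_field K (base_field \<union> radical ` I)"
proof -
  have sub: "base_field \<union> radical ` I \<subseteq> carrier K" using subfieldE(3)[OF base_field_subfield] radical_closed by auto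
  show ?thesis
    unfolding big_field_def
    by (rule K.finite_extension_subring_incl[OF subfieldE(1)[OF K.generate_field_is_subfield[OF sub]]])
      (auto simp: set_index_list intro: generate_field.incl)
qed

lemma mon_unit_big:
  assumes i: "i \<in> I"
  shows "mon (unit_exponent i m) \<in> big_field"
proof -
  have "con (1 / \<zeta> i) \<otimes>\<^bsub>K\<^esub> radical i = mon (unit_exponent i (- 1))"
    unfolding radical_def by (simp add: K.m_assoc[symmetric] con_closed mon_closed con_mult \<zeta>_def)
      (simp add: con_def to_Frac_S_one mon_closed)
  moreover have "con (1 / \<zeta> i) \<otimes>\<^bsub>K\<^esub> radical i \<in> big_field"
    by (rule big_ring(6)[OF subsetD[OF base_big base_field_mem(1)] radical_big[OF i]])
  ultimately have one: "mon (unit_exponent i (- 1)) \<in> big_field" by simp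
  have neg: "mon (unit_exponent i (- int n)) \<in> big_field" for n
  proof (induction n)
    case 0
    have "mon (unit_exponent i (- int 0)) = \<one>\<^bsub>K\<^esub>"
      unfolding mon_zero[symmetric] by (rule mon_cong) (simp add: unit_exponent_def)
    then show ?case using big_ring(3) by simp
  next
    case (Suc n)
    have "mon (unit_exponent i (- int (Suc n))) = mon (unit_exponent i (- int n)) \<otimes>\<^bsub>K\<^esub> mon (unit_exponent i (- 1))"
      unfolding mon_mult by (rule mon_cong) (simp add: unit_exponent_def)
    then show ?case using big_ring(6)[OF Suc one] by simp
  qed
  \<comment> \<open>Division with remainder writes \<open>m\<close> as \<open>- n\<close> plus a
    multiple of \<open>N\<close>: powers of the radical give the first part, the base field gives
    the second.\<close>
  define n where "n = nat ((- m) mod int N)"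
  define q where "q = (- m) div int N"
  have "m = - int n + int N * - q"
  proof -
    have "int N * q + int n = - m" unfolding n_def q_def using N by simp
    then show ?thesis by simp
  qed
  then have "mon (unit_exponent i m) = mon (unit_exponent i (- int n)) \<otimes>\<^bsub>K\<^esub> mon (\<lambda>j. int N * unit_exponent i (- q) j)"
    unfolding mon_mult by (intro mon_cong) (simp add: unit_exponent_def)
  moreover have "\<dots> \<in> big_field" by (rule big_ring(6)[OF neg subsetD[OF base_big mon_base_field]])
  ultimately show ?thesis by simp
qed

lemma trig_big: "P \<in> trig N I \<Longrightarrow> to_Frac S P \<in> big_field"
proof (induction rule: trig.induct)
  case (const c)
  show ?case using base_big base_field_mem(1)[of c] unfolding con_def by blast
next
  case (harmonic i m)
  have "mon_fun (unit_exponent i m) = (\<lambda>k. harmonic N m (k i))"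
    by (rule ext) (rule mon_fun_unit_exponent[OF harmonic])
  then show ?case using mon_unit_big[OF harmonic, of m] unfolding mon_def by simp
next
  case (add P Q)
  then show ?case
    using to_Frac_S_add[of P Q] entire_trig[OF _ finite_I] big_ring(7) unfolding S_carrier by simp
next
  case (mult P Q)
  then show ?case
    using to_Frac_S_mult[of P Q] entire_trig[OF _ finite_I] big_ring(6) unfolding S_carrier by simp
qed

text \<open>This will be the character field, and \<open>top_field\<close> its composite with the
  constants.\<close>

definition value_field :: "'i fun_quot set" where "value_field = generate_field K (Q_field \<union> \<Omega>)"

definition top_field :: "'i fun_quot set" where "top_field = generate_field K (range con \<union> value_field)"

lemma \<Omega>_big: "\<Omega> \<subseteq> big_field"
  using base_field_mem(2) base_big by (intro \<Omega>_trig big_field_subfield trig_big) auto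

lemma value_closed: "Q_field \<union> \<Omega> \<subseteq> carrier K"
  using \<Omega>_big big_ring(1) Q_field_closed by blast

lemma value_subfield: "subfield value_field K"
  unfolding value_field_def by (rule K.generate_field_is_subfield[OF value_closed])

lemma top_gens: "range con \<union> value_field \<subseteq> carrier K"
  using con_closed subfieldE(3)[OF value_subfield] by auto

lemma top_subfield: "subfield top_field K"
  unfolding top_field_def by (rule K.generate_field_is_subfield[OF top_gens])

lemmas top_ring = subringE[OF subfieldE(1)[OF top_subfield]]

lemma top_big: "top_field \<subseteq> big_field"
proof -
  have "value_field \<subseteq> big_field"
    unfolding value_field_def
    by (rule K.generate_field_min_subfield1[OF value_closed big_field_subfield])
      (use \<Omega>_big base_field_mem(2) base_big in blast)
  moreover have "range con \<subseteq> big_field" using base_field_mem(1) base_big by auto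
  ultimately show ?thesis
    unfolding top_field_def by (intro K.generate_field_min_subfield1[OF top_gens big_field_subfield]) simp
qed

lemma base_top: "base_field \<subseteq> top_field"
proof -
  have "Q_field \<subseteq> value_field" unfolding value_field_def by (rule subsetI) (rule generate_field.incl[OF UnI1])
  moreover have "range con \<union> value_field \<subseteq> top_field"
    unfolding top_field_def by (rule subsetI) (rule generate_field.incl)
  ultimately have "range con \<union> Q_field \<subseteq> top_field" by auto
  then show ?thesis
    unfolding base_field_def using Q_field_closed con_closed
    by (intro K.generate_field_min_subfield1[OF _ top_subfield]) auto
qed

lemma translate_top:
  assumes w: "integral_shift w" and x: "x \<in> top_field"
  shows "translate w x \<in> top_field"
proof -
  have "value_field \<subseteq> {x \<in> carrier K. translate w x \<in> value_field}"
    unfolding value_field_def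
  proof (rule K.generate_field_min_subfield1[OF value_closed])
    show "subfield {x \<in> carrier K. translate w x \<in> generate_field K (Q_field \<union> \<Omega>)} K"
      by (rule translate_subfield[OF value_subfield[unfolded value_field_def]])
    show "Q_field \<union> \<Omega> \<subseteq> {x \<in> carrier K. translate w x \<in> generate_field K (Q_field \<union> \<Omega>)}"
    proof
      fix x assume x: "x \<in> Q_field \<union> \<Omega>"
      then have "translate w x \<in> Q_field \<union> \<Omega>" using translate_Q_field[OF w] \<Omega>_translate[OF w] by auto
      then show "x \<in> {x \<in> carrier K. translate w x \<in> generate_field K (Q_field \<union> \<Omega>)}"
        using subsetD[OF value_closed x] by (intro CollectI conjI generate_field.incl)
    qed
  qed
  then have v: "translate w x \<in> value_field" if "x \<in> value_field" for x using that by blast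
  have "top_field \<subseteq> {x \<in> carrier K. translate w x \<in> top_field}"
    unfolding top_field_def
  proof (rule K.generate_field_min_subfield1[OF top_gens])
    show "subfield {x \<in> carrier K. translate w x \<in> generate_field K (range con \<union> value_field)} K"
      by (rule translate_subfield[OF top_subfield[unfolded top_field_def]])
    show "range con \<union> value_field \<subseteq> {x \<in> carrier K. translate w x \<in> generate_field K (range con \<union> value_field)}"
    proof
      fix x assume x: "x \<in> range con \<union> value_field"
      then have "translate w x \<in> range con \<union> value_field" using translate_con v by auto
      then show "x \<in> {x \<in> carrier K. translate w x \<in> generate_field K (range con \<union> value_field)}"
        using subsetD[OF top_gens x] by (intro CollectI conjI generate_field.incl)
    qed
  qed
  then show ?thesis using x by blast
qed

text \<open>The translations supply enough automorphisms to cut out the base field as the fixed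
  field.\<close>

lemma translate_automorphism:
  assumes w: "integral_shift w"
  shows "translate w \<in> field_automorphisms K base_field top_field"
proof -
  have "bij_betw (translate w) top_field top_field"
    by (rule bij_betw_byWitness[where f' = "translate (\<lambda>i. - w i)"])
      (auto simp: translate_uminus_cancel translate_uminus_cancel' intro: translate_top[OF w] translate_top[OF integral_shift_uminus[OF w]])
  moreover have "translate w \<in> Ring.ring_hom (K\<lparr>carrier := top_field\<rparr>) (K\<lparr>carrier := top_field\<rparr>)"
  proof (rule ring_hom_memI)
    fix x y assume xy: "x \<in> carrier (K\<lparr>carrier := top_field\<rparr>)" "y \<in> carrier (K\<lparr>carrier := top_field\<rparr>)"
    then have c: "x \<in> carrier K" "y \<in> carrier K" using top_ring(1) by auto
    show "translate w x \<in> carrier (K\<lparr>carrier := top_field\<rparr>)" using translate_top[OF w] xy by simp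
    show "translate w (x \<otimes>\<^bsub>K\<lparr>carrier := top_field\<rparr>\<^esub> y) = translate w x \<otimes>\<^bsub>K\<lparr>carrier := top_field\<rparr>\<^esub> translate w y"
      using translate_mult[OF c] by simp
    show "translate w (x \<oplus>\<^bsub>K\<lparr>carrier := top_field\<rparr>\<^esub> y) = translate w x \<oplus>\<^bsub>K\<lparr>carrier := top_field\<rparr>\<^esub> translate w y"
      using translate_add[OF c] by simp
  qed (simp add: translate_one)
  ultimately show ?thesis
    unfolding field_automorphisms_def ring_iso_def using translate_base_field[OF w] by simp
qed

text \<open>Because \<open>top_field\<close> is stable under translations, the eigenvector summands
  of its elements, found a priori in \<open>span\<close>, lie in \<open>top_field\<close>;
  automorphisms of \<open>top_field\<close> can thus be applied to them.\<close>

lemma top_components: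
  assumes x: "x \<in> top_field"
  shows "\<exists>e\<in>box \<rightarrow> base_field. x = (\<Oplus>\<^bsub>K\<^esub>b\<in>box. e b \<otimes>\<^bsub>K\<^esub> mon b) \<and> (\<forall>b\<in>box. e b \<otimes>\<^bsub>K\<^esub> mon b \<in> top_field)"
proof -
  have "x \<in> span" using x top_big big_span by blast
  then obtain e where e: "e \<in> box \<rightarrow> base_field" "x = (\<Oplus>\<^bsub>K\<^esub>b\<in>box. e b \<otimes>\<^bsub>K\<^esub> mon b)" unfolding span_def by blast
  have "e b \<otimes>\<^bsub>K\<^esub> mon b \<in> top_field" if b: "b \<in> box" for b
  proof (rule span_components[OF top_ring(1) _ _ _ e(1) _ b])
    show "x \<ominus>\<^bsub>K\<^esub> y \<in> top_field" if "x \<in> top_field" "y \<in> top_field" for x y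
      unfolding K.minus_eq by (rule top_ring(7)[OF that(1) top_ring(5)[OF that(2)]])
    show "e \<otimes>\<^bsub>K\<^esub> x \<in> top_field" if "e \<in> base_field" "x \<in> top_field" for e x
      by (rule top_ring(6)[OF subsetD[OF base_top that(1)] that(2)])
    show "translate (basis_shift j) x \<in> top_field" if "x \<in> top_field" for j x
      by (rule translate_top[OF integral_basis_shift that])
    show "(\<Oplus>\<^bsub>K\<^esub>b\<in>box. e b \<otimes>\<^bsub>K\<^esub> mon b) \<in> top_field" using x unfolding e(2) .
  qed
  then have "\<forall>b\<in>box. e b \<otimes>\<^bsub>K\<^esub> mon b \<in> top_field" by (rule ballI)
  then show ?thesis using e by (intro bexI[where x = e] conjI)
qed

text \<open>The summands of a fixed element are fixed. A non-zero fixed multiple of a monomial has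
  all eigenvalues 1, which for exponents in \<open>box\<close> forces them to be 0.\<close>

lemma fixed_base_field:
  assumes x: "x \<in> top_field" and fixed: "\<And>j. translate (basis_shift j) x = x"
  shows "x \<in> base_field"
proof -
  obtain e where e: "e \<in> box \<rightarrow> base_field" "x = (\<Oplus>\<^bsub>K\<^esub>b\<in>box. e b \<otimes>\<^bsub>K\<^esub> mon b)"
    using top_components[OF x] by (elim bexE conjE)
  let ?L = "{x \<in> carrier K. \<forall>j. translate (basis_shift j) x = x}"
  have eb: "e b \<in> base_field" if "b \<in> box" for b using e(1) that by blast
  have comp: "e b \<otimes>\<^bsub>K\<^esub> mon b \<in> ?L" if b: "b \<in> box" for b
  proof (rule span_components[OF _ _ _ _ e(1) _ b])
    show "?L \<subseteq> carrier K" by simp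
    show "x \<ominus>\<^bsub>K\<^esub> y \<in> ?L" if "x \<in> ?L" "y \<in> ?L" for x y using that by (simp add: translate_minus_closed)
    show "e \<otimes>\<^bsub>K\<^esub> x \<in> ?L" if "e \<in> base_field" "x \<in> ?L" for e x
      using that by (simp add: translate_mult base_closed translate_base_field[OF integral_basis_shift])
    show "translate (basis_shift j) x \<in> ?L" if "x \<in> ?L" for j x using that by simp
    show "(\<Oplus>\<^bsub>K\<^esub>b\<in>box. e b \<otimes>\<^bsub>K\<^esub> mon b) \<in> ?L"
      using fixed x top_ring(1) unfolding e(2)[symmetric] by blast
  qed
  have "e b \<otimes>\<^bsub>K\<^esub> mon b \<in> base_field" if b: "b \<in> box" for b
  proof (cases "e b \<otimes>\<^bsub>K\<^esub> mon b = \<zero>\<^bsub>K\<^esub>")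
    case True
    then show ?thesis using base_ring(2) by simp
  next
    case False
    have cl: "e b \<otimes>\<^bsub>K\<^esub> mon b \<in> carrier K" by (rule mon_closed'[OF eb[OF b]])
    have "b j = 0" if j: "j \<in> I" for j
    proof -
      have "con (root (b j)) \<otimes>\<^bsub>K\<^esub> (e b \<otimes>\<^bsub>K\<^esub> mon b) = e b \<otimes>\<^bsub>K\<^esub> (con (root (b j)) \<otimes>\<^bsub>K\<^esub> mon b)"
        by (rule K.m_lcomm[OF con_closed base_closed[OF eb[OF b]] mon_closed])
      also have "\<dots> = translate (basis_shift j) (e b \<otimes>\<^bsub>K\<^esub> mon b)"
        unfolding translate_mult[OF base_closed[OF eb[OF b]] mon_closed] translate_mon
          translate_base_field[OF integral_basis_shift eb[OF b]] using j by (simp add: eigenvalue_def)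
      also have "\<dots> = e b \<otimes>\<^bsub>K\<^esub> mon b" using comp[OF b] by blast
      also have "\<dots> = \<one>\<^bsub>K\<^esub> \<otimes>\<^bsub>K\<^esub> (e b \<otimes>\<^bsub>K\<^esub> mon b)" by (rule K.l_one[OF cl, symmetric])
      finally have "con (root (b j)) = \<one>\<^bsub>K\<^esub>"
        by (rule K.m_rcancel[OF False cl con_closed K.one_closed, THEN iffD1])
      then have "con (root (b j)) = con (root 0)" by (simp add: root_zero con_def to_Frac_S_one)
      then have "root (b j) = root 0" by (rule con_inject)
      moreover have "b j \<in> {0..<int N}" by (rule PiE_mem[OF b[unfolded box_def] j])
      ultimately show ?thesis using root_eqD[of "b j" 0] N by simp
    qed
    then have "mon b = mon (\<lambda>i. 0)" by (rule mon_cong)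
    then show ?thesis using eb[OF b] base_closed[OF eb[OF b]] by (simp add: mon_zero)
  qed
  note summands = this
  show ?thesis
    unfolding e(2) by (rule K.finsum_mem[OF base_ring(1,2,7) finite_box summands])
qed

text \<open>The \<open>N\<close>-th power of the component lies in the base field and is therefore
  fixed, so the component and its image differ by an \<open>N\<close>-th root of unity, which is a
  constant.\<close>

lemma automorphism_component:
  assumes \<alpha>: "\<alpha> \<in> field_automorphisms K base_field top_field"
    and e: "e \<in> base_field" and y: "e \<otimes>\<^bsub>K\<^esub> mon b \<in> top_field"
  shows "\<exists>c. \<alpha> (e \<otimes>\<^bsub>K\<^esub> mon b) = con c \<otimes>\<^bsub>K\<^esub> (e \<otimes>\<^bsub>K\<^esub> mon b)"
proof -
  let ?y = "e \<otimes>\<^bsub>K\<^esub> mon b"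
  have hom: "\<alpha> \<in> Ring.ring_hom (K\<lparr>carrier := top_field\<rparr>) (K\<lparr>carrier := top_field\<rparr>)"
    and fix_base: "\<And>x. x \<in> base_field \<Longrightarrow> \<alpha> x = x"
    using \<alpha> unfolding field_automorphisms_def ring_iso_def by auto
  have cl: "\<alpha> x \<in> top_field" if "x \<in> top_field" for x using ring_hom_closed[OF hom, of x] that by simp
  have mult: "\<alpha> (x \<otimes>\<^bsub>K\<^esub> y) = \<alpha> x \<otimes>\<^bsub>K\<^esub> \<alpha> y" if "x \<in> top_field" "y \<in> top_field" for x y
    using ring_hom_mult[OF hom, of x y] that by simp
  have yc: "?y \<in> carrier K" and sc: "\<alpha> ?y \<in> carrier K" using y cl top_ring(1) by blast+
  have pow: "?y [^]\<^bsub>K\<^esub> n \<in> top_field \<and> \<alpha> (?y [^]\<^bsub>K\<^esub> n) = \<alpha> ?y [^]\<^bsub>K\<^esub> n" for n :: nat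
  proof (induction n)
    case 0
    show ?case using top_ring(3) fix_base[OF base_ring(3)] by simp
  next
    case (Suc n)
    then show ?case using mult[of "?y [^]\<^bsub>K\<^esub> n" ?y] y top_ring(6) by simp
  qed
  have epow: "e [^]\<^bsub>K\<^esub> n \<in> base_field" for n :: nat
    by (induction n) (simp_all add: base_ring(3) base_ring(6) e)
  have "?y [^]\<^bsub>K\<^esub> N = e [^]\<^bsub>K\<^esub> N \<otimes>\<^bsub>K\<^esub> mon (\<lambda>i. int N * b i)"
    unfolding mon_power[symmetric] by (rule K.nat_pow_distrib[OF base_closed[OF e] mon_closed])
  then have "?y [^]\<^bsub>K\<^esub> N \<in> base_field" using base_ring(6)[OF epow mon_base_field] by simp
  then have eq: "\<alpha> ?y [^]\<^bsub>K\<^esub> N = ?y [^]\<^bsub>K\<^esub> N" using pow[of N] fix_base by simp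
  show ?thesis
  proof (cases "?y = \<zero>\<^bsub>K\<^esub>")
    case True
    then show ?thesis using fix_base[OF base_ring(2)] con_closed by simp
  next
    case False
    have U: "?y \<in> Units K" using yc False K.field_Units by simp
    note iy = K.Units_inv_closed[OF U]
    let ?q = "\<alpha> ?y \<otimes>\<^bsub>K\<^esub> inv\<^bsub>K\<^esub> ?y"
    have "?q [^]\<^bsub>K\<^esub> N = ?y [^]\<^bsub>K\<^esub> N \<otimes>\<^bsub>K\<^esub> (inv\<^bsub>K\<^esub> ?y) [^]\<^bsub>K\<^esub> N"
      unfolding K.nat_pow_distrib[OF sc iy] eq ..
    also have "\<dots> = (?y \<otimes>\<^bsub>K\<^esub> inv\<^bsub>K\<^esub> ?y) [^]\<^bsub>K\<^esub> N" by (rule K.nat_pow_distrib[OF yc iy, symmetric])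
    also have "\<dots> = \<one>\<^bsub>K\<^esub>" unfolding K.Units_r_inv[OF U] by (rule K.nat_pow_one)
    finally obtain c where c: "?q = con c"
      using root_of_unity_constant[OF N K.m_closed[OF sc iy]] by (elim meta_impE exE)
    have "\<alpha> ?y = ?q \<otimes>\<^bsub>K\<^esub> ?y"
      unfolding K.m_assoc[OF sc iy yc] K.Units_l_inv[OF U] by (rule K.r_one[OF sc, symmetric])
    then show ?thesis unfolding c ..
  qed
qed

lemma automorphisms_commute:
  assumes \<alpha>: "\<alpha> \<in> field_automorphisms K base_field top_field"
    and \<beta>: "\<beta> \<in> field_automorphisms K base_field top_field" and x: "x \<in> top_field"
  shows "\<alpha> (\<beta> x) = \<beta> (\<alpha> x)"
proof -
  obtain e where e: "e \<in> box \<rightarrow> base_field" "x = (\<Oplus>\<^bsub>K\<^esub>b\<in>box. e b \<otimes>\<^bsub>K\<^esub> mon b)"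
    and comps: "\<forall>b\<in>box. e b \<otimes>\<^bsub>K\<^esub> mon b \<in> top_field"
    using top_components[OF x] by (elim bexE conjE)
  have y: "e b \<otimes>\<^bsub>K\<^esub> mon b \<in> top_field" if "b \<in> box" for b by (rule bspec[OF comps that])
  let ?y = "\<lambda>b. e b \<otimes>\<^bsub>K\<^esub> mon b"
  have iso: "\<alpha> \<in> ring_iso (K\<lparr>carrier := top_field\<rparr>) (K\<lparr>carrier := top_field\<rparr>)" 
    if "\<alpha> \<in> field_automorphisms K base_field top_field" for \<alpha> using that unfolding field_automorphisms_def by simp
  have hom: "\<alpha> \<in> Ring.ring_hom (K\<lparr>carrier := top_field\<rparr>) (K\<lparr>carrier := top_field\<rparr>)"
    if "\<alpha> \<in> field_automorphisms K base_field top_field" for \<alpha> using iso[OF that] unfolding ring_iso_def by simp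
  have cl: "\<alpha> x \<in> top_field" if "\<alpha> \<in> field_automorphisms K base_field top_field" "x \<in> top_field" for \<alpha> x
    using ring_hom_closed[OF hom[OF that(1)], of x] that by simp
  have con: "\<alpha> (con c \<otimes>\<^bsub>K\<^esub> y) = con c \<otimes>\<^bsub>K\<^esub> \<alpha> y"
    if "\<alpha> \<in> field_automorphisms K base_field top_field" "y \<in> top_field" for \<alpha> c y
    using ring_hom_mult[OF hom[OF that(1)], of "con c" y] that subsetD[OF base_top base_field_mem(1)[of c]] base_field_mem(1)[of c]
    unfolding field_automorphisms_def by simp
  have comm: "\<alpha> (\<beta> (?y b)) = \<beta> (\<alpha> (?y b))" if b: "b \<in> box" for b
  proof -
    have eb: "e b \<in> base_field" using e(1) b by blast
    obtain c where c: "\<alpha> (?y b) = con c \<otimes>\<^bsub>K\<^esub> ?y b" using automorphism_component[OF \<alpha> eb y[OF b]] by (elim exE)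
    obtain d where d: "\<beta> (?y b) = con d \<otimes>\<^bsub>K\<^esub> ?y b" using automorphism_component[OF \<beta> eb y[OF b]] by (elim exE)
    have "con d \<otimes>\<^bsub>K\<^esub> (con c \<otimes>\<^bsub>K\<^esub> ?y b) = con c \<otimes>\<^bsub>K\<^esub> (con d \<otimes>\<^bsub>K\<^esub> ?y b)"
      by (rule K.m_lcomm[OF con_closed con_closed mon_closed'[OF eb]])
    then show ?thesis unfolding d con[OF \<alpha> y[OF b]] c con[OF \<beta> y[OF b]] d .
  qed
  have "\<alpha> (\<beta> x) = \<alpha> (\<Oplus>\<^bsub>K\<^esub>b\<in>box. \<beta> (?y b))"
    unfolding e(2) by (rule arg_cong[OF K.automorphism_finsum[OF top_subfield iso[OF \<beta>] finite_box y]])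
  also have "\<dots> = (\<Oplus>\<^bsub>K\<^esub>b\<in>box. \<alpha> (\<beta> (?y b)))"
    by (rule K.automorphism_finsum[OF top_subfield iso[OF \<alpha>] finite_box cl[OF \<beta> y]])
  also have "\<dots> = (\<Oplus>\<^bsub>K\<^esub>b\<in>box. \<beta> (\<alpha> (?y b)))"
    by (rule K.finsum_cong'[OF HOL.refl _ comm], rule Pi_I, rule subsetD[OF top_ring(1)], rule cl[OF \<beta> cl[OF \<alpha> y]])
  also have "\<dots> = \<beta> (\<Oplus>\<^bsub>K\<^esub>b\<in>box. \<alpha> (?y b))"
    by (rule K.automorphism_finsum[OF top_subfield iso[OF \<beta>] finite_box cl[OF \<alpha> y], symmetric])
  also have "\<dots> = \<beta> (\<alpha> x)"
    unfolding e(2) by (rule arg_cong[OF K.automorphism_finsum[OF top_subfield iso[OF \<alpha>] finite_box y, symmetric]])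
  finally show ?thesis .
qed

theorem abelian_top: "abelian_extension K base_field top_field"
  unfolding abelian_extension_def
proof (intro conjI ballI)
  show "subfield base_field K" "subfield top_field K" "base_field \<subseteq> top_field"
    by (rule base_field_subfield top_subfield base_top)+
  show "(ring.algebraic K over base_field) x" if "x \<in> top_field" for x
    by (rule K.finite_extesion_mem_imp_algebraic[OF base_field_subfield radicals_closed radicals_algebraic])
      (use that top_big in \<open>auto simp: big_field_def\<close>)
  show "{x \<in> top_field. \<forall>\<alpha>\<in>field_automorphisms K base_field top_field. \<alpha> x = x} = base_field"
  proof (rule equalityI; rule subsetI)
    fix x assume x: "x \<in> {x \<in> top_field. \<forall>\<alpha>\<in>field_automorphisms K base_field top_field. \<alpha> x = x}"
    show "x \<in> base_field"
    proof (rule fixed_base_field)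
      show "x \<in> top_field" using x by simp
      show "translate (basis_shift j) x = x" for j
        using x translate_automorphism[OF integral_basis_shift, of j] by blast
    qed
  next
    fix x assume "x \<in> base_field"
    then show "x \<in> {x \<in> top_field. \<forall>\<alpha>\<in>field_automorphisms K base_field top_field. \<alpha> x = x}"
      using base_top unfolding field_automorphisms_def by auto
  qed
qed (rule automorphisms_commute)

theorem top_radicals: "top_field \<subseteq> generate_field K (base_field \<union> radical ` I)"
  using top_big big_generated by (rule subset_trans)

end

end

section \<open>The character field\<close>

text \<open>Provides the two properties of character values that the Kummer part asks for: twisting
  gives stability under translations, and the trace theorem for elements of \<open>H\<close> extends
  to the rational form.\<close>

lemma (in extended_algebra) character_field_abelian:
  fixes n :: nat
  assumes gen: "module_generated_by (laurent_ring I) H n"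
  defines "\<Omega> \<equiv> {ch x | ch x. ch \<in> irreducible_characters K KH \<and> x \<in> rational_span Q_field}"
  defines "L \<equiv> generate_field K (range con \<union> generate_field K (Q_field \<union> \<Omega>))"
  shows "(\<exists>N > (0::nat). \<exists>r \<in> I \<rightarrow> carrier K. (\<forall>i \<in> I. r i [^]\<^bsub>K\<^esub> N = \<theta> (laurent_var i)) \<and>
            L \<subseteq> generate_field K (base_field \<union> r ` I)) \<and> abelian_extension K base_field L"
proof -
  \<comment> \<open>Divisible by every period that can occur: these are at most
    \<open>n ^ d\<close>, and \<open>d \<le> n\<close> for every irreducible representation.\<close>
  define N :: nat where "N = fact (n ^ n)"
  have N: "N > 0" unfolding N_def by (rule fact_gt_zero)
  interpret kf: kummer_field I z N by (intro kummer_field.intro kummer_field_axioms.intro param_field_axioms N)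
  have \<Omega>_translate: "translate w x \<in> \<Omega>" if w: "integral_shift w" and x: "x \<in> \<Omega>" for w x
  proof -
    obtain ch Y where x: "x = ch Y" and ch: "ch \<in> irreducible_characters K KH" and Y: "Y \<in> rational_span Q_field"
      using x unfolding \<Omega>_def by (elim CollectE exE conjE)
    obtain d \<rho> where irr: "irreducible_matrix_rep K KH d \<rho>" and ch: "ch = (\<lambda>a. mat_trace K d (\<rho> a))"
      using ch unfolding irreducible_characters_def by (elim CollectE exE conjE)
    interpret r: extended_algebra_rep I z H d \<rho>
      by (intro extended_algebra_rep.intro extended_algebra_rep_axioms.intro extended_algebra_axioms)
        (rule irr[unfolded irreducible_matrix_rep_def, THEN conjunct1])
    have YK: "Y \<in> carrier KH"
      using rational_span_induct[OF Y Q_field_closed, where P = "\<lambda>_. True"] by simp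
    have v: "integral_shift (\<lambda>i. - w i)" by (rule integral_shift_uminus[OF w])
    have "lift_coset (\<lambda>i. - w i) Y = Y"
      by (rule lift_coset_rational[OF v Q_field_closed translate_Q_field[OF v] Y])
    then have "mat_trace K d (r.twist w Y) = translate w x"
      unfolding r.twist_trace[OF w YK] x ch by simp
    moreover have "(\<lambda>a. mat_trace K d (r.twist w a)) \<in> irreducible_characters K KH"
      unfolding irreducible_characters_def
      by (intro CollectI exI[where x = d] exI[where x = "r.twist w"] conjI HOL.refl r.twist_irreducible[OF w irr])
    ultimately show ?thesis
      unfolding \<Omega>_def using Y by (intro CollectI exI[where x = "\<lambda>a. mat_trace K d (r.twist w a)"] exI[where x = Y]) simp
  qed
  have \<Omega>_trig: "\<Omega> \<subseteq> L'" if L: "subfield L' K" "Q_field \<subseteq> L'" and trig: "\<And>P. P \<in> trig N I \<Longrightarrow> to_Frac S P \<in> L'" for L'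
  proof
    fix x assume "x \<in> \<Omega>"
    then obtain ch Y where x: "x = ch Y" and ch: "ch \<in> irreducible_characters K KH" and Y: "Y \<in> rational_span Q_field"
      unfolding \<Omega>_def by (elim CollectE exE conjE)
    obtain d \<rho> where irr: "irreducible_matrix_rep K KH d \<rho>" and ch: "ch = (\<lambda>a. mat_trace K d (\<rho> a))"
      using ch unfolding irreducible_characters_def by (elim CollectE exE conjE)
    interpret r: extended_algebra_rep I z H d \<rho>
      by (intro extended_algebra_rep.intro extended_algebra_rep_axioms.intro extended_algebra_axioms)
        (rule irr[unfolded irreducible_matrix_rep_def, THEN conjunct1])
    have d: "0 < d" by (rule irr[unfolded irreducible_matrix_rep_def, THEN conjunct2, THEN conjunct1])
    have dn: "d \<le> n" by (rule r.irreducible_dimension[OF irr gen])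
    \<comment> \<open>\<open>0 < d\<close> and \<open>d \<le> n\<close> make the base
      \<open>n\<close> positive, as monotonicity of powers requires.\<close>
    have "n ^ d \<le> n ^ n" by (rule power_increasing[OF dn]) (use d dn in simp)
    then have dvd: "p dvd N" if "0 < p" "p \<le> n ^ d" for p
      unfolding N_def using that by (intro dvd_fact) simp_all
    have tr: "mat_trace K d (r.\<phi> h) \<in> L'" if h: "h \<in> carrier H" for h
    proof -
      have "\<exists>P\<in>trig N I. mat_trace K d (r.\<phi> h) = to_Frac S P"
        by (rule r.trace_trig_rep[OF gen h N dvd])
      then obtain P where P: "P \<in> trig N I" "mat_trace K d (r.\<phi> h) = to_Frac S P" by (elim bexE)
      show ?thesis unfolding P(2) by (rule trig[OF P(1)])
    qed
    show "x \<in> L'" unfolding x ch by (rule r.trace_rational[OF Q_field_closed L tr Y])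
  qed
  note \<Omega> = \<Omega>_translate \<Omega>_trig
  \<comment> \<open>Definitions made under the assumptions on \<open>\<Omega>\<close> are exported
    with these assumptions as premises.\<close>
  have top: "kf.top_field \<Omega> = generate_field K (range con \<union> kf.value_field \<Omega>)"
    by (rule kf.top_field_def[OF \<Omega>])
  have val: "kf.value_field \<Omega> = generate_field K (Q_field \<union> \<Omega>)"
    by (rule kf.value_field_def[OF \<Omega>])
  have L: "L = kf.top_field \<Omega>" unfolding L_def top val ..
  have "kf.radical \<in> I \<rightarrow> carrier K" by (rule Pi_I) (rule kf.radical_closed)
  moreover have "\<forall>i\<in>I. kf.radical i [^]\<^bsub>K\<^esub> N = \<theta> (laurent_var i)" by (rule ballI) (rule kf.radical_power)
  moreover have "L \<subseteq> generate_field K (base_field \<union> kf.radical ` I)"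
    unfolding L by (rule kf.top_radicals[OF \<Omega>])
  moreover have "abelian_extension K base_field L"
    unfolding L by (rule kf.abelian_top[OF \<Omega>])
  ultimately show ?thesis
    using N by (intro conjI exI[where x = N] bexI[where x = kf.radical])
qed

lemma finite_param_index:
  assumes "finite_reflection_group W"
  shows "finite (param_index W)"
proof -
  have "finite W" using assms unfolding finite_reflection_group_def by simp
  then have "finite (hyperplane_orbits W)" by (simp add: hyperplane_orbits_def hyperplanes_def)
  moreover have "param_index W = Sigma (hyperplane_orbits W) (\<lambda>C. {..<orbit_order W C})"
    by (auto simp: param_index_def)
  ultimately show ?thesis by (simp add: finite_SigmaI)
qed

theorem theorem6p7:
  fixes W :: "(complex ^ 'n ^ 'n) set"
    and v0 :: "complex ^ 'n"
    and l :: "(complex ^ 'n) set \<Rightarrow> 'n braid"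
  assumes "finite_reflection_group W"
    and "v0 \<in> V_reg W"
    and "\<And>H. H \<in> hyperplanes W \<Longrightarrow> l H \<in> braid_reflections W v0 H"
    and "coxeter_like_presentation W v0"
    and "module_generated_by (ring_R W) (hecke_algebra W v0 l) (card W)"
  shows "(\<exists>N > (0::nat). \<exists>r \<in> param_index W \<rightarrow> carrier (field_K W).
            (\<forall>i \<in> param_index W. r i [^]\<^bsub>field_K W\<^esub> N = R_to_K W (laurent_var i)) \<and>
            complex_composite W (character_field W v0 l)
              \<subseteq> generate_field (field_K W) (complex_composite W (field_Q W) \<union> r ` param_index W))
       \<and> abelian_extension (field_K W)
            (complex_composite W (field_Q W)) (complex_composite W (character_field W v0 l))"
proof -
  let ?I = "param_index W"
  \<comment> \<open>With these roots of unity \<open>u_eval z\<close> is the given embedding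
    \<open>u_value\<close>, and the abstract fields become those of the statement.\<close>
  define z :: "'n param \<Rightarrow> complex" where "z = (\<lambda>(C, j). exp (2 * pi * \<i> / of_nat (orbit_order W C)) ^ j)"
  note I = finite_param_index[OF assms(1)]
  have z: "z i \<noteq> 0" for i by (simp add: z_def split: prod.split)
  have R: "ring_R W = laurent_ring ?I" by (rule ring_R_def)
  note hecke = hecke_algebra_ring[OF I, of v0 l, unfolded R]
  interpret A: extended_algebra ?I z "hecke_algebra W v0 l"
  proof (intro extended_algebra.intro param_field.intro entire_field.intro param_field_axioms.intro
      extended_algebra_axioms.intro I z)
    show "ring (hecke_algebra W v0 l)" by (rule hecke[THEN conjunct1])
    show "r \<odot>\<^bsub>hecke_algebra W v0 l\<^esub> h \<in> carrier (hecke_algebra W v0 l)"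
      if "r \<in> carrier (laurent_ring ?I)" "h \<in> carrier (hecke_algebra W v0 l)" for r h
      by (rule hecke[THEN conjunct2, rule_format, OF that])
  qed
  have K: "field_K W = Frac (entire_ring ?I)" unfolding field_K_def ring_S_def ..
  have u: "u_value W k = u_eval z k" for k
    by (rule ext) (simp add: u_value_def u_eval_def z_def split: prod.split)
  have T: "R_to_K W = A.\<theta>"
    by (rule ext) (simp only: R_to_K_def A.\<theta>_def u ring_S_def)
  have Q: "field_Q W = A.Q_field" unfolding field_Q_def A.Q_field_def T K R ..
  have C: "constants W = range A.con" unfolding constants_def A.con_def ring_S_def ..
  have KH: "K_hecke_algebra W v0 l = A.KH" unfolding K_hecke_algebra_def A.KH_def K R T ..
  have QH: "Q_hecke_algebra W v0 l = A.rational_span A.Q_field"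
    unfolding Q_hecke_algebra_def A.rational_span_def KH K R T Q A.pure_tensor_eq ..
  have base: "complex_composite W (field_Q W) = A.base_field"
    unfolding complex_composite_def A.base_field_def K C Q ..
  show ?thesis
    unfolding base unfolding complex_composite_def character_field_def K C Q KH QH T
    by (rule A.character_field_abelian[OF assms(5)[unfolded R]])
qed

end
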